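(* Let $G$ be a weighted graph (the communication network) and $T\subseteq G$ a rooted spanning tree of $G$ consisting of exactly a root $r$ and $k$ vertex-disjoint trees $T_1,\dots,T_k$ (a subtree instance). There exists a deterministic $\tilde O(1)$-round Minor-Aggregation algorithm on $G$ that computes the minimum of the 1-respecting cut values $\min_{e\in E(T)}\mathrm{Cut}_{T,G}(e)$ and the 2-respecting cut values $\min_{i<j}\min_{e\in E(T_i),f\in E(T_j)}\mathrm{Cut}_{T,G}(e,f)$.
   Context: Minor-Aggregation model. The communication network is a connected undirected graph $G=(V,E)$ with $n=|V|$ nodes; both nodes and edges are computational units with private memory. Initially nodes know only their unique $\tilde O(1)$-bit ID (and inputs) and edges know the IDs of their endpoints. Computation proceeds in synchronous rounds, each of three steps: (i) Contraction: each edge $e$ chooses $c_e\in\{\bot,\top\}$, defining the minor $G'=G/\{e:c_e=\top\}$ (self-loops removed), whose vertices (supernodes) are identified with the sets of nodes they contain. (ii) Consensus: each node $v$ chooses an $\tilde O(1)$-bit value $x_v$; for each supernode $s$ all nodes of $s$ learn $y_s=\bigoplus_{v\in s}x_v$ for a predefined aggregation operator $\bigoplus$. (iii) Aggregation: each edge $e$ of $G'$ joining supernodes $a,b$ learns $y_a,y_b$ and chooses $\tilde O(1)$-bit values $z_{e,a},z_{e,b}$; all nodes of each supernode $s$ learn the same aggregate $\bigotimes_{e \text{ incident to } s} z_{e,s}$ for a predefined aggregation operator $\bigotimes$. An aggregation operator maps two $B$-bit messages ($B=\tilde O(1)$) to one $B$-bit message, applied pairwise in arbitrary order to aggregate several messages.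 $\tilde O(\cdot)$ hides $\mathrm{poly}(\log n)$ factors. Inputs are distributedly stored: each edge knows its weight (positive integers bounded by $\mathrm{poly}(n)$) and whether it is in $T$, each tree edge knows which endpoint is closer to the root. For tree edges $e,f$: $\mathrm{Cut}_{T,G}(e)$ is the total weight of edges $\{u,v\}\in E(G)$ whose unique $u$–$v$ path in $T$ contains $e$; $\mathrm{Cut}_{T,G}(e,f)$ is the total weight of edges $\{u,v\}\in E(G)$ whose unique $u$–$v$ path in $T$ contains exactly one of $e,f$. *)

theory Defs
  imports Complex_Main "HOL-Library.Multiset" "HOL-Library.Extended_Nat"
    "HOL-Library.Disjoint_Sets" "HOL-Library.Landau_Symbols"
begin

section \<open>Asymptotic size bounds\<close>

definition polylog :: "(nat \<Rightarrow> nat) \<Rightarrow> bool" where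
  "polylog f \<longleftrightarrow> (\<exists>c::nat. (\<lambda>n. real (f n)) \<in> O(\<lambda>n. ln (real n) ^ c))"

definition poly_bounded :: "(nat \<Rightarrow> nat) \<Rightarrow> bool" where
  "poly_bounded f \<longleftrightarrow> (\<exists>c::nat. (\<lambda>n. real (f n)) \<in> O(\<lambda>n. real n ^ c))"


section \<open>Simple graphs, trees and cuts\<close>

text \<open>Nodes are natural numbers, each node being identified with its unique ID. Edges are
  two-element sets of nodes.\<close>

definition simple_graph :: "nat set \<Rightarrow> nat set set \<Rightarrow> bool" where
  "simple_graph V E \<longleftrightarrow> finite V \<and> (\<forall>e\<in>E. e \<subseteq> V \<and> card e = 2)"

definition path_edges :: "nat list \<Rightarrow> nat set set" where
  "path_edges p = {{p ! i, p ! Suc i} | i. Suc i < length p}"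

definition is_path :: "nat set set \<Rightarrow> nat \<Rightarrow> nat \<Rightarrow> nat list \<Rightarrow> bool" where
  "is_path F u v p \<longleftrightarrow> p \<noteq> [] \<and> hd p = u \<and> last p = v \<and> distinct p \<and> path_edges p \<subseteq> F"

definition is_cycle :: "nat set set \<Rightarrow> nat list \<Rightarrow> bool" where
  "is_cycle F p \<longleftrightarrow> 3 \<le> length p \<and> distinct p \<and> path_edges p \<subseteq> F \<and> {last p, hd p} \<in> F"

definition connected_graph :: "nat set \<Rightarrow> nat set set \<Rightarrow> bool" where
  "connected_graph V E \<longleftrightarrow>
     simple_graph V E \<and> V \<noteq> {} \<and> (\<forall>u\<in>V. \<forall>v\<in>V. \<exists>p. is_path E u v p)"

definition is_tree :: "nat set \<Rightarrow> nat set set \<Rightarrow> bool" where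
  "is_tree V F \<longleftrightarrow> connected_graph V F \<and> (\<nexists>p. is_cycle F p)"

definition tree_path :: "nat set set \<Rightarrow> nat \<Rightarrow> nat \<Rightarrow> nat list" where
  "tree_path F u v = (THE p. is_path F u v p)"

definition tree_dist :: "nat set set \<Rightarrow> nat \<Rightarrow> nat \<Rightarrow> nat" where
  "tree_dist F u v = length (tree_path F u v) - 1"

definition endpoint_near_root :: "nat set set \<Rightarrow> nat \<Rightarrow> nat set \<Rightarrow> nat" where
  "endpoint_near_root F r e = (ARG_MIN (tree_dist F r) u. u \<in> e)"

text \<open>The two endpoints of an edge \<open>g\<close> are \<open>Min g\<close> and \<open>Max g\<close>.\<close>

definition covers :: "nat set set \<Rightarrow> nat set \<Rightarrow> nat set \<Rightarrow> bool" where
  "covers F g e \<longleftrightarrow> e \<in> path_edges (tree_path F (Min g) (Max g))"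

definition cut1 :: "nat set set \<Rightarrow> nat set set \<Rightarrow> (nat set \<Rightarrow> nat) \<Rightarrow> nat set \<Rightarrow> nat" where
  "cut1 F E w e = (\<Sum>g | g \<in> E \<and> covers F g e. w g)"

definition cut2 ::
  "nat set set \<Rightarrow> nat set set \<Rightarrow> (nat set \<Rightarrow> nat) \<Rightarrow> nat set \<Rightarrow> nat set \<Rightarrow> nat" where
  "cut2 F E w e f = (\<Sum>g | g \<in> E \<and> (covers F g e \<noteq> covers F g f). w g)"


section \<open>The Minor-Aggregation model\<close>

type_synonym msg = "bool list"

text \<open>Memory is private and unbounded, so without loss of generality a node or an edge
  remembers everything it has learned, and the algorithm consists of functions of that
  history. In each round a node learns the consensus value of its supernode and the aggregate
  over the edges incident to it (\<open>None\<close> if there are no such edges). An edge learns the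
  consensus values of the supernodes containing its endpoints, in the order of the endpoint
  IDs, or \<open>None\<close> if it is not an edge of the minor. Histories list the rounds in
  chronological order.\<close>

type_synonym node_history = "(msg \<times> msg option) list"
type_synonym edge_history = "(msg \<times> msg) option list"

record 'ni node_view =
  nv_id :: nat
  nv_input :: 'ni
  nv_history :: node_history

record 'ei edge_view =
  ev_low_id :: nat
  ev_high_id :: nat
  ev_input :: 'ei
  ev_history :: edge_history

text \<open>The components do not receive the number of nodes of the network: one algorithm has to
  work for all networks. The aggregation operators may depend on the round number. An output
  \<open>None\<close> means that the node has not decided yet. The pair chosen by \<open>agg_value\<close> is listed in
  the order of the endpoint IDs.\<close>

record ('ni, 'ei, 'o) ma_algorithm =
  contracts :: "'ei edge_view \<Rightarrow> bool"
  cons_value :: "'ni node_view \<Rightarrow> msg"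
  cons_op :: "nat \<Rightarrow> msg \<Rightarrow> msg \<Rightarrow> msg"
  agg_value :: "'ei edge_view \<Rightarrow> msg \<Rightarrow> msg \<Rightarrow> msg \<times> msg"
  agg_op :: "nat \<Rightarrow> msg \<Rightarrow> msg \<Rightarrow> msg"
  node_output :: "'ni node_view \<Rightarrow> 'o option"

record ('ni, 'ei) network =
  nodes :: "nat set"
  edges :: "nat set set"
  node_input :: "nat \<Rightarrow> 'ni"
  edge_input :: "nat set \<Rightarrow> 'ei"

text \<open>\<open>aggregates_to f M y\<close>: the value \<open>y\<close> can be obtained from the messages \<open>M\<close> by repeatedly
  replacing two of them by their combination, in some order. The operator \<open>f\<close> need not be
  associative or commutative, so \<open>y\<close> need not be unique.\<close>

inductive aggregates_to :: "(msg \<Rightarrow> msg \<Rightarrow> msg) \<Rightarrow> msg multiset \<Rightarrow> msg \<Rightarrow> bool"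
  for f :: "msg \<Rightarrow> msg \<Rightarrow> msg" where
  single: "aggregates_to f {#y#} y"
| combine: "aggregates_to f (add_mset (f a b) M) y \<Longrightarrow> aggregates_to f (add_mset a (add_mset b M)) y"

definition node_view_of :: "('ni, 'ei) network \<Rightarrow> (nat \<Rightarrow> node_history) \<Rightarrow> nat \<Rightarrow> 'ni node_view" where
  "node_view_of N hn v = \<lparr>nv_id = v, nv_input = node_input N v, nv_history = hn v\<rparr>"

definition edge_view_of ::
  "('ni, 'ei) network \<Rightarrow> (nat set \<Rightarrow> edge_history) \<Rightarrow> nat set \<Rightarrow> 'ei edge_view" where
  "edge_view_of N he e =
     \<lparr>ev_low_id = Min e, ev_high_id = Max e, ev_input = edge_input N e, ev_history = he e\<rparr>"

definition contracted_edges ::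
  "('ni, 'ei, 'o) ma_algorithm \<Rightarrow> ('ni, 'ei) network \<Rightarrow> (nat set \<Rightarrow> edge_history) \<Rightarrow> nat set set" where
  "contracted_edges A N he = {e \<in> edges N. contracts A (edge_view_of N he e)}"

definition supernode ::
  "('ni, 'ei, 'o) ma_algorithm \<Rightarrow> ('ni, 'ei) network \<Rightarrow> (nat set \<Rightarrow> edge_history) \<Rightarrow> nat \<Rightarrow> nat set" where
  "supernode A N he v = {u \<in> nodes N. \<exists>p. is_path (contracted_edges A N he) v u p}"

definition minor_edges ::
  "('ni, 'ei, 'o) ma_algorithm \<Rightarrow> ('ni, 'ei) network \<Rightarrow> (nat set \<Rightarrow> edge_history) \<Rightarrow> nat set set" where
  "minor_edges A N he =
     {e \<in> edges N. supernode A N he (Min e) \<noteq> supernode A N he (Max e)}"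

definition consensus_outcome ::
  "('ni, 'ei, 'o) ma_algorithm \<Rightarrow> ('ni, 'ei) network \<Rightarrow> nat \<Rightarrow> (nat \<Rightarrow> node_history) \<Rightarrow>
   (nat set \<Rightarrow> edge_history) \<Rightarrow> (nat set \<Rightarrow> msg) \<Rightarrow> bool" where
  "consensus_outcome A N t hn he y \<longleftrightarrow>
     (\<forall>s \<in> supernode A N he ` nodes N.
        aggregates_to (cons_op A t)
          (image_mset (\<lambda>v. cons_value A (node_view_of N hn v)) (mset_set s)) (y s))"

definition edge_values ::
  "('ni, 'ei, 'o) ma_algorithm \<Rightarrow> ('ni, 'ei) network \<Rightarrow> (nat set \<Rightarrow> edge_history) \<Rightarrow>
   (nat set \<Rightarrow> msg) \<Rightarrow> nat set \<Rightarrow> msg \<times> msg" where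
  "edge_values A N he y e =
     agg_value A (edge_view_of N he e)
       (y (supernode A N he (Min e))) (y (supernode A N he (Max e)))"

definition aggregation_outcome ::
  "('ni, 'ei, 'o) ma_algorithm \<Rightarrow> ('ni, 'ei) network \<Rightarrow> nat \<Rightarrow>
   (nat set \<Rightarrow> edge_history) \<Rightarrow> (nat set \<Rightarrow> msg) \<Rightarrow> (nat set \<Rightarrow> msg option) \<Rightarrow> bool" where
  "aggregation_outcome A N t he y z \<longleftrightarrow>
     (\<forall>s \<in> supernode A N he ` nodes N.
        let I = {e \<in> minor_edges A N he. e \<inter> s \<noteq> {}};
            val = (\<lambda>e. if Min e \<in> s then fst (edge_values A N he y e)
                       else snd (edge_values A N he y e))
        in if I = {} then z s = None
           else \<exists>m. z s = Some m \<and>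
                  aggregates_to (agg_op A t) (image_mset val (mset_set I)) m)"

text \<open>\<open>ma_run A N t hn he\<close>: after \<open>t\<close> rounds some execution reaches the histories \<open>hn\<close> of the
  nodes and \<open>he\<close> of the edges.\<close>

inductive ma_run ::
  "('ni, 'ei, 'o) ma_algorithm \<Rightarrow> ('ni, 'ei) network \<Rightarrow> nat \<Rightarrow> (nat \<Rightarrow> node_history) \<Rightarrow>
   (nat set \<Rightarrow> edge_history) \<Rightarrow> bool"
  for A :: "('ni, 'ei, 'o) ma_algorithm" and N :: "('ni, 'ei) network" where
  start: "ma_run A N 0 (\<lambda>_. []) (\<lambda>_. [])"
| round: "\<lbrakk>ma_run A N t hn he; consensus_outcome A N t hn he y; aggregation_outcome A N t he y z\<rbrakk>
    \<Longrightarrow> ma_run A N (Suc t)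
          (\<lambda>v. hn v @ [(y (supernode A N he v), z (supernode A N he v))])
          (\<lambda>e. he e @ [if e \<in> minor_edges A N he
                       then Some (y (supernode A N he (Min e)), y (supernode A N he (Max e)))
                       else None])"

definition op_bits :: "nat \<Rightarrow> (msg \<Rightarrow> msg \<Rightarrow> msg) \<Rightarrow> bool" where
  "op_bits B f \<longleftrightarrow> (\<forall>a b. length a \<le> B \<longrightarrow> length b \<le> B \<longrightarrow> length (f a b) \<le> B)"

definition ma_bits :: "('ni, 'ei, 'o) ma_algorithm \<Rightarrow> ('ni, 'ei) network \<Rightarrow> nat \<Rightarrow> nat \<Rightarrow> bool" where
  "ma_bits A N B R \<longleftrightarrow>
     (\<forall>t<R. op_bits B (cons_op A t) \<and> op_bits B (agg_op A t)) \<and>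
     (\<forall>t<R. \<forall>hn he. ma_run A N t hn he \<longrightarrow>
        (\<forall>v\<in>nodes N. length (cons_value A (node_view_of N hn v)) \<le> B) \<and>
        (\<forall>y. consensus_outcome A N t hn he y \<longrightarrow>
           (\<forall>e\<in>minor_edges A N he.
              length (fst (edge_values A N he y e)) \<le> B \<and>
              length (snd (edge_values A N he y e)) \<le> B)))"

text \<open>In every execution, whatever the order of the aggregations, no node ever decides on a
  value other than \<open>res\<close>, and after \<open>R\<close> rounds all nodes have decided.\<close>

definition ma_computes ::
  "('ni, 'ei, 'o) ma_algorithm \<Rightarrow> ('ni, 'ei) network \<Rightarrow> nat \<Rightarrow> nat \<Rightarrow> 'o \<Rightarrow> bool" where
  "ma_computes A N B R res \<longleftrightarrow>
     ma_bits A N B R \<and>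
     (\<forall>t\<le>R. \<forall>hn he. ma_run A N t hn he \<longrightarrow>
        (\<forall>v\<in>nodes N. node_output A (node_view_of N hn v) \<in> {None, Some res})) \<and>
     (\<forall>hn he. ma_run A N R hn he \<longrightarrow>
        (\<forall>v\<in>nodes N. node_output A (node_view_of N hn v) = Some res))"


section \<open>Subtree instances\<close>

definition weighted_network ::
  "(nat \<Rightarrow> nat) \<Rightarrow> (nat \<Rightarrow> nat) \<Rightarrow> nat set \<Rightarrow> nat set set \<Rightarrow> (nat set \<Rightarrow> nat) \<Rightarrow> bool" where
  "weighted_network id_bits max_weight V E w \<longleftrightarrow>
     connected_graph V E \<and>
     (\<forall>v\<in>V. v < 2 ^ id_bits (card V)) \<and>
     (\<forall>e\<in>E. 0 < w e \<and> w e \<le> max_weight (card V))"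

definition subtree_instance ::
  "nat set \<Rightarrow> nat set set \<Rightarrow> nat set set \<Rightarrow> nat \<Rightarrow> nat \<Rightarrow> (nat \<Rightarrow> nat set) \<Rightarrow> (nat \<Rightarrow> nat set set) \<Rightarrow> bool"
where
  "subtree_instance V E F r k VT FT \<longleftrightarrow>
     F \<subseteq> E \<and> is_tree V F \<and> r \<in> V \<and>
     V = {r} \<union> (\<Union>i\<in>{1..k}. VT i) \<and>
     disjoint_family_on VT {1..k} \<and>
     (\<forall>i\<in>{1..k}. r \<notin> VT i \<and> is_tree (VT i) (FT i) \<and> FT i \<subseteq> F) \<and>
     (\<forall>e\<in>F - (\<Union>i\<in>{1..k}. FT i). r \<in> e)"

text \<open>An edge knows its weight, and either that it is not in the tree (\<open>None\<close>) or which of its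
  endpoints is closer to the root. Nodes have no input.\<close>

type_synonym tree_edge_input = "nat \<times> nat option"

definition tree_network ::
  "nat set \<Rightarrow> nat set set \<Rightarrow> (nat set \<Rightarrow> nat) \<Rightarrow> nat set set \<Rightarrow> nat \<Rightarrow> (unit, tree_edge_input) network"
where
  "tree_network V E w F r =
     \<lparr>nodes = V, edges = E, node_input = (\<lambda>_. ()),
      edge_input = (\<lambda>e. (w e, if e \<in> F then Some (endpoint_near_root F r e) else None))\<rparr>"

text \<open>Minima over an empty index set are \<open>\<infinity>\<close>.\<close>

definition min_1_respecting :: "nat set set \<Rightarrow> nat set set \<Rightarrow> (nat set \<Rightarrow> nat) \<Rightarrow> enat" where
  "min_1_respecting F E w = (INF e\<in>F. enat (cut1 F E w e))"

definition min_2_respecting ::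
  "nat set set \<Rightarrow> nat set set \<Rightarrow> (nat set \<Rightarrow> nat) \<Rightarrow> nat \<Rightarrow> (nat \<Rightarrow> nat set set) \<Rightarrow> enat" where
  "min_2_respecting F E w k FT =
     (INF i\<in>{1..k}. INF j\<in>{i<..k}. INF e\<in>FT i. INF f\<in>FT j. enat (cut2 F E w e f))"

end

theory Submission
  imports Defs
begin

text \<open>An edge of the tree is named by its lower endpoint. For edges \<open>x\<close>, \<open>y\<close> in different trees below
  the root, the cut value is \<open>C x + C y - 2 W\<close>, where \<open>W\<close> is the weight between the subtrees of \<open>x\<close>
  and \<open>y\<close>. If it is smaller than both \<open>C x\<close> and \<open>C y\<close>, then more than half of the weight \<open>C x\<close> goes
  to the subtree of \<open>y\<close> and vice versa.

  The tree is decomposed into vertical paths by Strahler ranks, of which there are logarithmically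
  many. Sums over subtrees become suffix sums along these paths, computed bit by bit from labels
  that increase along root paths. Separating the trees below the root by one bit of the ID of their
  top nodes, and using the majority property at each scale \<open>2 ^ s\<close> of the weight leaving a path, every
  path gets polylogarithmically many candidates for the path containing the other edge (the
  quartiles of the keys of its partners). It remains to treat disjoint pairs of paths that choose
  each other. There \<open>W\<close> has the Monge property, and a divide and conquer of logarithmic depth finds
  the minimum; its blocks are connected in the minor through an edge between the two paths.

  Lower-level computations are phrased by what nodes know: any quantity that is a function of the
  history of a node may be used in the next round, since local computation is free.\<close>

section \<open>Rooted trees\<close>

text \<open>A round aggregates only over one supernode or over the edges at one supernode, and
  supernodes are connected. So every sum or minimum has to be recast as one over connected sets of
  nodes that the edges can recognise locally. This shapes the intermediate notions: blocks below
  marked nodes, classes of a convex function on a path, and row blocks that learn from column blocks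
  only through edges between them. Order along a path needs numbers. Depths would do, but a depth is
  itself a sum over a root path, the kind of task that the numbers are meant to solve. Any labels
  increasing along root paths suffice, and the bit length of the labels is the number of doubling
  steps, both for suffix sums and for the divide and conquer. Addition and minimum make the outcome
  independent of the order of aggregation only if no sum overflows; the word length \<open>L\<close>
  is chosen so that every total of weights fits several times over, and \<open>2 ^ L - 1\<close> is
  free to serve as infinity. The length \<open>L\<close> and the program depend on the number of
  nodes, which nobody is told; it has to be counted first, with numbers whose length is obtained
  from the identifiers.\<close>

definition adj :: "nat set set \<Rightarrow> (nat \<times> nat) set" where
  "adj F = {(a, b). {a, b} \<in> F}"

lemma path_edges_simps [simp]:
  "path_edges [] = {}" "path_edges [a] = {}"
  "path_edges (a # b # p) = insert {a, b} (path_edges (b # p))"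
proof -
  show "path_edges (a # b # p) = insert {a, b} (path_edges (b # p))" (is "?l = ?r")
  proof
    show "?l \<subseteq> ?r"
    proof
      fix e assume "e \<in> ?l"
      then obtain i where "Suc i < length (a # b # p)" "e = {(a # b # p) ! i, (a # b # p) ! Suc i}"
        by (auto simp: path_edges_def)
      then show "e \<in> ?r" by (cases i) (auto simp: path_edges_def)
    qed
    have "e \<in> ?l" if h: "e \<in> path_edges (b # p)" for e
    proof -
      obtain i where "Suc i < length (b # p)" "e = {(b # p) ! i, (b # p) ! Suc i}"
        using h by (auto simp: path_edges_def)
      then show ?thesis unfolding path_edges_def
        by (intro CollectI exI[of _ "Suc i"]) auto
    qed
    moreover have "{a, b} \<in> ?l" unfolding path_edges_def by force
    ultimately show "?r \<subseteq> ?l" by auto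
  qed
qed (auto simp: path_edges_def)

lemma path_edges_append:
  assumes "p \<noteq> []" "q \<noteq> []"
  shows "path_edges (p @ q) = insert {last p, hd q} (path_edges p \<union> path_edges q)"
  using assms
proof (induction p)
  case (Cons a p)
  show ?case
  proof (cases p)
    case Nil
    then show ?thesis using Cons.prems by (cases q) auto
  next
    case (Cons b p')
    then show ?thesis using Cons.IH Cons.prems by auto
  qed
qed simp

lemma path_edges_subset: "e \<in> path_edges p \<Longrightarrow> e \<subseteq> set p"
  by (auto simp: path_edges_def)

section \<open>Paths and reachability\<close>

lemma is_path_refl [simp]: "is_path F v v [v]"
  by (simp add: is_path_def)

lemma is_path_prefix:
  assumes "is_path F u v (p @ x # q)"
  shows "is_path F u x (p @ [x])"
  using assms by (cases "p = []") (auto simp: is_path_def path_edges_append)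

lemma is_path_suffix:
  assumes "is_path F u v (p @ x # q)"
  shows "is_path F x v (x # q)"
  using assms by (cases "p = []") (auto simp: is_path_def path_edges_append)

lemma is_path_snoc:
  assumes "is_path F u v p" "{v, x} \<in> F"
  shows "\<exists>q. is_path F u x q"
proof (cases "x \<in> set p")
  case True
  then obtain p1 p2 where "p = p1 @ x # p2" by (meson split_list)
  then show ?thesis using is_path_prefix assms by blast
next
  case False
  then have "is_path F u x (p @ [x])"
    using assms by (auto simp: is_path_def path_edges_append)
  then show ?thesis by blast
qed

lemma rtrancl_adj_is_path: "(u, v) \<in> (adj F)\<^sup>* \<Longrightarrow> \<exists>p. is_path F u v p"
proof (induction rule: rtrancl_induct)
  case base
  then show ?case using is_path_refl by blast
next
  case (step y z)
  then show ?case using is_path_snoc by (auto simp: adj_def)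
qed

lemma walk_rtrancl: "p \<noteq> [] \<Longrightarrow> path_edges p \<subseteq> F \<Longrightarrow> (hd p, last p) \<in> (adj F)\<^sup>*"
proof (induction p)
  case (Cons a p)
  show ?case
  proof (cases p)
    case (Cons b p')
    then have "(a, b) \<in> adj F" "(b, last p) \<in> (adj F)\<^sup>*"
      using Cons.IH Cons.prems by (auto simp: adj_def)
    then show ?thesis using Cons by (auto intro: converse_rtrancl_into_rtrancl)
  qed simp
qed simp

lemma is_path_iff_rtrancl: "(\<exists>p. is_path F u v p) \<longleftrightarrow> (u, v) \<in> (adj F)\<^sup>*"
  using rtrancl_adj_is_path walk_rtrancl by (fastforce simp: is_path_def)

lemma sym_adj: "sym ((adj F)\<^sup>*)"
  by (rule sym_rtrancl) (auto simp: adj_def sym_def insert_commute)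

text \<open>A path between the ends that avoids the edge closes up with it to a cycle. It has at
  least three nodes, since a path on two nodes would consist of the removed edge itself.\<close>

lemma acyclic_edge_separates:
  assumes "\<nexists>p. is_cycle F p" "{a, b} \<in> F" "a \<noteq> b"
  shows "(a, b) \<notin> (adj (F - {{a, b}}))\<^sup>*"
proof
  assume "(a, b) \<in> (adj (F - {{a, b}}))\<^sup>*"
  then obtain p where p: "is_path (F - {{a, b}}) a b p" using rtrancl_adj_is_path by blast
  have "3 \<le> length p"
  proof (rule ccontr)
    assume "\<not> 3 \<le> length p"
    then consider x where "p = [x]" | x y where "p = [x, y]" | "p = []"
      by (cases p; cases "tl p"; cases "tl (tl p)") auto
    then show False using p assms(3) by cases (auto simp: is_path_def)
  qed
  then have "is_cycle F p"
    using p assms(2) by (auto simp: is_cycle_def is_path_def insert_commute)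
  then show False using assms(1) by blast
qed

lemma path_edges_Cons_avoid:
  "distinct (u # p) \<Longrightarrow> e \<in> path_edges p \<Longrightarrow> u \<notin> e"
  using path_edges_subset by fastforce

text \<open>If two paths from \<open>u\<close> part there and the first goes on to \<open>b\<close>,
  then the rest of the first and the whole second path join \<open>b\<close> to \<open>u\<close>
  without the edge \<open>{u, b}\<close>, against \<open>acyclic_edge_separates\<close>.\<close>

lemma acyclic_path_unique:
  assumes ac: "\<nexists>p. is_cycle F p"
  shows "is_path F u v p \<Longrightarrow> is_path F u v q \<Longrightarrow> p = q"
proof (induction p arbitrary: u q)
  case Nil
  then show ?case by (simp add: is_path_def)
next
  case (Cons a p)
  have a: "a = u" using Cons.prems by (simp add: is_path_def)
  obtain q' where q: "q = u # q'" using Cons.prems(2) by (cases q) (auto simp: is_path_def)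
  show ?case
  proof (cases "p = [] \<or> q' = []")
    case True
    then show ?thesis using Cons.prems a q by (auto simp: is_path_def split: if_splits)
  next
    case False
    then obtain b p2 c q2 where pq: "p = b # p2" "q' = c # q2" by (meson neq_Nil_conv)
    have pp: "is_path F b v p" and qp: "is_path F c v q'"
      using Cons.prems a q pq by (auto simp: is_path_def)
    show ?thesis
    proof (cases "b = c")
      case True
      then show ?thesis using Cons.IH[OF pp] qp a q by simp
    next
      case False
      let ?e = "{u, b}"
      have d: "distinct (u # p)" "distinct (u # q')" using Cons.prems a q by (auto simp: is_path_def)
      have "path_edges p \<subseteq> F - {?e}"
        using pp path_edges_Cons_avoid[OF d(1)] by (auto simp: is_path_def)
      then have 1: "(b, v) \<in> (adj (F - {?e}))\<^sup>*"
        using walk_rtrancl[of p] pp by (auto simp: is_path_def)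
      have "path_edges q' \<subseteq> F - {?e}"
        using qp path_edges_Cons_avoid[OF d(2)] by (auto simp: is_path_def)
      then have "path_edges q \<subseteq> F - {?e}"
        using Cons.prems(2) q pq False d by (auto simp: is_path_def doubleton_eq_iff)
      then have 2: "(u, v) \<in> (adj (F - {?e}))\<^sup>*"
        using walk_rtrancl[of q] Cons.prems(2) by (auto simp: is_path_def)
      have "(u, b) \<in> (adj (F - {?e}))\<^sup>*"
        using 1 2 sym_adj by (meson rtrancl_trans symE)
      moreover have "{u, b} \<in> F" "u \<noteq> b" using Cons.prems(1) a pq by (auto simp: is_path_def)
      ultimately show ?thesis using acyclic_edge_separates[OF ac] by blast
    qed
  qed
qed

text \<open>The trees below the root are left out on purpose: by \<open>result_eq\<close> the
  requested minimum is determined by these five components.\<close>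

record inst =
  iV :: "nat set"
  iE :: "nat set set"
  iw :: "nat set \<Rightarrow> nat"
  iF :: "nat set set"
  ir :: nat

section \<open>Ancestors, subtrees and nearest marked ancestors\<close>

definition root_path :: "inst \<Rightarrow> nat \<Rightarrow> nat list" where
  "root_path J v = tree_path (iF J) (ir J) v"

definition par :: "inst \<Rightarrow> nat \<Rightarrow> nat" where
  "par J v = (if v = ir J then v else last (butlast (root_path J v)))"

definition anc :: "inst \<Rightarrow> nat \<Rightarrow> nat set" where
  "anc J v = set (root_path J v)"

definition sub :: "inst \<Rightarrow> nat \<Rightarrow> nat set" where
  "sub J x = {u \<in> iV J. x \<in> anc J u}"

definition dep :: "inst \<Rightarrow> nat \<Rightarrow> nat" where
  "dep J v = tree_dist (iF J) (ir J) v"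

text \<open>The closest ancestor of a node, possibly itself, that lies in \<open>H\<close>.\<close>
definition near :: "inst \<Rightarrow> nat set \<Rightarrow> nat \<Rightarrow> nat" where
  "near J H v = last (filter (\<lambda>z. z \<in> H) (root_path J v))"

locale rooted_tree =
  fixes J :: inst
  assumes tree: "is_tree (iV J) (iF J)" and root [simp]: "ir J \<in> iV J"
begin

lemma acyc: "\<nexists>p. is_cycle (iF J) p" and conn: "connected_graph (iV J) (iF J)"
  using tree by (auto simp: is_tree_def)

lemma finite_V [simp]: "finite (iV J)" and F_edge: "e \<in> iF J \<Longrightarrow> e \<subseteq> iV J \<and> card e = 2"
  using conn by (auto simp: connected_graph_def simple_graph_def)

lemma tree_path_eq: "is_path (iF J) u v p \<Longrightarrow> tree_path (iF J) u v = p"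
  unfolding tree_path_def using acyclic_path_unique[OF acyc] by blast

lemma tree_path_is_path:
  "u \<in> iV J \<Longrightarrow> v \<in> iV J \<Longrightarrow> is_path (iF J) u v (tree_path (iF J) u v)"
  using conn tree_path_eq unfolding connected_graph_def by metis

lemma root_path_is_path: "v \<in> iV J \<Longrightarrow> is_path (iF J) (ir J) v (root_path J v)"
  unfolding root_path_def by (rule tree_path_is_path) auto

lemma root_path_root [simp]: "root_path J (ir J) = [ir J]"
  unfolding root_path_def by (rule tree_path_eq) simp

lemma par_root [simp]: "par J (ir J) = ir J"
  by (simp add: par_def)

lemma root_path_par:
  assumes "v \<in> iV J" "v \<noteq> ir J"
  shows "par J v \<in> iV J" "{par J v, v} \<in> iF J" "root_path J v = root_path J (par J v) @ [v]"
    "v \<notin> set (root_path J (par J v))"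
proof -
  let ?p = "root_path J v"
  have p: "is_path (iF J) (ir J) v ?p" using root_path_is_path assms by blast
  have "?p \<noteq> []" "last ?p = v" "hd ?p = ir J" using p by (auto simp: is_path_def)
  then have 1: "?p = butlast ?p @ [v]" "butlast ?p \<noteq> []"
    using assms(2) append_butlast_last_id[of ?p] by (auto simp del: append_butlast_last_id)
      (metis append_Nil list.sel(1))
  define q x where "q = butlast (butlast ?p)" and "x = last (butlast ?p)"
  have "butlast ?p = q @ [x]" using 1 by (simp add: q_def x_def)
  then have 2: "?p = q @ x # [v]" using 1 by simp
  have x: "x = par J v" using assms by (simp add: par_def x_def)
  have px: "is_path (iF J) (ir J) x (q @ [x])" using is_path_prefix p 2 by metis
  then have rp: "root_path J x = q @ [x]" unfolding root_path_def by (rule tree_path_eq)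
  have "is_path (iF J) x v [x, v]" using is_path_suffix p 2 by metis
  then have e: "{x, v} \<in> iF J" by (simp add: is_path_def)
  then show "{par J v, v} \<in> iF J" "par J v \<in> iV J" using x F_edge by auto
  show "root_path J v = root_path J (par J v) @ [v]" using 2 rp x by simp
  show "v \<notin> set (root_path J (par J v))"
    using p 2 rp x by (auto simp: is_path_def)
qed

lemma par_in_V [simp]: "v \<in> iV J \<Longrightarrow> par J v \<in> iV J"
  using root_path_par by (cases "v = ir J") auto

lemma dep_root [simp]: "dep J (ir J) = 0"
  using root_path_root by (simp add: dep_def tree_dist_def root_path_def)

lemma dep_par: "v \<in> iV J \<Longrightarrow> v \<noteq> ir J \<Longrightarrow> dep J v = Suc (dep J (par J v))"
proof -
  assume v: "v \<in> iV J" "v \<noteq> ir J"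
  have "root_path J (par J v) \<noteq> []" using root_path_is_path v by (auto simp: is_path_def)
  then show ?thesis
    using root_path_par(3)[OF v] by (simp add: dep_def tree_dist_def root_path_def[symmetric])
qed

lemma par_neq: "v \<in> iV J \<Longrightarrow> v \<noteq> ir J \<Longrightarrow> par J v \<noteq> v"
  using dep_par by force

lemma tree_induct [consumes 1, case_names root step]:
  assumes "v \<in> iV J" "P (ir J)" "\<And>v. v \<in> iV J \<Longrightarrow> v \<noteq> ir J \<Longrightarrow> P (par J v) \<Longrightarrow> P v"
  shows "P v"
  using assms(1)
proof (induction "dep J v" arbitrary: v rule: less_induct)
  case less
  then show ?case using assms(2,3) dep_par by (cases "v = ir J") auto
qed

lemma anc_root [simp]: "anc J (ir J) = {ir J}"
  by (simp add: anc_def)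

lemma anc_par: "v \<in> iV J \<Longrightarrow> v \<noteq> ir J \<Longrightarrow> anc J v = insert v (anc J (par J v))"
  using root_path_par(3) by (simp add: anc_def)

lemma anc_self [simp]: "v \<in> iV J \<Longrightarrow> v \<in> anc J v"
  by (cases "v = ir J") (auto simp: anc_par)

lemma root_anc [simp]: "v \<in> iV J \<Longrightarrow> ir J \<in> anc J v"
  by (induction rule: tree_induct) (auto simp: anc_par)

lemma anc_V: "v \<in> iV J \<Longrightarrow> x \<in> anc J v \<Longrightarrow> x \<in> iV J"
  by (induction rule: tree_induct) (auto simp: anc_par)

lemma anc_subset: "v \<in> iV J \<Longrightarrow> x \<in> anc J v \<Longrightarrow> anc J x \<subseteq> anc J v"
  by (induction rule: tree_induct) (auto simp: anc_par)

lemma anc_trans: "v \<in> iV J \<Longrightarrow> x \<in> anc J v \<Longrightarrow> y \<in> anc J x \<Longrightarrow> y \<in> anc J v"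
  using anc_subset by blast

lemma anc_dep: "v \<in> iV J \<Longrightarrow> x \<in> anc J v \<Longrightarrow> x \<noteq> v \<Longrightarrow> dep J x < dep J v"
proof (induction rule: tree_induct)
  case (step v)
  then have "x \<in> anc J (par J v)" using anc_par by blast
  then have "x = par J v \<or> dep J x < dep J (par J v)" using step.IH by blast
  then show ?case using dep_par[OF step.hyps] by auto
qed auto

lemma anc_strict: "v \<in> iV J \<Longrightarrow> x \<in> anc J v \<Longrightarrow> x \<noteq> v \<Longrightarrow> x \<in> anc J (par J v) \<and> v \<noteq> ir J"
  by (cases "v = ir J") (auto simp: anc_par)

lemma anc_antisym: "v \<in> iV J \<Longrightarrow> x \<in> anc J v \<Longrightarrow> v \<in> anc J x \<Longrightarrow> x = v"
  using anc_dep anc_V by (metis less_asym)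

lemma anc_linear: "v \<in> iV J \<Longrightarrow> x \<in> anc J v \<Longrightarrow> y \<in> anc J v \<Longrightarrow> x \<in> anc J y \<or> y \<in> anc J x"
proof (induction rule: tree_induct)
  case (step v)
  consider "x = v" | "y = v" | "x \<in> anc J (par J v)" "y \<in> anc J (par J v)"
    using step.prems anc_par[OF step.hyps] by blast
  then show ?case using step by cases blast+
qed auto

lemma par_anc: "v \<in> iV J \<Longrightarrow> par J v \<in> anc J v"
  by (cases "v = ir J") (auto simp: anc_par)

lemma finite_sub [simp]: "finite (sub J x)"
  by (simp add: sub_def)

lemma sub_V: "u \<in> sub J x \<Longrightarrow> u \<in> iV J"
  by (simp add: sub_def)

lemma sub_self [simp]: "x \<in> iV J \<Longrightarrow> x \<in> sub J x"
  by (simp add: sub_def)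

lemma sub_mono: "y \<in> sub J x \<Longrightarrow> sub J y \<subseteq> sub J x"
  using anc_trans by (auto simp: sub_def)

text \<open>Of two adjacent nodes at least one is not an ancestor of the other; appending it to the
  root path of the other gives its own root path, so the other is its parent.\<close>

lemma F_iff: "e \<in> iF J \<longleftrightarrow> (\<exists>v\<in>iV J. v \<noteq> ir J \<and> e = {par J v, v})"
proof
  assume e: "e \<in> iF J"
  then obtain a b where ab: "e = {a, b}" "a \<noteq> b" by (meson F_edge card_2_iff)
  then have V: "a \<in> iV J" "b \<in> iV J" using F_edge e by auto
  have main: "\<exists>v\<in>iV J. v \<noteq> ir J \<and> {a, b} = {par J v, v}"
    if ab: "{a, b} \<in> iF J" "a \<in> iV J" "b \<in> iV J" "b \<notin> set (root_path J a)" for a b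
  proof -
    have "is_path (iF J) (ir J) b (root_path J a @ [b])"
      using root_path_is_path[OF ab(2)] ab by (auto simp: is_path_def path_edges_append)
    then have 1: "root_path J b = root_path J a @ [b]"
      unfolding root_path_def by (metis tree_path_eq root_path_def)
    have 2: "root_path J a \<noteq> []" "last (root_path J a) = a"
      using root_path_is_path[OF ab(2)] by (auto simp: is_path_def)
    have "b \<noteq> ir J" using 1 2 by auto
    then have "par J b = a" using 1 2 by (simp add: par_def)
    then show ?thesis using ab \<open>b \<noteq> ir J\<close> by auto
  qed
  show "\<exists>v\<in>iV J. v \<noteq> ir J \<and> e = {par J v, v}"
  proof (cases "b \<in> anc J a")
    case False
    then show ?thesis using main e ab V by (auto simp: anc_def)
  next
    case True
    then have "a \<notin> anc J b" using anc_antisym V ab by blast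
    then show ?thesis using main[of b a] e ab V by (auto simp: anc_def insert_commute)
  qed
qed (auto simp: root_path_par)

lemma near_root: "ir J \<in> H \<Longrightarrow> near J H (ir J) = ir J"
  by (simp add: near_def)

lemma near_par:
  "v \<in> iV J \<Longrightarrow> v \<noteq> ir J \<Longrightarrow> near J H v = (if v \<in> H then v else near J H (par J v))"
  using root_path_par(3) by (simp add: near_def)

lemma near_self: "v \<in> iV J \<Longrightarrow> v \<in> H \<Longrightarrow> near J H v = v"
  by (cases "v = ir J") (auto simp: near_par near_root)

lemma near_in:
  assumes "ir J \<in> H" "v \<in> iV J"
  shows "near J H v \<in> H" "near J H v \<in> anc J v"
proof -
  have "near J H v \<in> H \<and> near J H v \<in> anc J v"
    using assms(2) by (induction rule: tree_induct) (auto simp: assms(1) near_root near_par anc_par)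
  then show "near J H v \<in> H" "near J H v \<in> anc J v" by auto
qed

lemma near_V [simp]: "ir J \<in> H \<Longrightarrow> v \<in> iV J \<Longrightarrow> near J H v \<in> iV J"
  using near_in anc_V by blast

lemma near_max:
  assumes "ir J \<in> H" "v \<in> iV J" "y \<in> anc J v" "y \<in> H"
  shows "y \<in> anc J (near J H v)"
  using assms(2,3)
proof (induction rule: tree_induct)
  case (step v)
  then show ?case using assms by (auto simp: near_par anc_par split: if_splits)
qed (use assms in \<open>auto simp: near_root\<close>)

lemma near_eqI:
  assumes "ir J \<in> H" "v \<in> iV J" "y \<in> anc J v" "y \<in> H" "\<And>z. z \<in> anc J v \<Longrightarrow> z \<in> H \<Longrightarrow> y \<in> anc J z \<Longrightarrow> z = y"
  shows "near J H v = y"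
  using near_in[OF assms(1,2)] near_max[OF assms(1-4)] assms(5) by blast

lemma near_between:
  assumes "ir J \<in> H" "v \<in> iV J" "u \<in> anc J v" "near J H v \<in> anc J u"
  shows "near J H u = near J H v"
proof (rule near_eqI)
  show "u \<in> iV J" using anc_V assms by blast
  fix z assume z: "z \<in> anc J u" "z \<in> H" "near J H v \<in> anc J z"
  then have "z \<in> anc J (near J H v)" using near_max assms anc_trans by blast
  then show "z = near J H v" using anc_antisym z assms near_V anc_V by blast
qed (use assms near_in in auto)

lemma near_near: "ir J \<in> H' \<Longrightarrow> H' \<subseteq> H \<Longrightarrow> v \<in> iV J \<Longrightarrow> near J H' (near J H v) = near J H' v"
proof -
  assume a: "ir J \<in> H'" "H' \<subseteq> H" "v \<in> iV J"
  then have r: "ir J \<in> H" by blast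
  show ?thesis
  proof (rule near_between[OF a(1,3)])
    show "near J H v \<in> anc J v" using near_in r a by blast
    show "near J H' v \<in> anc J (near J H v)" using near_max r a near_in by blast
  qed
qed

lemma near_invariant:
  assumes "ir J \<in> H" "\<And>z. z \<in> iV J \<Longrightarrow> z \<noteq> ir J \<Longrightarrow> z \<notin> H \<Longrightarrow> f z = f (par J z)" "v \<in> iV J"
  shows "f (near J H v) = f v"
  using assms(3) by (induction rule: tree_induct) (auto simp: assms near_root near_par)

lemma child_towards:
  assumes "v \<in> iV J" "x \<in> anc J v" "x \<noteq> v"
  shows "\<exists>c\<in>iV J. c \<noteq> ir J \<and> par J c = x \<and> c \<in> anc J v"
  using assms
proof (induction rule: tree_induct)
  case (step v)
  then have "x \<in> anc J (par J v)" using anc_par by blast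
  then have "x = par J v \<or> (\<exists>c\<in>iV J. c \<noteq> ir J \<and> par J c = x \<and> c \<in> anc J (par J v))"
    using step.IH by blast
  then show ?case using anc_par[OF step.hyps] step.hyps by blast
qed auto

text \<open>The common parent of the two nodes is the lowest common ancestor, found as the nearest
  ancestor of \<open>u\<close> among the ancestors of \<open>v\<close>.\<close>

lemma meet_exists:
  assumes "u \<in> iV J" "v \<in> iV J" "u \<notin> anc J v" "v \<notin> anc J u"
  obtains c c' where "c \<in> iV J" "c' \<in> iV J" "c \<noteq> ir J" "c' \<noteq> ir J" "c \<noteq> c'" "par J c = par J c'"
    "c \<in> anc J u" "c' \<in> anc J v"
proof -
  define m where "m = near J (anc J v) u"
  have m: "m \<in> anc J v" "m \<in> anc J u"
    using near_in[of "anc J v" u] assms by (auto simp: m_def)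
  have "m \<noteq> u" "m \<noteq> v" using m assms by auto
  then obtain c c' where c: "c \<in> iV J" "c \<noteq> ir J" "par J c = m" "c \<in> anc J u"
    and c': "c' \<in> iV J" "c' \<noteq> ir J" "par J c' = m" "c' \<in> anc J v"
    using child_towards[of u m] child_towards[of v m] assms m by blast
  have "c \<noteq> c'"
  proof
    assume "c = c'"
    then have "c \<in> anc J m" unfolding m_def using near_max[of "anc J v" u c] c c' assms by auto
    moreover have "m \<in> anc J c" using c par_anc by auto
    ultimately have "c = m" using anc_antisym c m assms anc_V by metis
    then show False using par_neq c by metis
  qed
  then show ?thesis using that[of c c'] c c' by simp
qed

lemma endpoint_near_root_eq:
  assumes "v \<in> iV J" "v \<noteq> ir J"
  shows "endpoint_near_root (iF J) (ir J) {par J v, v} = par J v"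
proof -
  have "is_arg_min (tree_dist (iF J) (ir J)) (\<lambda>u. u \<in> {par J v, v}) x \<longleftrightarrow> x = par J v" for x
    using dep_par[OF assms] by (auto simp: is_arg_min_def dep_def)
  then show ?thesis unfolding endpoint_near_root_def arg_min_def by (intro some_equality) auto
qed

text \<open>Every tree edge other than \<open>{par J x, x}\<close> has both ends inside or both ends
  outside \<open>sub J x\<close>. A path therefore changes sides only by using this edge, and a
  simple path uses it at most once.\<close>

lemma covers_iff:
  assumes "u \<in> iV J" "v \<in> iV J" "x \<in> iV J" "x \<noteq> ir J"
  shows "{par J x, x} \<in> path_edges (tree_path (iF J) u v) \<longleftrightarrow> (u \<in> sub J x) \<noteq> (v \<in> sub J x)"
proof -
  let ?S = "sub J x" and ?p = "tree_path (iF J) u v" and ?e = "{par J x, x}"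
  have p: "is_path (iF J) u v ?p" using tree_path_is_path assms by blast
  have cross: "(a \<in> ?S) = (b \<in> ?S)" if h: "{a, b} \<in> iF J" "{a, b} \<noteq> ?e" for a b
  proof -
    obtain z where z: "z \<in> iV J" "z \<noteq> ir J" "{a, b} = {par J z, z}"
      using h(1) unfolding F_iff by blast
    then have "z \<noteq> x" using h by auto
    then have "(z \<in> ?S) = (par J z \<in> ?S)" using z by (auto simp: sub_def anc_par)
    then show ?thesis using z by (auto simp: doubleton_eq_iff)
  qed
  have walk: "path_edges q \<subseteq> iF J - {?e} \<Longrightarrow> q \<noteq> [] \<Longrightarrow> (hd q \<in> ?S) = (last q \<in> ?S)" for q
  proof (induction q)
    case (Cons a q)
    show ?case
    proof (cases q)
      case Nil
      then show ?thesis by simp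
    next
      case (Cons b q')
      then have "(a \<in> ?S) = (b \<in> ?S)" using Cons.prems by (intro cross) auto
      then show ?thesis using Cons.IH Cons.prems Cons by simp
    qed
  qed simp
  show ?thesis
  proof
    assume "?e \<in> path_edges ?p"
    then obtain i where i: "Suc i < length ?p" "?e = {?p ! i, ?p ! Suc i}"
      by (auto simp: path_edges_def)
    \<comment> \<open>The path is cut where it uses the edge. Its nodes are distinct, so neither
      piece uses the edge again and each piece stays on one side.\<close>
    define p1 p2 where "p1 = take (Suc i) ?p" and "p2 = drop (Suc i) ?p"
    have pp: "?p = p1 @ p2" "p1 \<noteq> []" "p2 \<noteq> []" using i by (auto simp: p1_def p2_def)
    have le: "last p1 = ?p ! i" "hd p2 = ?p ! Suc i"
      using i(1) by (auto simp: p1_def p2_def take_Suc_conv_app_nth hd_drop_conv_nth)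
    have d: "set p1 \<inter> set p2 = {}" using p pp(1) distinct_append[of p1 p2] by (simp add: is_path_def)
    have in12: "last p1 \<in> set p1" "hd p2 \<in> set p2" using pp by auto
    have "?e \<notin> path_edges p1" "?e \<notin> path_edges p2"
      using path_edges_subset[of ?e p1] path_edges_subset[of ?e p2] i(2) le in12 d by auto
    then have "path_edges p1 \<subseteq> iF J - {?e}" "path_edges p2 \<subseteq> iF J - {?e}"
      using p pp by (auto simp: is_path_def path_edges_append)
    then have "(hd p1 \<in> ?S) = (last p1 \<in> ?S)" "(hd p2 \<in> ?S) = (last p2 \<in> ?S)"
      using walk pp by auto
    moreover have "hd p1 = u" "last p2 = v" using p pp by (auto simp: is_path_def)
    moreover have "(last p1 \<in> ?S) \<noteq> (hd p2 \<in> ?S)"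
    proof -
      have "x \<in> ?S" "par J x \<notin> ?S"
        using assms anc_antisym[of "par J x" x] par_anc[of x] par_neq[of x] by (auto simp: sub_def)
      then show ?thesis using i(2) le by (auto simp: doubleton_eq_iff)
    qed
    ultimately show "(u \<in> ?S) \<noteq> (v \<in> ?S)" by auto
  next
    assume ne: "(u \<in> ?S) \<noteq> (v \<in> ?S)"
    show "?e \<in> path_edges ?p"
    proof (rule ccontr)
      assume "?e \<notin> path_edges ?p"
      then have "path_edges ?p \<subseteq> iF J - {?e}" using p by (auto simp: is_path_def)
      then show False using walk[of ?p] p ne by (auto simp: is_path_def)
    qed
  qed
qed

end

section \<open>Programs and the knowledge of nodes\<close>

definition natbits :: "nat \<Rightarrow> nat \<Rightarrow> msg" where
  "natbits l m = map (bit m) [0..<l]"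

definition bitsnat :: "msg \<Rightarrow> nat" where
  "bitsnat bs = horner_sum of_bool 2 bs"

lemma length_natbits [simp]: "length (natbits l m) = l"
  by (simp add: natbits_def)

lemma bitsnat_natbits [simp]: "m < 2 ^ l \<Longrightarrow> bitsnat (natbits l m) = m"
  by (simp add: bitsnat_def natbits_def horner_sum_bit_eq_take_bit take_bit_nat_eq_self)

lemma bitsnat_less: "bitsnat bs < 2 ^ length bs"
  unfolding bitsnat_def by (induction bs) (auto simp: of_bool_def)

text \<open>The first bit of a message selects between addition and minimum, so that one operator
  serves all rounds.\<close>
definition uop :: "msg \<Rightarrow> msg \<Rightarrow> msg" where
  "uop a b = (case a of [] \<Rightarrow> [] | t # as \<Rightarrow>
     t # natbits (length as)
       (if t then bitsnat as + bitsnat (tl b) else min (bitsnat as) (bitsnat (tl b))))"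

definition encm :: "nat \<Rightarrow> bool \<Rightarrow> nat \<Rightarrow> msg" where
  "encm l t m = t # natbits l m"

lemma op_bits_uop: "op_bits B uop"
  by (auto simp: op_bits_def uop_def split: list.splits)

text \<open>\<open>natbits\<close> truncates, so \<open>uop\<close> adds modulo
  \<open>2 ^ l\<close>. A partial sum never exceeds the total, hence a bound on the total excludes
  overflow for every order of aggregation.\<close>

lemma aggregates_sum:
  assumes "aggregates_to uop M y" "\<forall>m\<in>#M. length m = Suc l \<and> hd m"
    "(\<Sum>m\<in>#M. bitsnat (tl m)) < 2 ^ l"
  shows "length y = Suc l \<and> hd y \<and> bitsnat (tl y) = (\<Sum>m\<in>#M. bitsnat (tl m))"
  using assms
proof (induction rule: aggregates_to.induct)
  case (combine a b M y)
  obtain as where a: "a = True # as" "length as = l"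
    using combine.prems(1) by (cases a) auto
  have "uop a b = True # natbits l (bitsnat as + bitsnat (tl b))"
    using a by (simp add: uop_def)
  moreover have "bitsnat as + bitsnat (tl b) < 2 ^ l" using combine.prems a by simp
  ultimately show ?case using combine a by simp
qed simp

lemma aggregates_min:
  assumes "aggregates_to uop M y" "\<forall>m\<in>#M. length m = Suc l \<and> \<not> hd m"
  shows "length y = Suc l \<and> \<not> hd y \<and> bitsnat (tl y) = Min ((\<lambda>m. bitsnat (tl m)) ` set_mset M)"
  using assms
proof (induction rule: aggregates_to.induct)
  case (combine a b M y)
  obtain as where a: "a = False # as" "length as = l"
    using combine.prems(1) by (cases a) auto
  have u: "uop a b = False # natbits l (min (bitsnat as) (bitsnat (tl b)))"
    using a by (simp add: uop_def)
  have "min (bitsnat as) (bitsnat (tl b)) < 2 ^ l" using bitsnat_less[of as] a by simp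
  then have 1: "bitsnat (tl (uop a b)) = min (bitsnat (tl a)) (bitsnat (tl b))" using u a by simp
  let ?f = "\<lambda>m. bitsnat (tl m)"
  have "Min (?f ` set_mset (add_mset (uop a b) M)) = Min (?f ` set_mset (add_mset a (add_mset b M)))"
  proof (cases "M = {#}")
    case False
    then show ?thesis using 1 by (simp add: Min_insert2 min.assoc)
  qed (simp add: 1)
  then show ?case using combine.IH combine.prems u by auto
qed simp

text \<open>A single round is written as a record for a whole algorithm. Its functions only have to
  be right on histories of one length, and \<open>prun\<close> reads its operators at round number
  0.\<close>

type_synonym round_spec = "(unit, tree_edge_input, enat) ma_algorithm"

abbreviation net :: "inst \<Rightarrow> (unit, tree_edge_input) network" where
  "net J \<equiv> tree_network (iV J) (iE J) (iw J) (iF J) (ir J)"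

inductive prun :: "(unit, tree_edge_input) network \<Rightarrow> round_spec list \<Rightarrow> (nat \<Rightarrow> node_history) \<Rightarrow>
    (nat set \<Rightarrow> edge_history) \<Rightarrow> bool" for N where
  prun_Nil: "prun N [] (\<lambda>_. []) (\<lambda>_. [])"
| prun_snoc: "prun N \<sigma> hn he \<Longrightarrow> consensus_outcome A N 0 hn he y \<Longrightarrow> aggregation_outcome A N 0 he y z
    \<Longrightarrow> prun N (\<sigma> @ [A]) (\<lambda>v. hn v @ [(y (supernode A N he v), z (supernode A N he v))])
          (\<lambda>e. he e @ [if e \<in> minor_edges A N he
                       then Some (y (supernode A N he (Min e)), y (supernode A N he (Max e)))
                       else None])"

lemma prun_length: "prun N \<sigma> hn he \<Longrightarrow> length (hn v) = length \<sigma> \<and> length (he e) = length \<sigma>"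
  by (induction rule: prun.induct) auto

lemma prun_snocE:
  assumes "prun N (\<sigma> @ [A]) hn he"
  obtains hn0 he0 y z where "prun N \<sigma> hn0 he0" "consensus_outcome A N 0 hn0 he0 y"
    "aggregation_outcome A N 0 he0 y z"
    "hn = (\<lambda>v. hn0 v @ [(y (supernode A N he0 v), z (supernode A N he0 v))])"
    "he = (\<lambda>e. he0 e @ [if e \<in> minor_edges A N he0
                       then Some (y (supernode A N he0 (Min e)), y (supernode A N he0 (Max e)))
                       else None])"
  using assms by cases auto

lemma prun_prefix:
  "prun N (\<sigma> @ \<rho>) hn he \<Longrightarrow>
   \<exists>hn0 he0. prun N \<sigma> hn0 he0 \<and> (\<forall>v. hn0 v = take (length \<sigma>) (hn v))"
proof (induction \<rho> arbitrary: hn he rule: rev_induct)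
  case Nil
  then have "\<forall>v. hn v = take (length \<sigma>) (hn v)" using prun_length[of N \<sigma> hn he] by simp
  then show ?case using Nil by auto
next
  case (snoc A \<rho>)
  then have "prun N ((\<sigma> @ \<rho>) @ [A]) hn he" by simp
  then obtain hn0 he0 y z where 1: "prun N (\<sigma> @ \<rho>) hn0 he0"
    "hn = (\<lambda>v. hn0 v @ [(y (supernode A N he0 v), z (supernode A N he0 v))])"
    by (rule prun_snocE) blast
  have "take (length \<sigma>) (hn v) = take (length \<sigma>) (hn0 v)" for v
    using 1 prun_length[OF 1(1), of v] by simp
  then show ?case using snoc.IH[OF 1(1)] by auto
qed

definition spec_ok :: "nat \<Rightarrow> round_spec \<Rightarrow> bool" where
  "spec_ok B A \<longleftrightarrow> cons_op A = (\<lambda>_. uop) \<and> agg_op A = (\<lambda>_. uop) \<and>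
     (\<forall>nv. length (cons_value A nv) \<le> B) \<and>
     (\<forall>ev a b. length (fst (agg_value A ev a b)) \<le> B \<and> length (snd (agg_value A ev a b)) \<le> B)"

definition nbr :: "inst \<Rightarrow> nat \<Rightarrow> nat set" where
  "nbr J v = {u. {v, u} \<in> iE J}"

text \<open>Relation of a neighbour \<open>u\<close> to \<open>v\<close>: 1 for the parent, 2 for a child, 0 if the edge
  is not in the tree.\<close>
definition trel :: "inst \<Rightarrow> nat \<Rightarrow> nat \<Rightarrow> nat" where
  "trel J v u = (if {v, u} \<in> iF J then if par J v = u \<and> v \<noteq> ir J then 1 else 2 else 0)"

definition tmsg :: "nat \<Rightarrow> nat \<Rightarrow> nat list \<Rightarrow> msg" where
  "tmsg l c xs = concat (map (\<lambda>i. natbits l (xs ! i)) [0..<c])"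

definition tdec :: "nat \<Rightarrow> nat \<Rightarrow> msg \<Rightarrow> nat list" where
  "tdec l c m = map (\<lambda>i. bitsnat (take l (drop (i * l) m))) [0..<c]"

lemma length_tmsg [simp]: "length (tmsg l c xs) = c * l"
  by (induction c) (auto simp: tmsg_def)

lemma tdec_tmsg:
  assumes "length xs = c" "\<forall>x\<in>set xs. x < 2 ^ l"
  shows "tdec l c (tmsg l c xs) = xs"
proof (rule nth_equalityI)
  show "length (tdec l c (tmsg l c xs)) = length xs" using assms by (simp add: tdec_def)
  fix i assume "i < length (tdec l c (tmsg l c xs))"
  then have i: "i < c" by (simp add: tdec_def)
  define f where "f = (\<lambda>i. natbits l (xs ! i))"
  have "[0..<c] = [0..<i] @ i # [Suc i..<c]"
    using i upt_add_eq_append[of 0 i "c - i"] upt_conv_Cons[of i c] by simp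
  then have "tmsg l c xs = concat (map f [0..<i]) @ f i @ concat (map f [Suc i..<c])"
    by (simp add: tmsg_def f_def)
  moreover have "length (concat (map f [0..<i])) = i * l"
    using length_tmsg[of l i xs] by (simp add: tmsg_def f_def)
  ultimately have "take l (drop (i * l) (tmsg l c xs)) = f i" by (simp add: f_def)
  then show "tdec l c (tmsg l c xs) ! i = xs ! i"
    using i assms by (simp add: tdec_def f_def)
qed

text \<open>A contracted edge joins two nodes with the same nearest ancestor in \<open>H\<close>.
  Conversely every node climbs to that ancestor through contracted edges, so nodes sharing it are
  connected.\<close>

lemma (in rooted_tree) block_reachable:
  assumes H: "ir J \<in> H" and C: "C = {{par J z, z} |z. z \<in> iV J \<and> z \<noteq> ir J \<and> z \<notin> H}" and v: "v \<in> iV J"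
  shows "{u \<in> iV J. (v, u) \<in> (adj C)\<^sup>*} = {u \<in> iV J. near J H u = near J H v}"
proof (intro Collect_cong conj_cong refl iffI)
  fix u
  assume "(v, u) \<in> (adj C)\<^sup>*"
  then have "u \<in> iV J \<and> near J H u = near J H v"
  proof (induction rule: rtrancl_induct)
    case (step a b)
    obtain z where z: "z \<in> iV J" "z \<noteq> ir J" "z \<notin> H" "{a, b} = {par J z, z}"
      using step(2) C by (auto simp: adj_def)
    then have "near J H z = near J H (par J z)" by (simp add: near_par)
    then show ?case using z step by (auto simp: doubleton_eq_iff)
  qed (use v in simp)
  then show "near J H u = near J H v" by simp
next
  fix u
  assume u: "u \<in> iV J" and eq: "near J H u = near J H v"
  have r: "(u, near J H u) \<in> (adj C)\<^sup>*" if "u \<in> iV J" for u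
    using that
  proof (induction rule: tree_induct)
    case (step v)
    show ?case
    proof (cases "v \<in> H")
      case False
      then have "(v, par J v) \<in> adj C" using step C by (auto simp: adj_def insert_commute)
      then show ?thesis using step False by (simp add: near_par converse_rtrancl_into_rtrancl)
    qed (simp add: step near_self)
  qed (simp add: near_root H)
  show "(v, u) \<in> (adj C)\<^sup>*" using r[OF u] r[OF v] eq sym_adj by (metis rtrancl_trans symE)
qed

text \<open>\<open>I\<close> collects the instances that one program has to serve, and among which a
  node may be unable to distinguish; \<open>L\<close> is the number of bits of a transmitted
  number.\<close>

locale frame =
  fixes I :: "inst set" and L :: nat
  assumes L_pos: "0 < L"
    and inst_wf: "J \<in> I \<Longrightarrow> connected_graph (iV J) (iE J) \<and> iF J \<subseteq> iE J \<and> rooted_tree J"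
begin

lemma I_rooted: "J \<in> I \<Longrightarrow> rooted_tree J"
  using inst_wf by blast

lemma I_finite: "J \<in> I \<Longrightarrow> finite (iV J)"
  using I_rooted rooted_tree.finite_V by blast

lemma E_edge:
  assumes "J \<in> I" "e \<in> iE J"
  obtains a b where "e = {a, b}" "a < b" "Min e = a" "Max e = b" "a \<in> iV J" "b \<in> iV J"
proof -
  have "card e = 2" "e \<subseteq> iV J"
    using inst_wf assms by (auto simp: connected_graph_def simple_graph_def)
  then obtain a b where e: "e = {a, b}" "a \<noteq> b" by (meson card_2_iff)
  show ?thesis
  proof (cases "a < b")
    case True
    then show ?thesis using that[of a b] e \<open>e \<subseteq> iV J\<close> by simp
  next
    case False
    then show ?thesis using that[of b a] e \<open>e \<subseteq> iV J\<close> by (simp add: insert_commute)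
  qed
qed

lemma nbr_V: "J \<in> I \<Longrightarrow> u \<in> nbr J v \<Longrightarrow> u \<in> iV J \<and> u \<noteq> v"
  unfolding nbr_def by (auto elim!: E_edge simp: doubleton_eq_iff)

lemma finite_nbr: "J \<in> I \<Longrightarrow> finite (nbr J v)"
  using nbr_V I_finite by (meson finite_subset subsetI)

text \<open>Indistinguishability at \<open>v\<close>. The two executions may also differ in the
  order of aggregation; this is what makes a known value readable from the history in every
  execution.\<close>

definition same :: "round_spec list \<Rightarrow> inst \<Rightarrow> inst \<Rightarrow> nat \<Rightarrow> bool" where
  "same \<sigma> J J' v \<longleftrightarrow> J \<in> I \<and> J' \<in> I \<and> v \<in> iV J \<and> v \<in> iV J' \<and>
     (\<exists>hn he hn' he'. prun (net J) \<sigma> hn he \<and> prun (net J') \<sigma> hn' he' \<and> hn v = hn' v)"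

text \<open>\<open>K J v\<close> is a function of what node \<open>v\<close> has learned when program \<open>\<sigma>\<close> ends.\<close>
definition knows :: "round_spec list \<Rightarrow> (inst \<Rightarrow> nat \<Rightarrow> 'a) \<Rightarrow> bool" where
  "knows \<sigma> K \<longleftrightarrow> (\<forall>J J' v. same \<sigma> J J' v \<longrightarrow> K J v = K J' v)"

text \<open>A message is a tuple of at most 16 numbers of \<open>L\<close> bits, or one such number
  with the bit that selects the operator; both fit into \<open>Suc (16 * L)\<close> bits.\<close>

definition ext :: "nat \<Rightarrow> round_spec list \<Rightarrow> round_spec list \<Rightarrow> bool" where
  "ext m \<sigma> \<sigma>' \<longleftrightarrow> (\<exists>\<rho>. \<sigma>' = \<sigma> @ \<rho> \<and> length \<rho> \<le> m \<and> (\<forall>A\<in>set \<rho>. spec_ok (Suc (16 * L)) A))"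

lemma sameD: "same \<sigma> J J' v \<Longrightarrow> J \<in> I" "same \<sigma> J J' v \<Longrightarrow> J' \<in> I"
  "same \<sigma> J J' v \<Longrightarrow> v \<in> iV J" "same \<sigma> J J' v \<Longrightarrow> v \<in> iV J'"
  by (auto simp: same_def)

lemma knowsI: "(\<And>J J' v. same \<sigma> J J' v \<Longrightarrow> K J v = K J' v) \<Longrightarrow> knows \<sigma> K"
  by (simp add: knows_def)

lemma knowsD: "knows \<sigma> K \<Longrightarrow> same \<sigma> J J' v \<Longrightarrow> K J v = K J' v"
  by (simp add: knows_def)

lemma knows_cong: "knows \<sigma> K \<Longrightarrow> (\<And>J v. J \<in> I \<Longrightarrow> v \<in> iV J \<Longrightarrow> K' J v = K J v) \<Longrightarrow> knows \<sigma> K'"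
  by (auto simp: knows_def same_def)

lemma knows_const: "knows \<sigma> (\<lambda>_ _. c)" and knows_id: "knows \<sigma> (\<lambda>_ v. v)"
  by (auto simp: knows_def)

lemma knows_1: "knows \<sigma> A \<Longrightarrow> knows \<sigma> (\<lambda>J v. h v (A J v))"
  by (auto simp: knows_def)

lemma knows_2: "knows \<sigma> A \<Longrightarrow> knows \<sigma> B \<Longrightarrow> knows \<sigma> (\<lambda>J v. h v (A J v) (B J v))"
  unfolding knows_def by metis

lemma knows_3: "knows \<sigma> A \<Longrightarrow> knows \<sigma> B \<Longrightarrow> knows \<sigma> C \<Longrightarrow> knows \<sigma> (\<lambda>J v. h v (A J v) (B J v) (C J v))"
  unfolding knows_def by metis

lemma ext_refl: "ext m \<sigma> \<sigma>"
  by (simp add: ext_def)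

lemma ext_trans: "ext m \<sigma> \<sigma>' \<Longrightarrow> ext m' \<sigma>' \<sigma>'' \<Longrightarrow> ext (m + m') \<sigma> \<sigma>''"
  unfolding ext_def by (fastforce intro: exI[of _ "\<rho> @ \<rho>'" for \<rho> \<rho>'])

lemma ext_mono: "ext m \<sigma> \<sigma>' \<Longrightarrow> m \<le> m' \<Longrightarrow> ext m' \<sigma> \<sigma>'"
  unfolding ext_def using le_trans by blast

lemma same_ext:
  assumes "ext m \<sigma> \<sigma>'" "same \<sigma>' J J' v"
  shows "same \<sigma> J J' v"
proof -
  obtain \<rho> where \<rho>: "\<sigma>' = \<sigma> @ \<rho>" using assms by (auto simp: ext_def)
  obtain hn he hn' he' where h: "prun (net J) \<sigma>' hn he" "prun (net J') \<sigma>' hn' he'" "hn v = hn' v"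
    using assms by (auto simp: same_def)
  obtain hn0 he0 where 1: "prun (net J) \<sigma> hn0 he0" "hn0 v = take (length \<sigma>) (hn v)"
    using prun_prefix h(1) \<rho> by blast
  obtain hn1 he1 where 2: "prun (net J') \<sigma> hn1 he1" "hn1 v = take (length \<sigma>) (hn' v)"
    using prun_prefix h(2) \<rho> by blast
  have "hn0 v = hn1 v" using 1 2 h by simp
  then show ?thesis using 1 2 assms(2) unfolding same_def by blast
qed

lemma knows_ext: "ext m \<sigma> \<sigma>' \<Longrightarrow> knows \<sigma> K \<Longrightarrow> knows \<sigma>' K"
  using same_ext unfolding knows_def by blast

text \<open>All instances and executions that produce a given history at \<open>v\<close> agree on
  the quantity, so choosing any of the possible values yields a correct function of ID and history.
  Such functions are what the later round specifications are built from.\<close>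

lemma knows_reader:
  assumes "knows \<sigma> K"
  shows "\<exists>g. \<forall>J\<in>I. \<forall>hn he v. prun (net J) \<sigma> hn he \<longrightarrow> v \<in> iV J \<longrightarrow> g v (hn v) = K J v"
proof -
  define Q where "Q v h k \<longleftrightarrow> (\<exists>J\<in>I. \<exists>hn he. prun (net J) \<sigma> hn he \<and> v \<in> iV J \<and> hn v = h \<and> k = K J v)" for v h k
  define g where "g v h = (SOME k. Q v h k)" for v h
  have "g v (hn v) = K J v" if "J \<in> I" "prun (net J) \<sigma> hn he" "v \<in> iV J" for J hn he v
  proof -
    have "Q v (hn v) (K J v)" using that unfolding Q_def by blast
    then have "Q v (hn v) (g v (hn v))" unfolding g_def by (rule someI)
    then show ?thesis using that assms unfolding Q_def knows_def same_def by metis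
  qed
  then show ?thesis by blast
qed

lemma knows_snoc:
  assumes "\<And>J hn he y z v. J \<in> I \<Longrightarrow> prun (net J) \<sigma> hn he \<Longrightarrow> consensus_outcome A (net J) 0 hn he y \<Longrightarrow>
    aggregation_outcome A (net J) 0 he y z \<Longrightarrow> v \<in> iV J \<Longrightarrow>
    K J v = f (y (supernode A (net J) he v)) (z (supernode A (net J) he v))"
  shows "knows (\<sigma> @ [A]) K"
proof (rule knowsI)
  fix J J' v assume s: "same (\<sigma> @ [A]) J J' v"
  have eq: "K J v = case_prod f (last (hn v))" if "J \<in> I" "v \<in> iV J" "prun (net J) (\<sigma> @ [A]) hn he" for J hn he
    using that(3)
  proof (cases rule: prun_snocE)
    case (1 hn0 he0 y z)
    then show ?thesis using assms[OF that(1) 1(1-3) that(2)] by simp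
  qed
  obtain hn he hn' he' where h: "prun (net J) (\<sigma> @ [A]) hn he" "prun (net J') (\<sigma> @ [A]) hn' he'" "hn v = hn' v"
    using s by (auto simp: same_def)
  then show "K J v = K J' v" using eq[OF _ _ h(1)] eq[OF _ _ h(2)] sameD[OF s] by simp
qed

section \<open>The two kinds of rounds: exchange with neighbours and consensus in blocks\<close>

lemma net_simps [simp]: "nodes (net J) = iV J" "edges (net J) = iE J"
  "edge_input (net J) = (\<lambda>e. (iw J e, if e \<in> iF J then Some (endpoint_near_root (iF J) (ir J) e) else None))"
  by (auto simp: tree_network_def)

lemma supernode_eq: "supernode A N he v = {u \<in> nodes N. (v, u) \<in> (adj (contracted_edges A N he))\<^sup>*}"
  by (simp add: supernode_def is_path_iff_rtrancl)

lemma supernode_single: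
  assumes "\<And>ev. \<not> contracts A ev" "v \<in> iV J"
  shows "supernode A (net J) he v = {v}"
proof -
  have "contracted_edges A (net J) he = {}" using assms by (simp add: contracted_edges_def)
  then show ?thesis using assms by (auto simp: supernode_eq adj_def)
qed

lemma minor_edges_single:
  assumes "J \<in> I" "\<And>ev. \<not> contracts A ev"
  shows "minor_edges A (net J) he = iE J"
proof -
  have "supernode A (net J) he (Min e) \<noteq> supernode A (net J) he (Max e)" if "e \<in> iE J" for e
    using E_edge[OF assms(1) that] supernode_single[OF assms(2)] by (metis order_less_irrefl singleton_inject)
  then show ?thesis by (auto simp: minor_edges_def)
qed

lemma consensus_single:
  assumes "consensus_outcome A (net J) 0 hn he y" "\<And>ev. \<not> contracts A ev" "v \<in> iV J"
  shows "y {v} = cons_value A (node_view_of (net J) hn v)"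
proof -
  have "aggregates_to (cons_op A 0) {#cons_value A (node_view_of (net J) hn v)#} (y {v})"
    using assms supernode_single[OF assms(2,3)] by (force simp: consensus_outcome_def)
  then show ?thesis by cases auto
qed

text \<open>The inserted number is the largest one with \<open>L\<close> bits: it gives a value to
  the empty minimum and does not disturb any other minimum of \<open>L\<close>-bit numbers.\<close>

definition aggr :: "bool \<Rightarrow> (nat \<Rightarrow> nat) \<Rightarrow> nat set \<Rightarrow> nat" where
  "aggr t f S = (if t then sum f S else Min (insert (2 ^ L - 1) (f ` S)))"

lemma aggregates_aggr:
  assumes agg: "aggregates_to uop (image_mset g (mset_set S)) m"
    and fin: "finite S" "S \<noteq> {}" and g: "\<And>x. x \<in> S \<Longrightarrow> g x = encm L t (f x)"
    and less: "\<And>x. x \<in> S \<Longrightarrow> f x < 2 ^ L" and bound: "t \<Longrightarrow> sum f S < 2 ^ L"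
  shows "bitsnat (tl m) = aggr t f S"
proof -
  have el: "x \<in># mset_set S \<longleftrightarrow> x \<in> S" for x using fin by simp
  have gi: "image_mset g (mset_set S) = image_mset (\<lambda>x. encm L t (f x)) (mset_set S)"
    by (rule image_mset_cong) (use g el in auto)
  have "bitsnat (tl (encm L t (f x))) = f x" if "x \<in> S" for x using less[OF that] by (simp add: encm_def)
  then have bi: "image_mset (\<lambda>m. bitsnat (tl m)) (image_mset g (mset_set S)) = image_mset f (mset_set S)"
    unfolding gi multiset.map_comp by (intro image_mset_cong) (use el in auto)
  have al: "\<forall>m\<in>#image_mset g (mset_set S). length m = Suc L \<and> (hd m = t)"
    unfolding gi by (auto simp: encm_def)
  show ?thesis
  proof (cases t)
    case True
    have "(\<Sum>m\<in>#image_mset g (mset_set S). bitsnat (tl m)) = sum f S"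
      unfolding bi by (simp add: sum_unfold_sum_mset)
    then show ?thesis using aggregates_sum[OF agg, of L] al True bound by (auto simp: aggr_def)
  next
    case False
    have "set_mset (image_mset (\<lambda>m. bitsnat (tl m)) (image_mset g (mset_set S))) = f ` S"
      unfolding bi using fin by simp
    then have "(\<lambda>m. bitsnat (tl m)) ` set_mset (image_mset g (mset_set S)) = f ` S" by simp
    then have 1: "bitsnat (tl m) = Min (f ` S)" using aggregates_min[OF agg, of L] al False by auto
    have "Min (insert (2 ^ L - 1) (f ` S)) = min (2 ^ L - 1) (Min (f ` S))"
      using fin by (simp add: Min_insert2)
    moreover have "Min (f ` S) < 2 ^ L" using fin less by (auto simp: Min_less_iff)
    ultimately show ?thesis using 1 False by (simp add: aggr_def)
  qed
qed

text \<open>Without contraction every supernode is a single node, so consensus merely shows each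
  edge the tuples of its two ends. The edge then evaluates \<open>\<phi>\<close> once in each
  direction.\<close>

definition nb_spec :: "bool \<Rightarrow> nat \<Rightarrow> (nat \<Rightarrow> node_history \<Rightarrow> nat list) \<Rightarrow>
    (nat list \<Rightarrow> nat list \<Rightarrow> nat \<Rightarrow> nat \<Rightarrow> nat) \<Rightarrow> round_spec" where
  "nb_spec t c g \<phi> = \<lparr>contracts = \<lambda>_. False,
     cons_value = \<lambda>nv. tmsg L c (g (nv_id nv) (nv_history nv)),
     cons_op = \<lambda>_. uop,
     agg_value = \<lambda>ev a b.
       let d = (\<lambda>u. case snd (ev_input ev) of None \<Rightarrow> 0 | Some q \<Rightarrow> if q = u then 1 else 2) in
       (encm L t (\<phi> (tdec L c a) (tdec L c b) (fst (ev_input ev)) (d (ev_high_id ev))),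
        encm L t (\<phi> (tdec L c b) (tdec L c a) (fst (ev_input ev)) (d (ev_low_id ev)))),
     agg_op = \<lambda>_. uop, node_output = \<lambda>_. None\<rparr>"

lemma nb_spec_ok: "c \<le> 16 \<Longrightarrow> spec_ok (Suc (16 * L)) (nb_spec t c g \<phi>)"
proof -
  assume "c \<le> 16"
  then have "c * L \<le> 16 * L" by simp
  then show ?thesis by (auto simp: spec_ok_def nb_spec_def encm_def Let_def intro: le_SucI)
qed

lemma trel_input:
  assumes "J \<in> I" "{v, u} \<in> iE J"
  shows "(case if {v, u} \<in> iF J then Some (endpoint_near_root (iF J) (ir J) {v, u}) else None of
     None \<Rightarrow> 0 | Some q \<Rightarrow> if q = u then 1 else 2) = trel J v u"
proof (cases "{v, u} \<in> iF J")
  case True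
  interpret rooted_tree J using I_rooted assms by blast
  obtain z where z: "z \<in> iV J" "z \<noteq> ir J" "{v, u} = {par J z, z}" using True unfolding F_iff by blast
  have e: "endpoint_near_root (iF J) (ir J) {v, u} = par J z" using endpoint_near_root_eq z by simp
  consider "v = par J z" "u = z" | "v = z" "u = par J z" using z by (auto simp: doubleton_eq_iff)
  then show ?thesis
  proof cases
    case 1
    have "par J v \<noteq> u \<or> v = ir J" using 1 z par_in_V dep_par by (metis n_not_Suc_n lessI less_SucI not_less_iff_gr_or_eq)
    then show ?thesis using 1 e True par_neq z by (auto simp: trel_def)
  qed (use e True z in \<open>auto simp: trel_def\<close>)
qed (simp add: trel_def)

lemma nb_round:
  fixes K :: "inst \<Rightarrow> nat \<Rightarrow> nat list"
  assumes k: "knows \<sigma> K"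
    and len: "\<And>J v. J \<in> I \<Longrightarrow> v \<in> iV J \<Longrightarrow> length (K J v) = c \<and> (\<forall>x\<in>set (K J v). x < 2 ^ L)"
    and c: "c \<le> 16"
    and less: "\<And>J v u. J \<in> I \<Longrightarrow> v \<in> iV J \<Longrightarrow> u \<in> nbr J v \<Longrightarrow> \<phi> (K J v) (K J u) (iw J {v, u}) (trel J v u) < 2 ^ L"
    and bound: "\<And>J v. t \<Longrightarrow> J \<in> I \<Longrightarrow> v \<in> iV J \<Longrightarrow> (\<Sum>u\<in>nbr J v. \<phi> (K J v) (K J u) (iw J {v, u}) (trel J v u)) < 2 ^ L"
  shows "\<exists>\<sigma>'. ext 1 \<sigma> \<sigma>' \<and> knows \<sigma>' (\<lambda>J v. aggr t (\<lambda>u. \<phi> (K J v) (K J u) (iw J {v, u}) (trel J v u)) (nbr J v))"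
proof -
  obtain g where g: "\<And>J hn he v. J \<in> I \<Longrightarrow> prun (net J) \<sigma> hn he \<Longrightarrow> v \<in> iV J \<Longrightarrow> g v (hn v) = K J v"
    using knows_reader[OF k] by blast
  let ?A = "nb_spec t c g \<phi>"
  have nc: "\<not> contracts ?A ev" for ev by (simp add: nb_spec_def)
  define f where "f y z = (case z of None \<Rightarrow> (if t then 0 else 2 ^ L - 1) | Some m \<Rightarrow> bitsnat (tl m))"
    for y :: msg and z
  have "knows (\<sigma> @ [?A]) (\<lambda>J v. aggr t (\<lambda>u. \<phi> (K J v) (K J u) (iw J {v, u}) (trel J v u)) (nbr J v))"
  proof (rule knows_snoc[where f = f])
    fix J hn he y z v
    assume i: "J \<in> I" and r: "prun (net J) \<sigma> hn he" and co: "consensus_outcome ?A (net J) 0 hn he y"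
      and ao: "aggregation_outcome ?A (net J) 0 he y z" and v: "v \<in> iV J"
    let ?\<phi> = "\<lambda>v u. \<phi> (K J v) (K J u) (iw J {v, u}) (trel J v u)"
    have y: "tdec L c (y {u}) = K J u" if "u \<in> iV J" for u
    proof -
      have "y {u} = tmsg L c (K J u)"
        using consensus_single[OF co nc that] g[OF i r that] by (simp add: nb_spec_def node_view_of_def)
      then show ?thesis using tdec_tmsg len[OF i that] by simp
    qed
    let ?I = "{e \<in> iE J. v \<in> e}"
    have me: "minor_edges ?A (net J) he = iE J" by (rule minor_edges_single[OF i nc])
    let ?val = "\<lambda>e. if Min e \<in> {v} then fst (edge_values ?A (net J) he y e)
                       else snd (edge_values ?A (net J) he y e)"
    have val: "?val {v, u} = encm L t (?\<phi> v u)" if u: "u \<in> nbr J v" for u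
    proof -
      have e: "{v, u} \<in> iE J" using u by (simp add: nbr_def)
      have V: "u \<in> iV J" "u \<noteq> v" using nbr_V[OF i u] by auto
      have s: "supernode ?A (net J) he u = {u}" "supernode ?A (net J) he v = {v}"
        using supernode_single[OF nc] V v by auto
      consider "v < u" "Min {v, u} = v" "Max {v, u} = u" | "u < v" "Min {v, u} = u" "Max {v, u} = v"
        using V by (cases "v < u") auto
      then show ?thesis
        using y V v s
        by cases (simp_all add: edge_values_def nb_spec_def edge_view_of_def Let_def
            trel_input[OF i e, symmetric])
    qed
    have bij: "bij_betw (\<lambda>u. {v, u}) (nbr J v) ?I"
    proof (rule bij_betwI')
      fix e assume e: "e \<in> ?I"
      then obtain a b where "e = {a, b}" using E_edge[OF i] by blast
      then show "\<exists>u\<in>nbr J v. e = {v, u}" using e by (auto simp: nbr_def insert_commute)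
    qed (auto simp: nbr_def doubleton_eq_iff)
    have sv: "supernode ?A (net J) he v = {v}" using supernode_single[OF nc v] .
    have ao': "if ?I = {} then z {v} = None else \<exists>m. z {v} = Some m \<and>
        aggregates_to uop (image_mset ?val (mset_set ?I)) m"
    proof -
      have I_eq: "{e \<in> minor_edges ?A (net J) he. e \<inter> {v} \<noteq> {}} = ?I" using me by auto
      have "{v} \<in> supernode ?A (net J) he ` nodes (net J)" using v sv by force
      note a = bspec[OF ao[unfolded aggregation_outcome_def Let_def] this]
      have op: "agg_op ?A 0 = uop" by (simp add: nb_spec_def)
      show ?thesis using a by (simp only: I_eq op)
    qed
    show "aggr t (?\<phi> v) (nbr J v) = f (y (supernode ?A (net J) he v)) (z (supernode ?A (net J) he v))"
    proof (cases "?I = {}")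
      case True
      then have "nbr J v = {}" by (auto simp: nbr_def)
      then show ?thesis using ao' True sv by (simp add: f_def aggr_def)
    next
      case False
      then obtain m where m: "z {v} = Some m" "aggregates_to uop (image_mset ?val (mset_set ?I)) m"
        using ao' unfolding if_not_P[OF False] by blast
      have ne: "nbr J v \<noteq> {}" using bij False by (auto simp: bij_betw_def)
      have "mset_set ?I = image_mset (\<lambda>u. {v, u}) (mset_set (nbr J v))"
        using bij by (metis image_mset_mset_set bij_betw_def)
      then have "aggregates_to uop (image_mset (\<lambda>u. ?val {v, u}) (mset_set (nbr J v))) m"
        using m(2) by (simp add: multiset.map_comp comp_def)
      then have "bitsnat (tl m) = aggr t (?\<phi> v) (nbr J v)"
        by (rule aggregates_aggr[OF _ finite_nbr[OF i] ne]) (use val less[OF i v] bound[OF _ i v] in auto)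
      then show ?thesis using m sv by (simp add: f_def)
    qed
  qed
  moreover have "ext 1 \<sigma> (\<sigma> @ [?A])" unfolding ext_def using nb_spec_ok[OF c] by auto
  ultimately show ?thesis by blast
qed

text \<open>An edge decides on its contraction from its own history, before it hears anything in
  that round. What it must know about its ends has to be shown to it one round earlier.\<close>

lemma nb_spec_tell:
  assumes i: "J \<in> I" and e: "e \<in> iE J" and r: "prun (net J) (\<sigma> @ [nb_spec t c g \<phi>]) hn he"
    and g: "\<And>hn he v. prun (net J) \<sigma> hn he \<Longrightarrow> v \<in> iV J \<Longrightarrow> g v (hn v) = K v"
  shows "last (he e) = Some (tmsg L c (K (Min e)), tmsg L c (K (Max e)))"
  using r
proof (cases rule: prun_snocE)
  case (1 hn0 he0 y z)
  let ?A = "nb_spec t c g \<phi>"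
  have nc: "\<not> contracts ?A ev" for ev by (simp add: nb_spec_def)
  have V: "Min e \<in> iV J" "Max e \<in> iV J" using E_edge[OF i e] by metis+
  have "y {u} = tmsg L c (K u)" if "u \<in> iV J" for u
    using consensus_single[OF 1(2) nc that] g[OF 1(1) that] by (simp add: nb_spec_def node_view_of_def)
  then show ?thesis
    using 1(5) minor_edges_single[OF i nc] e supernode_single[OF nc] V by simp
qed

text \<open>The edge to be tested is contracted if its lower end announced 0, that is, not to be a
  block top. Since \<open>q\<close> is the upper end, the announcement of the lower end is the
  second one exactly if \<open>q\<close> has the smaller ID.\<close>

definition block_spec :: "bool \<Rightarrow> (nat \<Rightarrow> node_history \<Rightarrow> nat) \<Rightarrow> round_spec" where
  "block_spec t g = \<lparr>contracts = \<lambda>ev. case snd (ev_input ev) of None \<Rightarrow> False | Some q \<Rightarrow>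
       (case last (ev_history ev) of None \<Rightarrow> False | Some (a, b) \<Rightarrow>
          tdec L 1 (if q = ev_low_id ev then b else a) = [0]),
     cons_value = \<lambda>nv. encm L t (g (nv_id nv) (nv_history nv)),
     cons_op = \<lambda>_. uop, agg_value = \<lambda>_ _ _. ([], []), agg_op = \<lambda>_. uop, node_output = \<lambda>_. None\<rparr>"

lemma block_round:
  fixes x :: "inst \<Rightarrow> nat \<Rightarrow> nat"
  assumes k: "knows \<sigma> (\<lambda>J v. v \<in> H J)" and H: "\<And>J. J \<in> I \<Longrightarrow> ir J \<in> H J" and kx: "knows \<sigma> x"
    and less: "\<And>J v. J \<in> I \<Longrightarrow> v \<in> iV J \<Longrightarrow> x J v < 2 ^ L"
    and bound: "\<And>J. t \<Longrightarrow> J \<in> I \<Longrightarrow> sum (x J) (iV J) < 2 ^ L"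
  shows "\<exists>\<sigma>'. ext 2 \<sigma> \<sigma>' \<and> knows \<sigma>' (\<lambda>J v. aggr t (x J) {u \<in> iV J. near J (H J) u = near J (H J) v})"
proof -
  define K :: "inst \<Rightarrow> nat \<Rightarrow> nat list" where "K J v = [of_bool (v \<in> H J)]" for J v
  have kK: "knows \<sigma> K" unfolding K_def by (rule knows_1[OF k])
  obtain g where g: "\<And>J hn he v. J \<in> I \<Longrightarrow> prun (net J) \<sigma> hn he \<Longrightarrow> v \<in> iV J \<Longrightarrow> g v (hn v) = K J v"
    using knows_reader[OF kK] by blast
  let ?A = "nb_spec True 1 g (\<lambda>_ _ _ _. 0)"
  have e1: "ext 1 \<sigma> (\<sigma> @ [?A])" unfolding ext_def using nb_spec_ok[of 1] by auto
  obtain h where h: "\<And>J hn he v. J \<in> I \<Longrightarrow> prun (net J) (\<sigma> @ [?A]) hn he \<Longrightarrow> v \<in> iV J \<Longrightarrow> h v (hn v) = x J v"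
    using knows_reader[OF knows_ext[OF e1 kx]] by blast
  let ?B = "block_spec t h"
  have e2: "ext 1 (\<sigma> @ [?A]) ((\<sigma> @ [?A]) @ [?B])"
    using L_pos unfolding ext_def by (auto simp: spec_ok_def block_spec_def encm_def)
  have "knows ((\<sigma> @ [?A]) @ [?B]) (\<lambda>J v. aggr t (x J) {u \<in> iV J. near J (H J) u = near J (H J) v})"
  proof (rule knows_snoc[where f = "\<lambda>y z. bitsnat (tl y)"])
    fix J hn he y z v
    assume i: "J \<in> I" and r: "prun (net J) (\<sigma> @ [?A]) hn he" and co: "consensus_outcome ?B (net J) 0 hn he y"
      and v: "v \<in> iV J"
    interpret rooted_tree J using I_rooted i by blast
    have dec: "tdec L 1 (tmsg L 1 (K J u)) = [of_bool (u \<in> H J)]" for u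
    proof -
      have "(1::nat) < 2 ^ L" using L_pos one_less_power[of "2::nat" L] by simp
      then show ?thesis unfolding K_def by (intro tdec_tmsg) auto
    qed
    have la: "last (he e) = Some (tmsg L 1 (K J (Min e)), tmsg L 1 (K J (Max e)))" if "e \<in> iE J" for e
      by (rule nb_spec_tell[OF i that r]) (use g[OF i] in auto)
    have con: "contracts ?B (edge_view_of (net J) he {par J z, z}) \<longleftrightarrow> z \<notin> H J" if z: "z \<in> iV J" "z \<noteq> ir J" for z
    proof -
      have F: "{par J z, z} \<in> iF J" using z root_path_par by blast
      then have E: "{par J z, z} \<in> iE J" using inst_wf i by blast
      have ne: "par J z \<noteq> z" using par_neq z by blast
      note simps = block_spec_def edge_view_of_def F endpoint_near_root_eq[OF z] la[OF E]
      show ?thesis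
      proof (cases "par J z < z")
        case True
        then have "Min {par J z, z} = par J z" "Max {par J z, z} = z" by auto
        then show ?thesis by (simp add: simps dec del: One_nat_def)
      next
        case False
        then have "Min {par J z, z} = z" "Max {par J z, z} = par J z" using ne by auto
        then show ?thesis using ne by (simp add: simps dec del: One_nat_def)
      qed
    qed
    have "contracted_edges ?B (net J) he = {{par J z, z} |z. z \<in> iV J \<and> z \<noteq> ir J \<and> z \<notin> H J}" (is "?l = ?r")
    proof
      show "?l \<subseteq> ?r"
      proof
        fix e assume e: "e \<in> ?l"
        then have "e \<in> iF J" by (auto simp: contracted_edges_def block_spec_def edge_view_of_def split: if_splits)
        then obtain z where "z \<in> iV J" "z \<noteq> ir J" "e = {par J z, z}" unfolding F_iff by blast
        then show "e \<in> ?r" using e con by (auto simp: contracted_edges_def)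
      qed
      show "?r \<subseteq> ?l" using con root_path_par(2) inst_wf[OF i] by (auto simp: contracted_edges_def)
    qed
    then have sn: "supernode ?B (net J) he v = {u \<in> iV J. near J (H J) u = near J (H J) v}" (is "_ = ?S")
      using block_reachable[OF H[OF i] _ v] by (simp add: supernode_eq)
    have "v \<in> ?S" "?S \<subseteq> iV J" using v by auto
    then have S: "finite ?S" "?S \<noteq> {}" by (auto intro: finite_subset)
    have "?S \<in> supernode ?B (net J) he ` nodes (net J)" using v sn by force
    note a = bspec[OF co[unfolded consensus_outcome_def] this]
    have op: "cons_op ?B 0 = uop" by (simp add: block_spec_def)
    have "aggregates_to uop (image_mset (\<lambda>u. cons_value ?B (node_view_of (net J) hn u)) (mset_set ?S)) (y ?S)"
      using a by (simp only: op)
    then have "bitsnat (tl (y ?S)) = aggr t (x J) ?S"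
    proof (rule aggregates_aggr[OF _ S])
      show "cons_value ?B (node_view_of (net J) hn u) = encm L t (x J u)" if "u \<in> ?S" for u
        using that h[OF i r] by (simp add: block_spec_def node_view_of_def)
      show "sum (x J) ?S < 2 ^ L" if t
      proof -
        have "sum (x J) ?S \<le> sum (x J) (iV J)" by (rule sum_mono2) auto
        then show ?thesis using bound[OF that i] by simp
      qed
    qed (use less[OF i] in auto)
    then show "aggr t (x J) ?S = bitsnat (tl (y (supernode ?B (net J) he v)))" using sn by simp
  qed
  moreover have "ext 2 \<sigma> ((\<sigma> @ [?A]) @ [?B])" using ext_trans[OF e1 e2] by (simp add: numeral_2_eq_2)
  ultimately show ?thesis by blast
qed

end

section \<open>Values obtained from neighbours, blocks and parents\<close>

context frame
begin

lemma ex_knows_cong: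
  assumes "\<exists>\<sigma>'. ext m \<sigma> \<sigma>' \<and> knows \<sigma>' K" "\<And>J v. J \<in> I \<Longrightarrow> v \<in> iV J \<Longrightarrow> K' J v = K J v"
  shows "\<exists>\<sigma>'. ext m \<sigma> \<sigma>' \<and> knows \<sigma>' K'"
proof -
  obtain \<sigma>' where "ext m \<sigma> \<sigma>'" "knows \<sigma>' K" using assms(1) by blast
  moreover have "knows \<sigma>' K'" by (rule knows_cong[OF \<open>knows \<sigma>' K\<close>]) (rule assms(2))
  ultimately show ?thesis by blast
qed

lemma nb_sum:
  fixes K :: "inst \<Rightarrow> nat \<Rightarrow> nat list" and \<phi> :: "nat list \<Rightarrow> nat list \<Rightarrow> nat \<Rightarrow> nat \<Rightarrow> nat"
  assumes "knows \<sigma> K"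
    and "\<And>J v. J \<in> I \<Longrightarrow> v \<in> iV J \<Longrightarrow> length (K J v) = c \<and> (\<forall>x\<in>set (K J v). x < 2 ^ L)"
    and "c \<le> 16"
    and bound: "\<And>J v. J \<in> I \<Longrightarrow> v \<in> iV J \<Longrightarrow> (\<Sum>u\<in>nbr J v. \<phi> (K J v) (K J u) (iw J {v, u}) (trel J v u)) < 2 ^ L"
  shows "\<exists>\<sigma>'. ext 1 \<sigma> \<sigma>' \<and> knows \<sigma>' (\<lambda>J v. \<Sum>u\<in>nbr J v. \<phi> (K J v) (K J u) (iw J {v, u}) (trel J v u))"
proof -
  have "\<phi> (K J v) (K J u) (iw J {v, u}) (trel J v u) < 2 ^ L" if "J \<in> I" "v \<in> iV J" "u \<in> nbr J v" for J v u
    using member_le_sum[OF that(3), of "\<lambda>u. \<phi> (K J v) (K J u) (iw J {v, u}) (trel J v u)"]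
      finite_nbr[OF that(1)] bound[OF that(1,2)] by simp
  from nb_round[of _ _ _ \<phi> True, OF assms(1-3) this bound] show ?thesis by (simp add: aggr_def)
qed

lemma nb_min:
  fixes K :: "inst \<Rightarrow> nat \<Rightarrow> nat list" and \<phi> :: "nat list \<Rightarrow> nat list \<Rightarrow> nat \<Rightarrow> nat \<Rightarrow> nat"
  assumes "knows \<sigma> K"
    and "\<And>J v. J \<in> I \<Longrightarrow> v \<in> iV J \<Longrightarrow> length (K J v) = c \<and> (\<forall>x\<in>set (K J v). x < 2 ^ L)"
    and "c \<le> 16"
    and "\<And>J v u. J \<in> I \<Longrightarrow> v \<in> iV J \<Longrightarrow> u \<in> nbr J v \<Longrightarrow> \<phi> (K J v) (K J u) (iw J {v, u}) (trel J v u) < 2 ^ L"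
  shows "\<exists>\<sigma>'. ext 1 \<sigma> \<sigma>' \<and> knows \<sigma>' (\<lambda>J v. Min (insert (2 ^ L - 1)
    ((\<lambda>u. \<phi> (K J v) (K J u) (iw J {v, u}) (trel J v u)) ` nbr J v)))"
  using nb_round[of _ _ _ \<phi> False, OF assms] by (simp add: aggr_def)

definition block :: "inst \<Rightarrow> nat set \<Rightarrow> nat \<Rightarrow> nat set" where
  "block J H v = {u \<in> iV J. near J H u = near J H v}"

lemma block_sum:
  fixes x :: "inst \<Rightarrow> nat \<Rightarrow> nat"
  assumes "knows \<sigma> (\<lambda>J v. v \<in> H J)" "\<And>J. J \<in> I \<Longrightarrow> ir J \<in> H J" "knows \<sigma> x"
    and bound: "\<And>J. J \<in> I \<Longrightarrow> sum (x J) (iV J) < 2 ^ L"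
  shows "\<exists>\<sigma>'. ext 2 \<sigma> \<sigma>' \<and> knows \<sigma>' (\<lambda>J v. \<Sum>u\<in>block J (H J) v. x J u)"
proof -
  have "x J v < 2 ^ L" if "J \<in> I" "v \<in> iV J" for J v
    using member_le_sum[OF that(2), of "x J"] I_finite[OF that(1)] bound[OF that(1)] by simp
  from block_round[where t = True, OF assms(1-3) this bound] show ?thesis by (simp add: aggr_def block_def)
qed

lemma block_min:
  fixes x :: "inst \<Rightarrow> nat \<Rightarrow> nat"
  assumes "knows \<sigma> (\<lambda>J v. v \<in> H J)" "\<And>J. J \<in> I \<Longrightarrow> ir J \<in> H J" "knows \<sigma> x"
    "\<And>J v. J \<in> I \<Longrightarrow> v \<in> iV J \<Longrightarrow> x J v < 2 ^ L"
  shows "\<exists>\<sigma>'. ext 2 \<sigma> \<sigma>' \<and> knows \<sigma>' (\<lambda>J v. Min (x J ` block J (H J) v))"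
proof -
  have "aggr False (x J) (block J (H J) v) = Min (x J ` block J (H J) v)" if "J \<in> I" "v \<in> iV J" for J v
  proof -
    have f: "finite (x J ` block J (H J) v)" "x J v \<in> x J ` block J (H J) v"
      using that I_finite by (auto simp: block_def)
    then have "Min (x J ` block J (H J) v) \<le> x J v" by simp
    moreover have "x J v < 2 ^ L" using assms(4) that by blast
    moreover have "x J ` block J (H J) v \<noteq> {}" using f(2) by blast
    ultimately show ?thesis using f(1) by (simp add: aggr_def)
  qed
  then have eq: "Min (x J ` block J (H J) v) = aggr False (x J) (block J (H J) v)" if "J \<in> I" "v \<in> iV J" for J v
    using that by simp
  have "\<exists>\<sigma>'. ext 2 \<sigma> \<sigma>' \<and> knows \<sigma>' (\<lambda>J v. aggr False (x J) (block J (H J) v))"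
    unfolding block_def by (rule block_round) (use assms in auto)
  then show ?thesis by (rule ex_knows_cong) (rule eq)
qed

text \<open>The top of a block is its only node in \<open>H\<close>. All other nodes contribute the
  neutral element of the minimum, so the minimum over the block is the value at the top.\<close>

lemma near_value:
  fixes f :: "inst \<Rightarrow> nat \<Rightarrow> nat"
  assumes H: "knows \<sigma> (\<lambda>J v. v \<in> H J)" "\<And>J. J \<in> I \<Longrightarrow> ir J \<in> H J" and f: "knows \<sigma> f"
    "\<And>J v. J \<in> I \<Longrightarrow> v \<in> iV J \<Longrightarrow> f J v < 2 ^ L"
  shows "\<exists>\<sigma>'. ext 2 \<sigma> \<sigma>' \<and> knows \<sigma>' (\<lambda>J v. f J (near J (H J) v))"
proof -
  define x where "x J v = (if v \<in> H J then f J v else 2 ^ L - 1)" for J v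
  have kx: "knows \<sigma> x" unfolding x_def by (rule knows_2[OF H(1) f(1)])
  have eq: "f J (near J (H J) v) = Min (x J ` block J (H J) v)" if i: "J \<in> I" "v \<in> iV J" for J v
  proof -
    interpret rooted_tree J using I_rooted i by blast
    let ?z = "near J (H J) v"
    have z: "?z \<in> H J" "?z \<in> iV J" using near_in(1)[OF H(2)] near_V[OF H(2)] i by auto
    then have zb: "?z \<in> block J (H J) v" using near_self by (simp add: block_def)
    have "f J ?z \<le> x J u" if u: "u \<in> block J (H J) v" for u
    proof (cases "u \<in> H J")
      case True
      then have "u = ?z" using u near_self by (auto simp: block_def)
      then show ?thesis using z by (simp add: x_def)
    next
      case False
      then show ?thesis using f(2)[OF i(1) z(2)] by (simp add: x_def)
    qed
    moreover have "x J ?z = f J ?z" using z by (simp add: x_def)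
    moreover have "finite (x J ` block J (H J) v)" by (simp add: block_def)
    ultimately show ?thesis using zb by (intro Min_eqI[symmetric]) force+
  qed
  have "x J v < 2 ^ L" if "J \<in> I" "v \<in> iV J" for J v using f(2)[OF that] by (simp add: x_def)
  from block_min[OF H kx this] show ?thesis by (rule ex_knows_cong) (simp_all add: eq)
qed

lemma trel_1:
  assumes "J \<in> I" "v \<in> iV J"
  shows "{u \<in> nbr J v. trel J v u = 1} = (if v = ir J then {} else {par J v})"
proof -
  interpret rooted_tree J using I_rooted assms by blast
  have "{v, par J v} \<in> iF J \<and> {v, par J v} \<in> iE J" if "v \<noteq> ir J"
    using root_path_par(2)[OF assms(2) that] inst_wf[OF assms(1)] by (auto simp: insert_commute)
  then show ?thesis by (auto simp: trel_def nbr_def split: if_splits)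
qed

lemma trel_2:
  assumes "J \<in> I" "v \<in> iV J"
  shows "{u \<in> nbr J v. trel J v u = 2} = {c \<in> iV J. c \<noteq> ir J \<and> par J c = v}"
proof -
  interpret rooted_tree J using I_rooted assms by blast
  have "{v, c} \<in> iF J \<and> {v, c} \<in> iE J \<and> \<not> (par J v = c \<and> v \<noteq> ir J)" if c: "c \<in> iV J" "c \<noteq> ir J" "par J c = v" for c
  proof -
    have "\<not> (par J v = c \<and> v \<noteq> ir J)"
    proof
      assume a: "par J v = c \<and> v \<noteq> ir J"
      have "dep J v = Suc (dep J c)"
        using dep_par[OF assms(2) conjunct2[OF a]] unfolding conjunct1[OF a] .
      moreover have "dep J c = Suc (dep J v)" using dep_par[OF c(1,2)] unfolding c(3) .
      ultimately show False by linarith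
    qed
    moreover have "{v, c} \<in> iF J" using root_path_par(2)[OF c(1,2)] unfolding c(3) .
    ultimately show ?thesis using inst_wf[OF assms(1)] by blast
  qed
  moreover have "c \<in> iV J \<and> c \<noteq> ir J \<and> par J c = v" if c: "{v, c} \<in> iF J" "\<not> (par J v = c \<and> v \<noteq> ir J)" for c
  proof -
    obtain z where z: "z \<in> iV J" "z \<noteq> ir J" "{v, c} = {par J z, z}" using c(1) unfolding F_iff by blast
    then show ?thesis using c(2) by (auto simp: doubleton_eq_iff)
  qed
  moreover have "trel J v u = 2 \<longleftrightarrow> {v, u} \<in> iF J \<and> \<not> (par J v = u \<and> v \<noteq> ir J)" for u
    by (simp add: trel_def)
  ultimately show ?thesis unfolding nbr_def by blast
qed

lemma sum_if_filter: "finite A \<Longrightarrow> (\<Sum>u\<in>A. if P u then f u else (0::nat)) = sum f {u \<in> A. P u}"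
  by (simp add: sum.inter_filter)

text \<open>Nodes have no input; only edges know which end is the upper one. The root is recognised
  by having no edge to a parent.\<close>

lemma root_known: "\<exists>\<sigma>'. ext 1 \<sigma> \<sigma>' \<and> knows \<sigma>' (\<lambda>J v. v = ir J)"
proof -
  let ?\<phi> = "\<lambda>(_::nat list) (_::nat list) (_::nat) (t::nat). if t = 1 then 1 else (0::nat)"
  have eq: "(\<Sum>u\<in>nbr J v. ?\<phi> [] [] (iw J {v, u}) (trel J v u)) = (if v = ir J then 0 else 1)"
    if "J \<in> I" "v \<in> iV J" for J v
    using that by (simp only: sum_if_filter finite_nbr trel_1) auto
  have "(1::nat) < 2 ^ L" using L_pos one_less_power[of "2::nat" L] by simp
  then have "\<exists>\<sigma>'. ext 1 \<sigma> \<sigma>' \<and> knows \<sigma>' (\<lambda>J v. \<Sum>u\<in>nbr J v. ?\<phi> [] [] (iw J {v, u}) (trel J v u))"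
    by (intro nb_sum[where K = "\<lambda>_ _. []" and \<phi> = ?\<phi> and c = 0]) (use knows_const eq in auto)
  then obtain \<sigma>' where s: "ext 1 \<sigma> \<sigma>'" "knows \<sigma>' (\<lambda>J v. \<Sum>u\<in>nbr J v. ?\<phi> [] [] (iw J {v, u}) (trel J v u))" by blast
  have "knows \<sigma>' (\<lambda>J v. (\<Sum>u\<in>nbr J v. ?\<phi> [] [] (iw J {v, u}) (trel J v u)) = 0)"
    by (rule knows_1[OF s(2)])
  then have "knows \<sigma>' (\<lambda>J v. v = ir J)" by (rule knows_cong) (simp only: eq split: if_splits, simp)
  then show ?thesis using s(1) by blast
qed

lemma par_value:
  fixes f :: "inst \<Rightarrow> nat \<Rightarrow> nat"
  assumes root: "knows \<sigma> (\<lambda>J v. v = ir J)" and f: "knows \<sigma> f" "\<And>J v. J \<in> I \<Longrightarrow> v \<in> iV J \<Longrightarrow> f J v < 2 ^ L"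
  shows "\<exists>\<sigma>'. ext 1 \<sigma> \<sigma>' \<and> knows \<sigma>' (\<lambda>J v. f J (par J v))"
proof -
  let ?\<phi> = "\<lambda>(_::nat list) (b::nat list) (_::nat) (t::nat). if t = 1 then b ! 0 else (0::nat)"
  have eq: "(\<Sum>u\<in>nbr J v. ?\<phi> [f J v] [f J u] (iw J {v, u}) (trel J v u)) = (if v = ir J then 0 else f J (par J v))"
    if "J \<in> I" "v \<in> iV J" for J v
    using that by (simp only: sum_if_filter finite_nbr trel_1) auto
  have "\<exists>\<sigma>'. ext 1 \<sigma> \<sigma>' \<and> knows \<sigma>' (\<lambda>J v. \<Sum>u\<in>nbr J v. ?\<phi> [f J v] [f J u] (iw J {v, u}) (trel J v u))"
  proof (rule nb_sum[where K = "\<lambda>J v. [f J v]" and \<phi> = ?\<phi> and c = 1])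
    show "knows \<sigma> (\<lambda>J v. [f J v])" by (rule knows_1[OF f(1)])
    fix J v assume i: "J \<in> I" "v \<in> iV J"
    interpret rooted_tree J using I_rooted i by blast
    show "(\<Sum>u\<in>nbr J v. ?\<phi> [f J v] [f J u] (iw J {v, u}) (trel J v u)) < 2 ^ L"
      unfolding eq[OF i] using f(2)[OF i(1), of "par J v"] i by simp
  qed (use f in auto)
  then obtain \<sigma>' where s: "ext 1 \<sigma> \<sigma>'" "knows \<sigma>' (\<lambda>J v. \<Sum>u\<in>nbr J v. ?\<phi> [f J v] [f J u] (iw J {v, u}) (trel J v u))" by blast
  have "knows \<sigma>' (\<lambda>J v. if v = ir J then f J v else (\<Sum>u\<in>nbr J v. ?\<phi> [f J v] [f J u] (iw J {v, u}) (trel J v u)))"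
    by (rule knows_3[OF knows_ext[OF s(1) root] knows_ext[OF s(1) f(1)] s(2)])
  then have "knows \<sigma>' (\<lambda>J v. f J (par J v))"
    by (rule knows_cong) (simp only: eq split: if_splits, auto simp: par_def)
  then show ?thesis using s(1) by blast
qed

text \<open>The step may assume that its program extends \<open>\<sigma>\<close>, so whatever was
  known at the start stays available in all iterations.\<close>

lemma ext_iter:
  assumes "\<Phi> 0 \<sigma>" and step: "\<And>i \<tau> k. i < m \<Longrightarrow> ext k \<sigma> \<tau> \<Longrightarrow> \<Phi> i \<tau> \<Longrightarrow> \<exists>\<tau>'. ext c \<tau> \<tau>' \<and> \<Phi> (Suc i) \<tau>'"
  shows "\<exists>\<tau>. ext (m * c) \<sigma> \<tau> \<and> \<Phi> m \<tau>"
proof -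
  have "i \<le> m \<Longrightarrow> \<exists>\<tau>. ext (i * c) \<sigma> \<tau> \<and> \<Phi> i \<tau>" for i
  proof (induction i)
    case 0
    then show ?case using assms(1) ext_refl by blast
  next
    case (Suc i)
    then obtain \<tau> where t: "ext (i * c) \<sigma> \<tau>" "\<Phi> i \<tau>" by auto
    then obtain \<tau>' where "ext c \<tau> \<tau>'" "\<Phi> (Suc i) \<tau>'" using step Suc.prems by (meson Suc_le_lessD)
    then show ?case using ext_trans[OF t(1)] by (auto simp: add.commute)
  qed
  then show ?thesis by blast
qed

lemma ext_all:
  assumes "\<And>i \<tau> k. i < m \<Longrightarrow> ext k \<sigma> \<tau> \<Longrightarrow> \<exists>\<tau>'. ext c \<tau> \<tau>' \<and> knows \<tau>' (K i)"
  shows "\<exists>\<tau>. ext (m * c) \<sigma> \<tau> \<and> (\<forall>i<m. knows \<tau> (K i))"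
proof (rule ext_iter[where \<Phi> = "\<lambda>i \<tau>. \<forall>j<i. knows \<tau> (K j)"])
  fix i \<tau> k assume a: "i < m" "ext k \<sigma> \<tau>" "\<forall>j<i. knows \<tau> (K j)"
  then obtain \<tau>' where t: "ext c \<tau> \<tau>'" "knows \<tau>' (K i)" using assms by blast
  then have "\<forall>j<Suc i. knows \<tau>' (K j)" using a knows_ext by (metis less_SucE)
  then show "\<exists>\<tau>'. ext c \<tau> \<tau>' \<and> (\<forall>j<Suc i. knows \<tau>' (K j))" using t by blast
qed simp

end

section \<open>Labels increasing along root paths\<close>

text \<open>Every round of the following construction cuts the tree into blocks, whose top nodes form
  \<open>Hs J i\<close>. The next blocks start where the sequence of IDs of the top nodes has just passed a local
  minimum. Inside a new block that sequence first increases and then decreases, so it can be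
  turned into an increasing label without any communication; and since no two consecutive blocks
  are both the first of a new block, the number of blocks on a root path is halved.\<close>

fun Hs :: "inst \<Rightarrow> nat \<Rightarrow> nat set" where
  "Hs J 0 = UNIV"
| "Hs J (Suc i) = {z \<in> Hs J i. z = ir J \<or>
     (let p = near J (Hs J i) (par J z); q = near J (Hs J i) (par J p) in p \<noteq> ir J \<and> p < z \<and> p < q)}"

text \<open>Step \<open>i\<close> supplies one digit in base \<open>2 ^ (b + 2)\<close>, later steps
  being more significant. The digit is \<open>1 + z\<close> while the IDs of the block tops rise and
  \<open>3 * 2 ^ b - z\<close> while they fall. As IDs are below \<open>2 ^ b\<close>, every falling
  digit exceeds every rising one.\<close>

fun lam :: "nat \<Rightarrow> inst \<Rightarrow> nat \<Rightarrow> nat \<Rightarrow> nat" where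
  "lam b J 0 v = 0"
| "lam b J (Suc i) v = (let z = near J (Hs J i) v; p = near J (Hs J i) (par J z) in
     (if z \<in> Hs J (Suc i) then 0 else if p < z then 1 + z else 3 * 2 ^ b - z) * 2 ^ ((b + 2) * i)
     + lam b J i v)"

declare Hs.simps(2) [simp del] lam.simps(2) [simp del]

context rooted_tree
begin

lemma Hs_root [simp]: "ir J \<in> Hs J i"
  by (induction i) (auto simp: Hs.simps)

lemma Hs_Suc_subset: "Hs J (Suc i) \<subseteq> Hs J i"
  by (auto simp: Hs.simps)

lemma lam_less:
  assumes "\<And>v. v \<in> iV J \<Longrightarrow> v < 2 ^ b" "v \<in> iV J"
  shows "lam b J i v < 2 ^ ((b + 2) * i)"
proof (induction i)
  case (Suc i)
  define z where "z = near J (Hs J i) v"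
  define g where "g = (if z \<in> Hs J (Suc i) then 0 else if near J (Hs J i) (par J z) < z then 1 + z else 3 * 2 ^ b - z)"
  have "z < 2 ^ b" using assms unfolding z_def by simp
  then have "g \<le> 3 * 2 ^ b" by (simp add: g_def)
  moreover have "1 \<le> (2::nat) ^ b" by simp
  moreover have "2 ^ (b + 2) = 4 * (2::nat) ^ b" by (simp add: power_add)
  ultimately have "Suc g \<le> 2 ^ (b + 2)" by linarith
  then have "Suc g * 2 ^ ((b + 2) * i) \<le> 2 ^ (b + 2) * 2 ^ ((b + 2) * i)" by (rule mult_le_mono1)
  moreover have "lam b J (Suc i) v = g * 2 ^ ((b + 2) * i) + lam b J i v"
    by (simp add: g_def z_def Let_def lam.simps)
  ultimately show ?case using Suc by (simp add: power_add algebra_simps)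
qed simp

text \<open>If \<open>v\<close> is not a block top in step \<open>i\<close>, its parent is in the
  same block, the digit is the same and earlier digits decide. Otherwise the digit grows from the
  block above: a rise after a fall would make that block a local minimum and \<open>v\<close> the
  start of a new block.\<close>

lemma lam_mono_block:
  assumes id: "\<And>v. v \<in> iV J \<Longrightarrow> v < 2 ^ b" and "v \<in> iV J" "v \<noteq> ir J" "v \<notin> Hs J i"
  shows "lam b J i (par J v) < lam b J i v"
  using assms(2-)
proof (induction i)
  case (Suc i)
  let ?nr = "near J (Hs J i)"
  define g where "g z = (if z \<in> Hs J (Suc i) then 0 else if ?nr (par J z) < z then 1 + z else 3 * 2 ^ b - z)" for z
  have lam: "lam b J (Suc i) u = g (?nr u) * 2 ^ ((b + 2) * i) + lam b J i u" for u
    by (simp add: g_def Let_def lam.simps)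
  show ?case
  proof (cases "v \<in> Hs J i")
    case False
    then have "?nr v = ?nr (par J v)" using Suc.prems by (simp add: near_par)
    then show ?thesis using Suc.IH[OF Suc.prems(1,2) False] unfolding lam by simp
  next
    case True
    define p where "p = ?nr (par J v)"
    define q where "q = ?nr (par J p)"
    have v: "?nr v = v" using near_self True Suc.prems by blast
    have pV: "p \<in> iV J" using Suc.prems by (simp add: p_def)
    have pH: "p \<in> Hs J i" unfolding p_def using near_in(1)[of "Hs J i"] Suc.prems by simp
    have pa: "p \<in> anc J (par J v)" unfolding p_def using near_in(2)[of "Hs J i"] Suc.prems by simp
    have pv: "p \<noteq> v"
      using anc_dep[of "par J v" p] dep_par[of v] Suc.prems pa by (cases "p = par J v") auto
    have nh: "\<not> (p \<noteq> ir J \<and> p < v \<and> p < q)"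
      using Suc.prems(3) True unfolding p_def q_def by (auto simp: Let_def Hs.simps)
    have gv: "g v = (if p < v then 1 + v else 3 * 2 ^ b - v)" using Suc.prems(3) by (simp add: g_def p_def)
    have bd: "v < 2 ^ b" "p < 2 ^ b" using id Suc.prems pV by auto
    have "g p < g v"
    proof (cases "p \<in> Hs J (Suc i)")
      case True
      then have "g p = 0" by (simp add: g_def)
      then show ?thesis using gv bd by auto
    next
      case False
      then have pr: "p \<noteq> ir J" using Hs_root by metis
      have qp: "q \<noteq> p"
      proof -
        have "q \<in> anc J (par J p)" unfolding q_def using near_in(2)[of "Hs J i" "par J p"] pV by simp
        then show ?thesis
          using anc_dep[of "par J p" q] dep_par[of p] pV pr by (cases "q = par J p") auto
      qed
      have gp: "g p = (if q < p then 1 + p else 3 * 2 ^ b - p)" using False by (simp add: g_def q_def)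
      show ?thesis using nh pr gp gv pv qp bd by (auto split: if_splits)
    qed
    then have "Suc (g p) * 2 ^ ((b + 2) * i) \<le> g v * 2 ^ ((b + 2) * i)" by (intro mult_le_mono1) simp
    moreover have "lam b J i (par J v) < 2 ^ ((b + 2) * i)" using lam_less[OF id] Suc.prems by simp
    ultimately show ?thesis unfolding lam v using p_def by simp
  qed
qed simp

text \<open>Two consecutive block tops on a root path are never both tops in the next step. The
  second conjunct carries the induction: the top preceding a new top is not new itself, and there
  the bound holds without the additional 1.\<close>

lemma Hs_count:
  assumes "z \<in> iV J" "z \<in> Hs J i"
  shows "2 * card (anc J z \<inter> Hs J (Suc i)) \<le> Suc (card (anc J z \<inter> Hs J i)) \<and>
    (z \<notin> Hs J (Suc i) \<longrightarrow> 2 * card (anc J z \<inter> Hs J (Suc i)) \<le> card (anc J z \<inter> Hs J i))"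
  using assms
proof (induction "dep J z" arbitrary: z rule: less_induct)
  case less
  let ?nr = "near J (Hs J i)"
  show ?case
  proof (cases "z = ir J")
    case True
    then have "anc J z \<inter> Hs J (Suc i) = {ir J}" "anc J z \<inter> Hs J i = {ir J}" using Hs_root by auto
    then show ?thesis using Hs_root[of "Suc i"] by (simp add: True)
  next
    case False
    note z = less.prems(1) False
    define p where "p = ?nr (par J z)"
    have pV: "p \<in> iV J" using z by (simp add: p_def)
    have pH: "p \<in> Hs J i" unfolding p_def using near_in(1)[of "Hs J i"] z by simp
    have pa: "p \<in> anc J (par J z)" unfolding p_def using near_in(2)[of "Hs J i"] z by simp
    have d: "dep J p < dep J z"
      using anc_dep[of "par J z" p] dep_par[OF z] z pa by (cases "p = par J z") auto
    have znp: "z \<notin> anc J p" using anc_dep[OF pV, of z] d by auto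
    have up: "anc J (par J z) \<inter> H = anc J p \<inter> H" if "H \<subseteq> Hs J i" for H
      using near_max[of "Hs J i" "par J z"] anc_trans[of "par J z" p] pa z that unfolding p_def by auto
    have fin: "finite (anc J p)" by (simp add: anc_def)
    have 1: "card (anc J z \<inter> Hs J i) = Suc (card (anc J p \<inter> Hs J i))"
    proof -
      have "anc J z \<inter> Hs J i = insert z (anc J p \<inter> Hs J i)"
        using up[OF subset_refl] anc_par[OF z] less.prems by auto
      then show ?thesis using znp fin by simp
    qed
    have 2: "card (anc J z \<inter> Hs J (Suc i)) = card (anc J p \<inter> Hs J (Suc i)) + of_bool (z \<in> Hs J (Suc i))"
    proof -
      have "anc J z \<inter> Hs J (Suc i) = (if z \<in> Hs J (Suc i) then insert z (anc J p \<inter> Hs J (Suc i)) else anc J p \<inter> Hs J (Suc i))"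
        using up[OF Hs_Suc_subset] anc_par[OF z] by auto
      then show ?thesis using znp fin by simp
    qed
    note IH = less.hyps[OF d pV pH]
    show ?thesis
    proof (cases "z \<in> Hs J (Suc i)")
      case True
      define q where "q = ?nr (par J p)"
      have "p \<noteq> ir J" "p < q" using True z by (auto simp: Let_def p_def q_def Hs.simps)
      then have "p \<notin> Hs J (Suc i)" by (auto simp: Let_def q_def Hs.simps)
      then show ?thesis using IH 1 2 True by simp
    next
      case False
      then show ?thesis using IH 1 2 by simp
    qed
  qed
qed

lemma Hs_count_all:
  assumes "v \<in> iV J"
  shows "2 * card (anc J v \<inter> Hs J (Suc i)) \<le> Suc (card (anc J v \<inter> Hs J i))"
proof -
  let ?z = "near J (Hs J i) v"
  have "anc J v \<inter> H = anc J ?z \<inter> H" if "H \<subseteq> Hs J i" for H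
    using near_max[OF Hs_root assms, of _ i] near_in(2)[OF Hs_root assms, of i] anc_trans[OF assms] that by blast
  then have "anc J v \<inter> Hs J (Suc i) = anc J ?z \<inter> Hs J (Suc i)" "anc J v \<inter> Hs J i = anc J ?z \<inter> Hs J i"
    using Hs_Suc_subset by blast+
  then show ?thesis using Hs_count[of ?z i] near_in[of "Hs J i" v] assms by (simp)
qed

text \<open>The number of tops on a root path, not counting one of them, is at least halved in every
  step. It starts below \<open>2 ^ h\<close>, so after \<open>h\<close> steps only the root is
  left.\<close>

lemma Hs_final:
  assumes "card (iV J) \<le> 2 ^ h" "v \<in> iV J" "v \<in> Hs J h"
  shows "v = ir J"
proof -
  have fin: "finite (anc J v)" by (simp add: anc_def)
  have ge: "1 \<le> card (anc J v \<inter> Hs J i)" for i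
  proof -
    have "anc J v \<inter> Hs J i \<noteq> {}" using assms(2) Hs_root root_anc by blast
    then show ?thesis using fin by (simp add: Suc_le_eq card_gt_0_iff)
  qed
  have "2 ^ i * (card (anc J v \<inter> Hs J i) - 1) \<le> card (anc J v) - 1" for i
  proof (induction i)
    case (Suc i)
    have "2 * (card (anc J v \<inter> Hs J (Suc i)) - 1) \<le> card (anc J v \<inter> Hs J i) - 1"
      using Hs_count_all[OF assms(2), of i] by (simp)
    then have "2 ^ i * (2 * (card (anc J v \<inter> Hs J (Suc i)) - 1)) \<le> 2 ^ i * (card (anc J v \<inter> Hs J i) - 1)"
      by (rule mult_le_mono2)
    moreover have "2 ^ Suc i * (card (anc J v \<inter> Hs J (Suc i)) - 1) = 2 ^ i * (2 * (card (anc J v \<inter> Hs J (Suc i)) - 1))"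
      by (simp only: power_Suc2 mult.assoc)
    ultimately show ?case using Suc by linarith
  qed simp
  moreover have "card (anc J v) \<le> card (iV J)" using anc_V assms(2) by (intro card_mono) auto
  moreover have "card (anc J v) > 0" using fin anc_self[OF assms(2)] by (auto simp: card_gt_0_iff)
  ultimately have "2 ^ h * (card (anc J v \<inter> Hs J h) - 1) < 2 ^ h" using assms(1) by (metis Suc_pred' le_trans less_eq_Suc_le not_less_eq_eq)
  then have "card (anc J v \<inter> Hs J h) = 1" using ge[of h] by (simp add: le_antisym)
  then have "\<exists>x. anc J v \<inter> Hs J h = {x}" by (simp add: card_1_singleton_iff)
  then show ?thesis using assms anc_self root_anc Hs_root by (metis IntI singletonD)
qed

end

section \<open>Strahler ranks\<close>

definition kids :: "inst \<Rightarrow> nat set \<Rightarrow> nat \<Rightarrow> nat set" where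
  "kids J S v = {c \<in> iV J. c \<noteq> ir J \<and> par J c = v \<and> c \<in> S}"

text \<open>With these block tops, the blocks inside \<open>S\<close> are the maximal chains in
  which every node but the first is the only child in \<open>S\<close> of its predecessor.\<close>

definition cutR :: "inst \<Rightarrow> nat set \<Rightarrow> nat set" where
  "cutR J S = {z. z = ir J \<or> z \<notin> S \<or> card (kids J S (par J z)) \<noteq> 1}"

text \<open>In every step the chains ending in a leaf are removed from the tree, except for the root.\<close>
fun Rk :: "inst \<Rightarrow> nat \<Rightarrow> nat set" where
  "Rk J 0 = iV J"
| "Rk J (Suc d) = {v \<in> Rk J d. v = ir J \<or>
     (\<forall>u\<in>Rk J d. near J (cutR J (Rk J d)) u = near J (cutR J (Rk J d)) v \<longrightarrow> kids J (Rk J d) u \<noteq> {})}"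

declare Rk.simps(2) [simp del]

text \<open>The root survives every step of \<open>Rk\<close>; the cap \<open>Suc h\<close> gives it
  a rank just above the ranks of all other nodes, which are at most \<open>h\<close> by
  \<open>rk_nonroot\<close>.\<close>

definition rk :: "nat \<Rightarrow> inst \<Rightarrow> nat \<Rightarrow> nat" where
  "rk h J v = (GREATEST d. d \<le> Suc h \<and> v \<in> Rk J d)"

text \<open>The nodes of rank \<open>d\<close> form vertical paths. For a node \<open>v\<close> below such a path, \<open>tp\<close> is the top of
  the path, \<open>lo\<close> the lowest node of the path above \<open>v\<close>, and \<open>mu\<close> the label of \<open>lo\<close>.\<close>
definition tp :: "nat \<Rightarrow> inst \<Rightarrow> nat \<Rightarrow> nat \<Rightarrow> nat" where
  "tp h J d v = near J {z. z = ir J \<or> d < rk h J (par J z)} v"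

definition lo :: "nat \<Rightarrow> inst \<Rightarrow> nat \<Rightarrow> nat \<Rightarrow> nat" where
  "lo h J d v = near J {z. d \<le> rk h J z} v"

definition mu :: "nat \<Rightarrow> nat \<Rightarrow> inst \<Rightarrow> nat \<Rightarrow> nat \<Rightarrow> nat" where
  "mu b h J d v = lam b J h (lo h J d v)"

text \<open>The top found by \<open>tp\<close> can have smaller rank, if the part of the tree
  hanging there contains no node of rank \<open>d\<close>, or larger rank, if \<open>v\<close>
  itself has larger rank. In both cases there is no path of rank \<open>d\<close> to refer
  to.\<close>

definition valid :: "nat \<Rightarrow> inst \<Rightarrow> nat \<Rightarrow> nat \<Rightarrow> bool" where
  "valid h J d v \<longleftrightarrow> rk h J (tp h J d v) = d"

context rooted_tree
begin

lemma children_eq: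
  assumes "c \<in> iV J" "c \<noteq> ir J" "c' \<in> iV J" "c' \<noteq> ir J" "par J c = par J c'"
    "v \<in> iV J" "c \<in> anc J v" "c' \<in> anc J v"
  shows "c = c'"
proof -
  have "dep J c = dep J c'" using dep_par[OF assms(1,2)] dep_par[OF assms(3,4)] assms(5) by simp
  then have "\<not> dep J c < dep J c'" "\<not> dep J c' < dep J c" by simp_all
  then show ?thesis using anc_linear[OF assms(6-8)] anc_dep[OF assms(1)] anc_dep[OF assms(3)] by blast
qed

lemma finite_kids [simp]: "finite (kids J S v)"
  by (simp add: kids_def)

lemma cutR_root [simp]: "ir J \<in> cutR J S"
  by (simp add: cutR_def)

lemma closed_anc:
  assumes "\<And>v. v \<in> S \<Longrightarrow> v \<noteq> ir J \<Longrightarrow> par J v \<in> S" "v \<in> iV J" "v \<in> S" "x \<in> anc J v"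
  shows "x \<in> S"
  using assms(2-4)
proof (induction rule: tree_induct)
  case (step v)
  have "par J v \<in> S" using assms(1)[OF step.prems(1) step.hyps(2)] .
  moreover have "x = v \<or> x \<in> anc J (par J v)" using step.prems(2) anc_par[OF step.hyps] by simp
  ultimately show ?case using step.IH step.prems(1) by blast
qed simp

text \<open>A block inside \<open>S\<close> is a vertical chain. If it contains the leaf
  \<open>u\<close>, it ends there, and every other node of it has the next node of the chain as its
  only child in \<open>S\<close>.\<close>

lemma leaf_block:
  assumes cl: "\<And>v. v \<in> S \<Longrightarrow> v \<noteq> ir J \<Longrightarrow> par J v \<in> S" and S: "S \<subseteq> iV J"
    and u: "u \<in> S" "kids J S u = {}" and w: "w \<in> S"
    and eq: "near J (cutR J S) u = near J (cutR J S) w"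
  shows "card (kids J S w) \<le> 1"
proof -
  have V: "u \<in> iV J" "w \<in> iV J" using S u w by auto
  let ?C = "cutR J S"
  have nw: "near J ?C u \<in> anc J w" using near_in(2)[OF cutR_root V(2)] eq by metis
  have cutanc: "c \<in> anc J w" if "c \<in> anc J u" "c \<in> ?C" for c
    using near_max[OF cutR_root V(1) that] anc_trans[OF V(2) nw] by blast
  consider "w = u" | "w \<in> anc J u" "w \<noteq> u" | "u \<in> anc J w" "w \<noteq> u" | "w \<notin> anc J u" "u \<notin> anc J w" by blast
  then show ?thesis
  proof cases
    case 1
    then show ?thesis using u by simp
  next
    case 2
    then obtain c where c: "c \<in> iV J" "c \<noteq> ir J" "par J c = w" "c \<in> anc J u"
      using child_towards[OF V(1)] by blast
    have "c \<notin> anc J w" using anc_dep[OF V(2), of c] dep_par[OF c(1,2)] c(3) par_neq[OF c(1,2)] by auto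
    then have "c \<notin> ?C" using cutanc c by blast
    then show ?thesis using c by (simp add: cutR_def)
  next
    case 3
    then obtain c where c: "c \<in> iV J" "c \<noteq> ir J" "par J c = u" "c \<in> anc J w"
      using child_towards[OF V(2), of u] by blast
    then have "c \<in> S" using closed_anc[OF cl V(2) w] by blast
    then show ?thesis using c u by (auto simp: kids_def)
  next
    case 4
    obtain c c' where c: "c \<in> iV J" "c' \<in> iV J" "c \<noteq> ir J" "c' \<noteq> ir J" "c \<noteq> c'" "par J c = par J c'"
      "c \<in> anc J u" "c' \<in> anc J w" by (rule meet_exists[OF V 4(2,1)])
    have cS: "c \<in> S" "c' \<in> S" using closed_anc[OF cl V(1) u(1)] closed_anc[OF cl V(2) w] c by blast+
    then have "{c, c'} \<subseteq> kids J S (par J c)" using c by (auto simp: kids_def)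
    then have "card {c, c'} \<le> card (kids J S (par J c))" by (rule card_mono[OF finite_kids])
    then have "c \<in> ?C" using c(5) by (simp add: cutR_def)
    then have "c \<in> anc J w" using cutanc c by blast
    then show ?thesis using children_eq[of c c' w] c V by blast
  qed
qed

text \<open>For closure under parents: if the parent of \<open>v\<close> is removed, its chain ends
  in a leaf, hence \<open>v\<close> is its only child, lies on the same chain and is removed with
  it.\<close>

lemma Rk_props:
  "Rk J d \<subseteq> iV J \<and> ir J \<in> Rk J d \<and> (\<forall>v. v \<in> Rk J d \<longrightarrow> v \<noteq> ir J \<longrightarrow> par J v \<in> Rk J d)"
proof (induction d)
  case (Suc d)
  let ?S = "Rk J d"
  have cl: "\<And>v. v \<in> ?S \<Longrightarrow> v \<noteq> ir J \<Longrightarrow> par J v \<in> ?S" using Suc by blast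
  have "par J v \<in> Rk J (Suc d)" if v: "v \<in> Rk J (Suc d)" "v \<noteq> ir J" for v
  proof (rule ccontr)
    assume n: "par J v \<notin> Rk J (Suc d)"
    have vS: "v \<in> ?S" "v \<in> iV J" using v Suc by (auto simp: Rk.simps)
    then have pS: "par J v \<in> ?S" using cl v by blast
    obtain u where u: "u \<in> ?S" "near J (cutR J ?S) u = near J (cutR J ?S) (par J v)" "kids J ?S u = {}"
      using n pS by (auto simp: Rk.simps)
    have "card (kids J ?S (par J v)) \<le> 1" using leaf_block[of ?S u "par J v"] cl Suc u pS by blast
    moreover have "v \<in> kids J ?S (par J v)" using v vS by (simp add: kids_def)
    then have "card (kids J ?S (par J v)) \<noteq> 0" using finite_kids by (metis card_0_eq empty_iff)
    ultimately have "card (kids J ?S (par J v)) = 1" by linarith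
    then have "v \<notin> cutR J ?S" using v vS by (simp add: cutR_def)
    then have "near J (cutR J ?S) u = near J (cutR J ?S) v" using u near_par[OF vS(2) v(2)] by simp
    then show False using u v by (auto simp: Rk.simps)
  qed
  then show ?case using Suc by (auto simp: Rk.simps)
qed auto

lemma Rk_anti: "d \<le> d' \<Longrightarrow> Rk J d' \<subseteq> Rk J d"
  by (rule lift_Suc_antimono_le) (auto simp: Rk.simps)

text \<open>Let \<open>u\<close> be a deepest node below \<open>v\<close> that survives step
  \<open>d\<close>. Its children are all removed in that step. If it had only one child in
  \<open>Rk J d\<close>, that child would share its chain and \<open>u\<close> would go as well. So
  it has two, with disjoint subtrees of size at least \<open>2 ^ d\<close> each.\<close>

lemma Rk_size: "v \<in> Rk J d \<Longrightarrow> v \<noteq> ir J \<Longrightarrow> 2 ^ d \<le> card (sub J v)"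
proof (induction d arbitrary: v)
  case 0
  then have "v \<in> sub J v" using Rk_props[of 0] by auto
  then show ?case by (simp add: Suc_le_eq card_gt_0_iff) blast
next
  case (Suc d)
  let ?S = "Rk J d" and ?T = "Rk J (Suc d)"
  have vV: "v \<in> iV J" using Suc Rk_props by blast
  have "finite (?T \<inter> sub J v)" "v \<in> ?T \<inter> sub J v" using Suc vV by auto
  then obtain u where u: "u \<in> ?T" "u \<in> sub J v" and umax: "\<And>u'. u' \<in> ?T \<Longrightarrow> u' \<in> sub J v \<Longrightarrow> dep J u' \<le> dep J u"
    using Max_in[of "dep J ` (?T \<inter> sub J v)"] Max_ge[of "dep J ` (?T \<inter> sub J v)"] by fastforce
  have uV: "u \<in> iV J" using u sub_V by blast
  have ur: "u \<noteq> ir J" using u Suc.prems by (auto simp: sub_def)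
  have uS: "u \<in> ?S" using u by (auto simp: Rk.simps)
  have nk: "c \<notin> ?T" if c: "c \<in> kids J ?S u" for c
  proof
    assume "c \<in> ?T"
    moreover have cc: "c \<in> iV J" "c \<noteq> ir J" "par J c = u" using c by (auto simp: kids_def)
    moreover have "c \<in> sub J v" using u cc anc_par[OF cc(1,2)] by (auto simp: sub_def)
    ultimately show False using umax[of c] dep_par[OF cc(1,2)] by simp
  qed
  have "\<not> card (kids J ?S u) \<le> 1"
  proof
    assume le: "card (kids J ?S u) \<le> 1"
    have ne: "kids J ?S u \<noteq> {}" using u ur uS by (auto simp: Rk.simps)
    then have c1: "card (kids J ?S u) = 1" using le by (simp add: le_Suc_eq)
    obtain c where c: "c \<in> kids J ?S u" using ne by blast
    then have cc: "c \<in> iV J" "c \<noteq> ir J" "par J c = u" "c \<in> ?S" by (auto simp: kids_def)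
    have "c \<notin> cutR J ?S" using cc c1 by (simp add: cutR_def)
    then have "near J (cutR J ?S) c = near J (cutR J ?S) u" using near_par[OF cc(1,2)] cc by simp
    moreover have "\<exists>u'\<in>?S. near J (cutR J ?S) u' = near J (cutR J ?S) c \<and> kids J ?S u' = {}"
      using nk[OF c] cc by (auto simp: Rk.simps)
    ultimately show False using u ur by (auto simp: Rk.simps)
  qed
  then obtain c c' where c: "c \<in> kids J ?S u" "c' \<in> kids J ?S u" "c \<noteq> c'"
    by (metis One_nat_def card_le_Suc0_iff_eq finite_kids)
  then have cc: "c \<in> iV J" "c \<noteq> ir J" "par J c = u" "c \<in> ?S" "c' \<in> iV J" "c' \<noteq> ir J" "par J c' = u" "c' \<in> ?S"
    by (auto simp: kids_def)
  have dj: "sub J c \<inter> sub J c' = {}" using children_eq cc c(3) by (auto simp: sub_def)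
  have "sub J c \<subseteq> sub J u" "sub J c' \<subseteq> sub J u"
    by (rule sub_mono, use par_anc[OF cc(1)] par_anc[OF cc(5)] cc in \<open>simp add: sub_def\<close>)+
  then have "sub J c \<union> sub J c' \<subseteq> sub J v" using sub_mono[OF u(2)] by blast
  then have "card (sub J c \<union> sub J c') \<le> card (sub J v)" by (intro card_mono) auto
  then show ?case using Suc.IH[OF cc(4,2)] Suc.IH[OF cc(8,6)] dj by (simp add: card_Un_disjoint)
qed

end

section \<open>Vertical paths of equal rank\<close>

locale ranked_tree = rooted_tree +
  fixes b h :: nat
  assumes id_less: "v \<in> iV J \<Longrightarrow> v < 2 ^ b" and size: "card (iV J) \<le> 2 ^ h"
begin

abbreviation "lab \<equiv> lam b J h"

lemma lab_less: "v \<in> iV J \<Longrightarrow> lab v < 2 ^ ((b + 2) * h)"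
  using lam_less id_less by blast

lemma lab_par: "v \<in> iV J \<Longrightarrow> v \<noteq> ir J \<Longrightarrow> lab (par J v) < lab v"
  using lam_mono_block[of b v h] id_less Hs_final[OF size] by blast

lemma lab_anc: "v \<in> iV J \<Longrightarrow> x \<in> anc J v \<Longrightarrow> x \<noteq> v \<Longrightarrow> lab x < lab v"
proof (induction rule: tree_induct)
  case (step v)
  then have "x \<in> anc J (par J v)" using anc_par by blast
  then have "x = par J v \<or> lab x < lab (par J v)" using step.IH by blast
  then show ?case using lab_par[OF step.hyps] by auto
qed auto

lemma lab_anc_le: "v \<in> iV J \<Longrightarrow> x \<in> anc J v \<Longrightarrow> lab x \<le> lab v"
  using lab_anc[of v x] by (cases "x = v") auto

lemma rk_iff:
  assumes "v \<in> iV J" "d \<le> Suc h"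
  shows "v \<in> Rk J d \<longleftrightarrow> d \<le> rk h J v"
proof -
  let ?P = "\<lambda>d. d \<le> Suc h \<and> v \<in> Rk J d"
  have "?P (rk h J v)" unfolding rk_def by (rule GreatestI_nat[of ?P 0 "Suc h"]) (use assms in auto)
  moreover have "?P d \<Longrightarrow> d \<le> rk h J v" unfolding rk_def by (rule Greatest_le_nat[of ?P d "Suc h"]) auto
  ultimately show ?thesis using assms Rk_anti by blast
qed

lemma rk_le: "v \<in> iV J \<Longrightarrow> rk h J v \<le> Suc h"
  unfolding rk_def using GreatestI_nat[of "\<lambda>d. d \<le> Suc h \<and> v \<in> Rk J d" 0 "Suc h"] by auto

lemma rk_root [simp]: "rk h J (ir J) = Suc h"
  using rk_iff[of "ir J" "Suc h"] rk_le[of "ir J"] Rk_props by auto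

lemma rk_nonroot: "v \<in> iV J \<Longrightarrow> v \<noteq> ir J \<Longrightarrow> rk h J v \<le> h"
proof (rule ccontr)
  assume a: "v \<in> iV J" "v \<noteq> ir J" "\<not> rk h J v \<le> h"
  then have "v \<in> Rk J (Suc h)" using rk_iff[of v "Suc h"] by simp
  then have "2 ^ Suc h \<le> card (sub J v)" using Rk_size a by blast
  moreover have "card (sub J v) \<le> card (iV J)" by (intro card_mono) (auto simp: sub_def)
  ultimately have "(2::nat) ^ Suc h \<le> 2 ^ h" using size by linarith
  then show False by simp
qed

lemma rk_par: "v \<in> iV J \<Longrightarrow> rk h J v \<le> rk h J (par J v)"
proof (cases "v = ir J")
  case False
  assume v: "v \<in> iV J"
  then have "v \<in> Rk J (rk h J v)" using rk_iff rk_le by blast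
  then have "par J v \<in> Rk J (rk h J v)" using Rk_props False by blast
  then show ?thesis using rk_iff rk_le v par_in_V by blast
qed simp

lemma rk_anc: "v \<in> iV J \<Longrightarrow> x \<in> anc J v \<Longrightarrow> rk h J v \<le> rk h J x"
proof (induction rule: tree_induct)
  case (step v)
  then show ?case using rk_par[OF step(1)] anc_par[OF step(1,2)] by force
qed auto

text \<open>Since \<open>v\<close> does not reach the next rank, its chain ends in a leaf of
  \<open>Rk J d\<close>, and by \<open>leaf_block\<close> it has at most one child in
  \<open>Rk J d\<close>.\<close>

lemma rk_unique:
  assumes "v \<in> iV J" "v \<noteq> ir J" "c \<in> iV J" "c \<noteq> ir J" "par J c = v" "c' \<in> iV J" "c' \<noteq> ir J" "par J c' = v"
    "rk h J c = rk h J v" "rk h J c' = rk h J v"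
  shows "c = c'"
proof -
  define d where "d = rk h J v"
  let ?S = "Rk J d"
  have dh: "d \<le> h" using rk_nonroot assms d_def by blast
  have S: "v \<in> ?S" "c \<in> ?S" "c' \<in> ?S" using rk_iff[of _ d] assms dh by (auto simp: d_def)
  have "v \<notin> Rk J (Suc d)" using rk_iff[of v "Suc d"] assms dh by (auto simp: d_def)
  then obtain u where u: "u \<in> ?S" "near J (cutR J ?S) u = near J (cutR J ?S) v" "kids J ?S u = {}"
    using S by (auto simp: Rk.simps)
  have "card (kids J ?S v) \<le> 1" using leaf_block[of ?S u v] Rk_props[of d] u S by blast
  moreover have "c \<in> kids J ?S v" "c' \<in> kids J ?S v" using assms S by (auto simp: kids_def)
  ultimately show ?thesis by (metis One_nat_def card_le_Suc0_iff_eq finite_kids)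
qed

abbreviation "tpH d \<equiv> {z. z = ir J \<or> d < rk h J (par J z)}"

lemma tp_in: "v \<in> iV J \<Longrightarrow> tp h J d v \<in> anc J v \<and> tp h J d v \<in> tpH d \<and> tp h J d v \<in> iV J"
  unfolding tp_def using near_in[of "tpH d" v] near_V[of "tpH d" v] by auto

lemma tp_max: "v \<in> iV J \<Longrightarrow> z \<in> anc J v \<Longrightarrow> z \<in> tpH d \<Longrightarrow> z \<in> anc J (tp h J d v)"
  unfolding tp_def using near_max[of "tpH d" v z] by auto

lemma tp_rank:
  assumes "v \<in> iV J" "rk h J v \<le> d" "d \<le> h"
  shows "tp h J d v \<noteq> ir J" "rk h J (tp h J d v) \<le> d"
proof -
  let ?p = "tp h J d v"
  note p = tp_in[OF assms(1), of d]
  show "rk h J ?p \<le> d"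
  proof (rule ccontr)
    assume n: "\<not> rk h J ?p \<le> d"
    then have "?p \<noteq> v" using assms by auto
    then obtain c where c: "c \<in> iV J" "c \<noteq> ir J" "par J c = ?p" "c \<in> anc J v"
      using child_towards[OF assms(1)] p by blast
    then have "c \<in> anc J ?p" using n by (intro tp_max[OF assms(1)]) auto
    then show False using anc_antisym[of ?p c] par_anc[of c] c p par_neq[of c] by auto
  qed
  then show "?p \<noteq> ir J" using assms(3) by auto
qed

lemma tp_iff:
  assumes "v \<in> iV J" "rk h J v \<le> d" "d \<le> h" "u \<in> iV J"
  shows "tp h J d u = tp h J d v \<longleftrightarrow> u \<in> sub J (tp h J d v)"
proof
  assume "tp h J d u = tp h J d v"
  then show "u \<in> sub J (tp h J d v)" using tp_in[OF assms(4), of d] assms(4) by (auto simp: sub_def)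
next
  let ?p = "tp h J d v"
  assume "u \<in> sub J ?p"
  then have pu: "?p \<in> anc J u" by (simp add: sub_def)
  note p = tp_in[OF assms(1), of d] tp_rank[OF assms(1-3)]
  show "tp h J d u = ?p" unfolding tp_def[of h J d u]
  proof (rule near_eqI)
    fix z assume z: "z \<in> anc J u" "z \<in> tpH d" "?p \<in> anc J z"
    have zV: "z \<in> iV J" using z anc_V assms by blast
    show "z = ?p"
    proof (rule ccontr)
      assume "z \<noteq> ?p"
      then have "?p \<in> anc J (par J z) \<and> z \<noteq> ir J" using anc_strict[OF zV z(3)] by simp
      then have "rk h J (par J z) \<le> d" using rk_anc[of "par J z" ?p] zV p by auto
      then show False using z \<open>?p \<in> anc J (par J z) \<and> z \<noteq> ir J\<close> by simp
    qed
  qed (use p pu assms in auto)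
qed

lemma valid_rank: "u \<in> iV J \<Longrightarrow> valid h J d u \<Longrightarrow> rk h J u \<le> d"
  using tp_in[of u d] rk_anc[of u "tp h J d u"] by (simp add: valid_def)

lemma valid_self: "x \<in> iV J \<Longrightarrow> rk h J x = d \<Longrightarrow> d \<le> h \<Longrightarrow> valid h J d x"
  using tp_in[of x d] rk_anc[of x "tp h J d x"] tp_rank[of x d] by (simp add: valid_def)

lemma valid_cong: "tp h J d u = tp h J d u' \<Longrightarrow> valid h J d u = valid h J d u'"
  by (simp add: valid_def)

lemma lo_in: "v \<in> iV J \<Longrightarrow> d \<le> h \<Longrightarrow> lo h J d v \<in> anc J v \<and> d \<le> rk h J (lo h J d v) \<and> lo h J d v \<in> iV J"
  unfolding lo_def using near_in[of "{z. d \<le> rk h J z}" v] near_V[of "{z. d \<le> rk h J z}" v] by auto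

lemma lo_max: "v \<in> iV J \<Longrightarrow> d \<le> h \<Longrightarrow> z \<in> anc J v \<Longrightarrow> d \<le> rk h J z \<Longrightarrow> z \<in> anc J (lo h J d v)"
  unfolding lo_def using near_max[of "{z. d \<le> rk h J z}" v z] by auto

lemma lo_self: "x \<in> iV J \<Longrightarrow> d \<le> rk h J x \<Longrightarrow> lo h J d x = x"
  unfolding lo_def by (rule near_self) auto

lemma lo_valid:
  assumes "u \<in> iV J" "valid h J d u" "d \<le> h"
  shows "rk h J (lo h J d u) = d" "tp h J d (lo h J d u) = tp h J d u"
proof -
  let ?p = "tp h J d u" and ?l = "lo h J d u"
  have p: "rk h J ?p = d" using assms by (simp add: valid_def)
  have a: "?p \<in> anc J ?l" using lo_max tp_in p assms by simp
  then show "rk h J ?l = d" using rk_anc[of ?l ?p] lo_in[of u d] p assms by simp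
  have "?l \<in> sub J ?p" using a lo_in assms by (simp add: sub_def)
  then show "tp h J d ?l = ?p" using tp_iff[OF assms(1) valid_rank[OF assms(1,2)] assms(3)] lo_in assms by blast
qed

text \<open>If the two nodes were incomparable, their lowest common ancestor would still lie below
  the common top and so have rank at most \<open>d\<close>. Ranks do not decrease upwards, so it and
  its two children towards \<open>x\<close> and \<open>y\<close> all have rank \<open>d\<close>,
  which \<open>rk_unique\<close> excludes.\<close>

lemma rank_chain:
  assumes "x \<in> iV J" "y \<in> iV J" "rk h J x = d" "rk h J y = d" "tp h J d x = tp h J d y" "d \<le> h"
  shows "x \<in> anc J y \<or> y \<in> anc J x"
proof (rule ccontr)
  assume n: "\<not> ?thesis"
  then have nn: "x \<notin> anc J y" "y \<notin> anc J x" by auto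
  obtain c c' where c: "c \<in> iV J" "c' \<in> iV J" "c \<noteq> ir J" "c' \<noteq> ir J" "c \<noteq> c'" "par J c = par J c'"
    "c \<in> anc J x" "c' \<in> anc J y" by (rule meet_exists[OF assms(1,2) nn])
  define m where "m = par J c"
  define p where "p = tp h J d x"
  have mV: "m \<in> iV J" using c m_def by simp
  have p: "p \<in> anc J x" "p \<in> anc J y" "p \<in> iV J" "rk h J p \<le> d"
    using tp_in[of x d] tp_in[of y d] tp_rank(2)[of x d] assms by (auto simp: p_def)
  have m: "m \<in> anc J x" "m \<in> anc J y"
    using c par_anc anc_trans assms(1,2) unfolding m_def by (metis, metis)
  have "p \<in> anc J m"
  proof (rule ccontr)
    assume np: "p \<notin> anc J m"
    then have mp: "m \<in> anc J p" using anc_linear[OF assms(1) p(1) m(1)] by blast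
    have "m \<noteq> p" using np mV by auto
    then obtain e where e: "e \<in> iV J" "e \<noteq> ir J" "par J e = m" "e \<in> anc J p" using child_towards p(3) mp by blast
    then have "e \<in> anc J x" "e \<in> anc J y" using anc_trans p assms by blast+
    then have "e = c" "e = c'"
      using children_eq[OF e(1,2) c(1,3) _ assms(1)] children_eq[OF e(1,2) c(2,4) _ assms(2)] c e(3) m_def by simp_all
    then show False using c by simp
  qed
  then have "rk h J m \<le> d" using rk_anc[OF mV] p by force
  moreover have "d \<le> rk h J c" "d \<le> rk h J c'"
    using rk_anc[OF assms(1) c(7)] rk_anc[OF assms(2) c(8)] assms(3,4) by simp_all
  moreover have "rk h J c \<le> rk h J m" "rk h J c' \<le> rk h J m"
    using rk_par[OF c(1)] rk_par[OF c(2)] c(6) unfolding m_def by simp_all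
  ultimately have r: "rk h J c = rk h J m" "rk h J c' = rk h J m" "rk h J m \<le> h" using assms(6) by linarith+
  have mr: "m \<noteq> ir J" using r(3) rk_root by (metis Suc_n_not_le_n)
  have pm: "par J c' = m" using c(6) m_def by (rule trans[OF sym sym])
  have "c = c'" by (rule rk_unique[OF mV mr c(1,3) m_def[symmetric] c(2,4) pm r(1,2)])
  then show False using c(5) by simp
qed

text \<open>This turns membership in a subtree into the comparison of two numbers, so that sums over
  subtrees of nodes of rank \<open>d\<close> are suffix sums by \<open>mu\<close>. The nodes of rank
  \<open>d\<close> under one top form a chain, along which the labels increase strictly.\<close>

lemma sub_iff:
  assumes "x \<in> iV J" "rk h J x = d" "d \<le> h" "u \<in> iV J"
  shows "u \<in> sub J x \<longleftrightarrow> tp h J d u = tp h J d x \<and> lab x \<le> mu b h J d u"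
proof
  assume "u \<in> sub J x"
  then have xu: "x \<in> anc J u" by (simp add: sub_def)
  have "u \<in> sub J (tp h J d x)" using tp_in[OF assms(1)] anc_trans xu assms by (auto simp: sub_def)
  then have 1: "tp h J d u = tp h J d x" using tp_iff[of x d u] assms by simp
  have "x \<in> anc J (lo h J d u)" using lo_max xu assms by simp
  then have "lab x \<le> mu b h J d u" using lab_anc_le[of "lo h J d u" x] lo_in[OF assms(4,3)] unfolding mu_def by blast
  with 1 show "tp h J d u = tp h J d x \<and> lab x \<le> mu b h J d u" by simp
next
  assume a: "tp h J d u = tp h J d x \<and> lab x \<le> mu b h J d u"
  let ?l = "lo h J d u"
  have v: "valid h J d u" using valid_cong valid_self[OF assms(1-3)] a by blast
  have l: "rk h J ?l = d" "tp h J d ?l = tp h J d x" "?l \<in> iV J" "?l \<in> anc J u"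
    using lo_valid[OF assms(4) v assms(3)] lo_in assms a by auto
  have "x \<in> anc J ?l"
  proof (rule ccontr)
    assume n: "x \<notin> anc J ?l"
    then have "?l \<in> anc J x" using rank_chain[of x ?l d] assms l by auto
    moreover have "?l \<noteq> x" using n l by auto
    ultimately have "lab ?l < lab x" using lab_anc assms by blast
    then show False using a by (simp add: mu_def)
  qed
  then show "u \<in> sub J x" using anc_trans assms l by (auto simp: sub_def)
qed

lemma mu_less: "v \<in> iV J \<Longrightarrow> d \<le> h \<Longrightarrow> mu b h J d v < 2 ^ ((b + 2) * h)"
  unfolding mu_def using lab_less lo_in by blast

text \<open>The classes of a function that is convex along a path are connected, so they arise as
  blocks: it suffices to cut where the rank exceeds \<open>d\<close> and where the function changes
  between a node and its parent.\<close>

lemma class_block: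
  assumes d: "d \<le> h" and u: "u \<in> iV J" "valid h J d u"
    and convex: "\<And>u1 u2 u3. u1 \<in> iV J \<Longrightarrow> u2 \<in> iV J \<Longrightarrow> u3 \<in> iV J \<Longrightarrow> valid h J d u1 \<Longrightarrow>
      tp h J d u1 = tp h J d u2 \<Longrightarrow> tp h J d u2 = tp h J d u3 \<Longrightarrow> mu b h J d u1 \<le> mu b h J d u2 \<Longrightarrow>
      mu b h J d u2 \<le> mu b h J d u3 \<Longrightarrow> \<kappa> u1 = \<kappa> u3 \<Longrightarrow> \<kappa> u2 = \<kappa> u1"
  shows "{u' \<in> iV J. near J {z. z = ir J \<or> d < rk h J (par J z) \<or> \<kappa> z \<noteq> \<kappa> (par J z)} u' =
      near J {z. z = ir J \<or> d < rk h J (par J z) \<or> \<kappa> z \<noteq> \<kappa> (par J z)} u} =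
    {u' \<in> iV J. tp h J d u' = tp h J d u \<and> \<kappa> u' = \<kappa> u}"
proof -
  let ?H = "{z. z = ir J \<or> d < rk h J (par J z) \<or> \<kappa> z \<noteq> \<kappa> (par J z)}"
  let ?T = "tp h J d"
  have tpn: "?T (near J ?H v) = ?T v" if "v \<in> iV J" for v
    unfolding tp_def by (rule near_near) (use that in auto)
  have kn: "\<kappa> (near J ?H v) = \<kappa> v" if "v \<in> iV J" for v
    by (rule near_invariant[of ?H]) (use that in auto)
  have same_mu: "\<kappa> u2 = \<kappa> u1" if "u1 \<in> iV J" "u2 \<in> iV J" "valid h J d u1" "?T u1 = ?T u2" "mu b h J d u1 = mu b h J d u2" for u1 u2
    by (rule convex[OF that(1,2,1,3,4) that(4)[symmetric]]) (simp_all add: that(5))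
  \<comment> \<open>Block tops lie on the path itself: a node off the path has the same
    \<open>lo\<close> and hence the same \<open>mu\<close> as its parent, and convexity then gives
    the same value of \<open>\<kappa>\<close>.\<close>
  have rkt: "rk h J (near J ?H v) = d" if v: "v \<in> iV J" "valid h J d v" for v
  proof -
    let ?t = "near J ?H v"
    have t: "?t \<in> ?H" "?t \<in> iV J" using near_in(1)[of ?H v] near_V[of ?H v] v by auto
    have vt: "valid h J d ?t" using tpn[OF v(1)] v(2) valid_cong by blast
    have le: "rk h J ?t \<le> d" using valid_rank[OF t(2) vt] .
    then have tr: "?t \<noteq> ir J" using d by auto
    show ?thesis
    proof (cases "d < rk h J (par J ?t)")
      case True
      have "?t \<in> anc J (?T ?t)" using tp_max[OF t(2)] True t by simp
      then have "?t = ?T ?t" using anc_antisym[of "?T ?t" ?t] tp_in[OF t(2), of d] by simp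
      then show ?thesis using vt unfolding valid_def by simp
    next
      case False
      then have ne: "\<kappa> ?t \<noteq> \<kappa> (par J ?t)" using t tr by auto
      let ?q = "par J ?t"
      have qV: "?q \<in> iV J" using t by simp
      have "?t \<notin> tpH d" using False tr by simp
      then have tq: "?T ?t = ?T ?q" unfolding tp_def using near_par[OF t(2) tr, of "tpH d"] by simp
      show ?thesis
      proof (rule ccontr)
        assume "rk h J ?t \<noteq> d"
        then have "?t \<notin> {z. d \<le> rk h J z}" using le by simp
        then have "lo h J d ?t = lo h J d ?q" unfolding lo_def using near_par[OF t(2) tr] by simp
        then have "mu b h J d ?t = mu b h J d ?q" by (simp add: mu_def)
        then have "\<kappa> ?q = \<kappa> ?t" using same_mu[OF t(2) qV vt tq] by simp
        then show False using ne by simp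
      qed
    qed
  qed
  \<comment> \<open>If two comparable tops belonged to one class, the parent of the lower one would
    have \<open>mu\<close> between theirs. Convexity gives it the same \<open>\<kappa>\<close>, so
    the lower node would not be a top.\<close>
  have step: "near J ?H u1 = near J ?H u2"
    if a: "u1 \<in> iV J" "u2 \<in> iV J" "valid h J d u1" "?T u1 = ?T u2" "\<kappa> u1 = \<kappa> u2" "near J ?H u1 \<in> anc J (near J ?H u2)" for u1 u2
  proof (rule ccontr)
    let ?t = "near J ?H u1" and ?s = "near J ?H u2"
    assume ne: "?t \<noteq> ?s"
    have v2: "valid h J d u2" using a valid_cong by blast
    have V: "?t \<in> iV J" "?s \<in> iV J" using a near_V[of ?H] by auto
    have rr: "rk h J ?t = d" "rk h J ?s = d" using rkt a v2 by auto
    let ?q = "par J ?s"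
    have q: "?t \<in> anc J ?q" "?s \<noteq> ir J" using anc_strict[OF V(2) a(6)] ne by auto
    have qV: "?q \<in> iV J" using V by simp
    have tt: "?T ?t = ?T u1" "?T ?s = ?T u1" using tpn a by auto
    have "?q \<in> sub J ?t" using q qV by (simp add: sub_def)
    then have q2: "?T ?q = ?T ?t" "lab ?t \<le> mu b h J d ?q" using sub_iff[OF V(1) rr(1) d qV] by auto
    have "mu b h J d ?q \<le> lab ?s"
    proof -
      have "lo h J d ?q \<in> anc J ?q" using lo_in qV d by blast
      then have "lo h J d ?q \<in> anc J ?s" using anc_par[OF V(2) q(2)] by blast
      then show ?thesis unfolding mu_def by (rule lab_anc_le[OF V(2)])
    qed
    moreover have "mu b h J d ?t = lab ?t" "mu b h J d ?s = lab ?s" using lo_self V rr unfolding mu_def by simp_all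
    moreover have "valid h J d ?t" using tt a valid_cong by blast
    moreover have "\<kappa> ?t = \<kappa> ?s" using kn a by simp
    ultimately have "\<kappa> ?q = \<kappa> ?t"
      using convex[OF V(1) qV V(2) _ q2(1)[symmetric]] q2 tt by simp
    then have "\<kappa> ?s = \<kappa> ?q" using \<open>\<kappa> ?t = \<kappa> ?s\<close> by simp
    moreover have "rk h J ?q \<le> d" using rk_anc[OF qV q(1)] rr by simp
    ultimately have "?s \<notin> ?H" using q by auto
    moreover have "?s \<in> ?H" using near_in(1)[of ?H u2] a by auto
    ultimately show False by blast
  qed
  show ?thesis
  proof (intro Collect_cong conj_cong refl iffI)
    fix u' assume u': "u' \<in> iV J" "near J ?H u' = near J ?H u"
    show "?T u' = ?T u \<and> \<kappa> u' = \<kappa> u" using tpn[OF u'(1)] tpn[OF u(1)] kn[OF u'(1)] kn[OF u(1)] u' by simp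
  next
    fix u' assume u': "u' \<in> iV J" "?T u' = ?T u \<and> \<kappa> u' = \<kappa> u"
    have v': "valid h J d u'" using u u' valid_cong by blast
    let ?t = "near J ?H u" and ?s = "near J ?H u'"
    have V: "?t \<in> iV J" "?s \<in> iV J" using u u' near_V[of ?H] by auto
    have "?t \<in> anc J ?s \<or> ?s \<in> anc J ?t"
      using rank_chain[of ?t ?s d] V rkt u u' v' tpn d by auto
    then show "?s = ?t" using step[of u u'] step[of u' u] u u' v' by auto
  qed
qed

end

section \<open>Computing labels, ranks and sums along paths\<close>

lemma (in frame) ex_extI:
  assumes "ext m \<sigma> \<sigma>'" "\<Phi> \<sigma>'" "m \<le> m'"
  shows "\<exists>\<sigma>'. ext m' \<sigma> \<sigma>' \<and> \<Phi> \<sigma>'"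
  using assms ext_mono by blast

text \<open>Every sum of weights over ordered pairs of nodes is at most \<open>n * n * W\<close>.
  The factor 8 leaves room for the sum of a few cut values to stay below the number that serves as
  infinity.\<close>

locale setting = frame +
  fixes n b h W :: nat
  assumes card_V: "J \<in> I \<Longrightarrow> card (iV J) = n" and ids: "J \<in> I \<Longrightarrow> v \<in> iV J \<Longrightarrow> v < 2 ^ b"
    and weights: "J \<in> I \<Longrightarrow> e \<in> iE J \<Longrightarrow> iw J e \<le> W"
    and n_h: "n \<le> 2 ^ h" and lab_L: "(b + 2) * h < L" and b_L: "b < L" and h_L: "h + 2 < 2 ^ L"
    and n_L: "n < 2 ^ L" and W_L: "8 * (n * n * W + 1) \<le> 2 ^ L"
begin

lemma I_ranked: "J \<in> I \<Longrightarrow> ranked_tree J b h"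
  using I_rooted ids card_V n_h by (simp add: ranked_tree_def ranked_tree_axioms_def)

lemma ids_L: "J \<in> I \<Longrightarrow> v \<in> iV J \<Longrightarrow> v < 2 ^ L"
proof -
  assume "J \<in> I" "v \<in> iV J"
  then have "v < 2 ^ b" using ids by blast
  also have "(2::nat) ^ b \<le> 2 ^ L" using b_L by simp
  finally show ?thesis .
qed

lemma lab_bound: "x < 2 ^ ((b + 2) * h) \<Longrightarrow> x < (2::nat) ^ L"
  using lab_L by (meson less_imp_le less_le_trans one_le_numeral power_increasing)

lemma root_id_known: "\<exists>\<sigma>'. ext 3 \<sigma> \<sigma>' \<and> knows \<sigma>' (\<lambda>J v. ir J)"
proof -
  obtain \<sigma>1 where s1: "ext 1 \<sigma> \<sigma>1" "knows \<sigma>1 (\<lambda>J v. v = ir J)" using root_known by blast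
  have "\<exists>\<sigma>'. ext 2 \<sigma>1 \<sigma>' \<and> knows \<sigma>' (\<lambda>J v. near J {ir J} v)"
    by (rule near_value[where f = "\<lambda>_ v. v"]) (use s1 knows_id ids_L in auto)
  then obtain \<sigma>2 where s2: "ext 2 \<sigma>1 \<sigma>2" "knows \<sigma>2 (\<lambda>J v. near J {ir J} v)" by blast
  have "knows \<sigma>2 (\<lambda>J v. ir J)"
  proof (rule knows_cong[OF s2(2)])
    fix J v assume i: "J \<in> I" "v \<in> iV J"
    then interpret rooted_tree J using I_rooted by blast
    show "ir J = near J {ir J} v" using near_in(1)[of "{ir J}" v] i by simp
  qed
  then show ?thesis by (rule ex_extI[OF ext_trans[OF s1(1) s2(1)]]) simp
qed

lemma knows_root: "knows \<sigma> (\<lambda>J v. ir J) \<Longrightarrow> knows \<sigma> (\<lambda>J v. v = ir J)"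
  by (rule knows_1)

lemma labels_known:
  assumes "knows \<sigma> (\<lambda>J v. ir J)"
  shows "\<exists>\<sigma>'. ext (h * 8) \<sigma> \<sigma>' \<and> knows \<sigma>' (\<lambda>J v. lam b J h v)"
proof -
  have "\<exists>\<tau>. ext (h * 8) \<sigma> \<tau> \<and> knows \<tau> (\<lambda>J v. v \<in> Hs J h) \<and> knows \<tau> (\<lambda>J v. lam b J h v)"
  proof (rule ext_iter[where \<Phi> = "\<lambda>i \<tau>. knows \<tau> (\<lambda>J v. v \<in> Hs J i) \<and> knows \<tau> (\<lambda>J v. lam b J i v)"])
    show "knows \<sigma> (\<lambda>J v. v \<in> Hs J 0) \<and> knows \<sigma> (\<lambda>J v. lam b J 0 v)" by (simp add: knows_const)
    fix i \<tau> k
    assume e0: "ext k \<sigma> \<tau>" and k: "knows \<tau> (\<lambda>J v. v \<in> Hs J i) \<and> knows \<tau> (\<lambda>J v. lam b J i v)"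
    \<comment> \<open>The tops of the own block and of the two blocks above it, which are the three
      IDs compared in the definition of \<open>Hs\<close>.\<close>
    define Z where "Z J v = near J (Hs J i) v" for J v
    define P where "P J v = near J (Hs J i) (par J (Z J v))" for J v
    define Q where "Q J v = near J (Hs J i) (par J (P J v))" for J v
    have V: "Z J v \<in> iV J" "P J v \<in> iV J" "Q J v \<in> iV J" if "J \<in> I" "v \<in> iV J" for J v
    proof -
      interpret rooted_tree J using I_rooted that by blast
      show "Z J v \<in> iV J" "P J v \<in> iV J" "Q J v \<in> iV J" using that by (auto simp: Z_def P_def Q_def)
    qed
    have root: "ir J \<in> Hs J i" if "J \<in> I" for J using rooted_tree.Hs_root I_rooted that by blast
    note kr = knows_root[OF knows_ext[OF e0 assms]]
    note VL = ids_L[OF _ V(1)] ids_L[OF _ V(2)]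
    have "\<exists>\<sigma>'. ext 2 \<tau> \<sigma>' \<and> knows \<sigma>' (\<lambda>J v. near J (Hs J i) v)"
      by (rule near_value[OF conjunct1[OF k] root knows_id ids_L])
    then obtain \<tau>1 where 1: "ext 2 \<tau> \<tau>1" "knows \<tau>1 Z" unfolding Z_def[abs_def] by blast
    obtain \<tau>2 where 2: "ext 1 \<tau>1 \<tau>2" "knows \<tau>2 (\<lambda>J v. Z J (par J v))"
      using par_value[OF knows_ext[OF 1(1) kr] 1(2) VL(1)] by blast
    note e12 = ext_trans[OF 1(1) 2(1)]
    note pV = rooted_tree.par_in_V[OF I_rooted]
    have "\<exists>\<sigma>'. ext 2 \<tau>2 \<sigma>' \<and> knows \<sigma>' (\<lambda>J v. Z J (par J (near J (Hs J i) v)))"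
      by (rule near_value[OF knows_ext[OF e12 conjunct1[OF k]] root 2(2)]) (auto intro!: VL pV)
    then obtain \<tau>3 where 3: "ext 2 \<tau>2 \<tau>3" "knows \<tau>3 P" unfolding P_def[abs_def] Z_def by blast
    note e13 = ext_trans[OF e12 3(1)]
    obtain \<tau>4 where 4: "ext 1 \<tau>3 \<tau>4" "knows \<tau>4 (\<lambda>J v. P J (par J v))"
      using par_value[OF knows_ext[OF e13 kr] 3(2) VL(2)] by blast
    note e14 = ext_trans[OF e13 4(1)]
    have "\<exists>\<sigma>'. ext 2 \<tau>4 \<sigma>' \<and> knows \<sigma>' (\<lambda>J v. P J (par J (near J (Hs J i) v)))"
      by (rule near_value[OF knows_ext[OF e14 conjunct1[OF k]] root 4(2)]) (auto intro!: VL pV)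
    then obtain \<tau>5 where 5: "ext 2 \<tau>4 \<tau>5" "knows \<tau>5 (\<lambda>J v. P J (par J (near J (Hs J i) v)))" by blast
    note e15 = ext_trans[OF e14 5(1)]
    have near_P: "P J (par J (near J (Hs J i) v)) = Q J v" if "J \<in> I" "v \<in> iV J" for J v
      unfolding P_def Q_def Z_def ..
    have kQ: "knows \<tau>5 Q" by (rule knows_cong[OF 5(2)]) (simp add: near_P)
    have kP: "knows \<tau>5 P" using knows_ext[OF ext_trans[OF 4(1) 5(1)] 3(2)] .
    have kZ: "knows \<tau>5 Z" using knows_ext[OF ext_trans[OF 2(1) ext_trans[OF 3(1) ext_trans[OF 4(1) 5(1)]]] 1(2)] .
    have kl: "knows \<tau>5 (\<lambda>J v. lam b J i v)" using knows_ext[OF e15 conjunct2[OF k]] .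
    have kR: "knows \<tau>5 (\<lambda>J v. ir J)" using knows_ext[OF ext_trans[OF e0 e15] assms] .
    define hd where "hd J v \<longleftrightarrow> Z J v = ir J \<or> (P J v \<noteq> ir J \<and> P J v < Z J v \<and> P J v < Q J v)" for J v
    have khd: "knows \<tau>5 hd"
      by (rule knowsI) (simp add: hd_def knowsD[OF kZ] knowsD[OF kP] knowsD[OF kQ] knowsD[OF kR])
    have ZH: "Z J v \<in> Hs J i" if "J \<in> I" "v \<in> iV J" for J v
      using rooted_tree.near_in(1)[OF I_rooted root] that unfolding Z_def by blast
    have hdZ: "Z J v \<in> Hs J (Suc i) \<longleftrightarrow> hd J v" if "J \<in> I" "v \<in> iV J" for J v
      using ZH[OF that] by (simp add: Hs.simps hd_def Let_def P_def Q_def)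
    have "knows \<tau>5 (\<lambda>J v. v = Z J v \<and> hd J v)" by (rule knows_2[OF kZ khd])
    then have "knows \<tau>5 (\<lambda>J v. v \<in> Hs J (Suc i))"
    proof (rule knows_cong)
      fix J v assume i: "J \<in> I" "v \<in> iV J"
      interpret rooted_tree J using I_rooted i by blast
      show "(v \<in> Hs J (Suc i)) = (v = Z J v \<and> hd J v)"
      proof (cases "v = Z J v")
        case True
        then show ?thesis using hdZ[OF i] by simp
      next
        case False
        then have "v \<notin> Hs J i" using near_self i unfolding Z_def by metis
        then show ?thesis using False Hs_Suc_subset by blast
      qed
    qed
    moreover have "knows \<tau>5 (\<lambda>J v. (if hd J v then 0 else if P J v < Z J v then 1 + Z J v else 3 * 2 ^ b - Z J v) *
        2 ^ ((b + 2) * i) + lam b J i v)"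
      by (rule knowsI) (simp add: knowsD[OF kZ] knowsD[OF kP] knowsD[OF khd] knowsD[OF kl])
    then have "knows \<tau>5 (\<lambda>J v. lam b J (Suc i) v)"
      by (rule knows_cong) (simp add: lam.simps Let_def hdZ[symmetric] P_def Z_def)
    ultimately show "\<exists>\<tau>'. ext 8 \<tau> \<tau>' \<and> knows \<tau>' (\<lambda>J v. v \<in> Hs J (Suc i)) \<and> knows \<tau>' (\<lambda>J v. lam b J (Suc i) v)"
      by (intro ex_extI[OF e15]) simp_all
  qed
  then show ?thesis by blast
qed

lemma ranks_known:
  assumes "knows \<sigma> (\<lambda>J v. ir J)"
  shows "\<exists>\<sigma>'. ext (Suc h * 4) \<sigma> \<sigma>' \<and> knows \<sigma>' (\<lambda>J v. rk h J v)"
proof -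
  have "\<exists>\<tau>. ext (Suc h * 4) \<sigma> \<tau> \<and> (\<forall>d\<le>Suc h. knows \<tau> (\<lambda>J v. v \<in> Rk J d))"
  proof (rule ext_iter[where \<Phi> = "\<lambda>i \<tau>. \<forall>d\<le>i. knows \<tau> (\<lambda>J v. v \<in> Rk J d)"])
    have "knows \<sigma> (\<lambda>J v. v \<in> Rk J 0)" by (rule knows_cong[OF knows_const[of _ True]]) simp
    then show "\<forall>d\<le>0. knows \<sigma> (\<lambda>J v. v \<in> Rk J d)" by simp
    fix i \<tau> k
    assume e0: "ext k \<sigma> \<tau>" and k: "\<forall>d\<le>i. knows \<tau> (\<lambda>J v. v \<in> Rk J d)"
    then have kS: "knows \<tau> (\<lambda>J v. v \<in> Rk J i)" by simp
    note kr = knows_root[OF knows_ext[OF e0 assms]]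
    let ?\<phi> = "\<lambda>(_::nat list) (c::nat list) (_::nat) (t::nat). if t = 2 then c ! 0 else (0::nat)"
    let ?K = "\<lambda>J v. [of_bool (v \<in> Rk J i)] :: nat list"
    have eq: "(\<Sum>u\<in>nbr J v. ?\<phi> (?K J v) (?K J u) (iw J {v, u}) (trel J v u)) = card (kids J (Rk J i) v)"
      if "J \<in> I" "v \<in> iV J" for J v
    proof -
      have "(\<Sum>u\<in>nbr J v. ?\<phi> (?K J v) (?K J u) (iw J {v, u}) (trel J v u))
          = (\<Sum>u\<in>{c \<in> iV J. c \<noteq> ir J \<and> par J c = v}. of_bool (u \<in> Rk J i))"
        using that by (simp only: sum_if_filter finite_nbr trel_2) simp
      also have "\<dots> = card (kids J (Rk J i) v)"
        using I_finite[OF that(1)] by (simp add: kids_def of_bool_def sum.If_cases Int_def conj_assoc)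
      finally show ?thesis .
    qed
    have kn: "card (kids J S v) < 2 ^ L" if "J \<in> I" for J S v
    proof -
      have "card (kids J S v) \<le> card (iV J)" using I_finite[OF that] by (intro card_mono) (auto simp: kids_def)
      then show ?thesis using card_V[OF that] n_L by simp
    qed
    have "\<exists>\<sigma>'. ext 1 \<tau> \<sigma>' \<and> knows \<sigma>' (\<lambda>J v. \<Sum>u\<in>nbr J v. ?\<phi> (?K J v) (?K J u) (iw J {v, u}) (trel J v u))"
    proof (rule nb_sum[where K = ?K and \<phi> = ?\<phi> and c = 1])
      show "knows \<tau> ?K" by (rule knows_1[OF kS])
      have "(1::nat) < 2 ^ L" using L_pos one_less_power[of "2::nat" L] by simp
      then show "length (?K J v) = 1 \<and> (\<forall>x\<in>set (?K J v). x < 2 ^ L)" for J v by simp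
      show "(\<Sum>u\<in>nbr J v. ?\<phi> (?K J v) (?K J u) (iw J {v, u}) (trel J v u)) < 2 ^ L" if "J \<in> I" "v \<in> iV J" for J v
        unfolding eq[OF that] by (rule kn[OF that(1)])
    qed simp
    then have "\<exists>\<sigma>'. ext 1 \<tau> \<sigma>' \<and> knows \<sigma>' (\<lambda>J v. card (kids J (Rk J i) v))"
      by (rule ex_knows_cong) (simp add: eq)
    then obtain \<tau>1 where 1: "ext 1 \<tau> \<tau>1" "knows \<tau>1 (\<lambda>J v. card (kids J (Rk J i) v))" by blast
    obtain \<tau>2 where 2: "ext 1 \<tau>1 \<tau>2" "knows \<tau>2 (\<lambda>J v. card (kids J (Rk J i) (par J v)))"
      using par_value[OF knows_ext[OF 1(1) kr] 1(2) kn] by blast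
    note e12 = ext_trans[OF 1(1) 2(1)]
    have kC: "knows \<tau>2 (\<lambda>J v. v \<in> cutR J (Rk J i))"
      unfolding cutR_def mem_Collect_eq
      by (rule knowsI) (simp add: knowsD[OF 2(2)] knowsD[OF knows_ext[OF e12 kS]] knowsD[OF knows_ext[OF e12 kr]])
    \<comment> \<open>Marks the leaves of the remaining tree; a chain is removed exactly if it
      contains a mark.\<close>
    define x :: "inst \<Rightarrow> nat \<Rightarrow> nat" where "x J v = of_bool (v \<in> Rk J i \<and> card (kids J (Rk J i) v) = 0)" for J v
    have kx: "knows \<tau>2 x" unfolding x_def
      by (rule knowsI) (simp add: knowsD[OF knows_ext[OF 2(1) 1(2)]] knowsD[OF knows_ext[OF e12 kS]])
    have "\<exists>\<sigma>'. ext 2 \<tau>2 \<sigma>' \<and> knows \<sigma>' (\<lambda>J v. \<Sum>u\<in>block J (cutR J (Rk J i)) v. x J u)"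
    proof (rule block_sum[OF kC _ kx])
      fix J assume i: "J \<in> I"
      show "ir J \<in> cutR J (Rk J i)" for i by (simp add: cutR_def)
      have "sum (x J) (iV J) \<le> sum (\<lambda>_. 1) (iV J)" by (rule sum_mono) (simp add: x_def)
      then show "sum (x J) (iV J) < 2 ^ L" using card_V[OF i] n_L by simp
    qed
    then obtain \<tau>3 where 3: "ext 2 \<tau>2 \<tau>3" "knows \<tau>3 (\<lambda>J v. \<Sum>u\<in>block J (cutR J (Rk J i)) v. x J u)" by blast
    note e13 = ext_trans[OF e12 3(1)]
    have "knows \<tau>3 (\<lambda>J v. v \<in> Rk J i \<and> (v = ir J \<or> (\<Sum>u\<in>block J (cutR J (Rk J i)) v. x J u) = 0))"
      by (rule knowsI) (simp add: knowsD[OF 3(2)] knowsD[OF knows_ext[OF e13 kS]] knowsD[OF knows_ext[OF e13 kr]])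
    then have "knows \<tau>3 (\<lambda>J v. v \<in> Rk J (Suc i))"
    proof (rule knows_cong)
      fix J v assume i': "J \<in> I" "v \<in> iV J"
      interpret rooted_tree J using I_rooted i' by blast
      have "finite (block J (cutR J (Rk J i)) v)" by (simp add: block_def)
      then have "(\<Sum>u\<in>block J (cutR J (Rk J i)) v. x J u) = 0 \<longleftrightarrow>
          (\<forall>u\<in>Rk J i. near J (cutR J (Rk J i)) u = near J (cutR J (Rk J i)) v \<longrightarrow> kids J (Rk J i) u \<noteq> {})"
        using Rk_props[of i] by (auto simp: block_def x_def)
      then show "(v \<in> Rk J (Suc i)) = (v \<in> Rk J i \<and> (v = ir J \<or> (\<Sum>u\<in>block J (cutR J (Rk J i)) v. x J u) = 0))"
        by (simp add: Rk.simps)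
    qed
    then have "\<forall>d\<le>Suc i. knows \<tau>3 (\<lambda>J v. v \<in> Rk J d)" using k knows_ext[OF e13] by (metis le_Suc_eq)
    then show "\<exists>\<tau>'. ext 4 \<tau> \<tau>' \<and> (\<forall>d\<le>Suc i. knows \<tau>' (\<lambda>J v. v \<in> Rk J d))"
      by (rule ex_extI[OF e13]) simp
  qed
  then obtain \<tau> where t: "ext (Suc h * 4) \<sigma> \<tau>" "\<And>d. d \<le> Suc h \<Longrightarrow> knows \<tau> (\<lambda>J v. v \<in> Rk J d)" by blast
  have "knows \<tau> (\<lambda>J v. rk h J v)" unfolding rk_def
    by (rule knowsI, rule arg_cong[where f = Greatest]) (use knowsD[OF t(2)] in auto)
  then show ?thesis using t by blast
qed

definition based :: "round_spec list \<Rightarrow> bool" where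
  "based \<sigma> \<longleftrightarrow> knows \<sigma> (\<lambda>J v. ir J) \<and> knows \<sigma> (\<lambda>J v. lam b J h v) \<and> knows \<sigma> (\<lambda>J v. rk h J v) \<and>
     knows \<sigma> (\<lambda>J v. rk h J (par J v)) \<and> (\<forall>d\<le>h. knows \<sigma> (\<lambda>J v. tp h J d v) \<and>
     knows \<sigma> (\<lambda>J v. mu b h J d v) \<and> knows \<sigma> (\<lambda>J v. valid h J d v))"

lemma based_ext: "ext m \<sigma> \<sigma>' \<Longrightarrow> based \<sigma> \<Longrightarrow> based \<sigma>'"
  unfolding based_def by (auto intro: knows_ext)

lemma rk_L: "J \<in> I \<Longrightarrow> v \<in> iV J \<Longrightarrow> rk h J v < 2 ^ L"
  using ranked_tree.rk_le[OF I_ranked, of J v] h_L by simp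

lemma level_known:
  assumes kR: "knows \<sigma> (\<lambda>J v. ir J)" and kl: "knows \<sigma> (\<lambda>J v. lam b J h v)" and kr: "knows \<sigma> (\<lambda>J v. rk h J v)"
    and kp: "knows \<sigma> (\<lambda>J v. rk h J (par J v))" and d: "d \<le> h"
  shows "\<exists>\<sigma>'. ext 6 \<sigma> \<sigma>' \<and> knows \<sigma>' (\<lambda>J v. (tp h J d v, mu b h J d v, valid h J d v))"
proof -
  have kH: "knows \<sigma> (\<lambda>J v. v \<in> {z. z = ir J \<or> d < rk h J (par J z)})"
    by (rule knowsI) (simp add: knowsD[OF kR] knowsD[OF kp])
  have "\<exists>\<sigma>'. ext 2 \<sigma> \<sigma>' \<and> knows \<sigma>' (\<lambda>J v. tp h J d v)"
    unfolding tp_def by (rule near_value[OF kH _ knows_id ids_L]) auto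
  then obtain \<tau>1 where 1: "ext 2 \<sigma> \<tau>1" "knows \<tau>1 (\<lambda>J v. tp h J d v)" by blast
  have "\<exists>\<sigma>'. ext 2 \<tau>1 \<sigma>' \<and> knows \<sigma>' (\<lambda>J v. rk h J (tp h J d v))"
    unfolding tp_def by (rule near_value[OF knows_ext[OF 1(1) kH] _ knows_ext[OF 1(1) kr] rk_L]) auto
  then obtain \<tau>2 where 2: "ext 2 \<tau>1 \<tau>2" "knows \<tau>2 (\<lambda>J v. rk h J (tp h J d v))" by blast
  note e12 = ext_trans[OF 1(1) 2(1)]
  have kH': "knows \<tau>2 (\<lambda>J v. v \<in> {z. d \<le> rk h J z})"
    by (rule knowsI) (simp add: knowsD[OF knows_ext[OF e12 kr]])
  have "\<exists>\<sigma>'. ext 2 \<tau>2 \<sigma>' \<and> knows \<sigma>' (\<lambda>J v. lam b J h (near J {z. d \<le> rk h J z} v))"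
  proof (rule near_value[OF kH' _ knows_ext[OF e12 kl]])
    fix J assume i: "J \<in> I"
    interpret ranked_tree J b h using I_ranked i by blast
    show "ir J \<in> {z. d \<le> rk h J z}" using d by simp
    show "lam b J h v < 2 ^ L" if "v \<in> iV J" for v using lab_less[OF that] lab_bound by blast
  qed
  then obtain \<tau>3 where 3: "ext 2 \<tau>2 \<tau>3" "knows \<tau>3 (\<lambda>J v. mu b h J d v)" unfolding mu_def lo_def by blast
  have kv: "knows \<tau>2 (\<lambda>J v. valid h J d v)" unfolding valid_def by (rule knows_1[OF 2(2)])
  have "knows \<tau>3 (\<lambda>J v. (tp h J d v, mu b h J d v, valid h J d v))"
    by (rule knows_3[OF knows_ext[OF ext_trans[OF 2(1) 3(1)] 1(2)] 3(2) knows_ext[OF 3(1) kv]])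
  then show ?thesis by (rule ex_extI[OF ext_trans[OF e12 3(1)]]) simp
qed

lemma based_known: "\<exists>\<sigma>. ext (20 * h + 20) [] \<sigma> \<and> based \<sigma>"
proof -
  obtain s1 where 1: "ext 3 [] s1" "knows s1 (\<lambda>J v. ir J)" using root_id_known by blast
  obtain s2 where 2: "ext (h * 8) s1 s2" "knows s2 (\<lambda>J v. lam b J h v)" using labels_known[OF 1(2)] by blast
  obtain s3 where 3: "ext (Suc h * 4) s2 s3" "knows s3 (\<lambda>J v. rk h J v)"
    using ranks_known[OF knows_ext[OF 2(1) 1(2)]] by blast
  obtain s4 where 4: "ext 1 s3 s4" "knows s4 (\<lambda>J v. rk h J (par J v))"
    using par_value[OF knows_root[OF knows_ext[OF ext_trans[OF 2(1) 3(1)] 1(2)]] 3(2) rk_L] by blast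
  have k4: "knows s4 (\<lambda>J v. ir J)" "knows s4 (\<lambda>J v. lam b J h v)" "knows s4 (\<lambda>J v. rk h J v)"
    using knows_ext[OF ext_trans[OF 2(1) ext_trans[OF 3(1) 4(1)]] 1(2)] knows_ext[OF ext_trans[OF 3(1) 4(1)] 2(2)]
      knows_ext[OF 4(1) 3(2)] by auto
  have "\<exists>\<tau>. ext (Suc h * 6) s4 \<tau> \<and> (\<forall>d<Suc h. knows \<tau> (\<lambda>J v. (tp h J d v, mu b h J d v, valid h J d v)))"
  proof (rule ext_all)
    fix d \<tau> k assume a: "d < Suc h" "ext k s4 \<tau>"
    show "\<exists>\<tau>'. ext 6 \<tau> \<tau>' \<and> knows \<tau>' (\<lambda>J v. (tp h J d v, mu b h J d v, valid h J d v))"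
      by (rule level_known) (use a k4 4(2) knows_ext[OF a(2)] in auto)
  qed
  then obtain s5 where 5: "ext (Suc h * 6) s4 s5" "\<forall>d<Suc h. knows s5 (\<lambda>J v. (tp h J d v, mu b h J d v, valid h J d v))"
    by blast
  have "knows s5 (\<lambda>J v. tp h J d v) \<and> knows s5 (\<lambda>J v. mu b h J d v) \<and> knows s5 (\<lambda>J v. valid h J d v)"
    if "d \<le> h" for d using 5(2) that by (auto simp: knows_def less_Suc_eq_le)
  then have "based s5" by (simp add: based_def knows_ext[OF 5(1)] k4 4(2))
  moreover have "ext (20 * h + 20) [] s5"
    by (rule ext_mono[OF ext_trans[OF 1(1) ext_trans[OF 2(1) ext_trans[OF 3(1) ext_trans[OF 4(1) 5(1)]]]]]) simp
  ultimately show ?thesis by blast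
qed

section \<open>Sums and minima over connected classes of a path\<close>

definition cls :: "inst \<Rightarrow> nat \<Rightarrow> (nat \<Rightarrow> nat) \<Rightarrow> nat \<Rightarrow> nat set" where
  "cls J d \<kappa> u = {u' \<in> iV J. tp h J d u' = tp h J d u \<and> \<kappa> u' = \<kappa> u}"

text \<open>On each path of rank \<open>d\<close>, the function \<open>\<kappa>\<close> is constant between any two places where it has
  the same value; hence its classes are connected.\<close>
definition convex_on_paths :: "nat \<Rightarrow> (inst \<Rightarrow> nat \<Rightarrow> nat) \<Rightarrow> bool" where
  "convex_on_paths d \<kappa> \<longleftrightarrow> (\<forall>J\<in>I. \<forall>u1\<in>iV J. \<forall>u2\<in>iV J. \<forall>u3\<in>iV J. valid h J d u1 \<longrightarrow>
     tp h J d u1 = tp h J d u2 \<longrightarrow> tp h J d u2 = tp h J d u3 \<longrightarrow> mu b h J d u1 \<le> mu b h J d u2 \<longrightarrow>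
     mu b h J d u2 \<le> mu b h J d u3 \<longrightarrow> \<kappa> J u1 = \<kappa> J u3 \<longrightarrow> \<kappa> J u2 = \<kappa> J u1)"

lemma convex_mono:
  assumes "\<And>J x y. x \<le> y \<Longrightarrow> f J x \<le> f J y"
  shows "convex_on_paths d (\<lambda>J u. f J (mu b h J d u))"
  unfolding convex_on_paths_def using assms by (metis order_antisym)

lemma class_cut:
  fixes \<kappa> :: "inst \<Rightarrow> nat \<Rightarrow> nat"
  assumes B: "based \<sigma>" and d: "d \<le> h" and \<kappa>: "knows \<sigma> \<kappa>" "\<And>J v. J \<in> I \<Longrightarrow> v \<in> iV J \<Longrightarrow> \<kappa> J v < 2 ^ L"
  shows "\<exists>\<sigma>'. ext 1 \<sigma> \<sigma>' \<and> knows \<sigma>' (\<lambda>J v. v \<in> {z. z = ir J \<or> d < rk h J (par J z) \<or> \<kappa> J z \<noteq> \<kappa> J (par J z)})"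
proof -
  have k: "knows \<sigma> (\<lambda>J v. ir J)" "knows \<sigma> (\<lambda>J v. rk h J (par J v))" using B by (auto simp: based_def)
  obtain \<tau> where t: "ext 1 \<sigma> \<tau>" "knows \<tau> (\<lambda>J v. \<kappa> J (par J v))" using par_value[OF knows_root[OF k(1)] \<kappa>] by blast
  have "knows \<tau> (\<lambda>J v. v \<in> {z. z = ir J \<or> d < rk h J (par J z) \<or> \<kappa> J z \<noteq> \<kappa> J (par J z)})"
    by (rule knowsI) (simp add: knowsD[OF t(2)] knowsD[OF knows_ext[OF t(1) k(1)]]
      knowsD[OF knows_ext[OF t(1) k(2)]] knowsD[OF knows_ext[OF t(1) \<kappa>(1)]])
  then show ?thesis using t by blast
qed

lemma class_block_eq:
  assumes "convex_on_paths d \<kappa>" "d \<le> h" "J \<in> I" "u \<in> iV J" "valid h J d u"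
  shows "block J {z. z = ir J \<or> d < rk h J (par J z) \<or> \<kappa> J z \<noteq> \<kappa> J (par J z)} u = cls J d (\<kappa> J) u"
proof -
  interpret ranked_tree J b h using I_ranked assms by blast
  show ?thesis unfolding block_def cls_def
    by (rule class_block[OF assms(2,4,5)]) (use assms(1,3) in \<open>unfold convex_on_paths_def, blast\<close>)
qed

lemma class_sum:
  fixes x \<kappa> :: "inst \<Rightarrow> nat \<Rightarrow> nat"
  assumes B: "based \<sigma>" and d: "d \<le> h" and \<kappa>: "knows \<sigma> \<kappa>" "\<And>J v. J \<in> I \<Longrightarrow> v \<in> iV J \<Longrightarrow> \<kappa> J v < 2 ^ L"
    and c: "convex_on_paths d \<kappa>" and x: "knows \<sigma> x" "\<And>J. J \<in> I \<Longrightarrow> sum (x J) (iV J) < 2 ^ L"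
  shows "\<exists>\<sigma>'. ext 3 \<sigma> \<sigma>' \<and> knows \<sigma>' (\<lambda>J v. if valid h J d v then \<Sum>u\<in>cls J d (\<kappa> J) v. x J u else 0)"
proof -
  let ?H = "\<lambda>J. {z. z = ir J \<or> d < rk h J (par J z) \<or> \<kappa> J z \<noteq> \<kappa> J (par J z)}"
  obtain \<tau> where 1: "ext 1 \<sigma> \<tau>" "knows \<tau> (\<lambda>J v. v \<in> ?H J)" using class_cut[OF B d \<kappa>] by blast
  obtain \<tau>' where 2: "ext 2 \<tau> \<tau>'" "knows \<tau>' (\<lambda>J v. \<Sum>u\<in>block J (?H J) v. x J u)"
    using block_sum[OF 1(2) _ knows_ext[OF 1(1) x(1)] x(2)] by blast
  note e = ext_trans[OF 1(1) 2(1)]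
  have kv: "knows \<tau>' (\<lambda>J v. valid h J d v)" using based_ext[OF e B] d by (simp add: based_def)
  have "knows \<tau>' (\<lambda>J v. if valid h J d v then \<Sum>u\<in>block J (?H J) v. x J u else 0)"
    by (rule knows_2[OF kv 2(2)])
  then have "knows \<tau>' (\<lambda>J v. if valid h J d v then \<Sum>u\<in>cls J d (\<kappa> J) v. x J u else 0)"
    by (rule knows_cong) (simp add: class_block_eq[OF c d])
  then show ?thesis by (rule ex_extI[OF e]) simp
qed

lemma class_min:
  fixes x \<kappa> :: "inst \<Rightarrow> nat \<Rightarrow> nat"
  assumes B: "based \<sigma>" and d: "d \<le> h" and \<kappa>: "knows \<sigma> \<kappa>" "\<And>J v. J \<in> I \<Longrightarrow> v \<in> iV J \<Longrightarrow> \<kappa> J v < 2 ^ L"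
    and c: "convex_on_paths d \<kappa>" and x: "knows \<sigma> x" "\<And>J v. J \<in> I \<Longrightarrow> v \<in> iV J \<Longrightarrow> x J v < 2 ^ L"
  shows "\<exists>\<sigma>'. ext 3 \<sigma> \<sigma>' \<and> knows \<sigma>' (\<lambda>J v. if valid h J d v then Min (x J ` cls J d (\<kappa> J) v) else 0)"
proof -
  let ?H = "\<lambda>J. {z. z = ir J \<or> d < rk h J (par J z) \<or> \<kappa> J z \<noteq> \<kappa> J (par J z)}"
  obtain \<tau> where 1: "ext 1 \<sigma> \<tau>" "knows \<tau> (\<lambda>J v. v \<in> ?H J)" using class_cut[OF B d \<kappa>] by blast
  obtain \<tau>' where 2: "ext 2 \<tau> \<tau>'" "knows \<tau>' (\<lambda>J v. Min (x J ` block J (?H J) v))"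
    using block_min[OF 1(2) _ knows_ext[OF 1(1) x(1)] x(2)] by blast
  note e = ext_trans[OF 1(1) 2(1)]
  have kv: "knows \<tau>' (\<lambda>J v. valid h J d v)" using based_ext[OF e B] d by (simp add: based_def)
  have "knows \<tau>' (\<lambda>J v. if valid h J d v then Min (x J ` block J (?H J) v) else 0)"
    by (rule knows_2[OF kv 2(2)])
  then have "knows \<tau>' (\<lambda>J v. if valid h J d v then Min (x J ` cls J d (\<kappa> J) v) else 0)"
    by (rule knows_cong) (simp add: class_block_eq[OF c d])
  then show ?thesis by (rule ex_extI[OF e]) simp
qed

text \<open>A suffix sum confined to the aligned window of \<open>2 ^ i\<close> labels that contains
  the own one. For \<open>i = 0\<close> only nodes with the same \<open>mu\<close> count; for
  \<open>i = Lam\<close> the window covers all labels.\<close>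

definition suffix :: "inst \<Rightarrow> nat \<Rightarrow> nat \<Rightarrow> (nat \<Rightarrow> nat) \<Rightarrow> nat \<Rightarrow> nat" where
  "suffix J d i f u = (if valid h J d u then
     \<Sum>u' | u' \<in> iV J \<and> tp h J d u' = tp h J d u \<and>
       mu b h J d u' div 2 ^ i = mu b h J d u div 2 ^ i \<and> mu b h J d u \<le> mu b h J d u'. f u' else 0)"

text \<open>Doubling the window: the suffix starting at \<open>m\<close> is the suffix within the
  own half and, if the own half is the lower one, the entire upper half.\<close>

lemma half_step:
  "(k::nat) div 2 ^ Suc i = m div 2 ^ Suc i \<and> m \<le> k \<longleftrightarrow>
   (k div 2 ^ i = m div 2 ^ i \<and> m \<le> k) \<or> (even (m div 2 ^ i) \<and> odd (k div 2 ^ i) \<and> k div 2 ^ Suc i = m div 2 ^ Suc i)"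
proof -
  define a c where "a = m div 2 ^ i" and "c = k div 2 ^ i"
  have s: "m div 2 ^ Suc i = a div 2" "k div 2 ^ Suc i = c div 2"
    unfolding a_def c_def by (simp_all only: power_Suc2 div_mult2_eq)
  have "m < k" if "a < c" using that unfolding a_def c_def by (metis div_le_mono not_less)
  moreover have "k < m" if "c < a" using that unfolding a_def c_def by (metis div_le_mono not_less)
  moreover have "c div 2 = a div 2 \<and> c \<noteq> a \<Longrightarrow> (a < c \<and> even a \<and> odd c) \<or> (c < a \<and> even c \<and> odd a)" by presburger
  ultimately show ?thesis unfolding s a_def[symmetric] c_def[symmetric] by (metis less_imp_le_nat not_le)
qed

lemma suffix_known:
  fixes f :: "inst \<Rightarrow> nat \<Rightarrow> nat"
  assumes B: "based \<sigma>" and d: "d \<le> h" and f: "knows \<sigma> f" "\<And>J. J \<in> I \<Longrightarrow> sum (f J) (iV J) < 2 ^ L"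
  shows "\<exists>\<sigma>'. ext (3 + i * 3) \<sigma> \<sigma>' \<and> knows \<sigma>' (\<lambda>J v. suffix J d i (f J) v)"
proof -
  let ?mu = "\<lambda>J u. mu b h J d u"
  have mul: "?mu J v < 2 ^ L" if "J \<in> I" "v \<in> iV J" for J v
    using ranked_tree.mu_less[OF I_ranked] lab_bound that d by blast
  have kmu: "knows \<sigma> ?mu" using B d by (simp add: based_def)
  have "\<exists>\<sigma>'. ext 3 \<sigma> \<sigma>' \<and> knows \<sigma>' (\<lambda>J v. if valid h J d v then \<Sum>u\<in>cls J d (?mu J) v. f J u else 0)"
    by (rule class_sum[OF B d kmu mul _ f]) (auto intro!: convex_mono[where f = "\<lambda>_ x. x"])
  then have "\<exists>\<sigma>'. ext 3 \<sigma> \<sigma>' \<and> knows \<sigma>' (\<lambda>J v. suffix J d 0 (f J) v)"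
    by (rule ex_knows_cong) (auto simp: suffix_def cls_def intro!: sum.cong)
  then obtain \<sigma>0 where s0: "ext 3 \<sigma> \<sigma>0" "knows \<sigma>0 (\<lambda>J v. suffix J d 0 (f J) v)" by blast
  have "\<exists>\<tau>. ext (i * 3) \<sigma>0 \<tau> \<and> knows \<tau> (\<lambda>J v. suffix J d i (f J) v)"
  proof (rule ext_iter[where \<Phi> = "\<lambda>i \<tau>. knows \<tau> (\<lambda>J v. suffix J d i (f J) v)"])
    fix j \<tau> k assume e: "ext k \<sigma>0 \<tau>" and k: "knows \<tau> (\<lambda>J v. suffix J d j (f J) v)"
    note e' = ext_trans[OF s0(1) e]
    define \<kappa> where "\<kappa> J u = ?mu J u div 2 ^ Suc j" for J u
    define x where "x J u = (if odd (?mu J u div 2 ^ j) then f J u else 0)" for J u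
    note km = knows_ext[OF e' kmu]
    have kx: "knows \<tau> x" unfolding x_def by (rule knows_2[OF km knows_ext[OF e' f(1)]])
    have kk: "knows \<tau> \<kappa>" unfolding \<kappa>_def by (rule knows_1[OF km])
    have "\<exists>\<sigma>'. ext 3 \<tau> \<sigma>' \<and> knows \<sigma>' (\<lambda>J v. if valid h J d v then \<Sum>u\<in>cls J d (\<kappa> J) v. x J u else 0)"
    proof (rule class_sum[OF based_ext[OF e' B] d kk _ _ kx])
      show "\<kappa> J v < 2 ^ L" if "J \<in> I" "v \<in> iV J" for J v
        unfolding \<kappa>_def using mul[OF that] div_le_dividend le_less_trans by blast
      show "convex_on_paths d \<kappa>" unfolding \<kappa>_def by (rule convex_mono) (rule div_le_mono)
      show "sum (x J) (iV J) < 2 ^ L" if "J \<in> I" for J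
      proof -
        have "sum (x J) (iV J) \<le> sum (f J) (iV J)" by (rule sum_mono) (simp add: x_def)
        then show ?thesis using f(2)[OF that] by simp
      qed
    qed
    then obtain \<tau>' where t: "ext 3 \<tau> \<tau>'" "knows \<tau>' (\<lambda>J v. if valid h J d v then \<Sum>u\<in>cls J d (\<kappa> J) v. x J u else 0)" by blast
    have "knows \<tau>' (\<lambda>J v. suffix J d j (f J) v + (if even (?mu J v div 2 ^ j) then
        if valid h J d v then \<Sum>u\<in>cls J d (\<kappa> J) v. x J u else 0 else 0))"
      by (rule knows_3[OF knows_ext[OF t(1) k] knows_ext[OF t(1) km] t(2)])
    then have "knows \<tau>' (\<lambda>J v. suffix J d (Suc j) (f J) v)"
    proof (rule knows_cong)
      fix J v assume i: "J \<in> I" "v \<in> iV J"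
      let ?m = "?mu J v"
      let ?A = "{u' \<in> iV J. tp h J d u' = tp h J d v \<and> ?mu J u' div 2 ^ j = ?m div 2 ^ j \<and> ?m \<le> ?mu J u'}"
      let ?B = "if even (?m div 2 ^ j) then {u' \<in> cls J d (\<kappa> J) v. odd (?mu J u' div 2 ^ j)} else {}"
      have f1: "finite ?A" "finite ?B" using I_finite[OF i(1)] by (auto simp: cls_def)
      have dj: "?A \<inter> ?B = {}" by auto
      have seteq: "{u' \<in> iV J. tp h J d u' = tp h J d v \<and> ?mu J u' div 2 ^ Suc j = ?m div 2 ^ Suc j \<and> ?m \<le> ?mu J u'} = ?A \<union> ?B"
        unfolding half_step by (auto simp: cls_def \<kappa>_def)
      have "(\<Sum>u' | u' \<in> iV J \<and> tp h J d u' = tp h J d v \<and> ?mu J u' div 2 ^ Suc j = ?m div 2 ^ Suc j \<and> ?m \<le> ?mu J u'. f J u')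
          = sum (f J) ?A + sum (f J) ?B"
        unfolding seteq by (rule sum.union_disjoint[OF f1 dj])
      moreover have "sum (f J) ?B = (if even (?m div 2 ^ j) then \<Sum>u\<in>cls J d (\<kappa> J) v. x J u else 0)"
        using I_finite[OF i(1)] by (simp add: x_def sum_if_filter cls_def)
      ultimately show "suffix J d (Suc j) (f J) v = suffix J d j (f J) v + (if even (?m div 2 ^ j) then
        if valid h J d v then \<Sum>u\<in>cls J d (\<kappa> J) v. x J u else 0 else 0)" by (simp add: suffix_def)
    qed
    then show "\<exists>\<tau>'. ext 3 \<tau> \<tau>' \<and> knows \<tau>' (\<lambda>J v. suffix J d (Suc j) (f J) v)" using t by blast
  qed (rule s0(2))
  then show ?thesis using ext_trans[OF s0(1)] by blast
qed

abbreviation "Lam \<equiv> (b + 2) * h"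

text \<open>All values of \<open>mu\<close> are below \<open>2 ^ Lam\<close>, so the window is the
  whole path, and by \<open>sub_iff\<close> the suffix is the subtree of the path node above
  \<open>u\<close>.\<close>

lemma suffix_full:
  assumes i: "J \<in> I" and d: "d \<le> h" and u: "u \<in> iV J" "valid h J d u"
  shows "suffix J d Lam f u = sum f (sub J (lo h J d u))"
proof -
  interpret ranked_tree J b h using I_ranked i by blast
  let ?l = "lo h J d u"
  have l: "?l \<in> iV J" "rk h J ?l = d" "tp h J d ?l = tp h J d u"
    using lo_in[OF u(1) d] lo_valid[OF u d] by auto
  have "sub J ?l = {u' \<in> iV J. tp h J d u' = tp h J d u \<and> mu b h J d u \<le> mu b h J d u'}"
    using sub_iff[OF l(1,2) d] l(3) sub_V by (auto simp: mu_def)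
  moreover have "mu b h J d u' div 2 ^ Lam = 0" if "u' \<in> iV J" for u' using mu_less[OF that d] by simp
  ultimately show ?thesis using u by (auto simp: suffix_def intro!: sum.cong)
qed

end

section \<open>Cut values\<close>

definition wt :: "inst \<Rightarrow> nat \<Rightarrow> nat \<Rightarrow> nat" where
  "wt J u v = (if {u, v} \<in> iE J then iw J {u, v} else 0)"

definition cutw :: "inst \<Rightarrow> nat \<Rightarrow> nat" where
  "cutw J x = (\<Sum>u\<in>sub J x. \<Sum>v\<in>iV J - sub J x. wt J u v)"

definition covw :: "inst \<Rightarrow> nat \<Rightarrow> nat \<Rightarrow> nat" where
  "covw J x y = (\<Sum>u\<in>sub J x. \<Sum>v\<in>sub J y. wt J u v)"

lemma wt_sym: "wt J u v = wt J v u"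
  by (simp add: wt_def insert_commute)

definition top_node :: "inst \<Rightarrow> nat \<Rightarrow> nat" where
  "top_node J v = near J {z. z = ir J \<or> par J z = ir J} v"

text \<open>The trees hanging from the root are divided into two sides according to bit \<open>\<beta>\<close> of the ID of
  their top node; the root is on neither side.\<close>
definition side :: "inst \<Rightarrow> nat \<Rightarrow> nat \<Rightarrow> nat" where
  "side J \<beta> v = (if v = ir J then 2 else of_bool (bit (top_node J v) \<beta>))"

abbreviation cross :: "inst \<Rightarrow> nat \<Rightarrow> nat \<Rightarrow> nat \<Rightarrow> bool" where
  "cross J \<beta> u v \<equiv> side J \<beta> u + side J \<beta> v = 1"

context rooted_tree
begin

lemma top_node_props:
  assumes "x \<in> iV J" "x \<noteq> ir J"
  shows "top_node J x \<in> anc J x" "top_node J x \<in> iV J" "top_node J x \<noteq> ir J" "par J (top_node J x) = ir J"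
proof -
  let ?H = "{z. z = ir J \<or> par J z = ir J}"
  have t: "top_node J x \<in> ?H" "top_node J x \<in> anc J x" "top_node J x \<in> iV J"
    unfolding top_node_def using near_in[of ?H x] near_V[of ?H x] assms by auto
  then show "top_node J x \<in> anc J x" "top_node J x \<in> iV J" by auto
  show "top_node J x \<noteq> ir J"
  proof
    assume r: "top_node J x = ir J"
    obtain c where c: "c \<in> iV J" "c \<noteq> ir J" "par J c = ir J" "c \<in> anc J x"
      using child_towards[OF assms(1), of "ir J"] assms by auto
    then have "c \<in> anc J (top_node J x)" unfolding top_node_def using near_max[of ?H x c] assms by simp
    then show False using r c by simp
  qed
  then show "par J (top_node J x) = ir J" using t by simp
qed

lemma sub_nonroot: "x \<in> iV J \<Longrightarrow> x \<noteq> ir J \<Longrightarrow> u \<in> sub J x \<Longrightarrow> u \<in> iV J \<and> u \<noteq> ir J"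
  by (auto simp: sub_def)

lemma top_node_eqI:
  assumes "u \<in> iV J" "u \<noteq> ir J" "t \<in> anc J u" "t \<noteq> ir J" "par J t = ir J"
  shows "top_node J u = t"
proof -
  note t = top_node_props[OF assms(1,2)]
  show ?thesis
    by (rule children_eq[OF t(2,3) anc_V[OF assms(1,3)] assms(4) _ assms(1) t(1) assms(3)])
      (simp only: t(4) assms(5))
qed

lemma top_sub:
  assumes "x \<in> iV J" "x \<noteq> ir J" "u \<in> sub J x"
  shows "top_node J u = top_node J x"
proof (rule top_node_eqI)
  show "u \<in> iV J" "u \<noteq> ir J" using sub_nonroot assms by blast+
  show "top_node J x \<in> anc J u"
    using anc_trans[of u x] top_node_props(1)[OF assms(1,2)] assms(3) by (auto simp: sub_def)
qed (rule top_node_props[OF assms(1,2)])+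

lemma side_sub: "x \<in> iV J \<Longrightarrow> x \<noteq> ir J \<Longrightarrow> u \<in> sub J x \<Longrightarrow> side J \<beta> u = side J \<beta> x"
  using top_sub[of x u] sub_nonroot[of x u] by (simp add: side_def)

lemma cross_sub:
  assumes "x \<in> iV J" "x \<noteq> ir J" "u \<in> sub J x" "cross J \<beta> u v"
  shows "v \<notin> sub J x"
proof
  assume "v \<in> sub J x"
  then have "side J \<beta> v = side J \<beta> u" using side_sub[OF assms(1,2)] assms(3) by metis
  then show False using assms(4) by presburger
qed

end

text \<open>The summands at \<open>u\<close> do not mention \<open>x\<close>, so two suffix sums
  serve all nodes of rank \<open>d\<close>. An edge inside the subtree of \<open>x\<close> with
  distinct \<open>mu\<close> is added at the end with larger \<open>mu\<close> and subtracted at the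
  other; with equal \<open>mu\<close> it is not counted. An edge leaving the subtree is only added,
  as its outer end has another top or a smaller \<open>mu\<close>.\<close>

lemma (in ranked_tree) cut_plus_minus:
  assumes x: "x \<in> iV J" "rk h J x = d" "d \<le> h"
  shows "(\<Sum>u\<in>sub J x. \<Sum>v\<in>iV J. if tp h J d u \<noteq> tp h J d v \<or> mu b h J d v < mu b h J d u then wt J u v else 0)
    = cutw J x + (\<Sum>u\<in>sub J x. \<Sum>v\<in>iV J. if tp h J d u = tp h J d v \<and> mu b h J d u < mu b h J d v then wt J u v else 0)"
proof -
  let ?S = "sub J x" and ?T = "tp h J d" and ?m = "mu b h J d"
  have SV: "?S \<subseteq> iV J" using sub_V by blast
  have S: "u \<in> ?S \<longleftrightarrow> ?T u = ?T x \<and> lam b J h x \<le> ?m u" if "u \<in> iV J" for u using sub_iff[OF x that] .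
  have out: "(?T u \<noteq> ?T v \<or> ?m v < ?m u) \<and> \<not> (?T u = ?T v \<and> ?m u < ?m v)" if "u \<in> ?S" "v \<in> iV J - ?S" for u v
    using S[of u] S[of v] that SV by auto
  have split: "(\<Sum>v\<in>iV J. f v) = (\<Sum>v\<in>?S. f v) + (\<Sum>v\<in>iV J - ?S. f v)" for f :: "nat \<Rightarrow> nat"
    using sum.subset_diff[OF SV finite_V, of f] by simp
  have inn: "?T u = ?T v" if "u \<in> ?S" "v \<in> ?S" for u v
  proof -
    have "u \<in> iV J" "v \<in> iV J" using that SV by auto
    then have "?T u = ?T x" "?T v = ?T x" using S that by blast+
    then show ?thesis by simp
  qed
  have in1: "(if ?T u \<noteq> ?T v \<or> ?m v < ?m u then wt J u v else 0) = (if ?m v < ?m u then wt J u v else 0)"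
    "(if ?T u = ?T v \<and> ?m u < ?m v then wt J u v else 0) = (if ?m u < ?m v then wt J u v else 0)"
    if "u \<in> ?S" "v \<in> ?S" for u v
    by (simp_all add: inn[OF that])
  have out1: "(if ?T u \<noteq> ?T v \<or> ?m v < ?m u then wt J u v else 0) = wt J u v"
    "(if ?T u = ?T v \<and> ?m u < ?m v then wt J u v else 0) = 0"
    if "u \<in> ?S" "v \<in> iV J - ?S" for u v
    using out[OF that] by (auto simp del: not_less)
  have 1: "(\<Sum>u\<in>?S. \<Sum>v\<in>iV J. if ?T u \<noteq> ?T v \<or> ?m v < ?m u then wt J u v else 0)
     = (\<Sum>u\<in>?S. \<Sum>v\<in>?S. if ?m v < ?m u then wt J u v else 0) + cutw J x"
    unfolding split cutw_def sum.distrib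
    by (intro arg_cong2[where f = "(+)"] sum.cong refl) (simp_all only: in1 out1)
  have 2: "(\<Sum>u\<in>?S. \<Sum>v\<in>iV J. if ?T u = ?T v \<and> ?m u < ?m v then wt J u v else 0)
     = (\<Sum>u\<in>?S. \<Sum>v\<in>?S. if ?m u < ?m v then wt J u v else 0)"
  proof -
    have "(\<Sum>v\<in>iV J - ?S. if ?T u = ?T v \<and> ?m u < ?m v then wt J u v else 0) = 0" if "u \<in> ?S" for u
      by (rule sum.neutral) (use out1(2)[OF that] in blast)
    then show ?thesis unfolding split by (intro sum.cong refl) (simp add: in1 cong: sum.cong del: sum.If_cases)
  qed
  have "(\<Sum>u\<in>?S. \<Sum>v\<in>?S. if ?m v < ?m u then wt J u v else 0) = (\<Sum>u\<in>?S. \<Sum>v\<in>?S. if ?m u < ?m v then wt J u v else 0)"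
    by (subst sum.swap) (intro sum.cong refl, simp add: wt_sym)
  then show ?thesis using 1 2 by simp
qed

section \<open>Bounds on sums of weights and computation of the cut values of single edges\<close>

context setting
begin

abbreviation "TW \<equiv> n * n * W"

lemma wt_le: "J \<in> I \<Longrightarrow> wt J u v \<le> W"
  using weights by (simp add: wt_def)

lemma wt_total:
  assumes "J \<in> I" "A \<subseteq> iV J" "B \<subseteq> iV J"
  shows "(\<Sum>u\<in>A. \<Sum>v\<in>B. wt J u v) \<le> TW"
proof -
  have c: "card A \<le> n" "card B \<le> n"
    using card_mono[OF I_finite[OF assms(1)]] assms card_V by auto
  have "(\<Sum>v\<in>B. wt J u v) \<le> n * W" for u
  proof -
    have "(\<Sum>v\<in>B. wt J u v) \<le> card B * W" using sum_bounded_above[of B "wt J u" W] wt_le[OF assms(1)] by simp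
    also have "\<dots> \<le> n * W" using c(2) by (rule mult_le_mono1)
    finally show ?thesis .
  qed
  then have "(\<Sum>u\<in>A. \<Sum>v\<in>B. wt J u v) \<le> card A * (n * W)" using sum_bounded_above[of A _ "n * W"] by simp
  also have "\<dots> \<le> n * (n * W)" using c(1) by (rule mult_le_mono1)
  finally show ?thesis by (simp add: mult.assoc)
qed

lemma TW_less: "8 * TW < 2 ^ L" and TW_L: "TW < 2 ^ L"
  using W_L by simp_all

lemma wsum_le:
  assumes "J \<in> I" "A \<subseteq> iV J"
  shows "(\<Sum>u\<in>A. \<Sum>v\<in>iV J. if P u v then wt J u v else 0) \<le> TW"
proof -
  have "(\<Sum>u\<in>A. \<Sum>v\<in>iV J. if P u v then wt J u v else 0) \<le> (\<Sum>u\<in>A. \<Sum>v\<in>iV J. wt J u v)"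
    by (intro sum_mono) simp
  then show ?thesis using wt_total[OF assms order.refl] by simp
qed

lemma wsum_le1:
  assumes "J \<in> I" "u \<in> iV J"
  shows "(\<Sum>v\<in>iV J. if P u v then wt J u v else 0) \<le> TW"
  using wsum_le[OF assms(1), of "{u}" P] assms(2) by simp

text \<open>The sum is really over neighbours, because \<open>wt\<close> vanishes on other pairs;
  summing over all nodes makes it easier to exchange and restrict sums later.\<close>

lemma wsum_known:
  fixes K :: "inst \<Rightarrow> nat \<Rightarrow> nat list"
  assumes "knows \<sigma> K"
    and "\<And>J v. J \<in> I \<Longrightarrow> v \<in> iV J \<Longrightarrow> length (K J v) = c \<and> (\<forall>x\<in>set (K J v). x < 2 ^ L)"
    and "c \<le> 16"
  shows "\<exists>\<sigma>'. ext 1 \<sigma> \<sigma>' \<and> knows \<sigma>' (\<lambda>J v. \<Sum>u\<in>iV J. if P (K J v) (K J u) then wt J v u else 0)"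
proof -
  let ?\<phi> = "\<lambda>(a::nat list) (c::nat list) (w::nat) (_::nat). if P a c then w else 0"
  have eq: "(\<Sum>u\<in>iV J. if P (K J v) (K J u) then wt J v u else 0) =
      (\<Sum>u\<in>nbr J v. ?\<phi> (K J v) (K J u) (iw J {v, u}) (trel J v u))" if "J \<in> I" "v \<in> iV J" for J v
  proof (rule sum.mono_neutral_cong_right)
    show "nbr J v \<subseteq> iV J" using nbr_V[OF that(1)] by blast
  qed (use I_finite[OF that(1)] in \<open>auto simp: nbr_def wt_def\<close>)
  have "(\<Sum>u\<in>nbr J v. ?\<phi> (K J v) (K J u) (iw J {v, u}) (trel J v u)) < 2 ^ L" if "J \<in> I" "v \<in> iV J" for J v
    unfolding eq[OF that, symmetric] using wsum_le1[OF that, of "\<lambda>v u. P (K J v) (K J u)"] TW_less by simp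
  from nb_sum[of \<sigma> K c ?\<phi>, OF assms this] show ?thesis by (rule ex_knows_cong) (auto simp: eq)
qed

text \<open>Per rank, two neighbour rounds yield the summands of \<open>cut_plus_minus\<close>, and
  two suffix sums take \<open>3 + 3 * Lam\<close> rounds each.\<close>

lemma cut_known:
  assumes B: "based \<sigma>"
  shows "\<exists>\<sigma>'. ext (Suc h * (8 + 6 * Lam)) \<sigma> \<sigma>' \<and> knows \<sigma>' (\<lambda>J v. if v = ir J then 0 else cutw J v)"
proof -
  define pl where "pl d J u = (\<Sum>v\<in>iV J. if tp h J d u \<noteq> tp h J d v \<or> mu b h J d v < mu b h J d u then wt J u v else 0)" for d J u
  define mi where "mi d J u = (\<Sum>v\<in>iV J. if tp h J d u = tp h J d v \<and> mu b h J d u < mu b h J d v then wt J u v else 0)" for d J u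
  let ?K = "\<lambda>d J v. (suffix J d Lam (pl d J) v, suffix J d Lam (mi d J) v)"
  have "\<exists>\<tau>. ext (Suc h * (8 + 6 * Lam)) \<sigma> \<tau> \<and> (\<forall>d<Suc h. knows \<tau> (?K d))"
  proof (rule ext_all)
    fix d \<tau> k assume d': "d < Suc h" and e: "ext k \<sigma> \<tau>"
    have d: "d \<le> h" using d' by simp
    have B: "based \<tau>" by (rule based_ext[OF e B])
    have k: "knows \<tau> (\<lambda>J v. tp h J d v)" "knows \<tau> (\<lambda>J v. mu b h J d v)" using B d by (auto simp: based_def)
    let ?L = "\<lambda>J v. [tp h J d v, mu b h J d v]"
    have kL: "knows \<tau> ?L" by (rule knows_2[OF k])
    have L: "length (?L J v) = 2 \<and> (\<forall>x\<in>set (?L J v). x < 2 ^ L)" if "J \<in> I" "v \<in> iV J" for J v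
    proof -
      interpret ranked_tree J b h using I_ranked that by blast
      show ?thesis using tp_in[OF that(2), of d] ids_L[OF that(1)] lab_bound[OF mu_less[OF that(2) d]] by simp
    qed
    have bound: "sum (pl d J) (iV J) < 2 ^ L" "sum (mi d J) (iV J) < 2 ^ L" if "J \<in> I" for J
      unfolding pl_def mi_def by (rule le_less_trans[OF wsum_le[OF that order.refl] TW_L])+
    have "\<exists>\<sigma>'. ext 1 \<tau> \<sigma>' \<and> knows \<sigma>' (pl d)"
      unfolding pl_def[abs_def] using wsum_known[OF kL L, of "\<lambda>a c. a ! 0 \<noteq> c ! 0 \<or> c ! 1 < a ! 1"] by simp
    then obtain t1 where 1: "ext 1 \<tau> t1" "knows t1 (pl d)" by blast
    have "\<exists>\<sigma>'. ext 1 t1 \<sigma>' \<and> knows \<sigma>' (mi d)"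
      unfolding mi_def[abs_def] using wsum_known[OF knows_ext[OF 1(1) kL] L, of "\<lambda>a c. a ! 0 = c ! 0 \<and> a ! 1 < c ! 1"] by simp
    then obtain t2 where 2: "ext 1 t1 t2" "knows t2 (mi d)" by blast
    note e12 = ext_trans[OF 1(1) 2(1)]
    obtain t3 where 3: "ext (3 + Lam * 3) t2 t3" "knows t3 (\<lambda>J v. suffix J d Lam (pl d J) v)"
      using suffix_known[OF based_ext[OF e12 B] d knows_ext[OF 2(1) 1(2)] bound(1)] by blast
    note e13 = ext_trans[OF e12 3(1)]
    obtain t4 where 4: "ext (3 + Lam * 3) t3 t4" "knows t4 (\<lambda>J v. suffix J d Lam (mi d J) v)"
      using suffix_known[OF based_ext[OF e13 B] d knows_ext[OF 3(1) 2(2)] bound(2)] by blast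
    have "knows t4 (?K d)" by (rule knows_2[OF knows_ext[OF 4(1) 3(2)] 4(2)])
    then show "\<exists>\<tau>'. ext (8 + 6 * Lam) \<tau> \<tau>' \<and> knows \<tau>' (?K d)"
      by (rule ex_extI[OF ext_trans[OF e13 4(1)]]) simp
  qed
  then obtain \<tau> where t: "ext (Suc h * (8 + 6 * Lam)) \<sigma> \<tau>" "\<And>d. d < Suc h \<Longrightarrow> knows \<tau> (?K d)" by blast
  have eq: "cutw J v = suffix J (rk h J v) Lam (pl (rk h J v) J) v - suffix J (rk h J v) Lam (mi (rk h J v) J) v \<and> rk h J v \<le> h"
    if "J \<in> I" "v \<in> iV J" "v \<noteq> ir J" for J v
  proof -
    interpret ranked_tree J b h using I_ranked that by blast
    let ?d = "rk h J v"
    have d: "?d \<le> h" using rk_nonroot that by blast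
    have "valid h J ?d v" "lo h J ?d v = v" using valid_self lo_self that d by auto
    then show ?thesis using suffix_full[OF that(1) d that(2)] cut_plus_minus[OF that(2) refl d] d
      by (simp add: pl_def mi_def)
  qed
  have kr: "knows \<tau> (\<lambda>J v. rk h J v)" "knows \<tau> (\<lambda>J v. v = ir J)"
    using based_ext[OF t(1) B] knows_root by (auto simp: based_def)
  have "knows \<tau> (\<lambda>J v. if v = ir J then 0 else cutw J v)"
  proof (rule knowsI)
    fix J J' v assume s: "same \<tau> J J' v"
    note D = sameD[OF s]
    show "(if v = ir J then 0 else cutw J v) = (if v = ir J' then 0 else cutw J' v)"
    proof (cases "v = ir J")
      case True
      then show ?thesis using knowsD[OF kr(2) s] by simp
    next
      case False
      then have F': "v \<noteq> ir J'" using knowsD[OF kr(2) s] by simp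
      note e = eq[OF D(1,3) False] and e' = eq[OF D(2,4) F']
      have r: "rk h J v = rk h J' v" using knowsD[OF kr(1) s] .
      have "?K (rk h J v) J v = ?K (rk h J v) J' v" using knowsD[OF t(2) s] e by simp
      then show ?thesis using e e' r False F' by simp
    qed
  qed
  then show ?thesis using t(1) by blast
qed

lemma side_known:
  assumes B: "based \<sigma>"
  shows "\<exists>\<sigma>'. ext 3 \<sigma> \<sigma>' \<and> knows \<sigma>' (\<lambda>J v. (par J v, top_node J v))"
proof -
  have kR: "knows \<sigma> (\<lambda>J v. ir J)" using B by (simp add: based_def)
  have "\<exists>\<sigma>'. ext 1 \<sigma> \<sigma>' \<and> knows \<sigma>' (\<lambda>J v. par J v)"
    by (rule par_value[OF knows_root[OF kR] knows_id ids_L]) auto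
  then obtain s1 where 1: "ext 1 \<sigma> s1" "knows s1 (\<lambda>J v. par J v)" by blast
  have kH: "knows s1 (\<lambda>J v. v \<in> {z. z = ir J \<or> par J z = ir J})"
    by (rule knowsI) (simp add: knowsD[OF 1(2)] knowsD[OF knows_ext[OF 1(1) kR]])
  have "\<exists>\<sigma>'. ext 2 s1 \<sigma>' \<and> knows \<sigma>' (\<lambda>J v. top_node J v)" unfolding top_node_def
    by (rule near_value[OF kH _ knows_id ids_L]) auto
  then obtain s2 where 2: "ext 2 s1 s2" "knows s2 (\<lambda>J v. top_node J v)" by blast
  have "knows s2 (\<lambda>J v. (par J v, top_node J v))" by (rule knows_2[OF knows_ext[OF 2(1) 1(2)] 2(2)])
  then show ?thesis by (rule ex_extI[OF ext_trans[OF 1(1) 2(1)]]) simp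
qed

end

section \<open>Candidate partners of a path\<close>

text \<open>The largest \<open>t < 2 ^ b\<close> with \<open>4 * F t \<le> k * T\<close>, found bit by bit.\<close>
fun quant :: "nat \<Rightarrow> (nat \<Rightarrow> nat) \<Rightarrow> nat \<Rightarrow> nat \<Rightarrow> nat \<Rightarrow> nat" where
  "quant b F k T 0 = 0"
| "quant b F k T (Suc i) = (let t = quant b F k T i + 2 ^ (b - Suc i) in
     if 4 * F t \<le> k * T then t else quant b F k T i)"

text \<open>The test for a threshold succeeds exactly if the threshold is at most \<open>q\<close>,
  so this is a binary search that keeps \<open>q\<close> in a window of size
  \<open>2 ^ (b - i)\<close>.\<close>

lemma quant_hit:
  assumes "mono F" "4 * F q \<le> k * T" "k * T < 4 * F (Suc q)" "q < 2 ^ b" "i \<le> b"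
  shows "quant b F k T i \<le> q \<and> q < quant b F k T i + 2 ^ (b - i)"
  using assms(5)
proof (induction i)
  case (Suc i)
  let ?t = "quant b F k T i + 2 ^ (b - Suc i)"
  have p: "(2::nat) ^ (b - i) = 2 ^ (b - Suc i) + 2 ^ (b - Suc i)"
    using Suc.prems by (metis Suc_diff_Suc Suc_le_lessD mult_2 power_Suc)
  have "4 * F ?t \<le> k * T \<longleftrightarrow> ?t \<le> q"
  proof
    assume a: "4 * F ?t \<le> k * T"
    show "?t \<le> q"
    proof (rule ccontr)
      assume "\<not> ?t \<le> q"
      then have "F (Suc q) \<le> F ?t" using assms(1) by (simp add: mono_def Suc_le_eq)
      then show False using a assms(3) by simp
    qed
  next
    assume "?t \<le> q"
    then have "F ?t \<le> F q" using assms(1) by (simp add: mono_def)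
    then show "4 * F ?t \<le> k * T" using assms(2) by simp
  qed
  then show ?case using Suc p by (simp add: Let_def)
qed (use assms in simp)

lemma quant_le: "i \<le> b \<Longrightarrow> quant b F k T i + 2 ^ (b - i) \<le> 2 ^ b"
proof (induction i)
  case (Suc i)
  have "(2::nat) ^ (b - i) = 2 ^ (b - Suc i) + 2 ^ (b - Suc i)"
    using Suc.prems by (metis Suc_diff_Suc Suc_le_lessD mult_2 power_Suc)
  then show ?case using Suc by (simp add: Let_def)
qed simp

text \<open>A key that carries more than a quarter of \<open>T\<close> leaves a gap between
  \<open>F q\<close> and \<open>F (Suc q)\<close> too wide to avoid all multiples of
  \<open>T / 4\<close>.\<close>

lemma heavy_quantile:
  assumes "mono F" "F (Suc q) \<le> T" "T < 4 * (F (Suc q) - F q)" "q < 2 ^ b"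
  shows "\<exists>k<4. quant b F k T b = q"
proof -
  have T: "0 < T" using assms(2,3) by (cases "T = 0") auto
  have le: "F q \<le> F (Suc q)" using assms(1) by (simp add: mono_def)
  \<comment> \<open>This is \<open>4 * F q / T\<close> rounded up, the first multiple of
    \<open>T / 4\<close> that is not below \<open>F q\<close>.\<close>
  define k where "k = (4 * F q + (T - 1)) div T"
  have k1: "4 * F q \<le> k * T"
  proof -
    have "4 * F q + (T - 1) < (k + 1) * T"
      unfolding k_def using T by (metis add.commute div_less_iff_less_mult less_add_one plus_1_eq_Suc lessI)
    then show ?thesis using T by simp
  qed
  have "k * T \<le> 4 * F q + (T - 1)" unfolding k_def by simp
  then have k2: "k * T < 4 * F (Suc q)" using assms(3) le T by simp
  then have "k * T < 4 * T" using assms(2) by (meson less_le_trans mult_le_mono2)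
  then have "k < 4" by simp
  moreover have "quant b F k T b = q" using quant_hit[OF assms(1) k1 k2 assms(4) le_refl] by simp
  ultimately show ?thesis by blast
qed

section \<open>Candidates of a path at all weight scales\<close>

context setting
begin

definition Aw :: "inst \<Rightarrow> nat \<Rightarrow> nat \<Rightarrow> nat" where
  "Aw J \<beta> u = (\<Sum>v\<in>iV J. if cross J \<beta> u v then wt J u v else 0)"

text \<open>The part of a path whose weight to the other side is below \<open>2 ^ s\<close>.\<close>
definition Us :: "inst \<Rightarrow> nat \<Rightarrow> nat \<Rightarrow> nat \<Rightarrow> nat \<Rightarrow> bool" where
  "Us J \<beta> d s u \<longleftrightarrow> suffix J d Lam (Aw J \<beta>) u < 2 ^ s"

definition TT :: "inst \<Rightarrow> nat \<Rightarrow> nat \<Rightarrow> nat \<Rightarrow> nat \<Rightarrow> nat" where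
  "TT J \<beta> d s p = (\<Sum>u | u \<in> iV J \<and> tp h J d u = p. if Us J \<beta> d s u then Aw J \<beta> u else 0)"

text \<open>The cumulative distribution of the weight of the light part over its partners, a partner
  being keyed by the ID of the top of its path of rank \<open>d'\<close>.\<close>

definition FF :: "inst \<Rightarrow> nat \<Rightarrow> nat \<Rightarrow> nat \<Rightarrow> nat \<Rightarrow> nat \<Rightarrow> nat \<Rightarrow> nat" where
  "FF J \<beta> d d' s p t = (\<Sum>u | u \<in> iV J \<and> tp h J d u = p. if Us J \<beta> d s u then
     \<Sum>v\<in>iV J. if cross J \<beta> u v \<and> tp h J d' v < t then wt J u v else 0 else 0)"

definition cand :: "inst \<Rightarrow> nat \<Rightarrow> nat \<Rightarrow> nat \<Rightarrow> nat \<Rightarrow> nat \<Rightarrow> nat \<Rightarrow> nat" where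
  "cand J \<beta> d d' s k p = quant b (FF J \<beta> d d' s p) k (TT J \<beta> d s p) b"

lemma FF_mono: "mono (FF J \<beta> d d' s p)"
  unfolding mono_def FF_def by (intro allI impI sum_mono) (auto intro!: sum_mono)

lemma FF_le_TT: "FF J \<beta> d d' s p t \<le> TT J \<beta> d s p"
  unfolding FF_def TT_def Aw_def by (intro sum_mono) (auto intro!: sum_mono)

text \<open>The choice is made by the whole path and must not depend on \<open>x\<close>, so all
  scales are tried. At the scale of the weight leaving \<open>x\<close>, the light part contains the
  subtree of \<open>x\<close> and has weight less than twice that of the subtree. As
  \<open>y\<close> receives more than half of the cut of \<open>x\<close>, its path carries more
  than a quarter of the light part and is hit by a quartile.\<close>

lemma cand_hit:
  assumes i: "J \<in> I" and x: "x \<in> iV J" "rk h J x = d" "d \<le> h" and y: "y \<in> iV J" "rk h J y = d'" "d' \<le> h"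
    and xy: "cross J \<beta> x y" and cov: "cutw J x < 2 * covw J x y"
  shows "\<exists>s<Suc L. \<exists>k<4. cand J \<beta> d d' s k (tp h J d x) = tp h J d' y"
proof -
  interpret ranked_tree J b h using I_ranked i by blast
  define p q where "p = tp h J d x" and "q = tp h J d' y"
  have xr: "x \<noteq> ir J" "y \<noteq> ir J" using x y by auto
  define A where "A = sum (Aw J \<beta>) (sub J x)"
  have subV: "sub J z \<subseteq> iV J" for z using sub_V by blast
  have cross: "cross J \<beta> u v" if "u \<in> sub J x" "v \<in> sub J y" for u v
    using side_sub[OF x(1) xr(1) that(1)] side_sub[OF y(1) xr(2) that(2)] xy by simp
  have "A \<le> cutw J x" unfolding A_def Aw_def cutw_def
  proof (rule sum_mono)
    fix u assume u: "u \<in> sub J x"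
    have "(\<Sum>v\<in>iV J. if cross J \<beta> u v then wt J u v else 0) = (\<Sum>v\<in>{v \<in> iV J. cross J \<beta> u v}. wt J u v)"
      by (simp add: sum.inter_filter)
    also have "\<dots> \<le> (\<Sum>v\<in>iV J - sub J x. wt J u v)"
      by (rule sum_mono2) (use cross_sub[OF x(1) xr(1) u] in auto)
    finally show "(\<Sum>v\<in>iV J. if cross J \<beta> u v then wt J u v else 0) \<le> (\<Sum>v\<in>iV J - sub J x. wt J u v)" .
  qed
  have "covw J x y \<le> A" unfolding A_def Aw_def covw_def
  proof (rule sum_mono)
    fix u assume u: "u \<in> sub J x"
    have "(\<Sum>v\<in>sub J y. wt J u v) = (\<Sum>v\<in>sub J y. if cross J \<beta> u v then wt J u v else 0)"
      by (rule sum.cong) (use cross u in auto)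
    also have "\<dots> \<le> (\<Sum>v\<in>iV J. if cross J \<beta> u v then wt J u v else 0)" by (rule sum_mono2) (use subV in auto)
    finally show "(\<Sum>v\<in>sub J y. wt J u v) \<le> (\<Sum>v\<in>iV J. if cross J \<beta> u v then wt J u v else 0)" .
  qed
  then have Apos: "0 < A" using cov by simp
  have "A \<le> TW" unfolding A_def Aw_def by (rule wsum_le[OF i subV])
  then have AL: "A < 2 ^ L" using TW_L by simp
  \<comment> \<open>The scale of \<open>x\<close>: the least \<open>s\<close> with
    \<open>A < 2 ^ s\<close>, so that \<open>2 ^ s\<close> is at most \<open>2 * A\<close>.\<close>
  define s where "s = (LEAST s. A < 2 ^ s)"
  have s: "A < 2 ^ s" unfolding s_def by (rule LeastI[of _ L]) (rule AL)
  have sL: "s \<le> L" unfolding s_def by (rule Least_le) (rule AL)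
  have "s \<noteq> 0" using s Apos by (cases s) auto
  then obtain s' where s': "s = Suc s'" by (cases s) auto
  have half: "2 ^ s' \<le> A" using not_less_Least[of s' "\<lambda>s. A < 2 ^ s"] s' unfolding s_def by simp
  have suf: "suffix J d Lam (Aw J \<beta>) u = sum (Aw J \<beta>) (sub J (lo h J d u))" if "u \<in> iV J" "tp h J d u = p" for u
    using suffix_full[OF i x(3) that(1)] valid_cong[of d u x] valid_self[OF x] that(2) p_def by simp
  have Usub: "Us J \<beta> d s u" if u: "u \<in> sub J x" for u
  proof -
    have uV: "u \<in> iV J" and t: "tp h J d u = p" using u sub_V sub_iff[OF x, of u] p_def by auto
    have "x \<in> anc J (lo h J d u)" using lo_max[OF uV x(3)] u x by (simp add: sub_def)
    then have "lo h J d u \<in> sub J x" using lo_in[OF uV x(3)] by (simp add: sub_def)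
    then have "sum (Aw J \<beta>) (sub J (lo h J d u)) \<le> A" unfolding A_def by (intro sum_mono2) (use sub_mono in auto)
    then show ?thesis using s suf[OF uV t] by (simp add: Us_def)
  qed
  \<comment> \<open>The light part lies below the path node above its member \<open>u0\<close> of
    least \<open>mu\<close>, so its total is at most the suffix sum at \<open>u0\<close>, which is
    below \<open>2 ^ s\<close> because \<open>u0\<close> is light.\<close>
  have TT: "TT J \<beta> d s p < 2 ^ s"
  proof -
    let ?U = "{u \<in> iV J. tp h J d u = p \<and> Us J \<beta> d s u}"
    have T: "TT J \<beta> d s p = sum (Aw J \<beta>) ?U" unfolding TT_def by (simp add: sum_if_filter conj_assoc)
    have "x \<in> ?U" using Usub[of x] x p_def by simp
    then have "finite (mu b h J d ` ?U)" "mu b h J d ` ?U \<noteq> {}" by auto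
    then obtain u0 where u0: "u0 \<in> ?U" "\<forall>u\<in>?U. mu b h J d u0 \<le> mu b h J d u"
      using Min_in[of "mu b h J d ` ?U"] Min_le[of "mu b h J d ` ?U"] by fastforce
    have v0: "valid h J d u0" using valid_cong[of d u0 x] valid_self[OF x] u0 p_def by simp
    have l0: "lo h J d u0 \<in> iV J" "rk h J (lo h J d u0) = d" "tp h J d (lo h J d u0) = p"
      using lo_in[of u0 d] lo_valid[OF _ v0 x(3)] u0 x by auto
    have "?U \<subseteq> sub J (lo h J d u0)" using sub_iff[OF l0(1,2) x(3)] l0(3) u0 by (auto simp: mu_def)
    then have "sum (Aw J \<beta>) ?U \<le> sum (Aw J \<beta>) (sub J (lo h J d u0))" by (intro sum_mono2) auto
    then show ?thesis using T suf[of u0] u0 by (simp add: Us_def)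
  qed
  \<comment> \<open>All nodes below \<open>y\<close> have key \<open>q\<close>, so raising the
    threshold from \<open>q\<close> to \<open>Suc q\<close> adds at least the weight between the two
    subtrees.\<close>
  have diff: "FF J \<beta> d d' s p q + covw J x y \<le> FF J \<beta> d d' s p (Suc q)"
  proof -
    let ?P = "{u \<in> iV J. tp h J d u = p}"
    let ?g = "\<lambda>u. if Us J \<beta> d s u then \<Sum>v\<in>iV J. if cross J \<beta> u v \<and> tp h J d' v = q then wt J u v else 0 else 0"
    have "FF J \<beta> d d' s p (Suc q) = FF J \<beta> d d' s p q + sum ?g ?P"
      unfolding FF_def sum.distrib[symmetric]
      by (intro sum.cong refl) (auto simp: sum.distrib[symmetric] less_Suc_eq intro!: sum.cong)
    moreover have "covw J x y \<le> sum ?g ?P"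
    proof -
      have "covw J x y \<le> sum ?g (sub J x)" unfolding covw_def
      proof (rule sum_mono)
        fix u assume u: "u \<in> sub J x"
        have "(\<Sum>v\<in>sub J y. wt J u v) = (\<Sum>v\<in>sub J y. if cross J \<beta> u v \<and> tp h J d' v = q then wt J u v else 0)"
        proof (rule sum.cong[OF refl])
          fix v assume v: "v \<in> sub J y"
          then have "tp h J d' v = q" using sub_iff[OF y sub_V[OF v]] q_def by simp
          then show "wt J u v = (if cross J \<beta> u v \<and> tp h J d' v = q then wt J u v else 0)"
            using cross[OF u v] by simp
        qed
        also have "\<dots> \<le> (\<Sum>v\<in>iV J. if cross J \<beta> u v \<and> tp h J d' v = q then wt J u v else 0)"
          by (rule sum_mono2) (use subV in auto)
        finally show "(\<Sum>v\<in>sub J y. wt J u v) \<le> ?g u" using Usub[OF u] by simp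
      qed
      also have "\<dots> \<le> sum ?g ?P" by (rule sum_mono2) (use sub_iff[OF x] sub_V p_def in auto)
      finally show ?thesis .
    qed
    ultimately show ?thesis by simp
  qed
  have qb: "q < 2 ^ b" using tp_in[OF y(1), of d'] id_less q_def by blast
  have "TT J \<beta> d s p < 4 * (FF J \<beta> d d' s p (Suc q) - FF J \<beta> d d' s p q)"
  proof -
    have "2 ^ s \<le> 2 * A" using half s' by simp
    then have "TT J \<beta> d s p < 4 * covw J x y" using TT \<open>A \<le> cutw J x\<close> cov by linarith
    then show ?thesis using diff by linarith
  qed
  from heavy_quantile[OF FF_mono FF_le_TT this qb]
  have "\<exists>k<4. cand J \<beta> d d' s k p = q" by (simp add: cand_def)
  then show ?thesis using sL unfolding p_def q_def by (meson le_imp_less_Suc)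
qed

lemma path_sum:
  fixes x :: "inst \<Rightarrow> nat \<Rightarrow> nat"
  assumes "based \<sigma>" "d \<le> h" "knows \<sigma> x" "\<And>J. J \<in> I \<Longrightarrow> sum (x J) (iV J) < 2 ^ L"
  shows "\<exists>\<sigma>'. ext 3 \<sigma> \<sigma>' \<and> knows \<sigma>' (\<lambda>J v. if valid h J d v then \<Sum>u | u \<in> iV J \<and> tp h J d u = tp h J d v. x J u else 0)"
proof -
  have "\<exists>\<sigma>'. ext 3 \<sigma> \<sigma>' \<and> knows \<sigma>' (\<lambda>J v. if valid h J d v then \<Sum>u\<in>cls J d ((\<lambda>_ _. 0) J) v. x J u else 0)"
    by (rule class_sum[OF assms(1,2) knows_const _ _ assms(3,4)]) (auto simp: convex_on_paths_def)
  then show ?thesis by (rule ex_knows_cong) (simp add: cls_def)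
qed

lemma cand_known:
  assumes B: "based \<sigma>" and kt: "knows \<sigma> (\<lambda>J v. top_node J v)" and d: "d \<le> h" "d' \<le> h"
  shows "\<exists>\<sigma>'. ext (7 + 3 * Lam + 4 * b) \<sigma> \<sigma>' \<and>
    knows \<sigma>' (\<lambda>J v. if valid h J d v then cand J \<beta> d d' s k (tp h J d v) else 0)"
proof -
  have ks: "knows \<sigma> (\<lambda>J v. side J \<beta> v)"
    unfolding side_def using B kt by (intro knowsI) (auto simp: based_def dest: knowsD)
  have sL: "side J \<beta> v < 2 ^ L" for J v
    using h_L by (simp add: side_def)
  let ?V = "\<lambda>J v. valid h J d v"
  obtain s1 where 1: "ext 1 \<sigma> s1" "knows s1 (\<lambda>J v. Aw J \<beta> v)"
    using wsum_known[of \<sigma> "\<lambda>J v. [side J \<beta> v]" 1 "\<lambda>a c. a ! 0 + c ! 0 = 1"] knows_1[OF ks, of "\<lambda>_ x. [x]"] sL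
    unfolding Aw_def by auto
  have AwL: "sum (Aw J \<beta>) (iV J) < 2 ^ L" if "J \<in> I" for J
    unfolding Aw_def by (rule le_less_trans[OF wsum_le[OF that order.refl] TW_L])
  obtain s2 where 2: "ext (3 + Lam * 3) s1 s2" "knows s2 (\<lambda>J v. suffix J d Lam (Aw J \<beta>) v)"
    using suffix_known[OF based_ext[OF 1(1) B] d(1) 1(2) AwL] by blast
  note e12 = ext_trans[OF 1(1) 2(1)]
  have kU: "knows s2 (\<lambda>J v. Us J \<beta> d s v)" unfolding Us_def by (rule knows_1[OF 2(2)])
  have "knows s2 (\<lambda>J v. if Us J \<beta> d s v then Aw J \<beta> v else 0)" by (rule knows_2[OF kU knows_ext[OF 2(1) 1(2)]])
  moreover have "(\<Sum>v\<in>iV J. if Us J \<beta> d s v then Aw J \<beta> v else 0) < 2 ^ L" if "J \<in> I" for J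
    by (rule le_less_trans[OF sum_mono AwL[OF that]]) simp
  ultimately have "\<exists>\<sigma>'. ext 3 s2 \<sigma>' \<and> knows \<sigma>' (\<lambda>J v. if ?V J v then TT J \<beta> d s (tp h J d v) else 0)"
    unfolding TT_def by (intro path_sum[OF based_ext[OF e12 B] d(1)])
  then obtain s3 where 3: "ext 3 s2 s3" "knows s3 (\<lambda>J v. if ?V J v then TT J \<beta> d s (tp h J d v) else 0)" by blast
  note e13 = ext_trans[OF e12 3(1)]
  let ?Q = "\<lambda>i J v. if ?V J v then quant b (FF J \<beta> d d' s (tp h J d v)) k (TT J \<beta> d s (tp h J d v)) i else 0"
  have "\<exists>\<tau>. ext (b * 4) s3 \<tau> \<and> knows \<tau> (?Q b)"
  proof (rule ext_iter[where \<Phi> = "\<lambda>i \<tau>. knows \<tau> (?Q i)"])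
    show "knows s3 (?Q 0)" by (rule knows_cong[OF knows_const[of _ 0]]) simp
    fix i \<tau> k' assume ib: "i < b" and e: "ext k' s3 \<tau>" and k: "knows \<tau> (?Q i)"
    note e' = ext_trans[OF e13 e]
    have B': "based \<tau>" by (rule based_ext[OF e' B])
    \<comment> \<open>The threshold is the same for all nodes of a path, so one exchange with
      neighbours and one sum over the path evaluate the distribution at it.\<close>
    define t where "t J v = ?Q i J v + 2 ^ (b - Suc i)" for J v
    have kt: "knows \<tau> t" unfolding t_def by (rule knows_1[OF k])
    have tp: "knows \<tau> (\<lambda>J v. tp h J d' v)" using B' d by (simp add: based_def)
    let ?L = "\<lambda>J v. [side J \<beta> v, tp h J d' v, t J v]"
    have kL: "knows \<tau> ?L" by (rule knows_3[OF knows_ext[OF e' ks] tp kt])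
    have bL: "(2::nat) ^ b < 2 ^ L" using b_L by simp
    have tL: "t J v < 2 ^ L" for J v
    proof -
      have "quant b F k T i + 2 ^ (b - Suc i) \<le> 2 ^ b" for F T
      proof -
        have "(2::nat) ^ (b - Suc i) \<le> 2 ^ (b - i)" by simp
        then show ?thesis using quant_le[of i b F k T] ib by linarith
      qed
      moreover have "(2::nat) ^ (b - Suc i) \<le> 2 ^ b" by simp
      ultimately have "t J v \<le> 2 ^ b" by (simp add: t_def)
      then show ?thesis using bL by (rule le_less_trans)
    qed
    have tpL: "tp h J d' v < 2 ^ L" if "J \<in> I" "v \<in> iV J" for J v
      using ids_L[OF that(1)] ranked_tree.tp_in[OF I_ranked[OF that(1)] that(2)] by blast
    define g where "g J u = (\<Sum>v\<in>iV J. if cross J \<beta> u v \<and> tp h J d' v < t J u then wt J u v else 0)" for J u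
    have "\<exists>\<sigma>'. ext 1 \<tau> \<sigma>' \<and> knows \<sigma>' g"
      unfolding g_def[abs_def]
      using wsum_known[OF kL, of 3 "\<lambda>a c. a ! 0 + c ! 0 = 1 \<and> c ! 1 < a ! 2"] sL tL tpL by (simp add: numeral_2_eq_2 numeral_3_eq_3)
    then obtain t1 where t1: "ext 1 \<tau> t1" "knows t1 g" by blast
    have k1: "knows t1 (\<lambda>J v. if Us J \<beta> d s v then g J v else 0)"
      by (rule knows_2[OF knows_ext[OF ext_trans[OF ext_trans[OF 3(1) e] t1(1)] kU] t1(2)])
    have "\<exists>\<sigma>'. ext 3 t1 \<sigma>' \<and> knows \<sigma>' (\<lambda>J v. if ?V J v then \<Sum>u | u \<in> iV J \<and> tp h J d u = tp h J d v. (if Us J \<beta> d s u then g J u else 0) else 0)"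
    proof (rule path_sum[OF based_ext[OF t1(1) B'] d(1) k1])
      fix J assume i: "J \<in> I"
      have "(\<Sum>v\<in>iV J. if Us J \<beta> d s v then g J v else 0) \<le> (\<Sum>v\<in>iV J. g J v)" by (rule sum_mono) simp
      also have "\<dots> \<le> TW" unfolding g_def by (rule wsum_le[OF i order.refl])
      finally show "(\<Sum>v\<in>iV J. if Us J \<beta> d s v then g J v else 0) < 2 ^ L" using TW_L by simp
    qed
    then have "\<exists>\<sigma>'. ext 3 t1 \<sigma>' \<and> knows \<sigma>' (\<lambda>J v. if ?V J v then FF J \<beta> d d' s (tp h J d v) (t J v) else 0)"
    proof (rule ex_knows_cong)
      fix J v assume "J \<in> I" "v \<in> iV J"
      have tt: "t J u = t J v" if "tp h J d u = tp h J d v" for u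
        using that by (simp add: t_def valid_def)
      have gu: "g J u = (\<Sum>v'\<in>iV J. if cross J \<beta> u v' \<and> tp h J d' v' < t J v then wt J u v' else 0)"
        if "tp h J d u = tp h J d v" for u
        unfolding g_def tt[OF that] ..
      show "(if ?V J v then FF J \<beta> d d' s (tp h J d v) (t J v) else 0) =
        (if ?V J v then \<Sum>u | u \<in> iV J \<and> tp h J d u = tp h J d v. (if Us J \<beta> d s u then g J u else 0) else 0)"
        by (auto simp: FF_def gu intro!: sum.cong)
    qed
    then obtain t2 where t2: "ext 3 t1 t2" "knows t2 (\<lambda>J v. if ?V J v then FF J \<beta> d d' s (tp h J d v) (t J v) else 0)" by blast
    note et = ext_trans[OF t1(1) t2(1)]
    have kV: "knows t2 ?V" using based_ext[OF et B'] d by (simp add: based_def)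
    have "knows t2 (?Q (Suc i))"
    proof (rule knowsI)
      fix J J' v assume sm: "same t2 J J' v"
      note a = knowsD[OF kV sm] knowsD[OF knows_ext[OF et k] sm] knowsD[OF t2(2) sm]
        knowsD[OF knows_ext[OF ext_trans[OF e et] 3(2)] sm]
      show "?Q (Suc i) J v = ?Q (Suc i) J' v"
        using a by (cases "?V J v") (simp_all add: Let_def t_def)
    qed
    then show "\<exists>\<tau>'. ext 4 \<tau> \<tau>' \<and> knows \<tau>' (?Q (Suc i))" by (rule ex_extI[OF et]) simp
  qed
  then obtain s4 where 4: "ext (b * 4) s3 s4" "knows s4 (?Q b)" by blast
  then show ?thesis unfolding cand_def by (intro ex_extI[OF ext_trans[OF e13 4(1)]]) simp_all
qed

end

section \<open>Minimising over a pair of paths\<close>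

text \<open>Rows \<open>X\<close> and columns \<open>Y\<close> carry labels, \<open>Col\<close> are the columns with a cost, and the
  sought quantity is the minimum of \<open>c y - 2 * cov s (\<nu> y)\<close> for all row labels \<open>s\<close>. By the Monge
  property the best column is monotone in the row. The rows are halved \<open>\<Lambda>\<close> times; the block of
  rows with index \<open>m\<close> in step \<open>i\<close> looks at the columns with index \<open>m\<close>. They are split at the
  best column \<open>js\<close> for the row \<open>mid\<close>, and every row of the block tests that column. Blocks
  without an edge need not be considered: there the Monge inequality is an equality, hence the
  column tested in the step before is at least as good. Therefore a block can always communicate
  through one of its edges.\<close>

record stair =
  sX :: "nat set"
  sY :: "nat set"
  sw :: "nat \<Rightarrow> nat \<Rightarrow> nat"
  smu :: "nat \<Rightarrow> nat"
  snu :: "nat \<Rightarrow> nat"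
  sCol :: "nat set"
  sc :: "nat \<Rightarrow> nat"
  sL :: nat
  sK :: nat
  sT :: nat

definition cov :: "stair \<Rightarrow> nat \<Rightarrow> nat \<Rightarrow> nat" where
  "cov S s t = (\<Sum>v\<in>sY S. \<Sum>u\<in>sX S. if s \<le> smu S u \<and> t \<le> snu S v then sw S u v else 0)"

definition mid :: "stair \<Rightarrow> nat \<Rightarrow> nat \<Rightarrow> nat" where
  "mid S i m = (if i < sL S then (2 * m + 1) * 2 ^ (sL S - Suc i) else m)"

definition rowsum :: "stair \<Rightarrow> nat \<Rightarrow> nat \<Rightarrow> nat" where
  "rowsum S s v = (\<Sum>u\<in>sX S. if s \<le> smu S u then sw S u v else 0)"

text \<open>In \<open>sfx\<close> every column uses the row \<open>mid\<close> of its own block. For the columns of one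
  block this differs from \<open>cov\<close> only by a constant.\<close>
definition sfx :: "stair \<Rightarrow> (nat \<Rightarrow> nat) \<Rightarrow> nat \<Rightarrow> nat \<Rightarrow> nat" where
  "sfx S f i t = (\<Sum>v\<in>sY S. if t \<le> snu S v then rowsum S (mid S i (f (snu S v))) v else 0)"

text \<open>The constant \<open>sK\<close> keeps the subtraction of natural numbers exact
  (\<open>sfx_le\<close>) and does not affect which column is best.\<close>

definition colval :: "stair \<Rightarrow> (nat \<Rightarrow> nat) \<Rightarrow> nat \<Rightarrow> nat \<Rightarrow> nat" where
  "colval S f i y = sc S y + sK S - 2 * sfx S f i (snu S y)"

definition cols :: "stair \<Rightarrow> (nat \<Rightarrow> nat) \<Rightarrow> nat \<Rightarrow> nat set" where
  "cols S f m = {y \<in> sCol S. f (snu S y) = m}"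

text \<open>Ties go to the smallest label. The default \<open>sT\<close> lies above all column
  labels, so a block without columns of finite cost sends all its labels to the lower half.\<close>

definition jsel :: "stair \<Rightarrow> (nat \<Rightarrow> nat) \<Rightarrow> nat \<Rightarrow> nat \<Rightarrow> nat" where
  "jsel S f i m = Min (insert (sT S) (snu S ` {y \<in> cols S f m. \<forall>y'\<in>cols S f m. colval S f i y \<le> colval S f i y'}))"

fun idx :: "stair \<Rightarrow> nat \<Rightarrow> nat \<Rightarrow> nat" where
  "idx S 0 t = 0"
| "idx S (Suc i) t = 2 * idx S i t + of_bool (jsel S (idx S i) i (idx S i t) \<le> t)"

abbreviation "js S i \<equiv> jsel S (idx S i) i"

definition conn_block :: "stair \<Rightarrow> nat \<Rightarrow> nat \<Rightarrow> bool" where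
  "conn_block S i m \<longleftrightarrow> (\<exists>u\<in>sX S. \<exists>v\<in>sY S. 0 < sw S u v \<and> smu S u div 2 ^ (sL S - i) = m \<and> idx S i (snu S v) = m)"

definition good :: "stair \<Rightarrow> nat \<Rightarrow> nat \<Rightarrow> bool" where
  "good S i m \<longleftrightarrow> conn_block S i m \<and> cols S (idx S i) m \<noteq> {}"

text \<open>Rows beyond the block against columns beyond the block. \<open>eoff\<close> takes the
  same rows against the columns of the block from \<open>js\<close> on, and \<open>rowsuf\<close>
  takes the rows of the block; by \<open>cov_split\<close> the three make up \<open>cov\<close>.
  They are separated because they are computed in different places: from former steps, on the column
  path and on the row path.\<close>

definition zoff :: "stair \<Rightarrow> nat \<Rightarrow> nat \<Rightarrow> nat" where
  "zoff S i m = (\<Sum>v\<in>sY S. if m < idx S i (snu S v) then rowsum S ((m + 1) * 2 ^ (sL S - i)) v else 0)"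

definition eoff :: "stair \<Rightarrow> nat \<Rightarrow> nat \<Rightarrow> nat" where
  "eoff S i m = (\<Sum>v\<in>sY S. if idx S i (snu S v) = m \<and> js S i m \<le> snu S v
     then rowsum S ((m + 1) * 2 ^ (sL S - i)) v else 0)"

definition gsum :: "stair \<Rightarrow> nat \<Rightarrow> nat \<Rightarrow> nat" where
  "gsum S j u = (\<Sum>v\<in>sY S. if j \<le> snu S v then sw S u v else 0)"

definition rowsuf :: "stair \<Rightarrow> nat \<Rightarrow> nat \<Rightarrow> nat \<Rightarrow> nat" where
  "rowsuf S i m s = (\<Sum>u\<in>sX S. if smu S u div 2 ^ (sL S - i) = m \<and> s \<le> smu S u then gsum S (js S i m) u else 0)"

lemma idx_mono: "t \<le> t' \<Longrightarrow> idx S i t \<le> idx S i t'"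
proof (induction i)
  case (Suc i)
  show ?case
  proof (cases "idx S i t = idx S i t'")
    case True
    then show ?thesis using Suc.prems by (auto simp: of_bool_def)
  next
    case False
    then have "idx S i t < idx S i t'" using Suc by simp
    then show ?thesis by (simp add: of_bool_def)
  qed
qed simp

lemma idx_half: "idx S (Suc i) t div 2 = idx S i t"
  by (simp add: of_bool_def)

lemma idx_less: "idx S i t < 2 ^ i"
  by (induction i) (auto simp: of_bool_def)

lemma div_pow_half: "i < l \<Longrightarrow> (x::nat) div 2 ^ (l - i) = x div 2 ^ (l - Suc i) div 2"
  by (metis Suc_diff_Suc div_mult2_eq power_Suc2)

lemma mid_cases:
  assumes "i < sL S" "s div 2 ^ (sL S - i) = m"
  shows "s < mid S i m \<longleftrightarrow> s div 2 ^ (sL S - Suc i) = 2 * m"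
    "mid S i m \<le> s \<longleftrightarrow> s div 2 ^ (sL S - Suc i) = 2 * m + 1"
proof -
  have "s div 2 ^ (sL S - Suc i) div 2 = m" using assms div_pow_half by metis
  moreover have "a div 2 = m \<Longrightarrow> a = 2 * m \<or> a = 2 * m + 1" for a by presburger
  ultimately have 1: "s div 2 ^ (sL S - Suc i) = 2 * m \<or> s div 2 ^ (sL S - Suc i) = 2 * m + 1" by blast
  have "mid S i m \<le> s \<longleftrightarrow> 2 * m + 1 \<le> s div 2 ^ (sL S - Suc i)"
    using assms(1) by (simp add: mid_def less_eq_div_iff_mult_less_eq)
  then show "s < mid S i m \<longleftrightarrow> s div 2 ^ (sL S - Suc i) = 2 * m"
    "mid S i m \<le> s \<longleftrightarrow> s div 2 ^ (sL S - Suc i) = 2 * m + 1" using 1 by linarith+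
qed

lemma mid_div: "i \<le> sL S \<Longrightarrow> mid S i m div 2 ^ (sL S - i) = m"
  by (cases "i < sL S") (simp_all add: mid_def div_pow_half)

section \<open>The Monge property and the divide and conquer\<close>

locale staircase =
  fixes S :: stair
  assumes finX: "finite (sX S)" and finY: "finite (sY S)" and ColY: "sCol S \<subseteq> sY S"
    and inj: "inj_on (snu S) (sCol S)" and nuT: "v \<in> sY S \<Longrightarrow> snu S v < sT S"
    and muL: "u \<in> sX S \<Longrightarrow> smu S u < 2 ^ sL S"
    and K: "2 * (\<Sum>v\<in>sY S. \<Sum>u\<in>sX S. sw S u v) \<le> sK S"
begin

abbreviation "X \<equiv> sX S" abbreviation "Y \<equiv> sY S" abbreviation "\<mu> \<equiv> smu S"
abbreviation "\<nu> \<equiv> snu S" abbreviation "c \<equiv> sc S"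

lemma fin_cols: "finite (cols S f m)"
  using finite_subset[OF ColY finY] by (simp add: cols_def)

lemma js_props:
  assumes "cols S f m \<noteq> {}"
  shows "\<exists>y\<in>cols S f m. jsel S f i m = \<nu> y \<and> (\<forall>y'\<in>cols S f m. colval S f i y \<le> colval S f i y')"
proof -
  let ?M = "{y \<in> cols S f m. \<forall>y'\<in>cols S f m. colval S f i y \<le> colval S f i y'}"
  have "Min (colval S f i ` cols S f m) \<in> colval S f i ` cols S f m" using assms fin_cols by simp
  then obtain y0 where y0: "y0 \<in> cols S f m" "colval S f i y0 = Min (colval S f i ` cols S f m)" by auto
  then have "y0 \<in> ?M" using fin_cols by auto
  then have ne: "\<nu> ` ?M \<noteq> {}" and fin: "finite (\<nu> ` ?M)" using fin_cols by auto
  have "Min (\<nu> ` ?M) \<in> \<nu> ` ?M" using ne fin by simp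
  then obtain y where y: "y \<in> ?M" "Min (\<nu> ` ?M) = \<nu> y" by auto
  have "y \<in> Y" using y ColY by (auto simp: cols_def)
  then have "jsel S f i m = \<nu> y" unfolding jsel_def using y nuT[of y] ne fin by (simp add: min_def)
  then show ?thesis using y by blast
qed

lemma js_top: "cols S f m = {} \<Longrightarrow> jsel S f i m = sT S"
  by (simp add: jsel_def)

lemma js_less: "cols S f m \<noteq> {} \<Longrightarrow> jsel S f i m < sT S"
  using js_props[of f m i] nuT ColY by (auto simp: cols_def)

lemma js_idx: "cols S (idx S i) m \<noteq> {} \<Longrightarrow> idx S i (js S i m) = m"
  using js_props[of "idx S i" m i] by (auto simp: cols_def)

lemma above_js:
  assumes "cols S (idx S i) m \<noteq> {}"
  shows "js S i m \<le> t \<longleftrightarrow> m < idx S i t \<or> (idx S i t = m \<and> js S i m \<le> t)"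
  using idx_mono[of t "js S i m" S i] idx_mono[of "js S i m" t S i] js_idx[OF assms] by (metis le_neq_implies_less linear not_le)

text \<open>The sums over the four corners differ by the weight in the rectangle between them. As
  \<open>cov\<close> is subtracted from the costs, this weight makes larger rows prefer larger
  columns.\<close>

lemma monge:
  assumes "s \<le> s'" "t \<le> t'"
  shows "cov S s t + cov S s' t' = cov S s t' + cov S s' t +
    (\<Sum>v\<in>Y. \<Sum>u\<in>X. if s \<le> \<mu> u \<and> \<mu> u < s' \<and> t \<le> \<nu> v \<and> \<nu> v < t' then sw S u v else 0)"
  unfolding cov_def sum.distrib[symmetric] using assms by (intro sum.cong refl) auto

lemma sfx_le: "2 * sfx S f i t \<le> sK S"
proof -
  have "sfx S f i t \<le> (\<Sum>v\<in>Y. \<Sum>u\<in>X. sw S u v)" unfolding sfx_def rowsum_def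
    by (intro sum_mono) (auto intro!: sum_mono)
  then show ?thesis using K by simp
qed

text \<open>The selection compares \<open>sfx\<close>, not \<open>cov\<close>. For labels of block
  \<open>m\<close> both contain the same part \<open>P\<close> from this block, and what comes from
  the blocks beyond is a constant, \<open>A\<close> for \<open>sfx\<close> and \<open>B\<close> for
  \<open>cov\<close>.\<close>

lemma js_best:
  assumes y: "y \<in> cols S (idx S i) m" and z: "z \<in> cols S (idx S i) m" "js S i m = \<nu> z"
  shows "int (c z) - 2 * int (cov S (mid S i m) (\<nu> z)) \<le> int (c y) - 2 * int (cov S (mid S i m) (\<nu> y))"
proof -
  define P where "P t = (\<Sum>v\<in>Y. if idx S i (\<nu> v) = m \<and> t \<le> \<nu> v then rowsum S (mid S i m) v else 0)" for t
  define A where "A = (\<Sum>v\<in>Y. if m < idx S i (\<nu> v) then rowsum S (mid S i (idx S i (\<nu> v))) v else 0)"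
  define B where "B = (\<Sum>v\<in>Y. if m < idx S i (\<nu> v) then rowsum S (mid S i m) v else 0)"
  have up: "t \<le> r \<longleftrightarrow> m < idx S i r \<or> (idx S i r = m \<and> t \<le> r)" if "idx S i t = m" for t r
    using idx_mono[of r t S i] idx_mono[of t r S i] that by (metis le_neq_implies_less linear not_le)
  have 1: "sfx S (idx S i) i t = P t + A" "cov S (mid S i m) t = P t + B" if t: "idx S i t = m" for t
  proof -
    show "sfx S (idx S i) i t = P t + A" unfolding sfx_def P_def A_def sum.distrib[symmetric]
      by (intro sum.cong refl) (use up[OF t] in auto)
    have "cov S (mid S i m) t = (\<Sum>v\<in>Y. if t \<le> \<nu> v then rowsum S (mid S i m) v else 0)"
      unfolding cov_def rowsum_def by (intro sum.cong refl) auto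
    also have "\<dots> = P t + B" unfolding P_def B_def sum.distrib[symmetric]
      by (intro sum.cong refl) (use up[OF t] in auto)
    finally show "cov S (mid S i m) t = P t + B" .
  qed
  obtain z' where z': "z' \<in> cols S (idx S i) m" "js S i m = \<nu> z'"
    "\<forall>y'\<in>cols S (idx S i) m. colval S (idx S i) i z' \<le> colval S (idx S i) i y'"
    using js_props[of "idx S i" m i] y by blast
  have "z' = z" using inj z z' by (auto simp: cols_def inj_on_def)
  then have "colval S (idx S i) i z \<le> colval S (idx S i) i y" using z' y by blast
  moreover have "idx S i (\<nu> y) = m" "idx S i (\<nu> z) = m" using y z by (auto simp: cols_def)
  ultimately show ?thesis
    using 1[of "\<nu> y"] 1[of "\<nu> z"] sfx_le[of "idx S i" i "\<nu> y"] sfx_le[of "idx S i" i "\<nu> z"]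
    unfolding colval_def by linarith
qed

text \<open>Row \<open>s\<close> and column \<open>y\<close> are followed as long as they stay in
  the same block and the block has an edge. When this ends, the column tested last is at least as
  good as \<open>y\<close> for row \<open>s\<close>. The edge in the assumption connects the initial
  block, which contains everything.\<close>

lemma domination:
  assumes y: "y \<in> sCol S" and s: "s < 2 ^ sL S" and e: "u \<in> X" "v \<in> Y" "0 < sw S u v"
  shows "\<exists>i\<le>sL S. \<exists>z\<in>cols S (idx S i) (s div 2 ^ (sL S - i)). good S i (s div 2 ^ (sL S - i)) \<and>
    js S i (s div 2 ^ (sL S - i)) = \<nu> z \<and>
    int (c z) - 2 * int (cov S s (\<nu> z)) \<le> int (c y) - 2 * int (cov S s (\<nu> y))" (is ?goal)
proof -
  have "idx S i (\<nu> y) = s div 2 ^ (sL S - i) \<Longrightarrow> conn_block S i (s div 2 ^ (sL S - i)) \<Longrightarrow> ?goal" if "i \<le> sL S" for i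
    using that
  proof (induction rule: inc_induct)
    case base
    let ?m = "s div 2 ^ (sL S - sL S)"
    have m: "?m = s" by simp
    have yc: "y \<in> cols S (idx S (sL S)) ?m" using base y by (simp add: cols_def)
    then obtain z where z: "z \<in> cols S (idx S (sL S)) ?m" "js S (sL S) ?m = \<nu> z"
      using js_props[of "idx S (sL S)" ?m "sL S"] by blast
    have "mid S (sL S) ?m = s" by (simp add: mid_def)
    then have "int (c z) - 2 * int (cov S s (\<nu> z)) \<le> int (c y) - 2 * int (cov S s (\<nu> y))"
      using js_best[OF yc z] by metis
    moreover have "good S (sL S) ?m" using base yc by (auto simp: good_def)
    ultimately show ?case using z by blast
  next
    case (step i)
    define m where "m = s div 2 ^ (sL S - i)"
    have i: "i < sL S" using step by simp
    have yc: "y \<in> cols S (idx S i) m" using step.prems y by (simp add: cols_def m_def)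
    then obtain z where z: "z \<in> cols S (idx S i) m" "js S i m = \<nu> z"
      using js_props[of "idx S i" m i] by blast
    have gd: "good S i m" using step.prems yc by (auto simp: good_def m_def)
    note best = js_best[OF yc z]
    define M where "M = mid S i m"
    have dn: ?goal if "int (c z) - 2 * int (cov S s (\<nu> z)) \<le> int (c y) - 2 * int (cov S s (\<nu> y))"
      using that z gd i unfolding m_def by (meson less_imp_le)
    note mc = mid_cases[OF i m_def[symmetric], folded M_def]
    have idy: "idx S (Suc i) (\<nu> y) = 2 * m + of_bool (\<nu> z \<le> \<nu> y)"
      using yc z by (simp add: cols_def)
    have idv: "idx S (Suc i) (\<nu> v) = 2 * m + of_bool (\<nu> z \<le> \<nu> v)" if "idx S i (\<nu> v) = m" for v
      using that z by simp
    \<comment> \<open>In the first two cases the row and the column are separated by the split, and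
      the rectangle term of \<open>monge\<close> favours the tested column. In the other two they go
      to the same half.\<close>
    consider "s < M" "\<nu> z \<le> \<nu> y" | "M \<le> s" "\<nu> y \<le> \<nu> z" "\<nu> y \<noteq> \<nu> z" | "s < M" "\<nu> y < \<nu> z" | "M \<le> s" "\<nu> z \<le> \<nu> y" by linarith
    then show ?case
    proof cases
      case 1
      then show ?thesis using dn best monge[of s M "\<nu> z" "\<nu> y"] unfolding M_def by simp
    next
      case 2
      then show ?thesis using dn best monge[of M s "\<nu> y" "\<nu> z"] unfolding M_def by simp
    next
      case 3
      show ?thesis
      proof (cases "conn_block S (Suc i) (2 * m)")
        case True
        then show ?thesis using step.IH mc(1) 3 idy by simp
      next
        case False
        \<comment> \<open>An edge in this rectangle would have its row and its column in the lower
          half and so connect it. Without one, the advantage of \<open>z\<close> at row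
          \<open>M\<close> carries over unchanged to row \<open>s\<close>.\<close>
        have "(\<Sum>v\<in>Y. \<Sum>u\<in>X. if s \<le> \<mu> u \<and> \<mu> u < M \<and> \<nu> y \<le> \<nu> v \<and> \<nu> v < \<nu> z then sw S u v else 0) = 0"
        proof (intro sum.neutral ballI)
          fix v u assume uv: "v \<in> Y" "u \<in> X"
          show "(if s \<le> \<mu> u \<and> \<mu> u < M \<and> \<nu> y \<le> \<nu> v \<and> \<nu> v < \<nu> z then sw S u v else 0) = 0"
          proof (cases "s \<le> \<mu> u \<and> \<mu> u < M \<and> \<nu> y \<le> \<nu> v \<and> \<nu> v < \<nu> z")
            case True
            have "\<mu> u div 2 ^ (sL S - Suc i) < 2 * m + 1"
              using True i by (simp only: M_def mid_def div_less_iff_less_mult zero_less_power zero_less_numeral if_True)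
            moreover have "2 * m \<le> \<mu> u div 2 ^ (sL S - Suc i)"
              using mc(1) 3(1) True div_le_mono[of s "\<mu> u" "2 ^ (sL S - Suc i)"] by simp
            ultimately have a: "\<mu> u div 2 ^ (sL S - Suc i) = 2 * m" by simp
            have "idx S i (\<nu> v) = m"
              using idx_mono[of "\<nu> y" "\<nu> v" S i] idx_mono[of "\<nu> v" "\<nu> z" S i] True yc z by (auto simp: cols_def)
            then have "idx S (Suc i) (\<nu> v) = 2 * m" using idv True by simp
            then have "sw S u v = 0" using False a uv by (auto simp: conn_block_def simp del: idx.simps)
            then show ?thesis by simp
          qed auto
        qed
        then show ?thesis using dn best monge[of s M "\<nu> y" "\<nu> z"] 3 unfolding M_def by simp
      qed
    next
      case 4
      show ?thesis
      proof (cases "conn_block S (Suc i) (2 * m + 1)")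
        case True
        then show ?thesis using step.IH mc(2) 4 idy by simp
      next
        case False
        have "(\<Sum>v\<in>Y. \<Sum>u\<in>X. if M \<le> \<mu> u \<and> \<mu> u < s \<and> \<nu> z \<le> \<nu> v \<and> \<nu> v < \<nu> y then sw S u v else 0) = 0"
        proof (intro sum.neutral ballI)
          fix v u assume uv: "v \<in> Y" "u \<in> X"
          show "(if M \<le> \<mu> u \<and> \<mu> u < s \<and> \<nu> z \<le> \<nu> v \<and> \<nu> v < \<nu> y then sw S u v else 0) = 0"
          proof (cases "M \<le> \<mu> u \<and> \<mu> u < s \<and> \<nu> z \<le> \<nu> v \<and> \<nu> v < \<nu> y")
            case True
            have "M div 2 ^ (sL S - Suc i) = 2 * m + 1" using i by (simp add: M_def mid_def)
            then have "2 * m + 1 \<le> \<mu> u div 2 ^ (sL S - Suc i)" using True div_le_mono[of M "\<mu> u"] by metis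
            moreover have "\<mu> u div 2 ^ (sL S - Suc i) \<le> 2 * m + 1"
              using mc(2) 4(1) True div_le_mono[of "\<mu> u" s "2 ^ (sL S - Suc i)"] by simp
            ultimately have a: "\<mu> u div 2 ^ (sL S - Suc i) = 2 * m + 1" by simp
            have "idx S i (\<nu> v) = m"
              using idx_mono[of "\<nu> z" "\<nu> v" S i] idx_mono[of "\<nu> v" "\<nu> y" S i] True yc z by (auto simp: cols_def)
            then have "idx S (Suc i) (\<nu> v) = 2 * m + 1" using idv True by simp
            then have "sw S u v = 0" using False a uv by (auto simp: conn_block_def simp del: idx.simps)
            then show ?thesis by simp
          qed auto
        qed
        then show ?thesis using dn best monge[of M s "\<nu> z" "\<nu> y"] 4 unfolding M_def by simp
      qed
    qed
  qed
  from this[of 0] show ?thesis using s e muL by (auto simp: conn_block_def)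
qed

text \<open>The rows from \<open>s\<close> on are those of the same block from \<open>s\<close> on
  and all rows beyond the block. For the latter, the columns from \<open>js\<close> on are split
  into those of the block and those beyond.\<close>

lemma cov_split:
  assumes g: "cols S (idx S i) m \<noteq> {}" and s: "s div 2 ^ (sL S - i) = m"
  shows "cov S s (js S i m) = rowsuf S i m s + eoff S i m + zoff S i m"
proof -
  let ?p = "(2::nat) ^ (sL S - i)" and ?j = "js S i m"
  let ?hi = "(m + 1) * ?p"
  have row: "s \<le> x \<longleftrightarrow> (x div ?p = m \<and> s \<le> x) \<or> ?hi \<le> x" and dj: "\<not> (x div ?p = m \<and> ?hi \<le> x)" for x
  proof -
    have h: "?hi \<le> x \<longleftrightarrow> m + 1 \<le> x div ?p" by (simp add: less_eq_div_iff_mult_less_eq)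
    have "m \<le> x div ?p" if "s \<le> x" using div_le_mono[OF that, of ?p] s by simp
    moreover have "s \<le> x" if "m < x div ?p" using that s by (metis div_le_mono linorder_not_less nle_le)
    ultimately show "s \<le> x \<longleftrightarrow> (x div ?p = m \<and> s \<le> x) \<or> ?hi \<le> x" using h by (metis Suc_eq_plus1 Suc_le_eq le_neq_implies_less)
    show "\<not> (x div ?p = m \<and> ?hi \<le> x)" using h by simp
  qed
  have "cov S s ?j = (\<Sum>v\<in>Y. \<Sum>u\<in>X. (if \<mu> u div ?p = m \<and> s \<le> \<mu> u \<and> ?j \<le> \<nu> v then sw S u v else 0) +
      (if ?hi \<le> \<mu> u \<and> ?j \<le> \<nu> v then sw S u v else 0))"
    unfolding cov_def
  proof (intro sum.cong refl)
    fix v u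
    show "(if s \<le> \<mu> u \<and> ?j \<le> \<nu> v then sw S u v else 0) = (if \<mu> u div ?p = m \<and> s \<le> \<mu> u \<and> ?j \<le> \<nu> v then sw S u v else 0) +
      (if ?hi \<le> \<mu> u \<and> ?j \<le> \<nu> v then sw S u v else 0)"
      using row[of "\<mu> u"] dj[of "\<mu> u"] by (cases "?hi \<le> \<mu> u"; cases "?j \<le> \<nu> v"; cases "\<mu> u div ?p = m") auto
  qed
  also have "\<dots> = (\<Sum>v\<in>Y. \<Sum>u\<in>X. if \<mu> u div ?p = m \<and> s \<le> \<mu> u \<and> ?j \<le> \<nu> v then sw S u v else 0) +
      (\<Sum>v\<in>Y. \<Sum>u\<in>X. if ?hi \<le> \<mu> u \<and> ?j \<le> \<nu> v then sw S u v else 0)" by (simp add: sum.distrib)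
  also have "(\<Sum>v\<in>Y. \<Sum>u\<in>X. if \<mu> u div ?p = m \<and> s \<le> \<mu> u \<and> ?j \<le> \<nu> v then sw S u v else 0) = rowsuf S i m s"
    unfolding rowsuf_def gsum_def by (subst sum.swap) (auto intro!: sum.cong)
  also have "(\<Sum>v\<in>Y. \<Sum>u\<in>X. if ?hi \<le> \<mu> u \<and> ?j \<le> \<nu> v then sw S u v else 0) = eoff S i m + zoff S i m"
    unfolding eoff_def zoff_def sum.distrib[symmetric]
  proof (intro sum.cong refl)
    fix v
    have "(\<Sum>u\<in>X. if ?hi \<le> \<mu> u \<and> ?j \<le> \<nu> v then sw S u v else 0) = (if ?j \<le> \<nu> v then rowsum S ?hi v else 0)"
      unfolding rowsum_def by (auto intro!: sum.cong)
    also have "\<dots> = (if idx S i (\<nu> v) = m \<and> ?j \<le> \<nu> v then rowsum S ?hi v else 0) + (if m < idx S i (\<nu> v) then rowsum S ?hi v else 0)"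
      using above_js[OF g, of "\<nu> v"] by auto
    finally show "(\<Sum>u\<in>X. if ?hi \<le> \<mu> u \<and> ?j \<le> \<nu> v then sw S u v else 0) =
      (if idx S i (\<nu> v) = m \<and> ?j \<le> \<nu> v then rowsum S ?hi v else 0) + (if m < idx S i (\<nu> v) then rowsum S ?hi v else 0)" .
  qed
  finally show ?thesis by (simp add: add.assoc)
qed

lemma zoff_0: "zoff S 0 m = 0"
  by (simp add: zoff_def)

text \<open>The upper half ends with the same row and the same column as the block it comes
  from.\<close>

lemma zoff_odd: "i < sL S \<Longrightarrow> zoff S (Suc i) (2 * m + 1) = zoff S i m"
proof -
  assume i: "i < sL S"
  have p: "(2::nat) ^ (sL S - i) = 2 * 2 ^ (sL S - Suc i)" using i by (metis Suc_diff_Suc power_Suc)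
  have h: "2 * m + 1 < a \<longleftrightarrow> m < a div 2" for a by presburger
  have "2 * m + 1 < idx S (Suc i) t \<longleftrightarrow> m < idx S i t" for t
    using h[of "idx S (Suc i) t"] unfolding idx_half .
  moreover have "(2 * m + 1 + 1) * 2 ^ (sL S - Suc i) = (m + 1) * 2 ^ (sL S - i)" unfolding p by simp
  ultimately show ?thesis unfolding zoff_def by (simp only:)
qed

text \<open>Beyond the lower half lie the rows from \<open>mid\<close> on and the columns from
  \<open>js\<close> on, so the offset is itself a value of \<open>cov\<close> and
  \<open>cov_split\<close> applies.\<close>

lemma zoff_even:
  assumes i: "i < sL S" and g: "cols S (idx S i) m \<noteq> {}"
  shows "zoff S (Suc i) (2 * m) = rowsuf S i m (mid S i m) + eoff S i m + zoff S i m"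
proof -
  have "2 * m < idx S (Suc i) t \<longleftrightarrow> js S i m \<le> t" for t
  proof (cases "idx S i t = m")
    case False
    have "2 * m < a \<longleftrightarrow> m < a div 2" if "a div 2 \<noteq> m" for a using that by presburger
    from this[of "idx S (Suc i) t"] have "2 * m < idx S (Suc i) t \<longleftrightarrow> m < idx S i t"
      unfolding idx_half using False by blast
    then show ?thesis using above_js[OF g, of t] False by blast
  qed simp
  then have "zoff S (Suc i) (2 * m) = (\<Sum>v\<in>Y. if js S i m \<le> \<nu> v then rowsum S (mid S i m) v else 0)"
    using i unfolding zoff_def mid_def by (simp del: idx.simps)
  also have "\<dots> = cov S (mid S i m) (js S i m)" unfolding cov_def rowsum_def by (intro sum.cong refl) auto
  also have "\<dots> = rowsuf S i m (mid S i m) + eoff S i m + zoff S i m"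
    by (rule cov_split[OF g]) (use mid_div i in auto)
  finally show ?thesis .
qed

text \<open>An edge and a column of a block also belong to the block it was split from. Hence a good
  block inherits offsets only from good blocks, the only ones where they are computed.\<close>

lemma good_Suc:
  assumes i: "i < sL S" and g: "good S (Suc i) m"
  shows "good S i (m div 2)"
proof -
  obtain u v where u: "u \<in> X" "v \<in> Y" "0 < sw S u v" "\<mu> u div 2 ^ (sL S - Suc i) = m" "idx S (Suc i) (\<nu> v) = m"
    using g unfolding good_def conn_block_def by blast
  obtain y where y: "y \<in> sCol S" "idx S (Suc i) (\<nu> y) = m" using g unfolding good_def cols_def by blast
  have "\<mu> u div 2 ^ (sL S - i) = m div 2" using div_pow_half[OF i] u(4) by simp
  moreover have "idx S i (\<nu> v) = m div 2" "idx S i (\<nu> y) = m div 2" using idx_half u(5) y(2) by metis+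
  ultimately show ?thesis using u(1-3) y(1) unfolding good_def conn_block_def cols_def by blast
qed

end

text \<open>Reconciles a minimum over a class, whose ineligible members contribute the top value
  \<open>t\<close>, with a minimum over the eligible members that has \<open>t\<close> as
  default.\<close>

lemma Min_top:
  assumes "finite B" "A \<subseteq> B" "B \<subseteq> insert t A" "A \<noteq> {}" "\<forall>a\<in>A. a \<le> (t::nat)"
  shows "Min A = Min B"
proof (rule antisym)
  have A: "finite A" using assms finite_subset by blast
  have "Min B \<in> B" using assms by (intro Min_in) auto
  then consider "Min B = t" | "Min B \<in> A" using assms by auto
  then show "Min A \<le> Min B"
  proof cases
    case 1
    have "Min A \<in> A" using A assms(4) by (rule Min_in)
    then show ?thesis using 1 assms(5) by simp
  qed (simp add: A)
  show "Min B \<le> Min A" using assms A by (intro Min_antimono) auto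
qed

text \<open>The parameters are the bit that separates the two sides, and for both sides the rank of the
  paths and the number \<open>(s, k)\<close> of the candidate. A path is paired with at most one path of the
  other side, namely if each of them is the chosen candidate of the other one.\<close>
locale pairing = setting +
  fixes \<beta> d1 d2 s1 k1 s2 k2 :: nat
  assumes d1: "d1 \<le> h" and d2: "d2 \<le> h"
begin

section \<open>The staircase of two paths that choose each other, seen from the column path\<close>

abbreviation "infv \<equiv> (2::nat) ^ L - 1"
abbreviation "t1 J u \<equiv> tp h J d1 u" abbreviation "t2 J v \<equiv> tp h J d2 v"
abbreviation "m1 J u \<equiv> mu b h J d1 u" abbreviation "m2 J v \<equiv> mu b h J d2 v"
abbreviation "v1 J u \<equiv> valid h J d1 u" abbreviation "v2 J v \<equiv> valid h J d2 v"

definition pY :: "inst \<Rightarrow> nat \<Rightarrow> nat" where "pY J q = cand J \<beta> d2 d1 s2 k2 q"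
definition cX :: "inst \<Rightarrow> nat \<Rightarrow> nat" where "cX J u = (if v1 J u then cand J \<beta> d1 d2 s1 k1 (t1 J u) else 0)"
definition cY :: "inst \<Rightarrow> nat \<Rightarrow> nat" where "cY J v = (if v2 J v then pY J (t2 J v) else 0)"

definition mat :: "inst \<Rightarrow> nat \<Rightarrow> nat \<Rightarrow> bool" where
  "mat J u v \<longleftrightarrow> side J \<beta> u = 0 \<and> side J \<beta> v = 1 \<and> v1 J u \<and> v2 J v \<and> cX J u = t2 J v \<and> cY J v = t1 J u"

text \<open>The requirement on the parent excludes the edges at the root: they belong to none of the
  trees below the root and do not enter the 2-respecting minimum.\<close>

definition colnode :: "inst \<Rightarrow> nat \<Rightarrow> nat \<Rightarrow> bool" where
  "colnode J d y \<longleftrightarrow> y \<noteq> ir J \<and> rk h J y = d \<and> par J y \<noteq> ir J"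

definition SS :: "inst \<Rightarrow> nat \<Rightarrow> stair" where
  "SS J q = \<lparr>sX = iV J, sY = {v \<in> iV J. v2 J v \<and> t2 J v = q},
     sw = (\<lambda>u v. if mat J u v then wt J u v else 0), smu = (\<lambda>u. m1 J u), snu = (\<lambda>v. m2 J v),
     sCol = {y \<in> iV J. v2 J y \<and> t2 J y = q \<and> colnode J d2 y}, sc = cutw J,
     sL = Lam, sK = 2 * TW, sT = infv\<rparr>"

lemma SS_simps [simp]: "sX (SS J q) = iV J" "sY (SS J q) = {v \<in> iV J. v2 J v \<and> t2 J v = q}"
  "sw (SS J q) u v = (if mat J u v then wt J u v else 0)" "smu (SS J q) u = m1 J u" "snu (SS J q) v = m2 J v"
  "sCol (SS J q) = {y \<in> iV J. v2 J y \<and> t2 J y = q \<and> colnode J d2 y}" "sc (SS J q) y = cutw J y"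
  "sL (SS J q) = Lam" "sK (SS J q) = 2 * TW" "sT (SS J q) = infv"
  by (simp_all add: SS_def)

lemma cutw_TW: "J \<in> I \<Longrightarrow> cutw J x \<le> TW"
  unfolding cutw_def by (rule wt_total) (auto simp: sub_def)

lemma pow_Lam: "2 * 2 ^ Lam \<le> (2::nat) ^ L"
proof -
  have "(2::nat) ^ Suc Lam \<le> 2 ^ L" using lab_L by (intro power_increasing) auto
  then show ?thesis by simp
qed

lemma mu_bounds:
  assumes "J \<in> I" "v \<in> iV J" "d \<le> h"
  shows "mu b h J d v < 2 ^ Lam" "mu b h J d v < infv" "mu b h J d v < 2 ^ L"
proof -
  show 1: "mu b h J d v < 2 ^ Lam" using ranked_tree.mu_less[OF I_ranked] assms by blast
  have "(1::nat) \<le> 2 ^ Lam" by simp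
  then show "mu b h J d v < infv" "mu b h J d v < 2 ^ L" using 1 pow_Lam by linarith+
qed

lemma SS_staircase:
  assumes i: "J \<in> I"
  shows "staircase (SS J q)"
proof
  interpret ranked_tree J b h using I_ranked i by blast
  show "finite (sX (SS J q))" "finite (sY (SS J q))" "sCol (SS J q) \<subseteq> sY (SS J q)" by auto
  \<comment> \<open>Columns lie on one path and are comparable by \<open>rank_chain\<close>; of two
    distinct comparable nodes the lower one has the larger label.\<close>
  show "inj_on (snu (SS J q)) (sCol (SS J q))"
  proof (rule inj_onI)
    fix x y assume "x \<in> sCol (SS J q)" "y \<in> sCol (SS J q)" and eq: "snu (SS J q) x = snu (SS J q) y"
    then have xy: "x \<in> iV J" "y \<in> iV J" "rk h J x = d2" "rk h J y = d2" "t2 J x = t2 J y" by (auto simp: colnode_def)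
    have "lo h J d2 x = x" "lo h J d2 y = y" using lo_self xy by auto
    then have "lam b J h x = lam b J h y" using eq by (simp add: mu_def)
    then show "x = y" using rank_chain[OF xy d2] lab_anc[OF xy(1), of y] lab_anc[OF xy(2), of x] by auto
  qed
  show "snu (SS J q) v < sT (SS J q)" if "v \<in> sY (SS J q)" for v using that mu_bounds[OF i _ d2] by simp
  show "smu (SS J q) u < 2 ^ sL (SS J q)" if "u \<in> sX (SS J q)" for u using that mu_bounds[OF i _ d1] by simp
  have "(\<Sum>v\<in>sY (SS J q). \<Sum>u\<in>sX (SS J q). sw (SS J q) u v) \<le> (\<Sum>v\<in>sY (SS J q). \<Sum>u\<in>sX (SS J q). wt J v u)"
  proof (intro sum_mono)
    fix v u show "sw (SS J q) u v \<le> wt J v u" using wt_sym[of J u v] by simp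
  qed
  also have "\<dots> \<le> TW" by (rule wt_total[OF i]) auto
  finally show "2 * (\<Sum>v\<in>sY (SS J q). \<Sum>u\<in>sX (SS J q). sw (SS J q) u v) \<le> sK (SS J q)" by simp
qed

text \<open>What two neighbours have to exchange in order to decide \<open>mat\<close>; booleans are
  sent as 0 or 1.\<close>

definition BL :: "inst \<Rightarrow> nat \<Rightarrow> nat list" where
  "BL J v = [side J \<beta> v, of_bool (v1 J v), of_bool (v2 J v), t1 J v, t2 J v, cX J v, cY J v]"

definition MM :: "nat list \<Rightarrow> nat list \<Rightarrow> bool" where
  "MM a c \<longleftrightarrow> a ! 0 = 0 \<and> c ! 0 = 1 \<and> a ! 1 = 1 \<and> c ! 2 = 1 \<and> a ! 5 = c ! 4 \<and> c ! 6 = a ! 3"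

lemma mat_MM: "mat J u v \<longleftrightarrow> MM (BL J u) (BL J v)"
  by (auto simp: mat_def MM_def BL_def)

lemma cand_less: "cand J \<beta>' d d' s k p < 2 ^ L"
proof -
  have "cand J \<beta>' d d' s k p + 1 \<le> 2 ^ b" using quant_le[of b b] by (simp add: cand_def)
  moreover have "(2::nat) ^ b \<le> 2 ^ L" using b_L by simp
  ultimately show ?thesis by linarith
qed

lemma BL_len [simp]: "length (BL J v) = 7"
  by (simp add: BL_def)

lemma L_nums: "2 < (2::nat) ^ L" "1 < (2::nat) ^ L" "0 < (2::nat) ^ L"
  using h_L by linarith+

lemma BL_bound: "J \<in> I \<Longrightarrow> v \<in> iV J \<Longrightarrow> \<forall>x\<in>set (BL J v). x < 2 ^ L"
  using ids_L ranked_tree.tp_in[OF I_ranked] cand_less L_nums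
  by (auto simp: BL_def side_def cX_def cY_def pY_def of_bool_def)

definition pbased :: "round_spec list \<Rightarrow> bool" where
  "pbased \<sigma> \<longleftrightarrow> based \<sigma> \<and> knows \<sigma> BL \<and> knows \<sigma> (\<lambda>J v. if v = ir J then 0 else cutw J v) \<and> knows \<sigma> (\<lambda>J v. par J v)"

lemma pbased_ext: "ext m \<sigma> \<sigma>' \<Longrightarrow> pbased \<sigma> \<Longrightarrow> pbased \<sigma>'"
  unfolding pbased_def by (auto intro: knows_ext based_ext)

lemma pbased_knows:
  assumes "pbased \<sigma>"
  shows "based \<sigma>" "knows \<sigma> m1" "knows \<sigma> m2" "knows \<sigma> t1" "knows \<sigma> t2" "knows \<sigma> v1" "knows \<sigma> v2"
    "knows \<sigma> (\<lambda>J v. rk h J v)" "knows \<sigma> (\<lambda>J v. ir J)" "knows \<sigma> (\<lambda>J v. par J v)"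
  using assms d1 d2 by (simp_all add: pbased_def based_def)

text \<open>The seven numbers of \<open>BL\<close> and at most nine further ones respect the limit
  of 16 numbers per message.\<close>

lemma xsum:
  fixes E :: "inst \<Rightarrow> nat \<Rightarrow> nat list"
  assumes B: "pbased \<sigma>" and E: "knows \<sigma> E" "\<And>J v. J \<in> I \<Longrightarrow> v \<in> iV J \<Longrightarrow> length (E J v) = e \<and> (\<forall>x\<in>set (E J v). x < 2 ^ L)" "e \<le> 9"
  shows "\<exists>\<sigma>'. ext 1 \<sigma> \<sigma>' \<and> knows \<sigma>' (\<lambda>J u. \<Sum>v\<in>iV J. if mat J u v \<and> P (E J u) (E J v) then wt J u v else 0)"
    "\<exists>\<sigma>'. ext 1 \<sigma> \<sigma>' \<and> knows \<sigma>' (\<lambda>J v. \<Sum>u\<in>iV J. if mat J u v \<and> P (E J v) (E J u) then wt J u v else 0)"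
proof -
  let ?K = "\<lambda>J v. BL J v @ E J v"
  have "knows \<sigma> BL" using B by (simp add: pbased_def)
  then have kK: "knows \<sigma> ?K" by (rule knows_2[OF _ E(1)])
  have K: "length (?K J v) = 7 + e \<and> (\<forall>x\<in>set (?K J v). x < 2 ^ L)" if "J \<in> I" "v \<in> iV J" for J v
    using E(2)[OF that] BL_bound[OF that] by auto
  show "\<exists>\<sigma>'. ext 1 \<sigma> \<sigma>' \<and> knows \<sigma>' (\<lambda>J u. \<Sum>v\<in>iV J. if mat J u v \<and> P (E J u) (E J v) then wt J u v else 0)"
    using wsum_known[OF kK K, of "\<lambda>a c. MM (take 7 a) (take 7 c) \<and> P (drop 7 a) (drop 7 c)"] E(3)
    by (simp add: mat_MM)
  have "\<exists>\<sigma>'. ext 1 \<sigma> \<sigma>' \<and> knows \<sigma>' (\<lambda>J v. \<Sum>u\<in>iV J. if mat J u v \<and> P (E J v) (E J u) then wt J v u else 0)"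
    using wsum_known[OF kK K, of "\<lambda>a c. MM (take 7 c) (take 7 a) \<and> P (drop 7 a) (drop 7 c)"] E(3)
    by (simp add: mat_MM)
  then show "\<exists>\<sigma>'. ext 1 \<sigma> \<sigma>' \<and> knows \<sigma>' (\<lambda>J v. \<Sum>u\<in>iV J. if mat J u v \<and> P (E J v) (E J u) then wt J u v else 0)"
    by (rule ex_knows_cong) (intro sum.cong refl if_cong wt_sym)
qed

definition midf :: "nat \<Rightarrow> nat \<Rightarrow> nat" where
  "midf i m = (if i < Lam then (2 * m + 1) * 2 ^ (Lam - Suc i) else m)"

lemma mid_SS [simp]: "mid (SS J q) i m = midf i m"
  by (simp add: mid_def midf_def)

lemma midf_less: "i \<le> Lam \<Longrightarrow> m < 2 ^ i \<Longrightarrow> midf i m < 2 ^ L"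
proof -
  assume i: "i \<le> Lam" "m < 2 ^ i"
  have "midf i m < 2 ^ Lam"
  proof (cases "i < Lam")
    case True
    have "2 * m + 1 < 2 ^ Suc i" using i by simp
    then have "(2 * m + 1) * 2 ^ (Lam - Suc i) < 2 ^ Suc i * 2 ^ (Lam - Suc i)"
      by (rule mult_strict_right_mono) simp
    also have "\<dots> = 2 ^ Lam" using True by (metis Suc_leI le_add_diff_inverse power_add)
    finally show ?thesis using True by (simp add: midf_def)
  qed (use i in \<open>simp add: midf_def\<close>)
  then show ?thesis using pow_Lam by linarith
qed

definition idxn :: "nat \<Rightarrow> inst \<Rightarrow> nat \<Rightarrow> nat" where
  "idxn i J v = (if v2 J v then idx (SS J (t2 J v)) i (m2 J v) else 0)"

text \<open>Column labels are distinct, so at most one column has the selected label; the minimum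
  only extracts its cost.\<close>

definition jcost :: "stair \<Rightarrow> nat \<Rightarrow> nat \<Rightarrow> nat" where
  "jcost S i m = Min (insert (sT S) (sc S ` {y \<in> cols S (idx S i) m. snu S y = js S i m}))"

definition jn :: "nat \<Rightarrow> inst \<Rightarrow> nat \<Rightarrow> nat" where
  "jn i J v = (if v2 J v then js (SS J (t2 J v)) i (idxn i J v) else 0)"
definition cn :: "nat \<Rightarrow> inst \<Rightarrow> nat \<Rightarrow> nat" where
  "cn i J v = (if v2 J v then jcost (SS J (t2 J v)) i (idxn i J v) else 0)"
definition en :: "nat \<Rightarrow> inst \<Rightarrow> nat \<Rightarrow> nat" where
  "en i J v = (if v2 J v then eoff (SS J (t2 J v)) i (idxn i J v) else 0)"

lemma idxn_less: "idxn i J v < 2 ^ i"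
  by (simp add: idxn_def idx_less)

lemma idxn_L: "i \<le> Lam \<Longrightarrow> idxn i J v < 2 ^ L"
proof -
  assume "i \<le> Lam"
  then have "(2::nat) ^ i \<le> 2 ^ L" using lab_L by (intro power_increasing) auto
  then show ?thesis using idxn_less[of i J v] by linarith
qed

lemma idxn_convex: "convex_on_paths d2 (idxn i)"
  unfolding convex_on_paths_def
proof (intro ballI impI)
  fix J u v w assume a: "v2 J u" "t2 J u = t2 J v" "t2 J v = t2 J w" "m2 J u \<le> m2 J v" "m2 J v \<le> m2 J w" "idxn i J u = idxn i J w"
  let ?S = "SS J (t2 J u)"
  have "v2 J v" "v2 J w" using a by (auto simp: valid_def)
  then have e: "idxn i J u = idx ?S i (m2 J u)" "idxn i J v = idx ?S i (m2 J v)" "idxn i J w = idx ?S i (m2 J w)"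
    using a by (simp_all add: idxn_def)
  show "idxn i J v = idxn i J u"
    using idx_mono[OF a(4), of ?S i] idx_mono[OF a(5), of ?S i] a(6) unfolding e by linarith
qed

lemma cls2_eq: "v2 J y \<Longrightarrow> cls J d2 (idxn i J) y =
  {v \<in> sY (SS J (t2 J y)). idx (SS J (t2 J y)) i (snu (SS J (t2 J y)) v) = idxn i J y}"
  by (auto simp: cls_def idxn_def valid_def)

lemma cls2_same: "v \<in> cls J d2 (idxn i J) y \<Longrightarrow> v2 J y \<Longrightarrow>
  v2 J v \<and> t2 J v = t2 J y \<and> idxn i J v = idxn i J y \<and> cls J d2 (idxn i J) v = cls J d2 (idxn i J) y"
  by (auto simp: cls_def valid_def)

lemma cols_cls: "v2 J y \<Longrightarrow> cols (SS J (t2 J y)) (idx (SS J (t2 J y)) i) (idxn i J y) =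
  {v \<in> cls J d2 (idxn i J) y. colnode J d2 v}"
  unfolding cls2_eq by (auto simp: cols_def)

lemma cls_finite: "J \<in> I \<Longrightarrow> finite (cls J d \<kappa> y)" "y \<in> iV J \<Longrightarrow> y \<in> cls J d \<kappa> y"
  using I_finite by (auto simp: cls_def)

text \<open>Two neighbour rounds give the row sums of each column node and one suffix sum gives
  \<open>sfx\<close>. Three minima over the column block then find the least value, the least label
  attaining it and the cost of that column; a final sum gives \<open>eoff\<close>.\<close>

lemma Ylevel:
  assumes B: "pbased \<tau>" and ki: "knows \<tau> (idxn i)" and i: "i \<le> Lam"
  shows "\<exists>\<tau>'. ext (17 + 3 * Lam) \<tau> \<tau>' \<and> (knows \<tau>' (jn i) \<and> knows \<tau>' (cn i) \<and> knows \<tau>' (en i))"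
proof -
  note PB = pbased_knows
  let ?S = "\<lambda>J v. SS J (t2 J v)"
  define rs where "rs J v = (\<Sum>u\<in>iV J. if mat J u v \<and> midf i (idxn i J v) \<le> m1 J u then wt J u v else 0)" for J v
  define rr where "rr J v = (\<Sum>u\<in>iV J. if mat J u v \<and> (idxn i J v + 1) * 2 ^ (Lam - i) \<le> m1 J u then wt J u v else 0)" for J v
  have hiL: "(idxn i J v + 1) * 2 ^ (Lam - i) < 2 ^ L" for J v
  proof -
    have "(idxn i J v + 1) * 2 ^ (Lam - i) \<le> 2 ^ i * 2 ^ (Lam - i)"
      using idxn_less[of i J v] by (intro mult_le_mono1) simp
    also have "\<dots> = 2 ^ Lam" using i by (metis le_add_diff_inverse power_add)
    finally show ?thesis using lab_L by (meson le_less_trans one_less_numeral_iff power_strict_increasing semiring_norm(76))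
  qed
  let ?E = "\<lambda>J v. [m1 J v, midf i (idxn i J v), (idxn i J v + 1) * 2 ^ (Lam - i)]"
  have kE: "knows \<tau> ?E" by (rule knows_2[OF PB(2)[OF B] ki])
  have E: "length (?E J v) = 3 \<and> (\<forall>x\<in>set (?E J v). x < 2 ^ L)" if "J \<in> I" "v \<in> iV J" for J v
    using mu_bounds(3)[OF that d1] midf_less[OF i idxn_less] hiL by simp
  have "\<exists>\<sigma>'. ext 1 \<tau> \<sigma>' \<and> knows \<sigma>' rs"
    unfolding rs_def[abs_def] using xsum(2)[OF B kE E, of "\<lambda>a c. a ! 1 \<le> c ! 0"] by simp
  then obtain a1 where 1: "ext 1 \<tau> a1" "knows a1 rs" by blast
  have "\<exists>\<sigma>'. ext 1 a1 \<sigma>' \<and> knows \<sigma>' rr"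
    unfolding rr_def[abs_def] using xsum(2)[OF pbased_ext[OF 1(1) B] knows_ext[OF 1(1) kE] E, of "\<lambda>a c. a ! 2 \<le> c ! 0"]
    by (simp add: numeral_2_eq_2)
  then obtain a2 where 2: "ext 1 a1 a2" "knows a2 rr" by blast
  note e2 = ext_trans[OF 1(1) 2(1)]
  have mat_le: "(\<Sum>v\<in>iV J. \<Sum>u\<in>iV J. if mat J u v \<and> Q v u then wt J u v else 0) \<le> TW" if "J \<in> I" for J Q
  proof -
    have "(\<Sum>v\<in>iV J. \<Sum>u\<in>iV J. if mat J u v \<and> Q v u then wt J u v else 0) =
        (\<Sum>v\<in>iV J. \<Sum>u\<in>iV J. if mat J u v \<and> Q v u then wt J v u else 0)"
      by (intro sum.cong refl if_cong wt_sym)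
    then show ?thesis using wsum_le[OF that order.refl, of "\<lambda>v u. mat J u v \<and> Q v u"] by simp
  qed
  have rsL: "sum (rs J) (iV J) < 2 ^ L" if "J \<in> I" for J
    unfolding rs_def by (rule le_less_trans[OF mat_le[OF that] TW_L])
  obtain a3 where 3: "ext (3 + Lam * 3) a2 a3" "knows a3 (\<lambda>J v. suffix J d2 Lam (rs J) v)"
    using suffix_known[OF PB(1)[OF pbased_ext[OF e2 B]] d2 knows_ext[OF 2(1) 1(2)] rsL] by blast
  note e3 = ext_trans[OF e2 3(1)]
  have rs_eq: "rs J v = rowsum (?S J v) (mid (?S J v) i (idx (?S J v) i (m2 J v))) v" if "v2 J v" for J v
    using that unfolding rs_def rowsum_def idxn_def by (auto intro!: sum.cong)
  have rr_eq: "rr J v = rowsum (?S J v) ((idxn i J v + 1) * 2 ^ (Lam - i)) v" if "v2 J v" for J v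
    using that unfolding rr_def rowsum_def by (auto intro!: sum.cong)
  have sfx_eq: "suffix J d2 Lam (rs J) y = sfx (?S J y) (idx (?S J y) i) i (m2 J y)"
    if y: "J \<in> I" "y \<in> iV J" "v2 J y" for J y
  proof -
    have z: "m2 J u div 2 ^ Lam = 0" if "u \<in> iV J" for u using mu_bounds(1)[OF y(1) that d2] by simp
    have "suffix J d2 Lam (rs J) y = (\<Sum>u | u \<in> sY (?S J y) \<and> m2 J y \<le> m2 J u. rs J u)"
      using y z by (auto simp: suffix_def valid_def intro!: sum.cong)
    also have "\<dots> = (\<Sum>u\<in>sY (?S J y). if m2 J y \<le> m2 J u then rs J u else 0)"
      using I_finite[OF y(1)] by (subst sum_if_filter) auto
    also have "\<dots> = sfx (?S J y) (idx (?S J y) i) i (m2 J y)"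
      unfolding sfx_def by (intro sum.cong refl) (use rs_eq in auto)
    finally show ?thesis .
  qed
  define x1 where "x1 J y = (if colnode J d2 y then cutw J y + 2 * TW - 2 * suffix J d2 Lam (rs J) y else infv)" for J y
  have kcol: "knows \<sigma> (\<lambda>J y. colnode J d2 y)" if "pbased \<sigma>" for \<sigma>
    unfolding colnode_def by (rule knowsI) (simp add: knowsD[OF PB(8)[OF that]] knowsD[OF PB(9)[OF that]] knowsD[OF PB(10)[OF that]])
  have kC: "knows \<sigma> (\<lambda>J v. if colnode J d2 v then cutw J v else 0)" if "pbased \<sigma>" for \<sigma>
  proof -
    have "knows \<sigma> (\<lambda>J v. if v = ir J then 0 else cutw J v)" using that by (simp add: pbased_def)
    then have "knows \<sigma> (\<lambda>J v. if colnode J d2 v then (if v = ir J then 0 else cutw J v) else 0)"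
      by (rule knows_2[OF kcol[OF that]])
    then show ?thesis by (rule knows_cong) (auto simp: colnode_def)
  qed
  have B3: "pbased a3" by (rule pbased_ext[OF e3 B])
  have "knows a3 (\<lambda>J y. if colnode J d2 y then (if colnode J d2 y then cutw J y else 0) + 2 * TW - 2 * suffix J d2 Lam (rs J) y else infv)"
    by (rule knows_3[OF kcol[OF B3] kC[OF B3] 3(2)])
  then have kx1: "knows a3 x1" by (rule knows_cong) (simp add: x1_def)
  have x1c: "x1 J y = colval (?S J y) (idx (?S J y) i) i y" if "J \<in> I" "y \<in> iV J" "v2 J y" "colnode J d2 y" for J y
    using that sfx_eq by (simp add: x1_def colval_def)
  \<comment> \<open>Every value of a genuine column is at most \<open>3 * TW\<close> and thus below
    \<open>infv\<close>, the value given to the other nodes.\<close>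
  have x1inf: "cutw J y + 2 * TW - 2 * z < infv" if "J \<in> I" for J y z
  proof -
    have "cutw J y + 2 * TW - 2 * z \<le> 3 * TW" using cutw_TW[OF that, of y] by linarith
    moreover have "3 * TW + 1 < 2 ^ L" using W_L by simp
    ultimately show ?thesis by linarith
  qed
  have x1L: "x1 J y < 2 ^ L" if "J \<in> I" for J y
    unfolding x1_def using less_le_trans[OF x1inf[OF that, of y "suffix J d2 Lam (rs J) y"] diff_le_self] L_nums by simp
  let ?cl = "\<lambda>J y. cls J d2 (idxn i J) y"
  obtain a4 where 4: "ext 3 a3 a4" "knows a4 (\<lambda>J y. if v2 J y then Min (x1 J ` ?cl J y) else 0)"
    using class_min[OF PB(1)[OF B3] d2 knows_ext[OF e3 ki] idxn_L[OF i] idxn_convex kx1 x1L] by blast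
  note e4 = ext_trans[OF e3 4(1)]
  define mv where "mv J y = (if v2 J y then Min (x1 J ` ?cl J y) else 0)" for J y
  have B4: "pbased a4" by (rule pbased_ext[OF e4 B])
  define x2 where "x2 J y = (if colnode J d2 y \<and> x1 J y = mv J y then m2 J y else infv)" for J y
  have kx2: "knows a4 x2" unfolding x2_def mv_def
    by (rule knowsI) (simp add: knowsD[OF kcol[OF B4]] knowsD[OF 4(2)] knowsD[OF knows_ext[OF 4(1) kx1]] knowsD[OF PB(3)[OF B4]])
  have x2L: "x2 J y < 2 ^ L" "x2 J y \<le> infv" if "J \<in> I" "y \<in> iV J" for J y
    using mu_bounds[OF that d2] L_nums by (auto simp: x2_def)
  obtain a5 where 5: "ext 3 a4 a5" "knows a5 (\<lambda>J y. if v2 J y then Min (x2 J ` ?cl J y) else 0)"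
    using class_min[OF PB(1)[OF B4] d2 knows_ext[OF e4 ki] idxn_L[OF i] idxn_convex kx2 x2L(1)] by blast
  note e5 = ext_trans[OF e4 5(1)]
  have jeq: "jn i J y = (if v2 J y then Min (x2 J ` ?cl J y) else 0)" if y: "J \<in> I" "y \<in> iV J" for J y
  proof (cases "v2 J y")
    case True
    let ?Sy = "?S J y" and ?m = "idxn i J y"
    interpret staircase ?Sy by (rule SS_staircase[OF y(1)])
    let ?co = "cols ?Sy (idx ?Sy i) ?m" and ?cv = "colval ?Sy (idx ?Sy i) i"
    let ?M = "{y' \<in> ?co. \<forall>y''\<in>?co. ?cv y' \<le> ?cv y''}"
    have co: "?co = {v \<in> ?cl J y. colnode J d2 v}" by (rule cols_cls[OF True])
    have clV: "v \<in> iV J \<and> v2 J v \<and> t2 J v = t2 J y" if "v \<in> ?cl J y" for v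
      using cls2_same[OF that True] that by (simp add: cls_def)
    have mvv: "mv J v = mv J y" if "v \<in> ?cl J y" for v using cls2_same[OF that True] True by (simp add: mv_def)
    have fin: "finite (?cl J y)" "y \<in> ?cl J y" using cls_finite y by auto
    have min_iff: "x1 J v = mv J v \<longleftrightarrow> v \<in> ?M" if v: "v \<in> ?co" for v
    proof -
      have vc: "v \<in> ?cl J y" "colnode J d2 v" using v co by auto
      have cvv: "x1 J w = ?cv w" if "w \<in> ?co" for w
        using that co clV[of w] x1c[OF y(1), of w] by auto
      have "x1 J v = Min (x1 J ` ?cl J y) \<longleftrightarrow> (\<forall>w\<in>?cl J y. x1 J v \<le> x1 J w)"
      proof
        assume "x1 J v = Min (x1 J ` ?cl J y)"
        then show "\<forall>w\<in>?cl J y. x1 J v \<le> x1 J w" using fin(1) by simp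
      next
        assume "\<forall>w\<in>?cl J y. x1 J v \<le> x1 J w"
        then show "x1 J v = Min (x1 J ` ?cl J y)" using fin(1) vc(1) by (intro Min_eqI[symmetric]) auto
      qed
      also have "\<dots> \<longleftrightarrow> (\<forall>w\<in>?co. ?cv v \<le> ?cv w)"
      proof
        assume a: "\<forall>w\<in>?cl J y. x1 J v \<le> x1 J w"
        show "\<forall>w\<in>?co. ?cv v \<le> ?cv w"
        proof
          fix w assume w: "w \<in> ?co"
          then have "w \<in> ?cl J y" using co by blast
          then have "x1 J v \<le> x1 J w" using a by blast
          then show "?cv v \<le> ?cv w" unfolding cvv[OF v] cvv[OF w] .
        qed
      next
        assume a: "\<forall>w\<in>?co. ?cv v \<le> ?cv w"
        show "\<forall>w\<in>?cl J y. x1 J v \<le> x1 J w"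
        proof
          fix w assume w: "w \<in> ?cl J y"
          show "x1 J v \<le> x1 J w"
          proof (cases "colnode J d2 w")
            case True
            then have "w \<in> ?co" using w co by blast
            then show ?thesis using a cvv v by simp
          next
            case False
            then have "x1 J w = infv" by (simp add: x1_def)
            then show ?thesis using x1L[OF y(1), of v] by simp
          qed
        qed
      qed
      finally show ?thesis using mvv[OF vc(1)] True v by (simp add: mv_def)
    qed
    have "Min (x2 J ` ?cl J y) = Min (insert infv (snu ?Sy ` ?M))"
    proof (rule Min_top)
      show "finite (insert infv (snu ?Sy ` ?M))" using fin_cols by simp
      show "x2 J ` ?cl J y \<subseteq> insert infv (snu ?Sy ` ?M)"
        using min_iff co by (auto simp: x2_def)
      have "m2 J v = x2 J v \<and> v \<in> ?cl J y" if "v \<in> ?M" for v using that min_iff[of v] co by (auto simp: x2_def)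
      then show "insert infv (snu ?Sy ` ?M) \<subseteq> insert infv (x2 J ` ?cl J y)" by auto
      show "x2 J ` ?cl J y \<noteq> {}" using fin by blast
      show "\<forall>a\<in>x2 J ` ?cl J y. a \<le> infv" using x2L(2)[OF y(1)] clV by blast
    qed
    then show ?thesis using True by (simp add: jn_def jsel_def)
  qed (simp add: jn_def)
  have kj: "knows a5 (jn i)" by (rule knows_cong[OF 5(2)]) (rule jeq)
  have B5: "pbased a5" by (rule pbased_ext[OF e5 B])
  define x3 where "x3 J y = (if colnode J d2 y \<and> m2 J y = jn i J y then cutw J y else infv)" for J y
  have "knows a5 (\<lambda>J y. colnode J d2 y \<and> m2 J y = jn i J y)" by (rule knows_3[OF kcol[OF B5] PB(3)[OF B5] kj])
  then have "knows a5 (\<lambda>J y. if colnode J d2 y \<and> m2 J y = jn i J y then (if colnode J d2 y then cutw J y else 0) else infv)"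
    by (rule knows_2[OF _ kC[OF B5]])
  then have kx3: "knows a5 x3" by (rule knows_cong) (simp add: x3_def)
  have x3L: "x3 J y < 2 ^ L" "x3 J y \<le> infv" if "J \<in> I" for J y
    using cutw_TW[OF that, of y] W_L by (auto simp: x3_def)
  obtain a6 where 6: "ext 3 a5 a6" "knows a6 (\<lambda>J y. if v2 J y then Min (x3 J ` ?cl J y) else 0)"
    using class_min[OF PB(1)[OF B5] d2 knows_ext[OF e5 ki] idxn_L[OF i] idxn_convex kx3 x3L(1)] by blast
  note e6 = ext_trans[OF e5 6(1)]
  have jn_cls: "jn i J v = jn i J y" if "v \<in> ?cl J y" "v2 J y" for J v y
    using cls2_same[OF that] that(2) by (simp add: jn_def)
  have ceq: "cn i J y = (if v2 J y then Min (x3 J ` ?cl J y) else 0)" if y: "J \<in> I" "y \<in> iV J" for J y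
  proof (cases "v2 J y")
    case True
    let ?Sy = "?S J y" and ?m = "idxn i J y"
    interpret staircase ?Sy by (rule SS_staircase[OF y(1)])
    let ?co = "cols ?Sy (idx ?Sy i) ?m"
    have co: "?co = {v \<in> ?cl J y. colnode J d2 v}" by (rule cols_cls[OF True])
    have j: "jn i J y = js ?Sy i ?m" using True by (simp add: jn_def)
    have "Min (x3 J ` ?cl J y) = Min (insert infv (sc ?Sy ` {v \<in> ?co. snu ?Sy v = js ?Sy i ?m}))"
    proof (rule Min_top)
      show "finite (insert infv (sc ?Sy ` {v \<in> ?co. snu ?Sy v = js ?Sy i ?m}))" using fin_cols by simp
      show "x3 J ` ?cl J y \<subseteq> insert infv (sc ?Sy ` {v \<in> ?co. snu ?Sy v = js ?Sy i ?m})"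
        using co j jn_cls[OF _ True] by (auto simp: x3_def)
      have "cutw J v = x3 J v" if "v \<in> ?cl J y" "colnode J d2 v" "m2 J v = js ?Sy i ?m" for v
        using that j jn_cls[OF that(1) True] by (simp add: x3_def)
      then show "insert infv (sc ?Sy ` {v \<in> ?co. snu ?Sy v = js ?Sy i ?m}) \<subseteq> insert infv (x3 J ` ?cl J y)"
        unfolding co by auto
      show "x3 J ` ?cl J y \<noteq> {}" using cls_finite(2)[OF y(2)] by blast
      show "\<forall>a\<in>x3 J ` ?cl J y. a \<le> infv" using x3L(2)[OF y(1)] by blast
    qed
    then show ?thesis using True by (simp add: cn_def jcost_def)
  qed (simp add: cn_def)
  have kc: "knows a6 (cn i)" by (rule knows_cong[OF 6(2)]) (rule ceq)
  have B6: "pbased a6" by (rule pbased_ext[OF e6 B])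
  define x4 where "x4 J v = (if jn i J v \<le> m2 J v then rr J v else 0)" for J v
  have kx4: "knows a6 x4" unfolding x4_def
    by (rule knows_3[OF knows_ext[OF 6(1) kj] PB(3)[OF B6] knows_ext[OF ext_trans[OF 3(1) ext_trans[OF 4(1) ext_trans[OF 5(1) 6(1)]]] 2(2)]])
  have x4L: "sum (x4 J) (iV J) < 2 ^ L" if "J \<in> I" for J
  proof -
    have "sum (x4 J) (iV J) \<le> sum (rr J) (iV J)" by (rule sum_mono) (simp add: x4_def)
    also have "\<dots> \<le> TW" unfolding rr_def by (rule mat_le[OF that])
    finally show ?thesis using TW_L by simp
  qed
  obtain a7 where 7: "ext 3 a6 a7" "knows a7 (\<lambda>J y. if v2 J y then \<Sum>v\<in>?cl J y. x4 J v else 0)"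
    using class_sum[OF PB(1)[OF B6] d2 knows_ext[OF e6 ki] idxn_L[OF i] idxn_convex kx4 x4L] by blast
  note e7 = ext_trans[OF e6 7(1)]
  have eeq: "en i J y = (if v2 J y then \<Sum>v\<in>?cl J y. x4 J v else 0)" if y: "J \<in> I" "y \<in> iV J" for J y
  proof (cases "v2 J y")
    case True
    let ?Sy = "?S J y" and ?m = "idxn i J y"
    have j: "jn i J y = js ?Sy i ?m" using True by (simp add: jn_def)
    have "(\<Sum>v\<in>?cl J y. x4 J v) = (\<Sum>v\<in>?cl J y. if js ?Sy i ?m \<le> m2 J v then rowsum ?Sy ((?m + 1) * 2 ^ (Lam - i)) v else 0)"
    proof (rule sum.cong[OF refl])
      fix v assume v: "v \<in> ?cl J y"
      note c = cls2_same[OF v True]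
      show "x4 J v = (if js ?Sy i ?m \<le> m2 J v then rowsum ?Sy ((?m + 1) * 2 ^ (Lam - i)) v else 0)"
        using c rr_eq[of J v] jn_cls[OF v True] j by (simp add: x4_def)
    qed
    also have "\<dots> = eoff ?Sy i ?m"
    proof -
      have f: "finite (sY ?Sy)" using I_finite[OF y(1)] by simp
      show ?thesis unfolding eoff_def cls2_eq[OF True]
        by (subst sum.inter_filter[OF f]) (auto intro!: sum.cong)
    qed
    finally show ?thesis using True by (simp add: en_def)
  qed (simp add: en_def)
  have ke: "knows a7 (en i)" by (rule knows_cong[OF 7(2)]) (rule eeq)
  have "knows a7 (jn i) \<and> knows a7 (cn i) \<and> knows a7 (en i)"
    using knows_ext[OF ext_trans[OF 6(1) 7(1)] kj] knows_ext[OF 7(1) kc] ke by simp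
  then show ?thesis by (rule ex_extI[OF e7]) simp
qed

end

section \<open>The row path: receiving the data of the column block\<close>

context pairing
begin

definition mX :: "nat \<Rightarrow> inst \<Rightarrow> nat \<Rightarrow> nat" where
  "mX i J u = m1 J u div 2 ^ (Lam - i)"

text \<open>Tested without knowing the other path: \<open>pY\<close> evaluates the choice made by
  the candidate. The path of \<open>u\<close> is paired if its candidate chooses it in
  return.\<close>

definition paired :: "inst \<Rightarrow> nat \<Rightarrow> bool" where
  "paired J u \<longleftrightarrow> v1 J u \<and> pY J (cX J u) = t1 J u"

lemma mX_convex: "convex_on_paths d1 (mX i)"
  unfolding mX_def by (rule convex_mono) (rule div_le_mono)

lemma mX_L: "J \<in> I \<Longrightarrow> u \<in> iV J \<Longrightarrow> mX i J u < 2 ^ L"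
  unfolding mX_def using mu_bounds(3)[OF _ _ d1] div_le_dividend le_less_trans by blast

lemma cls1_same: "u' \<in> cls J d1 (mX i J) u \<Longrightarrow> v1 J u \<Longrightarrow>
  u' \<in> iV J \<and> v1 J u' \<and> t1 J u' = t1 J u \<and> mX i J u' = mX i J u \<and> cX J u' = cX J u"
  by (auto simp: cls_def valid_def cX_def)

lemma mat_paired:
  assumes "v1 J u" "pY J (cX J u) = t1 J u" "mat J u' v" "t2 J v = cX J u"
  shows "t1 J u' = t1 J u"
  using assms by (auto simp: mat_def cY_def)

text \<open>Connectedness of a block becomes visible on the row path: some node of the row block has
  a matching edge of positive weight to a column node with the same block index.\<close>

lemma conn_iff:
  assumes i: "J \<in> I" and u: "u \<in> iV J" "v1 J u"
  shows "(\<exists>u'\<in>cls J d1 (mX i J) u. \<exists>v\<in>nbr J u'. mat J u' v \<and> idxn i J v = mX i J u' \<and> 0 < iw J {u', v}) \<longleftrightarrow>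
    paired J u \<and> conn_block (SS J (cX J u)) i (mX i J u)" (is "?l \<longleftrightarrow> ?r")
proof
  assume ?l
  then obtain u' v where a: "u' \<in> cls J d1 (mX i J) u" "v \<in> nbr J u'" "mat J u' v" "idxn i J v = mX i J u'" "0 < iw J {u', v}" by blast
  note c = cls1_same[OF a(1) u(2)]
  have v: "v \<in> iV J" using nbr_V[OF i a(2)] by blast
  have m: "v2 J v" "t2 J v = cX J u" "pY J (t2 J v) = t1 J u" using a(3) c by (auto simp: mat_def cY_def)
  have "0 < sw (SS J (cX J u)) u' v" using a by (simp add: wt_def nbr_def)
  moreover have "idx (SS J (cX J u)) i (m2 J v) = mX i J u" using a(4) c m by (simp add: idxn_def)
  ultimately have "conn_block (SS J (cX J u)) i (mX i J u)"
    unfolding conn_block_def using c v m by (intro bexI[of _ u'] bexI[of _ v]) (auto simp: mX_def)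
  then show ?r using m u by (simp add: paired_def)
next
  assume r: ?r
  then obtain u' v where a: "u' \<in> iV J" "v \<in> iV J" "v2 J v" "t2 J v = cX J u" "0 < sw (SS J (cX J u)) u' v"
    "m1 J u' div 2 ^ Lam div 2 ^ 0 = m1 J u' div 2 ^ Lam" "m1 J u' div 2 ^ (Lam - i) = mX i J u" "idx (SS J (cX J u)) i (m2 J v) = mX i J u"
    unfolding conn_block_def by auto
  have mt: "mat J u' v" and w: "0 < wt J u' v" using a(5) by (auto split: if_splits)
  have "t1 J u' = t1 J u" using mat_paired[OF u(2) _ mt a(4)] r by (simp add: paired_def)
  then have c: "u' \<in> cls J d1 (mX i J) u" using a by (simp add: cls_def mX_def)
  have "v \<in> nbr J u'" "0 < iw J {u', v}" using w by (auto simp: wt_def nbr_def split: if_splits)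
  moreover have "idxn i J v = mX i J u'" using a cls1_same[OF c u(2)] by (simp add: idxn_def)
  ultimately show ?l using c mt by blast
qed

text \<open>All edges between a row block and its column block offer the same number, namely the
  value of the column block. So the minimum over these edges, followed by the minimum over the row
  block, delivers that number; \<open>infv\<close> means that there is no such edge.\<close>

lemma transport:
  fixes f :: "inst \<Rightarrow> nat \<Rightarrow> nat"
  assumes B: "pbased \<tau>" and ki: "knows \<tau> (idxn i)" and i: "i \<le> Lam" and kf: "knows \<tau> f"
    and fL: "\<And>J v. J \<in> I \<Longrightarrow> v \<in> iV J \<Longrightarrow> f J v < 2 ^ L"
    and fF: "\<And>J v. v2 J v \<Longrightarrow> f J v = F J (t2 J v) (idxn i J v)"
  shows "\<exists>\<tau>'. ext 4 \<tau> \<tau>' \<and> knows \<tau>' (\<lambda>J u. if v1 J u then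
    if paired J u \<and> conn_block (SS J (cX J u)) i (mX i J u) then F J (cX J u) (mX i J u) else infv else 0)"
proof -
  let ?K = "\<lambda>J v. BL J v @ [idxn i J v, f J v, mX i J v]"
  let ?\<phi> = "\<lambda>(a::nat list) (c::nat list) w (_::nat). if MM (take 7 a) (take 7 c) \<and> c ! 7 = a ! 9 \<and> 0 < w then c ! 8 else infv"
  have km: "knows \<tau> (mX i)" unfolding mX_def by (rule knows_1[OF pbased_knows(2)[OF B]])
  have kB: "knows \<tau> BL" using B by (simp add: pbased_def)
  have kK: "knows \<tau> ?K"
    by (rule knowsI) (simp add: knowsD[OF kB] knowsD[OF ki] knowsD[OF kf] knowsD[OF km])
  have K: "length (?K J v) = 10 \<and> (\<forall>x\<in>set (?K J v). x < 2 ^ L)" if "J \<in> I" "v \<in> iV J" for J v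
    using BL_bound[OF that] idxn_L[OF i] fL[OF that] mX_L[OF that] by auto
  have nth: "?K J v ! 7 = idxn i J v" "?K J v ! 8 = f J v" "?K J v ! 9 = mX i J v" for J v
    by (simp_all add: nth_append)
  have \<phi>: "?\<phi> (?K J u) (?K J v) w t = (if mat J u v \<and> idxn i J v = mX i J u \<and> 0 < w then f J v else infv)" for J u v w t
    unfolding nth by (simp add: mat_MM)
  have "\<exists>\<sigma>'. ext 1 \<tau> \<sigma>' \<and> knows \<sigma>' (\<lambda>J u. Min (insert infv ((\<lambda>v. ?\<phi> (?K J u) (?K J v) (iw J {u, v}) (trel J u v)) ` nbr J u)))"
  proof (rule nb_min[where \<phi> = ?\<phi>, OF kK K])
    fix J u v assume a: "J \<in> I" "u \<in> iV J" "v \<in> nbr J u"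
    then have "v \<in> iV J" using nbr_V by blast
    then show "?\<phi> (?K J u) (?K J v) (iw J {u, v}) (trel J u v) < 2 ^ L" unfolding \<phi> using fL[OF a(1)] L_nums by simp
  qed simp_all
  then obtain a1 where 1: "ext 1 \<tau> a1"
    "knows a1 (\<lambda>J u. Min (insert infv ((\<lambda>v. ?\<phi> (?K J u) (?K J v) (iw J {u, v}) (trel J u v)) ` nbr J u)))" by blast
  define g where "g J u = Min (insert infv ((\<lambda>v. if mat J u v \<and> idxn i J v = mX i J u \<and> 0 < iw J {u, v} then f J v else infv) ` nbr J u))" for J u
  have kg: "knows a1 g" using 1(2) unfolding \<phi> g_def[abs_def] .
  have gle: "g J u \<le> infv" if "J \<in> I" for J u unfolding g_def using finite_nbr[OF that] by (intro Min_le) auto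
  have gL: "g J u < 2 ^ L" if "J \<in> I" "u \<in> iV J" for J u using gle[OF that(1), of u] L_nums by linarith
  have B1: "pbased a1" by (rule pbased_ext[OF 1(1) B])
  obtain a2 where 2: "ext 3 a1 a2" "knows a2 (\<lambda>J u. if v1 J u then Min (g J ` cls J d1 (mX i J) u) else 0)"
    using class_min[OF pbased_knows(1)[OF B1] d1 knows_ext[OF 1(1) km] mX_L mX_convex kg gL] by blast
  have "knows a2 (\<lambda>J u. if v1 J u then
    if paired J u \<and> conn_block (SS J (cX J u)) i (mX i J u) then F J (cX J u) (mX i J u) else infv else 0)"
  proof (rule knows_cong[OF 2(2)])
    fix J u assume a: "J \<in> I" "u \<in> iV J"
    show "(if v1 J u then if paired J u \<and> conn_block (SS J (cX J u)) i (mX i J u) then F J (cX J u) (mX i J u) else infv else 0)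
      = (if v1 J u then Min (g J ` cls J d1 (mX i J) u) else 0)"
    proof (cases "v1 J u")
      case True
      let ?cl = "cls J d1 (mX i J) u" and ?F = "F J (cX J u) (mX i J u)"
      have fin: "finite ?cl" "u \<in> ?cl" using cls_finite a by auto
      have fv: "f J v = ?F \<and> f J v \<le> infv" if "u' \<in> ?cl" "mat J u' v" "idxn i J v = mX i J u'" "v \<in> nbr J u'" for u' v
      proof -
        have "v \<in> iV J" using nbr_V a that by blast
        then have "f J v < 2 ^ L" using fL a by blast
        moreover have "v2 J v" "t2 J v = cX J u" using that cls1_same[OF that(1) True] by (auto simp: mat_def)
        ultimately show ?thesis using fF[of J v] that cls1_same[OF that(1) True] by simp
      qed
      have ge: "min ?F infv \<le> g J u'" if "u' \<in> ?cl" for u'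
        unfolding g_def using finite_nbr[OF a(1)] fv[OF that] by (subst Min_ge_iff) auto
      show ?thesis
      proof (cases "paired J u \<and> conn_block (SS J (cX J u)) i (mX i J u)")
        case P: True
        then obtain u' v where c: "u' \<in> ?cl" "v \<in> nbr J u'" "mat J u' v" "idxn i J v = mX i J u'" "0 < iw J {u', v}"
          using conn_iff[OF a True, of i] by blast
        have F: "?F \<le> infv" "f J v = ?F" using fv[OF c(1,3,4,2)] by auto
        have "g J u' \<le> ?F" unfolding g_def using finite_nbr[OF a(1)] c F by (intro Min_le) (auto intro!: image_eqI[of _ _ v])
        then have "g J u' = ?F" using ge[OF c(1)] F by simp
        then have "?F \<in> g J ` ?cl" using imageI[OF c(1), of "g J"] by simp
        then have "Min (g J ` ?cl) = ?F" using fin ge F by (intro Min_eqI) auto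
        then show ?thesis using P True by simp
      next
        case N: False
        have "g J u' = infv" if u': "u' \<in> ?cl" for u'
        proof -
          have "(\<lambda>v. if mat J u' v \<and> idxn i J v = mX i J u' \<and> 0 < iw J {u', v} then f J v else infv) ` nbr J u' \<subseteq> {infv}"
            using N conn_iff[OF a True, of i] u' by auto
          then have seteq: "insert infv ((\<lambda>v. if mat J u' v \<and> idxn i J v = mX i J u' \<and> 0 < iw J {u', v} then f J v else infv) ` nbr J u') = {infv}"
            by blast
          show ?thesis unfolding g_def seteq by (rule Min_singleton)
        qed
        then have "g J ` ?cl = {infv}" using fin by auto
        then show ?thesis unfolding if_P[OF True] if_not_P[OF N] by simp
      qed
    qed simp
  qed
  then show ?thesis by (rule ex_extI[OF ext_trans[OF 1(1) 2(1)]]) simp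
qed

definition goodX :: "nat \<Rightarrow> inst \<Rightarrow> nat \<Rightarrow> bool" where
  "goodX i J u \<longleftrightarrow> paired J u \<and> good (SS J (cX J u)) i (mX i J u)"

definition GI :: "nat \<Rightarrow> inst \<Rightarrow> nat \<Rightarrow> (nat \<times> nat \<times> nat \<times> nat) option" where
  "GI i J u = (let S = SS J (cX J u); m = mX i J u in if goodX i J u then
     Some (jcost S i m, eoff S i m, rowsuf S i m (m1 J u), rowsuf S i m (midf i m)) else None)"

text \<open>Matching columns belong to the candidate path, which chose the path of \<open>u\<close>;
  rows on other paths contribute nothing. The sum over all rows shrinks to the connected class of
  \<open>u\<close>.\<close>

lemma rowsuf_eq:
  assumes i: "J \<in> I" and p: "paired J u" and j: "j = js (SS J (cX J u)) i (mX i J u)"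
  shows "rowsuf (SS J (cX J u)) i (mX i J u) s = (\<Sum>u'\<in>cls J d1 (mX i J) u. if s \<le> m1 J u' then
    \<Sum>v\<in>iV J. if mat J u' v \<and> j \<le> m2 J v then wt J u' v else 0 else 0)"
proof -
  let ?S = "SS J (cX J u)"
  have v: "v1 J u" "pY J (cX J u) = t1 J u" using p by (auto simp: paired_def)
  have g: "gsum ?S j u' = (\<Sum>v\<in>iV J. if mat J u' v \<and> j \<le> m2 J v then wt J u' v else 0)"
    if "u' \<in> cls J d1 (mX i J) u" for u'
    unfolding gsum_def
  proof (rule sum.mono_neutral_cong_left)
    show "\<forall>v\<in>iV J - sY ?S. (if mat J u' v \<and> j \<le> m2 J v then wt J u' v else 0) = 0"
      using cls1_same[OF that v(1)] by (auto simp: mat_def)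
  qed (use I_finite[OF i] in auto)
  have z: "gsum ?S j u' = 0" if "t1 J u' \<noteq> t1 J u" for u'
    unfolding gsum_def by (rule sum.neutral) (use mat_paired[OF v] that in auto)
  have "rowsuf ?S i (mX i J u) s = (\<Sum>u'\<in>cls J d1 (mX i J) u. if s \<le> m1 J u' then gsum ?S j u' else 0)"
    unfolding rowsuf_def j[symmetric]
  proof (rule sum.mono_neutral_cong_right)
    show "\<forall>u'\<in>sX ?S - cls J d1 (mX i J) u. (if smu ?S u' div 2 ^ (sL ?S - i) = mX i J u \<and> s \<le> smu ?S u' then gsum ?S j u' else 0) = 0"
    proof
      fix u' assume "u' \<in> sX ?S - cls J d1 (mX i J) u"
      then have "t1 J u' \<noteq> t1 J u \<or> smu ?S u' div 2 ^ (sL ?S - i) \<noteq> mX i J u" by (auto simp: cls_def mX_def)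
      then show "(if smu ?S u' div 2 ^ (sL ?S - i) = mX i J u \<and> s \<le> smu ?S u' then gsum ?S j u' else 0) = 0"
        using z[of u'] by auto
    qed
  qed (use I_finite[OF i] in \<open>auto simp: cls_def mX_def\<close>)
  then show ?thesis using g by (auto intro!: sum.cong)
qed

lemma js_SS_L: "J \<in> I \<Longrightarrow> js (SS J q) i m \<le> infv"
  unfolding jsel_def by (rule Min_le) (use staircase.fin_cols[OF SS_staircase] in auto)

lemma jcost_L: "J \<in> I \<Longrightarrow> jcost (SS J q) i m \<le> infv"
  unfolding jcost_def by (rule Min_le) (use staircase.fin_cols[OF SS_staircase] in auto)

lemma eoff_L: "J \<in> I \<Longrightarrow> eoff (SS J q) i m \<le> TW"
proof -
  assume i: "J \<in> I"
  have "eoff (SS J q) i m \<le> (\<Sum>v\<in>sY (SS J q). \<Sum>u\<in>iV J. if mat J u v then wt J v u else 0)"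
    unfolding eoff_def rowsum_def by (intro sum_mono) (auto intro!: sum_mono simp: wt_sym)
  also have "\<dots> \<le> TW" by (rule wsum_le[OF i]) auto
  finally show ?thesis .
qed

text \<open>Three transports bring the selected label, its cost and \<open>eoff\<close> to the rows.
  Each row then sums its weight to columns from that label on, and sums over the row block give the
  two values of \<open>rowsuf\<close>.\<close>

lemma Xlevel:
  assumes B: "pbased \<tau>" and ki: "knows \<tau> (idxn i)" and i: "i \<le> Lam"
    and kj: "knows \<tau> (jn i)" and kc: "knows \<tau> (cn i)" and ke: "knows \<tau> (en i)"
  shows "\<exists>\<tau>'. ext (19 + 3 * Lam) \<tau> \<tau>' \<and> knows \<tau>' (GI i)"
proof -
  have infL: "infv < 2 ^ L" using L_nums by simp
  have fL: "jn i J v < 2 ^ L" "cn i J v < 2 ^ L" "en i J v < 2 ^ L" if "J \<in> I" for J v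
    unfolding jn_def cn_def en_def
    using le_less_trans[OF js_SS_L[OF that] infL] le_less_trans[OF jcost_L[OF that] infL]
      le_less_trans[OF eoff_L[OF that] TW_L] L_nums by auto
  let ?C = "\<lambda>J u. paired J u \<and> conn_block (SS J (cX J u)) i (mX i J u)"
  obtain a1 where 1: "ext 4 \<tau> a1" "knows a1 (\<lambda>J u. if v1 J u then if ?C J u then js (SS J (cX J u)) i (mX i J u) else infv else 0)"
    using transport[where F = "\<lambda>J q m. js (SS J q) i m", OF B ki i kj fL(1)] by (auto simp: jn_def)
  have B1: "pbased a1" by (rule pbased_ext[OF 1(1) B])
  obtain a2 where 2: "ext 4 a1 a2" "knows a2 (\<lambda>J u. if v1 J u then if ?C J u then jcost (SS J (cX J u)) i (mX i J u) else infv else 0)"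
    using transport[where F = "\<lambda>J q m. jcost (SS J q) i m", OF B1 knows_ext[OF 1(1) ki] i knows_ext[OF 1(1) kc] fL(2)] by (auto simp: cn_def)
  note e2 = ext_trans[OF 1(1) 2(1)]
  have B2: "pbased a2" by (rule pbased_ext[OF e2 B])
  obtain a3 where 3: "ext 4 a2 a3" "knows a3 (\<lambda>J u. if v1 J u then if ?C J u then eoff (SS J (cX J u)) i (mX i J u) else infv else 0)"
    using transport[where F = "\<lambda>J q m. eoff (SS J q) i m", OF B2 knows_ext[OF e2 ki] i knows_ext[OF e2 ke] fL(3)] by (auto simp: en_def)
  note e3 = ext_trans[OF e2 3(1)]
  have B3: "pbased a3" by (rule pbased_ext[OF e3 B])
  define jx where "jx J u = (if v1 J u then if ?C J u then js (SS J (cX J u)) i (mX i J u) else infv else 0)" for J u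
  have kjx: "knows a3 jx" unfolding jx_def by (rule knows_ext[OF ext_trans[OF 2(1) 3(1)] 1(2)])
  have jxL: "jx J u < 2 ^ L" if "J \<in> I" for J u
    using js_SS_L[OF that, of "cX J u" i "mX i J u"] infL L_nums by (auto simp: jx_def intro: le_less_trans)
  \<comment> \<open>A single number tells good blocks apart: \<open>infv\<close> arrives both when
    no edge leads to the column block and when the block has no column, because \<open>js\<close> is
    then the default \<open>infv\<close>.\<close>
  have jx_good: "v1 J u \<and> jx J u \<noteq> infv \<longleftrightarrow> goodX i J u" if "J \<in> I" for J u
  proof -
    interpret staircase "SS J (cX J u)" by (rule SS_staircase[OF that])
    show ?thesis
      using js_less[of "idx (SS J (cX J u)) i" "mX i J u" i] js_top[of "idx (SS J (cX J u)) i" "mX i J u" i]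
      by (cases "cols (SS J (cX J u)) (idx (SS J (cX J u)) i) (mX i J u) = {}")
        (auto simp: jx_def goodX_def good_def paired_def)
  qed
  define g where "g J u = (\<Sum>v\<in>iV J. if mat J u v \<and> jx J u \<le> m2 J v then wt J u v else 0)" for J u
  let ?E = "\<lambda>J v. [m2 J v, jx J v]"
  have kE: "knows a3 ?E" by (rule knows_2[OF pbased_knows(3)[OF B3] kjx])
  have E: "length (?E J v) = 2 \<and> (\<forall>x\<in>set (?E J v). x < 2 ^ L)" if "J \<in> I" "v \<in> iV J" for J v
    using mu_bounds(3)[OF that d2] jxL[OF that(1)] by simp
  have "\<exists>\<sigma>'. ext 1 a3 \<sigma>' \<and> knows \<sigma>' g"
    unfolding g_def[abs_def] using xsum(1)[OF B3 kE E, of "\<lambda>a c. a ! 1 \<le> c ! 0"] by simp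
  then obtain a4 where 4: "ext 1 a3 a4" "knows a4 g" by blast
  note e4 = ext_trans[OF e3 4(1)]
  have B4: "pbased a4" by (rule pbased_ext[OF e4 B])
  have gL: "sum (g J) (iV J) < 2 ^ L" if "J \<in> I" for J
    unfolding g_def by (rule le_less_trans[OF wsum_le[OF that order.refl] TW_L])
  \<comment> \<open>The windows of \<open>2 ^ (Lam - i)\<close> labels are exactly the row blocks of
    step \<open>i\<close>, so the doubling of suffix sums stops there.\<close>
  obtain a5 where 5: "ext (3 + (Lam - i) * 3) a4 a5" "knows a5 (\<lambda>J v. suffix J d1 (Lam - i) (g J) v)"
    using suffix_known[OF pbased_knows(1)[OF B4] d1 4(2) gL] by blast
  note e5 = ext_trans[OF e4 5(1)]
  have B5: "pbased a5" by (rule pbased_ext[OF e5 B])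
  have km: "knows \<sigma> (mX i)" if "pbased \<sigma>" for \<sigma> unfolding mX_def by (rule knows_1[OF pbased_knows(2)[OF that]])
  define x where "x J u = (if midf i (mX i J u) \<le> m1 J u then g J u else 0)" for J u
  have kx: "knows a5 x" unfolding x_def
    by (rule knows_3[OF km[OF B5] pbased_knows(2)[OF B5] knows_ext[OF 5(1) 4(2)]])
  have xL: "sum (x J) (iV J) < 2 ^ L" if "J \<in> I" for J
    by (rule le_less_trans[OF sum_mono gL[OF that]]) (simp add: x_def)
  obtain a6 where 6: "ext 3 a5 a6" "knows a6 (\<lambda>J u. if v1 J u then \<Sum>u'\<in>cls J d1 (mX i J) u. x J u' else 0)"
    using class_sum[OF pbased_knows(1)[OF B5] d1 km[OF B5] mX_L mX_convex kx xL] by blast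
  note e6 = ext_trans[OF e5 6(1)]
  have B6: "pbased a6" by (rule pbased_ext[OF e6 B])
  have g_cls: "g J u' = (\<Sum>v\<in>iV J. if mat J u' v \<and> js (SS J (cX J u)) i (mX i J u) \<le> m2 J v then wt J u' v else 0)"
    if "goodX i J u" "u' \<in> cls J d1 (mX i J) u" for J u u'
  proof -
    have v: "v1 J u" using that by (simp add: goodX_def paired_def)
    have "jx J u' = js (SS J (cX J u)) i (mX i J u)"
      using cls1_same[OF that(2) v] that(1) by (simp add: jx_def goodX_def good_def paired_def)
    then show ?thesis unfolding g_def by simp
  qed
  have GI: "GI i J u = (if v1 J u \<and> jx J u \<noteq> infv then Some
      (if v1 J u then if ?C J u then jcost (SS J (cX J u)) i (mX i J u) else infv else 0,
       if v1 J u then if ?C J u then eoff (SS J (cX J u)) i (mX i J u) else infv else 0,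
       suffix J d1 (Lam - i) (g J) u, if v1 J u then \<Sum>u'\<in>cls J d1 (mX i J) u. x J u' else 0) else None)"
    if a: "J \<in> I" "u \<in> iV J" for J u
  proof (cases "goodX i J u")
    case True
    then have p: "paired J u" "v1 J u" "?C J u" by (auto simp: goodX_def paired_def good_def)
    have "suffix J d1 (Lam - i) (g J) u = (\<Sum>u'\<in>cls J d1 (mX i J) u. if m1 J u \<le> m1 J u' then g J u' else 0)"
      using p(2) unfolding sum_if_filter[OF cls_finite(1)[OF a(1)]] suffix_def
      by (auto simp: cls_def mX_def intro!: sum.cong)
    then have 1: "suffix J d1 (Lam - i) (g J) u = rowsuf (SS J (cX J u)) i (mX i J u) (m1 J u)"
      unfolding rowsuf_eq[OF a(1) p(1) refl] using g_cls[OF True] by (auto intro!: sum.cong)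
    have 2: "(\<Sum>u'\<in>cls J d1 (mX i J) u. x J u') = rowsuf (SS J (cX J u)) i (mX i J u) (midf i (mX i J u))"
      unfolding rowsuf_eq[OF a(1) p(1) refl]
    proof (rule sum.cong[OF refl])
      fix u' assume u': "u' \<in> cls J d1 (mX i J) u"
      show "x J u' = (if midf i (mX i J u) \<le> m1 J u' then
          \<Sum>v\<in>iV J. if mat J u' v \<and> js (SS J (cX J u)) i (mX i J u) \<le> m2 J v then wt J u' v else 0 else 0)"
        unfolding x_def g_cls[OF True u'] using cls1_same[OF u' p(2)] by simp
    qed
    show ?thesis using jx_good[OF a(1), of u] True p 1 2 by (simp add: GI_def Let_def)
  next
    case False
    then have "\<not> (v1 J u \<and> jx J u \<noteq> infv)" using jx_good[OF a(1)] by blast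
    then show ?thesis using False unfolding GI_def Let_def by (simp only: if_False)
  qed
  have "knows a6 (\<lambda>J u. (if v1 J u \<and> jx J u \<noteq> infv then Some
      (if v1 J u then if ?C J u then jcost (SS J (cX J u)) i (mX i J u) else infv else 0,
       if v1 J u then if ?C J u then eoff (SS J (cX J u)) i (mX i J u) else infv else 0,
       suffix J d1 (Lam - i) (g J) u, if v1 J u then \<Sum>u'\<in>cls J d1 (mX i J) u. x J u' else 0) else None))"
  proof (rule knowsI)
    fix J J' u assume s: "same a6 J J' u"
    note e36 = ext_trans[OF 4(1) ext_trans[OF 5(1) 6(1)]]
    note k = knowsD[OF pbased_knows(6)[OF B6] s] knowsD[OF knows_ext[OF e36 kjx] s]
      knowsD[OF knows_ext[OF ext_trans[OF 3(1) e36] 2(2)] s] knowsD[OF knows_ext[OF e36 3(2)] s]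
      knowsD[OF knows_ext[OF 6(1) 5(2)] s] knowsD[OF 6(2) s]
    show "(if v1 J u \<and> jx J u \<noteq> infv then Some
      (if v1 J u then if ?C J u then jcost (SS J (cX J u)) i (mX i J u) else infv else 0,
       if v1 J u then if ?C J u then eoff (SS J (cX J u)) i (mX i J u) else infv else 0,
       suffix J d1 (Lam - i) (g J) u, if v1 J u then \<Sum>u'\<in>cls J d1 (mX i J) u. x J u' else 0) else None) =
      (if v1 J' u \<and> jx J' u \<noteq> infv then Some
      (if v1 J' u then if ?C J' u then jcost (SS J' (cX J' u)) i (mX i J' u) else infv else 0,
       if v1 J' u then if ?C J' u then eoff (SS J' (cX J' u)) i (mX i J' u) else infv else 0,
       suffix J' d1 (Lam - i) (g J') u, if v1 J' u then \<Sum>u'\<in>cls J' d1 (mX i J') u. x J' u' else 0) else None)"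
      unfolding k(3,4,5,6) by (simp only: k(1,2))
  qed
  then have "knows a6 (GI i)" by (rule knows_cong) (rule GI)
  then show ?thesis by (rule ex_extI[OF e6]) simp
qed

end

section \<open>The best partner of a node within one choice of parameters\<close>

context pairing
begin

definition OUT :: "nat \<Rightarrow> inst \<Rightarrow> nat \<Rightarrow> nat" where
  "OUT i J u = (let S = SS J (cX J u); m = mX i J u in if goodX i J u \<and> colnode J d1 u then
     cutw J u + jcost S i m - 2 * cov S (m1 J u) (js S i m) else infv)"

lemma OUT_known:
  assumes B: "pbased \<sigma>"
  shows "\<exists>\<sigma>'. ext (Suc Lam * (36 + 6 * Lam)) \<sigma> \<sigma>' \<and> (\<forall>i<Suc Lam. knows \<sigma>' (OUT i))"
proof -
  \<comment> \<open>The offset is claimed at good blocks only. This is enough for the recursion by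
    \<open>good_Suc\<close>, since a good block of the next step comes from a good block of this
    one.\<close>
  define Zp where "Zp i Z \<longleftrightarrow> (i \<le> Lam \<longrightarrow> (\<forall>J\<in>I. \<forall>u\<in>iV J. goodX i J u \<longrightarrow> Z J u = zoff (SS J (cX J u)) i (mX i J u)))"
    for i and Z :: "inst \<Rightarrow> nat \<Rightarrow> nat"
  let ?P = "\<lambda>i \<tau>. knows \<tau> (idxn i) \<and> (\<exists>Z. knows \<tau> Z \<and> Zp i Z) \<and> (\<forall>j<i. knows \<tau> (OUT j))"
  have "\<exists>\<tau>. ext (Suc Lam * (36 + 6 * Lam)) \<sigma> \<tau> \<and> ?P (Suc Lam) \<tau>"
  proof (rule ext_iter[where \<Phi> = ?P])
    have "knows \<sigma> (idxn 0)" by (rule knows_cong[OF knows_const[of _ 0]]) (simp add: idxn_def)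
    moreover have "Zp 0 (\<lambda>_ _. 0)" unfolding Zp_def using staircase.zoff_0[OF SS_staircase] by auto
    ultimately show "?P 0 \<sigma>" by (intro conjI exI[of _ "\<lambda>_ _. 0"] knows_const) auto
    fix i \<tau> k assume i': "i < Suc Lam" and e: "ext k \<sigma> \<tau>" and P: "?P i \<tau>"
    have i: "i \<le> Lam" using i' by simp
    have B0: "pbased \<tau>" by (rule pbased_ext[OF e B])
    obtain Z where ki: "knows \<tau> (idxn i)" and kZ: "knows \<tau> Z" and Z: "Zp i Z" and kO: "\<forall>j<i. knows \<tau> (OUT j)" using P by blast
    obtain a1 where 1: "ext (17 + 3 * Lam) \<tau> a1" "knows a1 (jn i)" "knows a1 (cn i)" "knows a1 (en i)"
      using Ylevel[OF B0 ki i] by blast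
    have B1: "pbased a1" by (rule pbased_ext[OF 1(1) B0])
    obtain a2 where 2: "ext (19 + 3 * Lam) a1 a2" "knows a2 (GI i)"
      using Xlevel[OF B1 knows_ext[OF 1(1) ki] i 1(2-4)] by blast
    note e2 = ext_trans[OF 1(1) 2(1)]
    have B2: "pbased a2" by (rule pbased_ext[OF e2 B0])
    have kZ2: "knows a2 Z" by (rule knows_ext[OF e2 kZ])
    have "knows a2 (\<lambda>J v. if v2 J v then 2 * idxn i J v + of_bool (jn i J v \<le> m2 J v) else 0)"
      by (rule knowsI) (simp add: knowsD[OF knows_ext[OF e2 ki]] knowsD[OF knows_ext[OF 2(1) 1(2)]]
        knowsD[OF pbased_knows(3)[OF B2]] knowsD[OF pbased_knows(7)[OF B2]])
    then have k1: "knows a2 (idxn (Suc i))" by (rule knows_cong) (simp add: idxn_def jn_def)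
    have "knows a2 (\<lambda>J u. colnode J d1 u)" unfolding colnode_def
      by (rule knowsI) (simp add: knowsD[OF pbased_knows(8)[OF B2]] knowsD[OF pbased_knows(9)[OF B2]] knowsD[OF pbased_knows(10)[OF B2]])
    moreover have "knows a2 (\<lambda>J v. if v = ir J then 0 else cutw J v)" using B2 by (simp add: pbased_def)
    ultimately have kcol: "knows a2 (\<lambda>J u. if colnode J d1 u then Some (if u = ir J then 0 else cutw J u) else None)"
      by (rule knows_2)
    define O' where "O' J u = (case GI i J u of None \<Rightarrow> infv | Some (jc, eo, r1, r2) \<Rightarrow>
      (case (if colnode J d1 u then Some (if u = ir J then 0 else cutw J u) else None) of None \<Rightarrow> infv
       | Some w \<Rightarrow> w + jc - 2 * (r1 + eo + Z J u)))" for J u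
    have kO': "knows a2 O'" unfolding O'_def by (rule knows_3[OF 2(2) kcol kZ2])
    have kOi: "knows a2 (OUT i)"
    proof (rule knows_cong[OF kO'])
      fix J u assume a: "J \<in> I" "u \<in> iV J"
      show "OUT i J u = O' J u"
      proof (cases "goodX i J u \<and> colnode J d1 u")
        case True
        interpret staircase "SS J (cX J u)" by (rule SS_staircase[OF a(1)])
        have "cols (SS J (cX J u)) (idx (SS J (cX J u)) i) (mX i J u) \<noteq> {}" using True by (simp add: goodX_def good_def)
        then have "cov (SS J (cX J u)) (m1 J u) (js (SS J (cX J u)) i (mX i J u)) =
          rowsuf (SS J (cX J u)) i (mX i J u) (m1 J u) + eoff (SS J (cX J u)) i (mX i J u) + zoff (SS J (cX J u)) i (mX i J u)"
          by (rule cov_split) (simp add: mX_def)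
        moreover have "Z J u = zoff (SS J (cX J u)) i (mX i J u)" using Z i a True by (simp add: Zp_def)
        ultimately show ?thesis using True by (simp add: OUT_def O'_def GI_def Let_def colnode_def)
      qed (auto simp: OUT_def O'_def GI_def Let_def split: option.splits)
    qed
    define Z' where "Z' J u = (case GI i J u of None \<Rightarrow> 0 | Some (jc, eo, r1, r2) \<Rightarrow>
      if odd (m1 J u div 2 ^ (Lam - Suc i)) then Z J u else r2 + eo + Z J u)" for J u
    have kZ': "knows a2 Z'" unfolding Z'_def by (rule knows_3[OF 2(2) pbased_knows(2)[OF B2] kZ2])
    have "Zp (Suc i) Z'" unfolding Zp_def
    proof (intro impI ballI)
      fix J u assume il: "Suc i \<le> Lam" and a: "J \<in> I" "u \<in> iV J" and g: "goodX (Suc i) J u"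
      interpret staircase "SS J (cX J u)" by (rule SS_staircase[OF a(1)])
      let ?S = "SS J (cX J u)" and ?m = "mX i J u" and ?m' = "mX (Suc i) J u"
      have il': "i < sL ?S" using il by simp
      have mm: "?m' div 2 = ?m" unfolding mX_def using div_pow_half[of i Lam "m1 J u"] il by simp
      have g0: "good ?S i ?m" using good_Suc[OF il', of ?m'] g mm by (simp add: goodX_def)
      then have g1: "goodX i J u" using g by (simp add: goodX_def)
      then have Zz: "Z J u = zoff ?S i ?m" using Z i a by (simp add: Zp_def)
      have ne: "cols ?S (idx ?S i) ?m \<noteq> {}" using g0 by (simp add: good_def)
      show "Z' J u = zoff ?S (Suc i) ?m'"
      proof (cases "odd ?m'")
        case True
        then have "?m' = 2 * ?m + 1" using mm by (metis odd_two_times_div_two_succ)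
        then show ?thesis using zoff_odd[OF il', of ?m] True Zz g1 unfolding Z'_def GI_def Let_def
          by (simp add: mX_def[of "Suc i"])
      next
        case False
        then have "?m' = 2 * ?m" using mm by (metis dvd_mult_div_cancel)
        then show ?thesis using zoff_even[OF il' ne] False Zz g1 unfolding Z'_def GI_def Let_def
          by (simp add: mX_def[of "Suc i"])
      qed
    qed
    moreover have "\<forall>j<Suc i. knows a2 (OUT j)" using kO kOi knows_ext[OF e2] by (auto simp: less_Suc_eq)
    ultimately have "?P (Suc i) a2" using k1 kZ' by blast
    then show "\<exists>\<tau>'. ext (36 + 6 * Lam) \<tau> \<tau>' \<and> ?P (Suc i) \<tau>'" by (rule ex_extI[OF e2]) simp
  qed
  then show ?thesis by blast
qed

definition best :: "inst \<Rightarrow> nat \<Rightarrow> nat" where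
  "best J u = Min ((\<lambda>i. OUT i J u) ` {..Lam})"

lemma best_known:
  assumes "pbased \<sigma>"
  shows "\<exists>\<sigma>'. ext (Suc Lam * (36 + 6 * Lam)) \<sigma> \<sigma>' \<and> knows \<sigma>' best"
proof -
  obtain \<tau> where t: "ext (Suc Lam * (36 + 6 * Lam)) \<sigma> \<tau>" "\<forall>i<Suc Lam. knows \<tau> (OUT i)" using OUT_known[OF assms] by blast
  have "knows \<tau> best"
  proof (rule knowsI)
    fix J J' u assume s: "same \<tau> J J' u"
    have "OUT i J u = OUT i J' u" if "i \<in> {..Lam}" for i
    proof -
      have "knows \<tau> (OUT i)" using t(2) that by (simp add: less_Suc_eq_le)
      then show ?thesis using s by (rule knowsD)
    qed
    then show "best J u = best J' u" unfolding best_def by (intro arg_cong[where f = Min] image_cong refl)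
  qed
  then show ?thesis using t(1) by blast
qed

text \<open>By \<open>sub_iff\<close>, rows from the label of \<open>x\<close> on and columns from
  the label of \<open>y\<close> on are the two subtrees. All pairs between them match, and rows on
  other paths have weight 0.\<close>

lemma cov_covw:
  assumes i: "J \<in> I" and x: "x \<in> iV J" "rk h J x = d1" "side J \<beta> x = 0" and y: "y \<in> iV J" "rk h J y = d2" "side J \<beta> y = 1"
    and c: "cX J x = t2 J y" "pY J (t2 J y) = t1 J x"
  shows "cov (SS J (t2 J y)) (m1 J x) (m2 J y) = covw J x y"
    "u \<in> sub J x \<Longrightarrow> v \<in> sub J y \<Longrightarrow> mat J u v"
proof -
  interpret ranked_tree J b h using I_ranked i by blast
  have xr: "x \<noteq> ir J" "y \<noteq> ir J" using x y d1 d2 by auto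
  have l: "m1 J x = lam b J h x" "m2 J y = lam b J h y" using lo_self x y by (simp_all add: mu_def)
  have vx: "v1 J x" "v2 J y" using valid_self x y d1 d2 by auto
  show mt: "mat J u v" if "u \<in> sub J x" "v \<in> sub J y" for u v
  proof -
    have V: "u \<in> iV J" "v \<in> iV J" using that sub_V by auto
    have s: "side J \<beta> u = 0" "side J \<beta> v = 1" using side_sub[OF x(1) xr(1) that(1)] side_sub[OF y(1) xr(2) that(2)] x y by auto
    have t: "t1 J u = t1 J x" "t2 J v = t2 J y" using sub_iff[OF x(1,2) d1 V(1)] sub_iff[OF y(1,2) d2 V(2)] that by auto
    have "v1 J u" "v2 J v" using vx t by (simp_all add: valid_def)
    then show ?thesis using s t vx c by (simp add: mat_def cX_def cY_def)
  qed
  have "(\<Sum>v\<in>sY (SS J (t2 J y)). \<Sum>u\<in>iV J. if m1 J x \<le> m1 J u \<and> m2 J y \<le> m2 J v then sw (SS J (t2 J y)) u v else 0)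
    = (\<Sum>v\<in>sub J y. \<Sum>u\<in>sub J x. wt J u v)"
  proof (rule sum.mono_neutral_cong_right)
    show "sub J y \<subseteq> sY (SS J (t2 J y))"
    proof
      fix v assume v: "v \<in> sub J y"
      then have "t2 J v = t2 J y" using sub_iff[OF y(1,2) d2 sub_V[OF v]] by simp
      then show "v \<in> sY (SS J (t2 J y))" using sub_V[OF v] vx(2) by (simp add: valid_def)
    qed
    show "\<forall>v\<in>sY (SS J (t2 J y)) - sub J y.
       (\<Sum>u\<in>iV J. if m1 J x \<le> m1 J u \<and> m2 J y \<le> m2 J v then sw (SS J (t2 J y)) u v else 0) = 0"
      using sub_iff[OF y(1,2) d2] l by (auto intro!: sum.neutral)
    fix v assume v: "v \<in> sub J y"
    have vV: "v \<in> iV J" using v sub_V by blast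
    have v': "m2 J y \<le> m2 J v" "t2 J v = t2 J y" using sub_iff[OF y(1,2) d2 vV] v l by auto
    show "(\<Sum>u\<in>iV J. if m1 J x \<le> m1 J u \<and> m2 J y \<le> m2 J v then sw (SS J (t2 J y)) u v else 0) = (\<Sum>u\<in>sub J x. wt J u v)"
    proof (rule sum.mono_neutral_cong_right)
      show "\<forall>u\<in>iV J - sub J x. (if m1 J x \<le> m1 J u \<and> m2 J y \<le> m2 J v then sw (SS J (t2 J y)) u v else 0) = 0"
      proof
        fix u assume u: "u \<in> iV J - sub J x"
        have "t1 J u \<noteq> t1 J x \<or> \<not> m1 J x \<le> m1 J u" using sub_iff[OF x(1,2) d1, of u] u l by auto
        moreover have "t1 J u = t1 J x" if "mat J u v" using that c v' by (auto simp: mat_def cY_def)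
        ultimately show "(if m1 J x \<le> m1 J u \<and> m2 J y \<le> m2 J v then sw (SS J (t2 J y)) u v else 0) = 0" by auto
      qed
      fix u assume u: "u \<in> sub J x"
      then have "m1 J x \<le> m1 J u" using sub_iff[OF x(1,2) d1 sub_V[OF u]] l by auto
      then show "(if m1 J x \<le> m1 J u \<and> m2 J y \<le> m2 J v then sw (SS J (t2 J y)) u v else 0) = wt J u v"
        using mt[OF u v] v' by simp
    qed (use sub_V in auto)
  qed (use I_finite[OF i] in auto)
  then show "cov (SS J (t2 J y)) (m1 J x) (m2 J y) = covw J x y"
    unfolding cov_def covw_def by (subst sum.swap) simp
qed

lemma jcost_eq:
  assumes i: "J \<in> I" and z: "z \<in> cols (SS J q) (idx (SS J q) j) m" "js (SS J q) j m = m2 J z"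
  shows "jcost (SS J q) j m = cutw J z"
proof -
  interpret staircase "SS J q" by (rule SS_staircase[OF i])
  have "{y \<in> cols (SS J q) (idx (SS J q) j) m. snu (SS J q) y = js (SS J q) j m} = {z}"
    using z inj by (auto simp: cols_def inj_on_def)
  moreover have "cutw J z \<le> infv" using cutw_TW[OF i, of z] W_L by simp
  ultimately show ?thesis by (simp add: jcost_def min_def)
qed

text \<open>A finite result comes from a good block, hence from an edge between sides 0 and 1 that
  joins the two paths. The side is constant below a top of rank at most \<open>h\<close>, so
  \<open>u\<close> and the tested column hang below different children of the root.\<close>

lemma best_sound:
  assumes i: "J \<in> I" and u: "u \<in> iV J" and lt: "best J u < infv"
  shows "\<exists>y\<in>iV J. u \<noteq> ir J \<and> par J u \<noteq> ir J \<and> y \<noteq> ir J \<and> par J y \<noteq> ir J \<and> top_node J u \<noteq> top_node J y \<and>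
    best J u = cutw J u + cutw J y - 2 * covw J u y"
proof -
  interpret ranked_tree J b h using I_ranked i by blast
  have "best J u \<in> (\<lambda>i. OUT i J u) ` {..Lam}" unfolding best_def by (intro Min_in) auto
  then obtain j where j: "best J u = OUT j J u" by blast
  let ?S = "SS J (cX J u)" and ?m = "mX j J u"
  interpret staircase ?S by (rule SS_staircase[OF i])
  have g: "goodX j J u" "colnode J d1 u" using lt j by (auto simp: OUT_def Let_def split: if_splits)
  have p: "v1 J u" "pY J (cX J u) = t1 J u" and cb: "conn_block ?S j ?m" and ne: "cols ?S (idx ?S j) ?m \<noteq> {}"
    using g by (auto simp: goodX_def paired_def good_def)
  obtain y where y: "y \<in> cols ?S (idx ?S j) ?m" "js ?S j ?m = m2 J y" using js_props[OF ne, of j] by auto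
  then have y': "y \<in> iV J" "v2 J y" "t2 J y = cX J u" "colnode J d2 y" by (auto simp: cols_def)
  obtain u' v where a: "u' \<in> iV J" "v \<in> iV J" "t2 J v = cX J u" "0 < sw ?S u' v" using cb by (auto simp: conn_block_def)
  have mt: "mat J u' v" using a(4) by (auto split: if_splits)
  have "t1 J u' = t1 J u" by (rule mat_paired[OF p mt a(3)])
  have side_tp: "side J \<beta> w = side J \<beta> (tp h J d w)" if "w \<in> iV J" "valid h J d w" "d \<le> h" for w d
  proof -
    have "tp h J d w \<noteq> ir J" using that by (auto simp: valid_def)
    moreover have "w \<in> sub J (tp h J d w)" using tp_in[OF that(1)] that(1) by (simp add: sub_def)
    ultimately show ?thesis using side_sub[of "tp h J d w" w] tp_in[OF that(1)] by blast
  qed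
  have s: "side J \<beta> u = 0" "side J \<beta> y = 1"
    using side_tp[OF u p(1) d1] side_tp[OF y'(1,2) d2] side_tp[OF a(1) _ d1] side_tp[OF a(2) _ d2] mt \<open>t1 J u' = t1 J u\<close> a(3) y'(3)
    by (auto simp: mat_def)
  have "cov ?S (m1 J u) (js ?S j ?m) = covw J u y"
    using cov_covw(1)[OF i u _ s(1) y'(1) _ s(2)] g y y' p by (simp add: colnode_def)
  then have "OUT j J u = cutw J u + cutw J y - 2 * covw J u y"
    using g jcost_eq[OF i y] by (simp add: OUT_def Let_def)
  moreover have "top_node J u \<noteq> top_node J y" using s g y'(4) by (auto simp: side_def colnode_def)
  ultimately show ?thesis using j g y' by (auto simp: colnode_def)
qed

text \<open>Positive weight between the subtrees provides the edge with which
  \<open>domination\<close> starts. The dominating column is tested by \<open>x\<close> in a good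
  block, so it takes part in the minimum.\<close>

lemma best_complete:
  assumes i: "J \<in> I" and x: "x \<in> iV J" "colnode J d1 x" "side J \<beta> x = 0" and y: "y \<in> iV J" "colnode J d2 y" "side J \<beta> y = 1"
    and c: "cand J \<beta> d1 d2 s1 k1 (t1 J x) = t2 J y" "cand J \<beta> d2 d1 s2 k2 (t2 J y) = t1 J x"
    and pos: "0 < covw J x y"
  shows "best J x \<le> cutw J x + cutw J y - 2 * covw J x y"
proof -
  interpret ranked_tree J b h using I_ranked i by blast
  let ?S = "SS J (t2 J y)"
  interpret staircase ?S by (rule SS_staircase[OF i])
  have xy: "rk h J x = d1" "rk h J y = d2" using x y by (auto simp: colnode_def)
  have v: "v1 J x" "v2 J y" using valid_self[OF x(1) xy(1) d1] valid_self[OF y(1) xy(2) d2] by auto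
  have cc: "cX J x = t2 J y" "pY J (t2 J y) = t1 J x" using c v by (auto simp: cX_def pY_def)
  have "\<exists>u\<in>sub J x. \<exists>v\<in>sub J y. wt J u v \<noteq> 0"
  proof (rule ccontr)
    assume "\<not> ?thesis"
    then have "covw J x y = 0" unfolding covw_def by (auto intro!: sum.neutral)
    then show False using pos by simp
  qed
  then obtain u w where uw: "u \<in> sub J x" "w \<in> sub J y" "wt J u w \<noteq> 0" by blast
  have "mat J u w" by (rule cov_covw(2)[OF i x(1) xy(1) x(3) y(1) xy(2) y(3) cc uw(1,2)])
  then have sw: "0 < sw ?S u w" using uw by simp
  have wY: "w \<in> sY ?S" using sub_iff[OF y(1) xy(2) d2 sub_V[OF uw(2)]] uw(2) sub_V[OF uw(2)] v by (auto simp: valid_def)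
  have "y \<in> sCol ?S" using y v by simp
  moreover have "m1 J x < 2 ^ sL ?S" using mu_bounds(1)[OF i x(1) d1] by simp
  moreover have "u \<in> sX ?S" using sub_V[OF uw(1)] by simp
  ultimately obtain j z where jz: "j \<le> sL ?S" "z \<in> cols ?S (idx ?S j) (m1 J x div 2 ^ (sL ?S - j))"
    "good ?S j (m1 J x div 2 ^ (sL ?S - j))" "js ?S j (m1 J x div 2 ^ (sL ?S - j)) = snu ?S z"
    "int (sc ?S z) - 2 * int (cov ?S (m1 J x) (snu ?S z)) \<le> int (sc ?S y) - 2 * int (cov ?S (m1 J x) (snu ?S y))"
    using domination[of y "m1 J x" u w] wY sw by blast
  have m: "m1 J x div 2 ^ (sL ?S - j) = mX j J x" by (simp add: mX_def)
  have gx: "goodX j J x" using jz(3) m cc v by (simp add: goodX_def paired_def)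
  have "best J x \<le> OUT j J x" unfolding best_def using jz(1) by (intro Min_le) auto
  also have "OUT j J x = cutw J x + cutw J z - 2 * cov ?S (m1 J x) (m2 J z)"
  proof -
    have "jcost ?S j (mX j J x) = cutw J z" by (rule jcost_eq[OF i]) (use jz m in auto)
    then show ?thesis using gx x(2) jz(4) m cc by (simp add: OUT_def Let_def)
  qed
  also have "\<dots> \<le> cutw J x + cutw J y - 2 * covw J x y"
    using jz(5) cov_covw(1)[OF i x(1) xy(1) x(3) y(1) xy(2) y(3) cc] by simp
  finally show ?thesis .
qed

end

section \<open>The minimum cut value\<close>

text \<open>Pairs of edges, given by their lower endpoints, in different trees below the root.\<close>
definition pairs :: "inst \<Rightarrow> (nat \<times> nat) set" where
  "pairs J = {(x, y). x \<in> iV J \<and> y \<in> iV J \<and> x \<noteq> ir J \<and> par J x \<noteq> ir J \<and> y \<noteq> ir J \<and> par J y \<noteq> ir J \<and>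
     top_node J x \<noteq> top_node J y}"

definition cutval :: "inst \<Rightarrow> nat \<Rightarrow> nat \<Rightarrow> nat" where
  "cutval J x y = cutw J x + cutw J y - 2 * covw J x y"

definition allcuts :: "inst \<Rightarrow> nat set" where
  "allcuts J = cutw J ` (iV J - {ir J}) \<union> (\<lambda>(x, y). cutval J x y) ` pairs J"

lemma covw_sym: "covw J x y = covw J y x"
  unfolding covw_def by (subst sum.swap) (intro sum.cong refl wt_sym)

context setting
begin

definition prep :: "round_spec list \<Rightarrow> bool" where
  "prep \<sigma> \<longleftrightarrow> based \<sigma> \<and> knows \<sigma> (\<lambda>J v. if v = ir J then 0 else cutw J v) \<and> knows \<sigma> (\<lambda>J v. (par J v, top_node J v))"

lemma prep_ext: "ext m \<sigma> \<sigma>' \<Longrightarrow> prep \<sigma> \<Longrightarrow> prep \<sigma>'"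
  unfolding prep_def by (auto intro: knows_ext based_ext)

lemma prep_known: "\<exists>\<sigma>. ext ((20 * h + 20) + (Suc h * (8 + 6 * Lam) + 3)) [] \<sigma> \<and> prep \<sigma>"
proof -
  obtain a1 where 1: "ext (20 * h + 20) [] a1" "based a1" using based_known by blast
  obtain a2 where 2: "ext (Suc h * (8 + 6 * Lam)) a1 a2" "knows a2 (\<lambda>J v. if v = ir J then 0 else cutw J v)"
    using cut_known[OF 1(2)] by blast
  obtain a3 where 3: "ext 3 a2 a3" "knows a3 (\<lambda>J v. (par J v, top_node J v))"
    using side_known[OF based_ext[OF 2(1) 1(2)]] by blast
  have "prep a3" unfolding prep_def
    using based_ext[OF ext_trans[OF 2(1) 3(1)] 1(2)] knows_ext[OF 3(1) 2(2)] 3(2) by blast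
  then show ?thesis using ext_trans[OF 1(1) ext_trans[OF 2(1) 3(1)]] by blast
qed

definition pair_rounds :: nat where
  "pair_rounds = 2 * (7 + 3 * Lam + 4 * b) + Suc Lam * (36 + 6 * Lam)"

text \<open>Summarises a \<open>pairing\<close> outside its locale, so that a quantity
  \<open>K\<close> can be chosen for each tuple of parameters.\<close>

lemma pairing_exists:
  assumes d: "d1 \<le> h" "d2 \<le> h"
  shows "\<exists>K. (\<forall>\<sigma>. prep \<sigma> \<longrightarrow> (\<exists>\<sigma>'. ext pair_rounds \<sigma> \<sigma>' \<and> knows \<sigma>' K)) \<and>
    (\<forall>J\<in>I. \<forall>u\<in>iV J. K J u < 2 ^ L - 1 \<longrightarrow> K J u \<in> allcuts J) \<and>
    (\<forall>J\<in>I. \<forall>x\<in>iV J. \<forall>y\<in>iV J. (x, y) \<in> pairs J \<longrightarrow> rk h J x = d1 \<longrightarrow> rk h J y = d2 \<longrightarrow>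
      side J \<beta> x = 0 \<longrightarrow> side J \<beta> y = 1 \<longrightarrow> cand J \<beta> d1 d2 s1 k1 (tp h J d1 x) = tp h J d2 y \<longrightarrow>
      cand J \<beta> d2 d1 s2 k2 (tp h J d2 y) = tp h J d1 x \<longrightarrow> 0 < covw J x y \<longrightarrow> K J x \<le> cutval J x y)"
proof -
  interpret pairing I L n b h W \<beta> d1 d2 s1 k1 s2 k2 by unfold_locales (use d in auto)
  have "\<exists>\<sigma>'. ext pair_rounds \<sigma> \<sigma>' \<and> knows \<sigma>' best" if P: "prep \<sigma>" for \<sigma>
  proof -
    have kt: "knows \<sigma> (\<lambda>J v. top_node J v)" "knows \<sigma> (\<lambda>J v. par J v)"
      using P by (auto simp: prep_def knows_def)
    obtain a1 where 1: "ext (7 + 3 * Lam + 4 * b) \<sigma> a1" "knows a1 (\<lambda>J v. if valid h J d1 v then cand J \<beta> d1 d2 s1 k1 (tp h J d1 v) else 0)"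
      using cand_known[OF conjunct1[OF P[unfolded prep_def]] kt(1) d] by blast
    have P1: "prep a1" by (rule prep_ext[OF 1(1) P])
    obtain a2 where 2: "ext (7 + 3 * Lam + 4 * b) a1 a2" "knows a2 (\<lambda>J v. if valid h J d2 v then cand J \<beta> d2 d1 s2 k2 (tp h J d2 v) else 0)"
      using cand_known[OF conjunct1[OF P1[unfolded prep_def]] knows_ext[OF 1(1) kt(1)] d(2,1)] by blast
    note e = ext_trans[OF 1(1) 2(1)]
    have P2: "prep a2" by (rule prep_ext[OF e P])
    have B: "based a2" using P2 by (simp add: prep_def)
    have k: "knows a2 cX" "knows a2 cY" unfolding cX_def[abs_def] cY_def[abs_def] pY_def
      using knows_ext[OF 2(1) 1(2)] 2(2) by auto
    have kr: "knows a2 (\<lambda>J v. ir J)" "knows a2 t1" "knows a2 t2" "knows a2 v1" "knows a2 v2"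
      using B d by (simp_all add: based_def)
    have ks: "knows a2 (\<lambda>J v. side J \<beta> v)" unfolding side_def
      by (rule knowsI) (simp add: knowsD[OF kr(1)] knowsD[OF knows_ext[OF e kt(1)]])
    have "knows a2 BL" unfolding BL_def
      by (rule knowsI) (simp add: knowsD[OF ks] knowsD[OF k(1)] knowsD[OF k(2)] knowsD[OF kr(2)] knowsD[OF kr(3)]
        knowsD[OF kr(4)] knowsD[OF kr(5)])
    then have "pbased a2" unfolding pbased_def using P2 knows_ext[OF e kt(2)] by (simp add: prep_def)
    then obtain a3 where 3: "ext (Suc Lam * (36 + 6 * Lam)) a2 a3" "knows a3 best" using best_known by blast
    have "ext pair_rounds \<sigma> a3" by (rule ext_mono[OF ext_trans[OF e 3(1)]]) (simp add: pair_rounds_def)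
    then show ?thesis using 3 by blast
  qed
  moreover have "best J u \<in> allcuts J" if h: "J \<in> I" "u \<in> iV J" "best J u < 2 ^ L - 1" for J u
  proof -
    obtain y where "y \<in> iV J" "u \<noteq> ir J" "par J u \<noteq> ir J" "y \<noteq> ir J" "par J y \<noteq> ir J" "top_node J u \<noteq> top_node J y"
      "best J u = cutw J u + cutw J y - 2 * covw J u y" using best_sound[OF h] by blast
    then have "(u, y) \<in> pairs J" "best J u = cutval J u y" using h by (auto simp: pairs_def cutval_def)
    then show ?thesis unfolding allcuts_def by force
  qed
  moreover have "best J x \<le> cutval J x y" if "J \<in> I" "x \<in> iV J" "y \<in> iV J" "(x, y) \<in> pairs J" "rk h J x = d1" "rk h J y = d2"
      "side J \<beta> x = 0" "side J \<beta> y = 1" "cand J \<beta> d1 d2 s1 k1 (tp h J d1 x) = tp h J d2 y"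
      "cand J \<beta> d2 d1 s2 k2 (tp h J d2 y) = tp h J d1 x" "0 < covw J x y" for J x y
    unfolding cutval_def by (rule best_complete) (use that in \<open>auto simp: colnode_def pairs_def\<close>)
  ultimately show ?thesis by (intro exI[of _ best]) blast
qed

text \<open>One run of a pairing for each separating bit, each pair of ranks and, for both paths,
  each scale up to \<open>L\<close> and each of the four quartiles; the last two rounds take the
  global minimum.\<close>

definition total_rounds :: nat where
  "total_rounds = (20 * h + 20) + (Suc h * (8 + 6 * Lam) + 3) +
     b * (Suc h * (Suc h * (Suc L * (4 * (Suc L * 4))))) * pair_rounds + 2"

text \<open>Each node takes the minimum of its own cut value and its results in all pairings. Every
  finite result is a genuine cut value, and every cut value is matched or undercut by some
  result.\<close>

lemma minimum_known:
  "\<exists>\<sigma>. ext total_rounds [] \<sigma> \<and> knows \<sigma> (\<lambda>J v. INF a\<in>allcuts J. enat a)"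
proof -
  define P where "P = {..<b} \<times> {..h} \<times> {..h} \<times> {..L} \<times> {..<4::nat} \<times> {..L} \<times> {..<4::nat}"
  define good where "good K p \<longleftrightarrow> (case p of (\<beta>, d1, d2, s1, k1, s2, k2) \<Rightarrow>
    (\<forall>\<sigma>. prep \<sigma> \<longrightarrow> (\<exists>\<sigma>'. ext pair_rounds \<sigma> \<sigma>' \<and> knows \<sigma>' K)) \<and>
    (\<forall>J\<in>I. \<forall>u\<in>iV J. K J u < 2 ^ L - 1 \<longrightarrow> K J u \<in> allcuts J) \<and>
    (\<forall>J\<in>I. \<forall>x\<in>iV J. \<forall>y\<in>iV J. (x, y) \<in> pairs J \<longrightarrow> rk h J x = d1 \<longrightarrow> rk h J y = d2 \<longrightarrow>
      side J \<beta> x = 0 \<longrightarrow> side J \<beta> y = 1 \<longrightarrow> cand J \<beta> d1 d2 s1 k1 (tp h J d1 x) = tp h J d2 y \<longrightarrow>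
      cand J \<beta> d2 d1 s2 k2 (tp h J d2 y) = tp h J d1 x \<longrightarrow> 0 < covw J x y \<longrightarrow> K J x \<le> cutval J x y))" for K p
  have "\<exists>K. good K p" if p: "p \<in> P" for p
  proof -
    obtain \<beta> d1 d2 s1 k1 s2 k2 where pp: "p = (\<beta>, d1, d2, s1, k1, s2, k2)" by (metis prod_cases7)
    then have d: "d1 \<le> h" "d2 \<le> h" using p by (auto simp: P_def)
    show ?thesis unfolding good_def pp prod.case by (rule pairing_exists[OF d])
  qed
  then obtain K where K: "\<And>p. p \<in> P \<Longrightarrow> good (K p) p" by metis
  have fin: "finite P" unfolding P_def by simp
  obtain ps where ps: "set ps = P" "distinct ps" using finite_distinct_list[OF fin] by blast
  have len: "length ps = b * (Suc h * (Suc h * (Suc L * (4 * (Suc L * 4)))))"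
    using distinct_card[OF ps(2)] ps(1) by (simp add: P_def card_cartesian_product)
  obtain a1 where 1: "ext ((20 * h + 20) + (Suc h * (8 + 6 * Lam) + 3)) [] a1" "prep a1" using prep_known by blast
  have "\<exists>\<tau>. ext (length ps * pair_rounds) a1 \<tau> \<and> (\<forall>i<length ps. knows \<tau> (K (ps ! i)))"
  proof (rule ext_all)
    fix i \<tau> k assume "i < length ps" and e: "ext k a1 \<tau>"
    then have "ps ! i \<in> P" using ps nth_mem by blast
    then have "good (K (ps ! i)) (ps ! i)" by (rule K)
    then have "\<forall>\<sigma>. prep \<sigma> \<longrightarrow> (\<exists>\<sigma>'. ext pair_rounds \<sigma> \<sigma>' \<and> knows \<sigma>' (K (ps ! i)))"
      unfolding good_def by (auto split: prod.splits)
    then show "\<exists>\<tau>'. ext pair_rounds \<tau> \<tau>' \<and> knows \<tau>' (K (ps ! i))" using prep_ext[OF e 1(2)] by blast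
  qed
  then obtain a2 where 2: "ext (length ps * pair_rounds) a1 a2" "\<forall>i<length ps. knows a2 (K (ps ! i))" by blast
  have k2: "knows a2 (K p)" if "p \<in> P" for p
    using that 2(2) ps(1) by (metis in_set_conv_nth)
  \<comment> \<open>\<open>2 ^ L - 1\<close> exceeds all cut values and stands for infinity. With
    the root as the only block top, the following consensus takes the minimum over the whole
    graph.\<close>
  define own where "own J v = Min (insert (2 ^ L - 1) ((if v = ir J then {} else {cutw J v}) \<union>
    (\<lambda>p. min (K p J v) (2 ^ L - 1)) ` P))" for J v
  have "prep a2" by (rule prep_ext[OF 2(1) 1(2)])
  then have kr: "knows a2 (\<lambda>J v. ir J)" and kc: "knows a2 (\<lambda>J v. if v = ir J then 0 else cutw J v)"
    by (auto simp: prep_def based_def)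
  have kown: "knows a2 own"
  proof (rule knowsI)
    fix J J' v assume s: "same a2 J J' v"
    have "(\<lambda>p. min (K p J v) (2 ^ L - 1)) ` P = (\<lambda>p. min (K p J' v) (2 ^ L - 1)) ` P"
      by (intro image_cong refl) (simp add: knowsD[OF k2 s])
    moreover have "(if v = ir J then {} else {cutw J v}) = (if v = ir J' then {} else {cutw J' v})"
      using knowsD[OF kr s] knowsD[OF kc s] by (auto split: if_splits)
    ultimately show "own J v = own J' v" unfolding own_def by simp
  qed
  have finO: "finite (insert (2 ^ L - 1) ((if v = ir J then {} else {cutw J v}) \<union> (\<lambda>p. min (K p J v) (2 ^ L - 1)) ` P))"
    for J v using fin by simp
  have own_le: "own J v \<le> 2 ^ L - 1" for J v unfolding own_def using finO by (intro Min_le) auto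
  have kH: "knows a2 (\<lambda>J v. v \<in> {ir J})" using knows_root[OF kr] by simp
  have "\<exists>\<sigma>'. ext 2 a2 \<sigma>' \<and> knows \<sigma>' (\<lambda>J v. Min (own J ` block J {ir J} v))"
  proof (rule block_min[OF kH _ kown])
    show "own J v < 2 ^ L" for J v using own_le[of J v] L_pos
      by (metis Suc_pred' less_Suc_eq_le zero_less_numeral zero_less_power One_nat_def)
  qed simp
  then obtain a3 where 3: "ext 2 a2 a3" "knows a3 (\<lambda>J v. Min (own J ` block J {ir J} v))" by blast
  have blk: "block J {ir J} v = iV J" if "J \<in> I" "v \<in> iV J" for J v
  proof -
    interpret rooted_tree J using I_rooted that by blast
    have "near J {ir J} u = ir J" if "u \<in> iV J" for u using near_in(1)[of "{ir J}" u] that by simp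
    then show ?thesis using that by (auto simp: block_def)
  qed
  have res: "(INF a\<in>allcuts J. enat a) = (if Min (own J ` iV J) = 2 ^ L - 1 then \<infinity> else enat (Min (own J ` iV J)))"
    if i: "J \<in> I" for J
  proof -
    interpret ranked_tree J b h using I_ranked i by blast
    have cw: "cutw J x \<le> TW" for x unfolding cutw_def by (rule wt_total[OF i]) (auto simp: sub_def)
    have small: "a < 2 ^ L - 1" if mem: "a \<in> allcuts J" for a
    proof -
      consider x where "a = cutw J x" | x y where "a = cutw J x + cutw J y - 2 * covw J x y"
        using mem by (auto simp: allcuts_def cutval_def)
      then have "a \<le> 2 * TW"
      proof cases
        case (1 x)
        then show ?thesis using cw[of x] by simp
      next
        case (2 x y)
        then show ?thesis using cw[of x] cw[of y] by simp
      qed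
      then show ?thesis using W_L by simp
    qed
    let ?R = "Min (own J ` iV J)"
    have finR: "finite (own J ` iV J)" "own J ` iV J \<noteq> {}" using finite_V root by blast+
    have Rmem: "?R = 2 ^ L - 1 \<or> ?R \<in> allcuts J"
    proof -
      have "?R \<in> own J ` iV J" using finR by (rule Min_in)
      then obtain v where v: "v \<in> iV J" "?R = own J v" by auto
      have "own J v \<in> insert (2 ^ L - 1) ((if v = ir J then {} else {cutw J v}) \<union> (\<lambda>p. min (K p J v) (2 ^ L - 1)) ` P)"
        unfolding own_def using finO by (intro Min_in) auto
      then consider "own J v = 2 ^ L - 1" | "v \<noteq> ir J" "own J v = cutw J v" | p where "p \<in> P" "own J v = min (K p J v) (2 ^ L - 1)"
        by (auto split: if_splits)
      then show ?thesis
      proof cases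
        case 2
        then show ?thesis using v by (auto simp: allcuts_def)
      next
        case 3
        have "K p J v \<in> allcuts J" if "K p J v < 2 ^ L - 1"
          using K[OF 3(1)] i v(1) that unfolding good_def by (auto split: prod.splits)
        then show ?thesis using 3 v by (cases "K p J v < 2 ^ L - 1") (auto simp: min_def)
      qed (use v in auto)
    qed
    have R1: "?R \<le> cutw J x" if "x \<in> iV J" "x \<noteq> ir J" for x
    proof -
      have "own J x \<le> cutw J x" unfolding own_def using finO that by (intro Min_le) auto
      moreover have "?R \<le> own J x" using finR that by (intro Min_le) auto
      ultimately show ?thesis by simp
    qed
    \<comment> \<open>A pair better than both single cuts satisfies the majority condition in both
      directions, so each path has the other among its candidates and some tuple of parameters pairs
      them.\<close>
    have R2: "?R \<le> cutval J x y" if xy: "(x, y) \<in> pairs J" and lt: "cutval J x y < cutw J x" "cutval J x y < cutw J y"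
      and s: "side J \<beta> x = 0" "side J \<beta> y = 1" and \<beta>: "\<beta> < b" for x y \<beta>
    proof -
      have V: "x \<in> iV J" "y \<in> iV J" "x \<noteq> ir J" "y \<noteq> ir J" using xy by (auto simp: pairs_def)
      have c: "cutw J x < 2 * covw J x y" "cutw J y < 2 * covw J x y" using lt by (auto simp: cutval_def)
      define d1 d2 where "d1 = rk h J x" and "d2 = rk h J y"
      have d: "d1 \<le> h" "d2 \<le> h" using rk_nonroot V d1_def d2_def by auto
      obtain s1 k1 where 1: "s1 < Suc L" "k1 < 4" "cand J \<beta> d1 d2 s1 k1 (tp h J d1 x) = tp h J d2 y"
        using cand_hit[OF i V(1) d1_def[symmetric] d(1) V(2) d2_def[symmetric] d(2) _ c(1), of \<beta>] s by auto
      obtain s2 k2 where 2: "s2 < Suc L" "k2 < 4" "cand J \<beta> d2 d1 s2 k2 (tp h J d2 y) = tp h J d1 x"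
        using cand_hit[OF i V(2) d2_def[symmetric] d(2) V(1) d1_def[symmetric] d(1), of \<beta>] c(2) s covw_sym[of J x y] by auto
      define p where "p = (\<beta>, d1, d2, s1, k1, s2, k2)"
      have p: "p \<in> P" using 1 2 d \<beta> by (auto simp: p_def P_def)
      have "0 < covw J x y" using c by simp
      then have "K p J x \<le> cutval J x y"
        using K[OF p] i V xy s 1(3) 2(3) d1_def d2_def unfolding good_def p_def by auto
      moreover have "own J x \<le> min (K p J x) (2 ^ L - 1)" unfolding own_def using finO p by (intro Min_le) auto
      moreover have "?R \<le> own J x" using finR V by (intro Min_le) auto
      ultimately show ?thesis by simp
    qed
    have Rle: "?R \<le> a" if a: "a \<in> allcuts J" for a
    proof -
      consider x where "x \<in> iV J" "x \<noteq> ir J" "a = cutw J x" | x y where "(x, y) \<in> pairs J" "a = cutval J x y"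
        using a by (auto simp: allcuts_def)
      then show ?thesis
      proof cases
        case 1
        then show ?thesis using R1 by simp
      next
        case 2
        have V: "x \<in> iV J" "y \<in> iV J" "x \<noteq> ir J" "y \<noteq> ir J" "top_node J x \<noteq> top_node J y" using 2 by (auto simp: pairs_def)
        show ?thesis
        proof (cases "cutval J x y < cutw J x \<and> cutval J x y < cutw J y")
          \<comment> \<open>Such a pair is irrelevant, because the cut value of one of its two edges
            alone is at least as small.\<close>
          case False
          then show ?thesis using R1[of x] R1[of y] V 2 by linarith
        next
          case True
          have tb: "top_node J x < 2 ^ b" "top_node J y < 2 ^ b" using top_node_props(2) V id_less by auto
          obtain \<beta> where \<beta>: "bit (top_node J x) \<beta> \<noteq> bit (top_node J y) \<beta>" using V(5) bit_eq_iff by blast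
          have bb: "\<beta> < b"
          proof (rule ccontr)
            assume "\<not> \<beta> < b"
            then have "(2::nat) ^ b \<le> 2 ^ \<beta>" by simp
            then have "top_node J x div 2 ^ \<beta> = 0" "top_node J y div 2 ^ \<beta> = 0"
              using tb less_le_trans by (metis div_less)+
            then show False using \<beta> by (simp add: bit_iff_odd)
          qed
          have sw: "(y, x) \<in> pairs J" "cutval J y x = cutval J x y"
            using 2 covw_sym[of J x y] by (auto simp: pairs_def cutval_def)
          show ?thesis
          proof (cases "bit (top_node J x) \<beta>")
            case False
            then have "side J \<beta> x = 0" "side J \<beta> y = 1" using \<beta> V by (auto simp: side_def)
            then show ?thesis using R2[OF 2(1)] True bb 2 by blast
          next
            case b1: True
            then have "side J \<beta> y = 0" "side J \<beta> x = 1" using \<beta> V by (auto simp: side_def)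
            then show ?thesis using R2[OF sw(1)] True bb 2 sw(2) by metis
          qed
        qed
      qed
    qed
    show ?thesis
    proof (cases "?R = 2 ^ L - 1")
      case True
      then have "allcuts J = {}" using Rle small by (metis all_not_in_conv leD)
      then show ?thesis using True by (simp add: top_enat_def)
    next
      case False
      then have "?R \<in> allcuts J" using Rmem by blast
      then have "(INF a\<in>allcuts J. enat a) = enat ?R"
        using Rle by (intro antisym INF_lower INF_greatest) auto
      then show ?thesis using False by simp
    qed
  qed
  have "knows a3 (\<lambda>J v. if Min (own J ` block J {ir J} v) = 2 ^ L - 1 then \<infinity> else enat (Min (own J ` block J {ir J} v)))"
    by (rule knows_1[OF 3(2)])
  then have "knows a3 (\<lambda>J v. INF a\<in>allcuts J. enat a)" by (rule knows_cong) (simp only: res blk)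
  moreover have "ext total_rounds [] a3"
    by (rule ext_mono[OF ext_trans[OF 1(1) ext_trans[OF 2(1) 3(1)]]]) (simp add: total_rounds_def len)
  ultimately show ?thesis by blast
qed

end

section \<open>The values of the problem statement\<close>

text \<open>An edge with ends on both sides of \<open>S\<close> corresponds to exactly one ordered
  pair whose first component lies in \<open>S\<close>.\<close>

lemma edge_sum:
  fixes w :: "nat set \<Rightarrow> nat"
  assumes V: "finite (iV J)" and E: "\<And>e. e \<in> iE J \<Longrightarrow> e \<subseteq> iV J \<and> card e = 2" and S: "S \<subseteq> iV J"
  shows "(\<Sum>g | g \<in> iE J \<and> ((Min g \<in> S) \<noteq> (Max g \<in> S)). iw J g) = (\<Sum>u\<in>S. \<Sum>v\<in>iV J - S. wt J u v)"
proof -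
  let ?P = "{(u, v). u \<in> S \<and> v \<in> iV J - S \<and> {u, v} \<in> iE J}"
  let ?G = "{g. g \<in> iE J \<and> ((Min g \<in> S) \<noteq> (Max g \<in> S))}"
  have fS: "finite S" using V S finite_subset by blast
  have mm: "(Min {u, v} \<in> S) \<noteq> (Max {u, v} \<in> S) \<longleftrightarrow> (u \<in> S) \<noteq> (v \<in> S)" for u v :: nat
    by (cases "u \<le> v") (auto simp: min_def max_def)
  have bij: "bij_betw (\<lambda>(u, v). {u, v}) ?P ?G"
  proof (rule bij_betw_imageI)
    show "inj_on (\<lambda>(u, v). {u, v}) ?P" by (auto simp: inj_on_def doubleton_eq_iff)
    show "(\<lambda>(u, v). {u, v}) ` ?P = ?G"
    proof
      show "(\<lambda>(u, v). {u, v}) ` ?P \<subseteq> ?G"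
      proof
        fix g assume "g \<in> (\<lambda>(u, v). {u, v}) ` ?P"
        then obtain u v where g: "g = {u, v}" "u \<in> S" "v \<notin> S" "{u, v} \<in> iE J" by auto
        show "g \<in> ?G" unfolding g(1) mem_Collect_eq mm using g by blast
      qed
      show "?G \<subseteq> (\<lambda>(u, v). {u, v}) ` ?P"
      proof
        fix g assume g: "g \<in> ?G"
        then obtain a c where ac: "g = {a, c}" "a \<noteq> c" using E by (metis (no_types, lifting) card_2_iff mem_Collect_eq)
        have gE: "{a, c} \<in> iE J" "(Min {a, c} \<in> S) \<noteq> (Max {a, c} \<in> S)" using g unfolding ac(1) by blast+
        have "(a \<in> S) \<noteq> (c \<in> S)" using gE(2) unfolding mm .
        moreover have "a \<in> iV J" "c \<in> iV J" using E[OF gE(1)] by auto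
        moreover note gE(1)
        ultimately have "(a \<in> S) \<noteq> (c \<in> S)" "{a, c} \<in> iE J" "a \<in> iV J" "c \<in> iV J" by blast+
        then have "(a, c) \<in> ?P \<or> (c, a) \<in> ?P" by (auto simp: insert_commute)
        then show "g \<in> (\<lambda>(u, v). {u, v}) ` ?P" using ac(1) by (force simp: insert_commute)
      qed
    qed
  qed
  have "(\<Sum>g\<in>?G. iw J g) = (\<Sum>p\<in>?P. iw J (case p of (u, v) \<Rightarrow> {u, v}))"
    using sum.reindex_bij_betw[OF bij, of "iw J"] by simp
  also have "\<dots> = (\<Sum>p\<in>?P. wt J (fst p) (snd p))" by (intro sum.cong refl) (auto simp: wt_def)
  also have "\<dots> = (\<Sum>p\<in>S \<times> (iV J - S). wt J (fst p) (snd p))"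
    by (rule sum.mono_neutral_left) (use fS V in \<open>auto simp: wt_def\<close>)
  also have "\<dots> = (\<Sum>u\<in>S. \<Sum>v\<in>iV J - S. wt J u v)" by (simp add: sum.cartesian_product split_def)
  finally show ?thesis .
qed

section \<open>Identification with the minima of the problem\<close>

locale graph_tree = rooted_tree +
  assumes graph: "connected_graph (iV J) (iE J)"
begin

lemma E_props: "e \<in> iE J \<Longrightarrow> e \<subseteq> iV J \<and> card e = 2"
  using graph by (auto simp: connected_graph_def simple_graph_def)

lemma E_ends: "e \<in> iE J \<Longrightarrow> Min e \<in> iV J \<and> Max e \<in> iV J"
  using E_props[of e] by (metis Max_in Min_in card.empty card.infinite subsetD zero_neq_numeral)

lemma covers_sub:
  "g \<in> iE J \<Longrightarrow> x \<in> iV J \<Longrightarrow> x \<noteq> ir J \<Longrightarrow> covers (iF J) g {par J x, x} \<longleftrightarrow> (Min g \<in> sub J x) \<noteq> (Max g \<in> sub J x)"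
  unfolding covers_def using covers_iff E_ends by blast

lemma cut1_eq:
  assumes "x \<in> iV J" "x \<noteq> ir J"
  shows "cut1 (iF J) (iE J) (iw J) {par J x, x} = cutw J x"
proof -
  have "cut1 (iF J) (iE J) (iw J) {par J x, x} = (\<Sum>g | g \<in> iE J \<and> ((Min g \<in> sub J x) \<noteq> (Max g \<in> sub J x)). iw J g)"
    unfolding cut1_def using covers_sub assms by (intro sum.cong) auto
  moreover have "sub J x \<subseteq> iV J" using sub_V by blast
  ultimately show ?thesis unfolding cutw_def using edge_sum[OF finite_V E_props, of "sub J x"] by simp
qed

text \<open>The subtrees are disjoint, so an edge of the graph covers exactly one of the two tree
  edges iff it leaves their union. Edges between the subtrees are counted in both cuts and have to
  be taken out twice.\<close>

lemma cut2_eq: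
  assumes "(x, y) \<in> pairs J"
  shows "cut2 (iF J) (iE J) (iw J) {par J x, x} {par J y, y} = cutval J x y"
proof -
  have V: "x \<in> iV J" "x \<noteq> ir J" "y \<in> iV J" "y \<noteq> ir J" "top_node J x \<noteq> top_node J y"
    using assms by (auto simp: pairs_def)
  let ?X = "sub J x" and ?Y = "sub J y"
  have dj: "?X \<inter> ?Y = {}" using top_sub[OF V(1,2)] top_sub[OF V(3,4)] V(5) by fastforce
  have fin: "finite ?X" "finite ?Y" by auto
  have sV: "?X \<subseteq> iV J" "?Y \<subseteq> iV J" using sub_V by auto
  have "cut2 (iF J) (iE J) (iw J) {par J x, x} {par J y, y} =
      (\<Sum>g | g \<in> iE J \<and> ((Min g \<in> ?X \<union> ?Y) \<noteq> (Max g \<in> ?X \<union> ?Y)). iw J g)"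
  proof -
    have "(covers (iF J) g {par J x, x} \<noteq> covers (iF J) g {par J y, y}) \<longleftrightarrow> (Min g \<in> ?X \<union> ?Y) \<noteq> (Max g \<in> ?X \<union> ?Y)"
      if "g \<in> iE J" for g using covers_sub[OF that V(1,2)] covers_sub[OF that V(3,4)] dj by auto
    then show ?thesis unfolding cut2_def by (intro sum.cong) auto
  qed
  also have "\<dots> = (\<Sum>u\<in>?X \<union> ?Y. \<Sum>v\<in>iV J - (?X \<union> ?Y). wt J u v)"
    using edge_sum[OF finite_V E_props, of "?X \<union> ?Y"] sV by simp
  also have "\<dots> = (\<Sum>u\<in>?X. \<Sum>v\<in>iV J - (?X \<union> ?Y). wt J u v) + (\<Sum>u\<in>?Y. \<Sum>v\<in>iV J - (?X \<union> ?Y). wt J u v)"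
    by (rule sum.union_disjoint[OF fin dj])
  finally have c2: "cut2 (iF J) (iE J) (iw J) {par J x, x} {par J y, y} =
    (\<Sum>u\<in>?X. \<Sum>v\<in>iV J - (?X \<union> ?Y). wt J u v) + (\<Sum>u\<in>?Y. \<Sum>v\<in>iV J - (?X \<union> ?Y). wt J u v)" .
  have 1: "iV J - ?X = (iV J - (?X \<union> ?Y)) \<union> ?Y" "iV J - ?Y = (iV J - (?X \<union> ?Y)) \<union> ?X" using sV dj by auto
  have 2: "(iV J - (?X \<union> ?Y)) \<inter> ?Y = {}" "(iV J - (?X \<union> ?Y)) \<inter> ?X = {}" by auto
  have "cutw J x = (\<Sum>u\<in>?X. \<Sum>v\<in>iV J - (?X \<union> ?Y). wt J u v) + covw J x y"
    unfolding cutw_def covw_def 1 sum.distrib[symmetric]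
    by (intro sum.cong refl sum.union_disjoint) (use fin 2 in auto)
  moreover have "cutw J y = (\<Sum>u\<in>?Y. \<Sum>v\<in>iV J - (?X \<union> ?Y). wt J u v) + covw J y x"
    unfolding cutw_def covw_def 1 sum.distrib[symmetric]
    by (intro sum.cong refl sum.union_disjoint) (use fin 2 in auto)
  ultimately show ?thesis using c2 covw_sym[of J x y] by (simp add: cutval_def)
qed

lemma min_1_eq: "min_1_respecting (iF J) (iE J) (iw J) = (INF a\<in>cutw J ` (iV J - {ir J}). enat a)"
proof -
  have F: "iF J = (\<lambda>x. {par J x, x}) ` (iV J - {ir J})" using F_iff by auto
  have "(\<lambda>x. enat (cut1 (iF J) (iE J) (iw J) {par J x, x})) ` (iV J - {ir J}) = (\<lambda>x. enat (cutw J x)) ` (iV J - {ir J})"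
    by (intro image_cong refl) (use cut1_eq in auto)
  then show ?thesis unfolding min_1_respecting_def by (subst F) (simp add: image_image)
qed

text \<open>Lying in different trees below the root amounts to having different top nodes, for tree
  edges not at the root. This makes the minimum independent of the numbering of the trees.\<close>

lemma min_2_eq:
  assumes sub: "subtree_instance (iV J) (iE J) (iF J) (ir J) k VT FT"
  shows "min_2_respecting (iF J) (iE J) (iw J) k FT = (INF a\<in>(\<lambda>(x, y). cutval J x y) ` pairs J. enat a)"
proof -
  have Vu: "iV J = {ir J} \<union> (\<Union>i\<in>{1..k}. VT i)" and dj: "disjoint_family_on VT {1..k}"
    and T: "\<And>i. i \<in> {1..k} \<Longrightarrow> ir J \<notin> VT i \<and> is_tree (VT i) (FT i) \<and> FT i \<subseteq> iF J"
    and Fr: "\<And>e. e \<in> iF J - (\<Union>i\<in>{1..k}. FT i) \<Longrightarrow> ir J \<in> e"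
    using sub by (auto simp: subtree_instance_def)
  have FV: "e \<subseteq> VT i" if "i \<in> {1..k}" "e \<in> FT i" for i e
    using T[OF that(1)] that(2) by (auto simp: is_tree_def connected_graph_def simple_graph_def)
  have uniq: "i = j" if "i \<in> {1..k}" "j \<in> {1..k}" "v \<in> VT i" "v \<in> VT j" for i j v
    using dj that unfolding disjoint_family_on_def by blast
  have edge: "\<exists>x. e = {par J x, x} \<and> x \<in> VT i \<and> par J x \<in> VT i \<and> x \<in> iV J \<and> x \<noteq> ir J \<and> par J x \<noteq> ir J"
    if "i \<in> {1..k}" "e \<in> FT i" for i e
  proof -
    have "e \<in> iF J" using T that by blast
    then obtain x where x: "x \<in> iV J" "x \<noteq> ir J" "e = {par J x, x}" unfolding F_iff by blast
    then have "x \<in> VT i" "par J x \<in> VT i" using FV[OF that] by auto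
    moreover have "par J x \<noteq> ir J" using calculation T[OF that(1)] by metis
    ultimately show ?thesis using x by blast
  qed
  have top_par: "top_node J x = top_node J (par J x)" if "x \<in> iV J" "x \<noteq> ir J" "par J x \<noteq> ir J" for x
    using top_sub[of "par J x" x] that par_anc by (simp add: sub_def)
  \<comment> \<open>Each tree is connected by edges that avoid the root, and along such an edge the
    top node does not change.\<close>
  have same_top: "top_node J u = top_node J v" if i: "i \<in> {1..k}" and uv: "u \<in> VT i" "v \<in> VT i" for i u v
  proof -
    have "\<exists>p. is_path (FT i) u v p" using T[OF i] uv unfolding is_tree_def connected_graph_def by blast
    then have "(u, v) \<in> (adj (FT i))\<^sup>*" using is_path_iff_rtrancl by blast
    then show ?thesis
    proof (induction rule: rtrancl_induct)
      case (step y z)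
      then obtain x where "{y, z} = {par J x, x}" "x \<in> iV J" "x \<noteq> ir J" "par J x \<noteq> ir J"
        using edge[OF i, of "{y, z}"] by (auto simp: adj_def)
      then have "top_node J y = top_node J z" using top_par[of x] by (auto simp: doubleton_eq_iff)
      then show ?case using step by simp
    qed simp
  qed
  have in_FT: "\<exists>i\<in>{1..k}. {par J x, x} \<in> FT i \<and> x \<in> VT i \<and> par J x \<in> VT i"
    if x: "x \<in> iV J" "x \<noteq> ir J" "par J x \<noteq> ir J" for x
  proof -
    have "{par J x, x} \<in> iF J" using root_path_par(2) x by blast
    then have "{par J x, x} \<in> (\<Union>i\<in>{1..k}. FT i)" using Fr[of "{par J x, x}"] x by auto
    then obtain i where i: "i \<in> {1..k}" "{par J x, x} \<in> FT i" by (rule UN_E)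
    then show ?thesis using FV[OF i] by auto
  qed
  \<comment> \<open>Climbing towards the root stays in the same tree until the child of the root is
    reached. Since the trees are disjoint, different trees have different top nodes.\<close>
  have top_VT: "top_node J x \<in> VT i" if "x \<in> iV J" "x \<noteq> ir J" "i \<in> {1..k}" "x \<in> VT i" for x i
    using that
  proof (induction rule: tree_induct)
    case (step x)
    show ?case
    proof (cases "par J x = ir J")
      case True
      then have "top_node J x = x" using top_node_eqI[of x x] step by simp
      then show ?thesis using step by simp
    next
      case False
      obtain j where j: "j \<in> {1..k}" "x \<in> VT j" "par J x \<in> VT j" using in_FT[OF step(1,2) False] by blast
      then have "j = i" using uniq step by blast
      then show ?thesis using step.IH False j top_par[OF step(1,2) False] step.prems by simp
    qed
  qed simp
  let ?c = "cut2 (iF J) (iE J) (iw J)"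
  have "(INF a\<in>(\<lambda>(x, y). cutval J x y) ` pairs J. enat a) \<le> enat (?c e f)"
    if ij: "i \<in> {1..k}" "j \<in> {i<..k}" and ef: "e \<in> FT i" "f \<in> FT j" for i j e f
  proof -
    have j: "j \<in> {1..k}" "i \<noteq> j" using ij by auto
    obtain x where x: "e = {par J x, x}" "x \<in> VT i" "x \<in> iV J" "x \<noteq> ir J" "par J x \<noteq> ir J" using edge[OF ij(1) ef(1)] by blast
    obtain y where y: "f = {par J y, y}" "y \<in> VT j" "y \<in> iV J" "y \<noteq> ir J" "par J y \<noteq> ir J" using edge[OF j(1) ef(2)] by blast
    have "top_node J x \<noteq> top_node J y"
      using top_VT[OF x(3,4) ij(1) x(2)] top_VT[OF y(3,4) j(1) y(2)] uniq[OF ij(1) j(1)] j(2) by metis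
    then have p: "(x, y) \<in> pairs J" using x y by (simp add: pairs_def)
    then have "?c e f = cutval J x y" using cut2_eq x y by simp
    then show ?thesis using p by (intro INF_lower2[of "cutval J x y"]) auto
  qed
  then have le1: "(INF a\<in>(\<lambda>(x, y). cutval J x y) ` pairs J. enat a) \<le> min_2_respecting (iF J) (iE J) (iw J) k FT"
    unfolding min_2_respecting_def by (intro INF_greatest) auto
  have low: "min_2_respecting (iF J) (iE J) (iw J) k FT \<le> enat (?c e f)"
    if "i \<in> {1..k}" "j \<in> {i<..k}" "e \<in> FT i" "f \<in> FT j" for i j e f
    unfolding min_2_respecting_def by (rule INF_lower2[OF that(1)], rule INF_lower2[OF that(2)],
      rule INF_lower2[OF that(3)], rule INF_lower2[OF that(4)]) simp
  have "min_2_respecting (iF J) (iE J) (iw J) k FT \<le> enat (cutval J x y)" if p: "(x, y) \<in> pairs J" for x y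
  proof -
    have V: "x \<in> iV J" "x \<noteq> ir J" "par J x \<noteq> ir J" "y \<in> iV J" "y \<noteq> ir J" "par J y \<noteq> ir J" "top_node J x \<noteq> top_node J y"
      using p by (auto simp: pairs_def)
    obtain i where i: "i \<in> {1..k}" "{par J x, x} \<in> FT i" "x \<in> VT i" using in_FT[OF V(1-3)] by blast
    obtain j where j: "j \<in> {1..k}" "{par J y, y} \<in> FT j" "y \<in> VT j" using in_FT[OF V(4-6)] by blast
    have "i \<noteq> j" using same_top[OF i(1,3)] j(3) V(7) by blast
    then consider "j \<in> {i<..k}" | "i \<in> {j<..k}" using i(1) j(1) by fastforce
    then show ?thesis
    proof cases
      case 1
      then show ?thesis using low[OF i(1) 1 i(2) j(2)] cut2_eq[OF p] by simp
    next
      case 2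
      have "?c {par J y, y} {par J x, x} = ?c {par J x, x} {par J y, y}"
        unfolding cut2_def by (rule sum.cong) auto
      then show ?thesis using low[OF j(1) 2 j(2) i(2)] cut2_eq[OF p] by simp
    qed
  qed
  then have "min_2_respecting (iF J) (iE J) (iw J) k FT \<le> (INF a\<in>(\<lambda>(x, y). cutval J x y) ` pairs J. enat a)"
    by (intro INF_greatest) auto
  then show ?thesis using le1 by (rule antisym)
qed

lemma result_eq:
  assumes "subtree_instance (iV J) (iE J) (iF J) (ir J) k VT FT"
  shows "min (min_1_respecting (iF J) (iE J) (iw J)) (min_2_respecting (iF J) (iE J) (iw J) k FT) =
    (INF a\<in>allcuts J. enat a)"
  unfolding min_1_eq min_2_eq[OF assms] allcuts_def image_Un Inf_union_distrib inf_min ..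

end

section \<open>From programs to one algorithm for all networks\<close>

lemma mset_set_subset: "x \<in># mset_set S \<Longrightarrow> x \<in> S"
  by (cases "finite S") auto

text \<open>Compares one round of two algorithms that keep different histories but act alike on
  them. It is applied to \<open>staged\<close> and to a round of the program, whose histories lack
  the first three entries.\<close>

lemma round_cong:
  assumes con: "\<And>e. e \<in> edges N \<Longrightarrow> contracts A (edge_view_of N he e) = contracts S (edge_view_of N he' e)"
    and cons: "\<And>v. v \<in> nodes N \<Longrightarrow> cons_value A (node_view_of N hn v) = cons_value S (node_view_of N hn' v)"
    and agg: "\<And>e a b. e \<in> edges N \<Longrightarrow> agg_value A (edge_view_of N he e) a b = agg_value S (edge_view_of N he' e) a b"
    and ops: "cons_op A t = cons_op S t'" "agg_op A t = agg_op S t'"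
  shows "supernode A N he = supernode S N he'" "minor_edges A N he = minor_edges S N he'"
    "e \<in> edges N \<Longrightarrow> edge_values A N he y e = edge_values S N he' y e"
    "consensus_outcome A N t hn he y \<longleftrightarrow> consensus_outcome S N t' hn' he' y"
    "aggregation_outcome A N t he y z \<longleftrightarrow> aggregation_outcome S N t' he' y z"
proof -
  have "contracted_edges A N he = contracted_edges S N he'"
    using con by (auto simp: contracted_edges_def)
  then show sn: "supernode A N he = supernode S N he'" by (auto simp: supernode_def fun_eq_iff)
  then show me: "minor_edges A N he = minor_edges S N he'" by (simp add: minor_edges_def)
  have ev: "edge_values A N he y e = edge_values S N he' y e" if "e \<in> edges N" for e
    using agg[OF that] sn by (simp add: edge_values_def)
  then show "e \<in> edges N \<Longrightarrow> edge_values A N he y e = edge_values S N he' y e" .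
  have "image_mset (\<lambda>v. cons_value A (node_view_of N hn v)) (mset_set s) =
      image_mset (\<lambda>v. cons_value S (node_view_of N hn' v)) (mset_set s)"
    if "s \<in> supernode S N he' ` nodes N" for s
  proof (rule image_mset_cong)
    fix v assume "v \<in># mset_set s"
    then have "v \<in> s" by (rule mset_set_subset)
    then have "v \<in> nodes N" using that by (auto simp: supernode_def)
    then show "cons_value A (node_view_of N hn v) = cons_value S (node_view_of N hn' v)" by (rule cons)
  qed
  then show "consensus_outcome A N t hn he y \<longleftrightarrow> consensus_outcome S N t' hn' he' y"
    unfolding consensus_outcome_def sn ops by (intro ball_cong refl) simp
  have im: "image_mset (\<lambda>e. if Min e \<in> s then fst (edge_values A N he y e) else snd (edge_values A N he y e))
        (mset_set {e \<in> minor_edges S N he'. e \<inter> s \<noteq> {}}) =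
      image_mset (\<lambda>e. if Min e \<in> s then fst (edge_values S N he' y e) else snd (edge_values S N he' y e))
        (mset_set {e \<in> minor_edges S N he'. e \<inter> s \<noteq> {}})" for s
  proof (rule image_mset_cong)
    fix e assume "e \<in># mset_set {e \<in> minor_edges S N he'. e \<inter> s \<noteq> {}}"
    then have "e \<in> edges N" using mset_set_subset by (fastforce simp: minor_edges_def)
    then show "(if Min e \<in> s then fst (edge_values A N he y e) else snd (edge_values A N he y e)) =
       (if Min e \<in> s then fst (edge_values S N he' y e) else snd (edge_values S N he' y e))"
      by (simp add: ev)
  qed
  show "aggregation_outcome A N t he y z \<longleftrightarrow> aggregation_outcome S N t' he' y z"
    unfolding aggregation_outcome_def Let_def sn me ops im ..
qed

lemma ma_run_length: "ma_run A N t hn he \<Longrightarrow> length (hn v) = t \<and> length (he e) = t"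
  by (induction rule: ma_run.induct) auto

definition longer :: "msg \<Rightarrow> msg \<Rightarrow> msg" where
  "longer a b = (if length b \<le> length a then a else b)"

lemma aggregates_longer:
  "aggregates_to longer M y \<Longrightarrow> y \<in># M \<and> (\<forall>m\<in>#M. length m \<le> length y)"
  by (induction rule: aggregates_to.induct) (auto simp: longer_def split: if_splits)

text \<open>With \<open>v + 1\<close> in place of \<open>v\<close>, a common length \<open>l\<close>
  bounds all IDs by \<open>2 ^ l - 2\<close>. Hence there are fewer than \<open>2 ^ l\<close> nodes
  and their number itself fits into \<open>l\<close> bits.\<close>

definition id_len :: "nat \<Rightarrow> nat" where
  "id_len v = (LEAST l. v + 1 < 2 ^ l)"

lemma id_len: "v + 1 < 2 ^ id_len v"
  unfolding id_len_def by (rule LeastI[of _ "v + 1"]) (rule less_exp)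

lemma id_len_le: "v < 2 ^ b \<Longrightarrow> id_len v \<le> Suc b"
  unfolding id_len_def by (rule Least_le) simp

definition node_count :: "node_history \<Rightarrow> nat" where
  "node_count h = bitsnat (tl (fst (h ! 1)))"

definition edge_count :: "edge_history \<Rightarrow> nat" where
  "edge_count h = (case h ! 2 of None \<Rightarrow> 0 | Some m \<Rightarrow> bitsnat (tl (fst m)))"

text \<open>The number of nodes is not given, but the program to run depends on it. Round 0 finds the
  length of the longest identifier, round 1 counts the nodes using numbers of that length, and
  round 2 tells the number of nodes to the edges.\<close>
definition staged :: "(nat \<Rightarrow> round_spec list) \<Rightarrow> (nat \<Rightarrow> nat \<Rightarrow> node_history \<Rightarrow> enat) \<Rightarrow> round_spec" where
  "staged P g = \<lparr>
     contracts = \<lambda>ev. (let h = ev_history ev; t = length h; p = P (edge_count h) in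
       if t < 3 then t < 2 else contracts (p ! (t - 3)) (ev\<lparr>ev_history := drop 3 h\<rparr>)),
     cons_value = \<lambda>nv. (let h = nv_history nv; t = length h; p = P (node_count h) in
       if t = 0 then replicate (id_len (nv_id nv)) True
       else if t < 3 then encm (length (fst (h ! 0))) True (if t = 1 then 1 else node_count h)
       else cons_value (p ! (t - 3)) (nv\<lparr>nv_history := drop 3 h\<rparr>)),
     cons_op = \<lambda>t. if t = 0 then longer else uop,
     agg_value = \<lambda>ev a b. (let h = ev_history ev; t = length h; p = P (edge_count h) in
       if t < 3 then ([], []) else agg_value (p ! (t - 3)) (ev\<lparr>ev_history := drop 3 h\<rparr>) a b),
     agg_op = \<lambda>_. uop,
     node_output = \<lambda>nv. (let h = nv_history nv; n = node_count h in
       if length h = 3 + length (P n) then Some (g n (nv_id nv) (drop 3 h)) else None)\<rparr>"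

lemma view_drop:
  "(edge_view_of N he e)\<lparr>ev_history := drop 3 (he e)\<rparr> = edge_view_of N (\<lambda>e. drop 3 (he e)) e"
  "(node_view_of N hn v)\<lparr>nv_history := drop 3 (hn v)\<rparr> = node_view_of N (\<lambda>v. drop 3 (hn v)) v"
  by (auto simp: edge_view_of_def node_view_of_def)

lemma view_history: "ev_history (edge_view_of N he e) = he e" "nv_history (node_view_of N hn v) = hn v"
  "nv_id (node_view_of N hn v) = v"
  by (auto simp: edge_view_of_def node_view_of_def)

context frame
begin

lemma supernode_all:
  assumes "J \<in> I" "v \<in> iV J" "\<And>e. e \<in> iE J \<Longrightarrow> contracts A (edge_view_of (net J) he e)"
  shows "supernode A (net J) he v = iV J"
proof -
  have "contracted_edges A (net J) he = iE J" using assms(3) by (auto simp: contracted_edges_def)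
  then show ?thesis
    using inst_wf[OF assms(1)] assms(2) by (auto simp: supernode_def connected_graph_def)
qed

lemma supernode_none:
  assumes "v \<in> iV J" "\<And>e. e \<in> iE J \<Longrightarrow> \<not> contracts A (edge_view_of (net J) he e)"
  shows "supernode A (net J) he v = {v}"
proof -
  have "contracted_edges A (net J) he = {}" using assms by (auto simp: contracted_edges_def)
  then show ?thesis using assms by (auto simp: supernode_eq adj_def)
qed

text \<open>In rounds 0 and 1 everything is contracted, so consensus is global. In round 2 nothing
  is contracted, and the consensus values, which now are the counts of single nodes, reach the
  edges. From then on the shifted histories form an execution of the program for
  \<open>n\<close>.\<close>

lemma staged_invariant:
  assumes i: "J \<in> I" and n: "card (iV J) = n" and ids: "\<And>v. v \<in> iV J \<Longrightarrow> v < 2 ^ b"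
    and ok: "\<And>A. A \<in> set (P n) \<Longrightarrow> spec_ok B A"
    and run: "ma_run (staged P g) (net J) t hn he" and t: "t \<le> 3 + length (P n)"
  shows "(0 < t \<longrightarrow> (\<exists>l \<le> Suc b. n < 2 ^ l \<and> (\<forall>v\<in>iV J. length (fst (hn v ! 0)) = l))) \<and>
    (1 < t \<longrightarrow> (\<forall>v\<in>iV J. node_count (hn v) = n)) \<and> (2 < t \<longrightarrow> (\<forall>e\<in>iE J. edge_count (he e) = n) \<and>
       prun (net J) (take (t - 3) (P n)) (\<lambda>v. drop 3 (hn v)) (\<lambda>e. drop 3 (he e)))"
  using run t
proof (induction rule: ma_run.induct)
  case (round t hn he y z)
  let ?A = "staged P g" and ?N = "net J"
  have len: "length (hn v) = t" "length (he e) = t" for v e using ma_run_length[OF round(1)] by auto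
  have fin: "finite (iV J)" using I_finite[OF i] .
  have sn_all: "supernode ?A ?N he v = iV J" if "v \<in> iV J" "t < 2" for v
    by (rule supernode_all[OF i that(1)]) (use that len in \<open>simp add: staged_def view_history Let_def\<close>)
  note co = round(2)[unfolded consensus_outcome_def]
  consider "t = 0" | "t = 1" | "t = 2" | "3 \<le> t" by linarith
  then show ?case
  proof cases
    case 1
    let ?y = "y (iV J)"
    obtain v0 where v0: "v0 \<in> iV J" using inst_wf[OF i] by (auto simp: connected_graph_def)
    have "iV J \<in> supernode ?A ?N he ` nodes ?N" using sn_all[OF v0] v0 1 by force
    note a = bspec[OF co this]
    have "cons_op ?A t = longer" using 1 by (simp add: staged_def)
    moreover have "cons_value ?A (node_view_of ?N hn v) = replicate (id_len v) True" for v
      using 1 len by (simp add: staged_def view_history Let_def)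
    ultimately have ag: "aggregates_to longer (image_mset (\<lambda>v. replicate (id_len v) True) (mset_set (iV J))) ?y"
      using a by simp
    have y: "\<exists>v\<in>iV J. length ?y = id_len v" and le: "id_len v \<le> length ?y" if "v \<in> iV J" for v
      using aggregates_longer[OF ag] fin that by auto
    have 2: "length ?y \<le> Suc b" using y[OF v0] id_len_le ids by auto
    have "v + 1 < 2 ^ length ?y" if "v \<in> iV J" for v
      using id_len[of v] le[OF that] by (meson less_le_trans one_le_numeral power_increasing)
    then have "iV J \<subseteq> {..<2 ^ length ?y - 1}" by fastforce
    then have "n \<le> 2 ^ length ?y - 1" using n by (metis card_lessThan card_mono finite_lessThan)
    moreover have "(0::nat) < 2 ^ length ?y" by simp
    ultimately have "n < 2 ^ length ?y" by linarith
    then show ?thesis using 1 2 len sn_all by (auto simp: nth_append)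
  next
    case 2
    obtain l where l: "l \<le> Suc b" "n < 2 ^ l" "\<And>v. v \<in> iV J \<Longrightarrow> length (fst (hn v ! 0)) = l"
      using round 2 by auto
    let ?y = "y (iV J)"
    obtain v0 where v0: "v0 \<in> iV J" using inst_wf[OF i] by (auto simp: connected_graph_def)
    have "iV J \<in> supernode ?A ?N he ` nodes ?N" using sn_all[OF v0] v0 2 by force
    note a = bspec[OF co this]
    have op: "cons_op ?A t = uop" using 2 by (simp add: staged_def)
    have v: "cons_value ?A (node_view_of ?N hn v) = encm l True 1" if "v \<in> iV J" for v
      using 2 len(1)[of v] l(3)[OF that] by (cases "hn v") (auto simp: staged_def view_history Let_def)
    have "image_mset (\<lambda>v. cons_value ?A (node_view_of ?N hn v)) (mset_set (iV J)) =
        image_mset (\<lambda>v. encm l True 1) (mset_set (iV J))" (is "_ = ?M")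
      by (rule image_mset_cong) (use v fin in auto)
    then have ag: "aggregates_to uop ?M ?y" using a op by simp
    have "n \<ge> 1" using v0 fin n by (metis One_nat_def Suc_leI card_gt_0_iff empty_iff)
    then have "bitsnat (tl (encm l True 1)) = 1" using l(2) by (simp add: encm_def)
    then have s: "(\<Sum>m\<in>#?M. bitsnat (tl m)) = n" using n by (simp add: multiset.map_comp comp_def)
    have "bitsnat (tl ?y) = n"
      using aggregates_sum[OF ag, of l] s l(2) fin by (auto simp: encm_def)
    then have "\<forall>v\<in>iV J. node_count (hn v @ [(y (supernode ?A ?N he v), z (supernode ?A ?N he v))]) = n"
      using 2 len sn_all by (simp add: node_count_def nth_append)
    then show ?thesis using 2 l len by (auto simp: nth_append intro!: exI[of _ l])
  next
    case 3
    obtain l where l: "l \<le> Suc b" "n < 2 ^ l" "\<And>v. v \<in> iV J \<Longrightarrow> length (fst (hn v ! 0)) = l"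
      using round 3 by auto
    have nc: "node_count (hn v) = n" if "v \<in> iV J" for v using round 3 that by auto
    have con: "\<not> contracts ?A (edge_view_of ?N he e)" for e
      using 3 len by (simp add: staged_def view_history Let_def)
    have sn: "supernode ?A ?N he v = {v}" if "v \<in> iV J" for v
      by (rule supernode_none[OF that]) (rule con)
    have yv: "bitsnat (tl (y {v})) = n" if v: "v \<in> iV J" for v
    proof -
      have "{v} \<in> supernode ?A ?N he ` nodes ?N" using sn[OF v] v by force
      from bspec[OF co this] have "aggregates_to (cons_op ?A t) {#cons_value ?A (node_view_of ?N hn v)#} (y {v})"
        by simp
      then have "y {v} = cons_value ?A (node_view_of ?N hn v)" by cases auto
      moreover have "hn v \<noteq> []" using 3 len(1)[of v] by auto
      ultimately show ?thesis using 3 len(1)[of v] l(2) l(3)[OF v] nc[OF v]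
        by (simp add: staged_def view_history Let_def encm_def)
    qed
    have "edge_count (he e @ [if e \<in> minor_edges ?A ?N he
        then Some (y (supernode ?A ?N he (Min e)), y (supernode ?A ?N he (Max e))) else None]) = n"
      if e: "e \<in> iE J" for e
    proof -
      obtain a c where e': "a < c" "Min e = a" "Max e = c" "a \<in> iV J" "c \<in> iV J" using E_edge[OF i e] by metis
      then have "e \<in> minor_edges ?A ?N he" using e sn by (simp add: minor_edges_def)
      then show ?thesis using 3 len sn e' yv by (simp add: edge_count_def nth_append)
    qed
    moreover have "prun ?N [] (\<lambda>_. []) (\<lambda>_. [])" by (rule prun_Nil)
    moreover have "node_count (hn v @ [x]) = node_count (hn v)" for v x
      using 3 len by (simp add: node_count_def nth_append)
    ultimately show ?thesis using 3 l len nc by (auto simp: nth_append intro!: exI[of _ l])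
  next
    case 4
    have ih: "\<exists>l \<le> Suc b. n < 2 ^ l \<and> (\<forall>v\<in>iV J. length (fst (hn v ! 0)) = l)"
      "\<And>v. v \<in> iV J \<Longrightarrow> node_count (hn v) = n" "\<And>e. e \<in> iE J \<Longrightarrow> edge_count (he e) = n"
      "prun ?N (take (t - 3) (P n)) (\<lambda>v. drop 3 (hn v)) (\<lambda>e. drop 3 (he e))"
      using round 4 by auto
    let ?S = "P n ! (t - 3)" and ?hn = "\<lambda>v. drop 3 (hn v)" and ?he = "\<lambda>e. drop 3 (he e)"
    have lt: "t - 3 < length (P n)" using round.prems 4 by simp
    then have S: "spec_ok B ?S" using ok by simp
    have con: "contracts ?A (edge_view_of ?N he e) = contracts ?S (edge_view_of ?N ?he e)" if "e \<in> edges ?N" for e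
      using that 4 len ih(3) by (simp add: staged_def view_history view_drop Let_def)
    have cv: "cons_value ?A (node_view_of ?N hn v) = cons_value ?S (node_view_of ?N ?hn v)" if "v \<in> nodes ?N" for v
      using that 4 len(1)[of v] ih(2)[of v] by (cases "hn v = []") (auto simp: staged_def view_history view_drop Let_def)
    have av: "agg_value ?A (edge_view_of ?N he e) a c = agg_value ?S (edge_view_of ?N ?he e) a c"
      if "e \<in> edges ?N" for e a c
      using that 4 len ih(3) by (simp add: staged_def view_history view_drop Let_def)
    have ops: "cons_op ?A t = cons_op ?S 0" "agg_op ?A t = agg_op ?S 0"
      using 4 S by (auto simp: staged_def spec_ok_def)
    note rc = round_cong[of ?N ?A he ?S ?he hn ?hn t 0, OF con cv av ops]
    have sn: "supernode ?A ?N he = supernode ?S ?N ?he" by (rule rc(1))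
    have me: "minor_edges ?A ?N he = minor_edges ?S ?N ?he" by (rule rc(2))
    have "consensus_outcome ?S ?N 0 ?hn ?he y" "aggregation_outcome ?S ?N 0 ?he y z"
      using round(2,3) rc(4,5) by blast+
    note p = prun_snoc[OF ih(4) this]
    have tk: "take (Suc t - 3) (P n) = take (t - 3) (P n) @ [?S]"
      using lt take_Suc_conv_app_nth Suc_diff_le[OF 4] by metis
    have dr: "drop 3 (hn v @ [x]) = drop 3 (hn v) @ [x]" "drop 3 (he e @ [x']) = drop 3 (he e) @ [x']" for v e x x'
      using 4 len by auto
    have r: "prun ?N (take (Suc t - 3) (P n))
       (\<lambda>v. drop 3 (hn v @ [(y (supernode ?A ?N he v), z (supernode ?A ?N he v))]))
       (\<lambda>e. drop 3 (he e @ [if e \<in> minor_edges ?A ?N he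
           then Some (y (supernode ?A ?N he (Min e)), y (supernode ?A ?N he (Max e))) else None]))"
      using p unfolding tk dr sn me .
    have k: "(hn v @ [x]) ! 0 = hn v ! 0" "node_count (hn v @ [x]) = node_count (hn v)"
      "edge_count (he e @ [x']) = edge_count (he e)" for v e x x'
      using 4 len by (auto simp: node_count_def edge_count_def nth_append)
    show ?thesis unfolding k using ih r by blast
  qed
qed simp

text \<open>In the first three rounds messages have at most \<open>b + 2\<close> bits: identifiers
  have length at most \<open>b + 1\<close>, and a number of that length is preceded by the bit that
  selects the operator.\<close>

lemma staged_computes:
  assumes i: "J \<in> I" and n: "card (iV J) = n" and ids: "\<And>v. v \<in> iV J \<Longrightarrow> v < 2 ^ b"
    and ok: "\<And>A. A \<in> set (P n) \<Longrightarrow> spec_ok B A"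
    and g: "\<And>hn he v. prun (net J) (P n) hn he \<Longrightarrow> v \<in> iV J \<Longrightarrow> g n v (hn v) = res"
  shows "ma_computes (staged P g) (net J) (B + b + 2) (3 + length (P n)) res"
proof -
  let ?A = "staged P g" and ?N = "net J" and ?B = "B + b + 2"
  have inv: "(0 < t \<longrightarrow> (\<exists>l \<le> Suc b. n < 2 ^ l \<and> (\<forall>v\<in>iV J. length (fst (hn v ! 0)) = l))) \<and>
    (1 < t \<longrightarrow> (\<forall>v\<in>iV J. node_count (hn v) = n)) \<and> (2 < t \<longrightarrow> (\<forall>e\<in>iE J. edge_count (he e) = n) \<and>
       prun ?N (take (t - 3) (P n)) (\<lambda>v. drop 3 (hn v)) (\<lambda>e. drop 3 (he e)))"
    if "ma_run ?A ?N t hn he" "t \<le> 3 + length (P n)" for t hn he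
    by (rule staged_invariant[OF i n _ _ that]) (use ids ok in auto)
  have ops: "op_bits ?B (cons_op ?A t)" "op_bits ?B (agg_op ?A t)" for t
    using op_bits_uop by (auto simp: staged_def op_bits_def longer_def)
  have cv: "length (cons_value ?A (node_view_of ?N hn v)) \<le> ?B"
    if r: "ma_run ?A ?N t hn he" and t: "t < 3 + length (P n)" and v: "v \<in> iV J" for t hn he v
  proof -
    have len: "length (hn v) = t" using ma_run_length[OF r] by simp
    note iv = inv[OF r less_imp_le[OF t]]
    consider "t = 0" | "0 < t" "t < 3" | "3 \<le> t" by linarith
    then show ?thesis
    proof cases
      case 1
      then show ?thesis using len id_len_le[OF ids[OF v]] by (simp add: staged_def view_history Let_def)
    next
      case 2
      then have "length (fst (hn v ! 0)) \<le> Suc b" using iv v by auto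
      moreover have "hn v \<noteq> []" using 2 len by auto
      ultimately show ?thesis using 2 len by (simp add: staged_def view_history Let_def encm_def)
    next
      case 3
      then have "node_count (hn v) = n" using iv v by auto
      moreover have "spec_ok B (P n ! (t - 3))" using 3 t ok by simp
      then have "length (cons_value (P n ! (t - 3)) nv) \<le> B" for nv by (simp add: spec_ok_def)
      ultimately show ?thesis using 3 len
        by (cases "hn v = []") (auto simp: staged_def view_history Let_def intro: le_SucI trans_le_add1)
    qed
  qed
  have av: "length (fst (edge_values ?A ?N he y e)) \<le> ?B \<and> length (snd (edge_values ?A ?N he y e)) \<le> ?B"
    if r: "ma_run ?A ?N t hn he" and t: "t < 3 + length (P n)" and e: "e \<in> minor_edges ?A ?N he" for t hn he e y
  proof -
    have len: "length (he e) = t" using ma_run_length[OF r] by simp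
    note iv = inv[OF r less_imp_le[OF t]]
    obtain a c where ev: "edge_values ?A ?N he y e = agg_value ?A (edge_view_of ?N he e) a c"
      by (auto simp: edge_values_def)
    show ?thesis
    proof (cases "t < 3")
      case True
      then show ?thesis unfolding ev using len by (simp add: staged_def view_history Let_def)
    next
      case False
      have "e \<in> iE J" using e by (simp add: minor_edges_def)
      then have "edge_count (he e) = n" using iv False by auto
      moreover have "spec_ok B (P n ! (t - 3))" using False t ok by simp
      then have "length (fst (agg_value (P n ! (t - 3)) ev a c)) \<le> B \<and> length (snd (agg_value (P n ! (t - 3)) ev a c)) \<le> B"
        for ev a c by (simp add: spec_ok_def)
      ultimately show ?thesis unfolding ev using False len
        by (simp add: staged_def view_history Let_def trans_le_add1 le_SucI)
    qed
  qed
  have out: "node_output ?A (node_view_of ?N hn v) = (if t = 3 + length (P n) then Some res else None)"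
    if r: "ma_run ?A ?N t hn he" and t: "t \<le> 3 + length (P n)" and v: "v \<in> iV J" for t hn he v
  proof -
    have len: "length (hn v) = t" using ma_run_length[OF r] by simp
    show ?thesis
    proof (cases "t < 3")
      case True
      then show ?thesis using len by (simp add: staged_def view_history Let_def)
    next
      case False
      then have c: "node_count (hn v) = n" and p: "prun ?N (take (t - 3) (P n)) (\<lambda>v. drop 3 (hn v)) (\<lambda>e. drop 3 (he e))"
        using inv[OF r t] v by auto
      show ?thesis
      proof (cases "t = 3 + length (P n)")
        case True
        then have "g n v (drop 3 (hn v)) = res" using g[OF _ v] p by simp
        then show ?thesis using True len c by (simp add: staged_def view_history Let_def)
      next
        case False
        then show ?thesis using len c by (simp add: staged_def view_history Let_def)
      qed
    qed
  qed
  have "ma_bits ?A ?N ?B (3 + length (P n))"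
    unfolding ma_bits_def using ops cv av by simp
  moreover have "\<forall>t\<le>3 + length (P n). \<forall>hn he. ma_run ?A ?N t hn he \<longrightarrow>
      (\<forall>v\<in>nodes ?N. node_output ?A (node_view_of ?N hn v) \<in> {None, Some res})"
    using out by simp
  moreover have "\<forall>hn he. ma_run ?A ?N (3 + length (P n)) hn he \<longrightarrow>
      (\<forall>v\<in>nodes ?N. node_output ?A (node_view_of ?N hn v) = Some res)"
    using out by simp
  ultimately show ?thesis unfolding ma_computes_def by blast
qed

end

section \<open>Asymptotic bounds\<close>

lemma polylog_le:
  assumes "polylog g" "\<And>n. f n \<le> g n"
  shows "polylog f"
proof -
  obtain c where "(\<lambda>n. real (g n)) \<in> O(\<lambda>n. ln (real n) ^ c)" using assms by (auto simp: polylog_def)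
  then have "(\<lambda>n. real (f n)) \<in> O(\<lambda>n. ln (real n) ^ c)"
    by (rule landau_o.big_trans[rotated]) (use assms(2) in \<open>auto intro!: landau_o.big_mono\<close>)
  then show ?thesis by (auto simp: polylog_def)
qed

lemma polylog_const: "polylog (\<lambda>_. c)"
  unfolding polylog_def by (intro exI[of _ 0]) simp

lemma ln_ge_1: "3 \<le> n \<Longrightarrow> 1 \<le> ln (real n)"
  using exp_le by (subst ln_ge_iff) (auto intro: order_trans)

lemma ln_power_bigo: "c \<le> d \<Longrightarrow> (\<lambda>n. ln (real n) ^ c) \<in> O(\<lambda>n. ln (real n) ^ d)"
  by (intro landau_o.big_mono eventually_sequentiallyI[of 3])
    (simp add: power_increasing[OF _ ln_ge_1] power_abs[symmetric] abs_of_nonneg ln_ge_1)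

lemma polylog_add:
  assumes "polylog f" "polylog g"
  shows "polylog (\<lambda>n. f n + g n)"
proof -
  obtain c d where "(\<lambda>n. real (f n)) \<in> O(\<lambda>n. ln (real n) ^ c)" "(\<lambda>n. real (g n)) \<in> O(\<lambda>n. ln (real n) ^ d)"
    using assms by (auto simp: polylog_def)
  then have "(\<lambda>n. real (f n)) \<in> O(\<lambda>n. ln (real n) ^ max c d)" "(\<lambda>n. real (g n)) \<in> O(\<lambda>n. ln (real n) ^ max c d)"
    using ln_power_bigo[of _ "max c d"] landau_o.big_trans by (meson max.cobounded1 max.cobounded2)+
  then have "(\<lambda>n. real (f n + g n)) \<in> O(\<lambda>n. ln (real n) ^ max c d)"
    using sum_in_bigo(1) by simp
  then show ?thesis by (auto simp: polylog_def)
qed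

lemma polylog_mult:
  assumes "polylog f" "polylog g"
  shows "polylog (\<lambda>n. f n * g n)"
proof -
  obtain c d where "(\<lambda>n. real (f n)) \<in> O(\<lambda>n. ln (real n) ^ c)" "(\<lambda>n. real (g n)) \<in> O(\<lambda>n. ln (real n) ^ d)"
    using assms by (auto simp: polylog_def)
  then have "(\<lambda>n. real (f n * g n)) \<in> O(\<lambda>n. ln (real n) ^ (c + d))"
    using landau_o.big.mult by (fastforce simp: power_add)
  then show ?thesis by (auto simp: polylog_def)
qed

lemma polylog_Suc: "polylog f \<Longrightarrow> polylog (\<lambda>n. Suc (f n))"
  using polylog_add[OF _ polylog_const[of 1]] by simp

lemmas polylog_intros = polylog_const polylog_add polylog_mult polylog_Suc

definition clog :: "nat \<Rightarrow> nat" where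
  "clog m = (LEAST l. m \<le> 2 ^ l)"

lemma le_clog: "m \<le> 2 ^ clog m"
  unfolding clog_def by (rule LeastI[of _ m]) (simp add: less_imp_le less_exp)

text \<open>A polynomial bound \<open>D * n ^ c\<close> is the exponential of
  \<open>ln D + c * ln n\<close>, so its binary logarithm is linear in \<open>ln n\<close>; for
  \<open>n\<close> from 3 on, constants are absorbed since \<open>ln n\<close> is at least
  1.\<close>

lemma polylog_clog:
  assumes "poly_bounded f"
  shows "polylog (\<lambda>n. clog (f n))"
proof -
  obtain c where "(\<lambda>n. real (f n)) \<in> O(\<lambda>n. real n ^ c)" using assms by (auto simp: poly_bounded_def)
  then obtain C where C: "C > 0" "eventually (\<lambda>n. norm (real (f n)) \<le> C * norm (real n ^ c)) sequentially"
    using landau_o.bigE by blast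
  define D where "D = max C 1"
  have D: "1 \<le> D" "C \<le> D" by (auto simp: D_def)
  have bound: "real (clog (f n)) \<le> (2 * ln D + 1 + 2 * real c) * ln (real n)"
    if n: "3 \<le> n" "norm (real (f n)) \<le> C * norm (real n ^ c)" for n
  proof -
    let ?x = "ln D + real c * ln (real n)"
    \<comment> \<open>Twice the natural logarithm suffices as binary exponent because
      \<open>ln 2\<close> is at least one half.\<close>
    define l where "l = nat \<lceil>2 * ?x\<rceil>"
    have l1: "1 \<le> ln (real n)" using ln_ge_1 n by simp
    have x: "0 \<le> ?x" using D l1 by simp
    have "r \<le> real (nat \<lceil>r\<rceil>) \<and> real (nat \<lceil>r\<rceil>) \<le> r + 1" if "0 \<le> r" for r using that by linarith
    then have lx: "2 * ?x \<le> real l" "real l \<le> 2 * ?x + 1" unfolding l_def using x by auto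
    have "real (f n) \<le> D * real n ^ c"
      using n(2) D by (simp add: order_trans[OF _ mult_right_mono])
    also have "\<dots> = exp ?x" using D n by (simp add: exp_add exp_of_nat_mult)
    also have "\<dots> \<le> exp (real l * ln 2)"
    proof -
      have "?x \<le> real l * (1 / 2)" using lx by simp
      also have "\<dots> \<le> real l * ln 2" using ln_le_minus_one[of "1 / 2"] by (intro mult_left_mono) (auto simp: ln_div)
      finally show ?thesis by simp
    qed
    also have "\<dots> = real (2 ^ l)" by (simp add: exp_of_nat_mult)
    finally have "f n \<le> 2 ^ l" by (simp only: of_nat_le_iff)
    then have "clog (f n) \<le> l" unfolding clog_def by (rule Least_le)
    then have "real (clog (f n)) \<le> 2 * ln D + 1 + 2 * real c * ln (real n)" using lx by simp
    also have "\<dots> \<le> (2 * ln D + 1) * ln (real n) + 2 * real c * ln (real n)"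
      using mult_left_mono[OF l1, of "2 * ln D + 1"] D by simp
    finally show ?thesis by (simp add: algebra_simps)
  qed
  have "(\<lambda>n. real (clog (f n))) \<in> O(\<lambda>n. ln (real n) ^ 1)"
  proof (rule landau_o.bigI[of "2 * ln D + 1 + 2 * real c"])
    show "0 < 2 * ln D + 1 + 2 * real c" using D by (simp add: add_pos_nonneg add_nonneg_pos)
    show "eventually (\<lambda>n. norm (real (clog (f n))) \<le> (2 * ln D + 1 + 2 * real c) * norm (ln (real n) ^ 1)) sequentially"
      using C(2) eventually_ge_at_top[of 3]
    proof eventually_elim
      case (elim n)
      then show ?case using bound[of n] ln_ge_1[of n] by simp
    qed
  qed
  then show ?thesis unfolding polylog_def by blast
qed

lemma poly_bounded_id: "poly_bounded (\<lambda>n. n)"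
  unfolding poly_bounded_def by (intro exI[of _ 1]) simp

lemma poly_bounded_weight:
  assumes "poly_bounded f"
  shows "poly_bounded (\<lambda>n. 8 * (n * n * f n + 1))"
proof -
  obtain c where c: "(\<lambda>n. real (f n)) \<in> O(\<lambda>n. real n ^ c)" using assms by (auto simp: poly_bounded_def)
  define d where "d = 2 + c"
  have "(\<lambda>n. real n ^ 2 * real (f n)) \<in> O(\<lambda>n. real n ^ 2 * real n ^ c)"
    by (rule landau_o.big.mult[OF landau_o.big_refl c])
  then have 1: "(\<lambda>n. real n ^ 2 * real (f n)) \<in> O(\<lambda>n. real n ^ d)" by (simp only: d_def power_add)
  have 2: "(\<lambda>n. 1) \<in> O(\<lambda>n. real n ^ d)"
    by (intro landau_o.big_mono eventually_sequentiallyI[of 1]) (simp add: one_le_power)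
  have "(\<lambda>n. 8 * (real n ^ 2 * real (f n) + 1)) \<in> O(\<lambda>n. real n ^ d)"
    by (subst landau_o.big.cmult_in_iff) (use sum_in_bigo(1)[OF 1 2] in auto)
  then have "(\<lambda>n. real (8 * (n * n * f n + 1))) \<in> O(\<lambda>n. real n ^ d)"
    by (simp add: power2_eq_square add.commute)
  then show ?thesis unfolding poly_bounded_def by blast
qed

definition instances :: "(nat \<Rightarrow> nat) \<Rightarrow> (nat \<Rightarrow> nat) \<Rightarrow> nat \<Rightarrow> inst set" where
  "instances id_bits max_weight n = {J. weighted_network id_bits max_weight (iV J) (iE J) (iw J) \<and>
     iF J \<subseteq> iE J \<and> is_tree (iV J) (iF J) \<and> ir J \<in> iV J \<and> card (iV J) = n}"

text \<open>One summand for each lower bound on \<open>L\<close> in \<open>setting\<close>: labels,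
  IDs, ranks and number of nodes, and total weight.\<close>

definition width :: "nat \<Rightarrow> nat \<Rightarrow> nat \<Rightarrow> nat" where
  "width n b W = (b + 2) * clog n + b + clog n + 3 + clog (8 * (n * n * W + 1))"

lemma setting_instances:
  "setting (instances id_bits max_weight n) (width n (id_bits n) (max_weight n)) n (id_bits n) (clog n) (max_weight n)"
proof -
  let ?I = "instances id_bits max_weight n" and ?b = "id_bits n" and ?h = "clog n" and ?W = "max_weight n"
  let ?L = "width n ?b ?W"
  have h: "?h + 3 \<le> ?L" by (simp add: width_def)
  have "?h + 3 < 2 ^ (?h + 3)" by (rule less_exp)
  also have "(2::nat) ^ (?h + 3) \<le> 2 ^ ?L" using h by (simp only: power_increasing one_le_numeral)
  finally have "?h + 2 < 2 ^ ?L" by simp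
  moreover have "n < 2 ^ ?L"
  proof -
    have "n \<le> 2 ^ ?h" by (rule le_clog)
    also have "(2::nat) ^ ?h < 2 ^ ?L" using h by (intro power_strict_increasing) auto
    finally show ?thesis .
  qed
  moreover have "8 * (n * n * ?W + 1) \<le> 2 ^ ?L"
  proof -
    have "8 * (n * n * ?W + 1) \<le> 2 ^ clog (8 * (n * n * ?W + 1))" by (rule le_clog)
    also have "\<dots> \<le> 2 ^ ?L" by (intro power_increasing) (auto simp: width_def)
    finally show ?thesis .
  qed
  moreover have "0 < ?L" "(?b + 2) * ?h < ?L" "?b < ?L" by (auto simp: width_def)
  ultimately show ?thesis
    using le_clog[of n]
    by unfold_locales (auto simp: instances_def weighted_network_def rooted_tree_def)
qed

theorem theorem8p4:
  fixes id_bits max_weight :: "nat \<Rightarrow> nat"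
  assumes "polylog id_bits" and "poly_bounded max_weight"
  shows "\<exists>(A :: (unit, tree_edge_input, enat) ma_algorithm) B R.
    polylog B \<and> polylog R \<and>
    (\<forall>V E w F r k VT FT.
       weighted_network id_bits max_weight V E w \<longrightarrow>
       subtree_instance V E F r k VT FT \<longrightarrow>
       ma_computes A (tree_network V E w F r) (B (card V)) (R (card V))
         (min (min_1_respecting F E w) (min_2_respecting F E w k FT)))"
proof -
  let ?I = "instances id_bits max_weight" and ?h = clog
  define L where "L n = width n (id_bits n) (max_weight n)" for n
  have st: "setting (?I n) (L n) n (id_bits n) (?h n) (max_weight n)" for n
    unfolding L_def by (rule setting_instances)
  have fr: "frame (?I n) (L n)" for n using st[of n] by (simp add: setting_def)
  define T where "T n = setting.total_rounds (L n) (id_bits n) (?h n)" for n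
  \<comment> \<open>A program together with a reader of its result exists for every \<open>n\<close>
    separately. Choice collects them into one family, from which \<open>staged\<close> selects by
    the number of nodes it has counted.\<close>
  let ?good = "\<lambda>n \<sigma> g. length \<sigma> \<le> T n \<and> (\<forall>A\<in>set \<sigma>. spec_ok (Suc (16 * L n)) A) \<and>
    (\<forall>J\<in>?I n. \<forall>hn he v. prun (net J) \<sigma> hn he \<longrightarrow> v \<in> iV J \<longrightarrow> g v (hn v) = (INF a\<in>allcuts J. enat a))"
  have "\<exists>\<sigma> g. ?good n \<sigma> g" for n
  proof -
    interpret setting "?I n" "L n" n "id_bits n" "?h n" "max_weight n" by (rule st)
    obtain \<sigma> where \<sigma>: "ext total_rounds [] \<sigma>" "knows \<sigma> (\<lambda>J v. INF a\<in>allcuts J. enat a)"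
      using minimum_known by blast
    obtain g where "\<forall>J\<in>?I n. \<forall>hn he v. prun (net J) \<sigma> hn he \<longrightarrow> v \<in> iV J \<longrightarrow> g v (hn v) = (INF a\<in>allcuts J. enat a)"
      using knows_reader[OF \<sigma>(2)] by blast
    then show ?thesis using \<sigma>(1) unfolding ext_def T_def by auto
  qed
  then obtain P g where good: "\<And>n. ?good n (P n) (g n)" by metis
  let ?B = "\<lambda>n. Suc (16 * L n) + id_bits n + 2" and ?R = "\<lambda>n. 3 + length (P n)"
  have L: "polylog L"
    unfolding L_def width_def
    by (intro polylog_intros assms(1) polylog_clog poly_bounded_id poly_bounded_weight assms(2))
  have "polylog ?B" by (intro polylog_intros assms(1) L)
  moreover have "polylog ?R"
  proof (rule polylog_le)
    show "?R n \<le> 3 + T n" for n using good[of n] by simp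
    show "polylog (\<lambda>n. 3 + T n)"
      unfolding T_def setting.total_rounds_def[OF st] setting.pair_rounds_def[OF st]
      by (intro polylog_intros assms(1) L polylog_clog poly_bounded_id)
  qed
  moreover have "ma_computes (staged P g) (tree_network V E w F r) (?B (card V)) (?R (card V))
      (min (min_1_respecting F E w) (min_2_respecting F E w k FT))"
    if net: "weighted_network id_bits max_weight V E w" and sub: "subtree_instance V E F r k VT FT"
    for V E w F r k VT FT
  proof -
    define J where "J = \<lparr>iV = V, iE = E, iw = w, iF = F, ir = r\<rparr>"
    have p: "iV J = V" "iE J = E" "iw J = w" "iF J = F" "ir J = r" by (auto simp: J_def)
    have i: "J \<in> ?I (card V)" using net sub by (auto simp: instances_def p subtree_instance_def)
    interpret graph_tree J
      using net sub by unfold_locales (auto simp: p subtree_instance_def weighted_network_def)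
    have res: "min (min_1_respecting F E w) (min_2_respecting F E w k FT) = (INF a\<in>allcuts J. enat a)"
      using result_eq[of k VT FT] sub unfolding p by blast
    have "ma_computes (staged P g) (net J) (?B (card V)) (?R (card V)) (INF a\<in>allcuts J. enat a)"
    proof (rule frame.staged_computes[OF fr i])
      show "v < 2 ^ id_bits (card V)" if "v \<in> iV J" for v using net that by (auto simp: weighted_network_def p)
      show "spec_ok (Suc (16 * L (card V))) A" if "A \<in> set (P (card V))" for A using good that by blast
      show "g (card V) v (hn v) = (INF a\<in>allcuts J. enat a)" if "prun (net J) (P (card V)) hn he" "v \<in> iV J" for hn he v
        using good i that by blast
    qed (simp add: p)
    then show ?thesis unfolding res by (simp add: p)
  qed
  ultimately show ?thesis by blast
qed

end
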